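(* For each $n\ge 0$, the group $G_n$ is isomorphic to the fundamental group $\pi_1(\boldsymbol{\Gamma}_n,T)$ of the graph of groups $\boldsymbol{\Gamma}_n$ relative to a maximal tree $T\subseteq\Gamma_n$. In particular, $G_n$ has an explicit presentation of the form $$\pi_1(\boldsymbol{\Gamma}_n,T)=\frac{(A_\sigma *_{U_\sigma}B_\sigma*\cdots)*\langle E(\Gamma_n\setminus T)\rangle}{\bigl(e^{-1}\alpha_\sigma(g)\,e=\beta_\sigma(g)\;:\;\forall\, e\in E(\Gamma_n\setminus T),\ \forall\, g\in U_\sigma\bigr)},$$ where $(A_\sigma*_{U_\sigma}B_\sigma*\cdots)$ stands for the tree product taken along the edges of $T$, and $\langle E(\Gamma_n\setminus T)\rangle$ denotes the free group generated by the set of edges of $\Gamma_n$ in the complement of $T$.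
   Context: $G$ is the group of all $\mathbb{C}$-algebra automorphisms $\sigma=(\sigma(x),\sigma(y))$ of the free associative algebra $\mathbb{C}\langle x,y\rangle$ with $\sigma([x,y])=[x,y]$. Its subgroups: $A$ consists of all $(ax+by+e,cx+dy+f)$ with $a,\dots,f\in\mathbb{C}$, $ad-bc=1$; $B$ consists of all $(ax+q(y),a^{-1}y+h)$ with $a\in\mathbb{C}^*$, $h\in\mathbb{C}$, $q\in\mathbb{C}[y]$; $U=A\cap B$. For $n\ge 1$, $\mathcal{C}_n$ is the quotient, by simultaneous conjugation by $\mathrm{PGL}_n(\mathbb{C})$, of the variety of pairs $(X,Y)$ of complex $n\times n$ matrices with $\mathrm{rank}([X,Y]+I_n)=1$; $\mathcal{C}_0$ is a point. $G$ acts (transitively) on $\mathcal{C}_n$ by $\sigma\cdot(X,Y)=(\sigma^{-1}(X),\sigma^{-1}(Y))$, where $\tau(X),\tau(Y)$ are obtained by substituting $x=X$, $y=Y$ into $\tau(x),\tau(y)$. For $n\ge1$, $G_n$ is the stabilizer in $G$ of the basepoint $(X_0,Y_0)\in\mathcal{C}_n$, where $X_0=\sum_{i=1}^{n-1}E_{i+1,i}$ and $Y_0=\sum_{i=1}^{n-1}(i-n)E_{i,i+1}$ ($E_{i,j}$ being the matrix units); $G_0=G$ (for $n=0$ the basepoint is the single point of $\mathcal{C}_0$). Graphs of groups: a graph of groups over a connected oriented graph $\Gamma$ assigns a group $G_a$ to each vertex $a$, a group $G_e$ to each edge $e$, and to each edge $e$ injective homomorphisms $\alpha_e:G_e\to G_{i(e)}$,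 $\beta_e:G_e\to G_{t(e)}$, where $i(e)$, $t(e)$ are the initial and terminal vertices of $e$. Its fundamental group relative to a maximal tree $T\subseteq\Gamma$ is the quotient of the free product of all the vertex groups and the free group on the set of edges by the relations $e^{-1}\alpha_e(g)e=\beta_e(g)$ (for all edges $e$ and $g\in G_e$) and $e=1$ (for all edges $e$ of $T$). When the underlying graph is a tree, this group is the inductive limit of the system of groups and is called the tree product of the vertex groups amalgamated by the edge groups. The graph $\Gamma_n$ is the oriented bipartite graph with vertex set $(\mathcal{C}_n/A)\sqcup(\mathcal{C}_n/B)$ and edge set $\mathcal{C}_n/U$ (sets of orbits), with incidence maps given by the canonical projections $i:\mathcal{C}_n/U\to\mathcal{C}_n/A$ and $t:\mathcal{C}_n/U\to\mathcal{C}_n/B$. It is connected. The graph of groups $\boldsymbol{\Gamma}_n$ over $\Gamma_n$: on each $A$-orbit and each $B$-orbit in $\mathcal{C}_n$ choose a basepoint and elements $\sigma_A\in G$, respectively $\sigma_B\in G$, moving these basepoints to $(X_0,Y_0)$. On each $U$-orbit $\mathcal{O}_U$ also choose a basepoint and an element $\sigma_U\in G$ moving this basepoint to $(X_0,Y_0)$ and such that $\sigma_U\in\sigma_A A\cap\sigma_B B$, where $\sigma_A$ and $\sigma_B$ correspond to the (unique) $A$- and $B$-orbits containing $\mathcal{O}_U$. Assign to the vertices and edges of $\Gamma_n$ the groups $A_\sigma=G_n\cap\sigma A\sigma^{-1}$ (with $\sigma=\sigma_A$), $B_\sigma=G_n\cap\sigma B\sigma^{-1}$ (with $\sigma=\sigma_B$)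 and $U_\sigma=G_n\cap\sigma U\sigma^{-1}$ (with $\sigma=\sigma_U$), respectively. These data, together with the natural injective homomorphisms (inclusions of subgroups of $G_n$) $\alpha_\sigma:U_\sigma\hookrightarrow A_\sigma$ and $\beta_\sigma:U_\sigma\hookrightarrow B_\sigma$ for each edge, define $\boldsymbol{\Gamma}_n$.
   Formalization: For edges outside T, σ_U ∈ σ_A A ∩ σ_B B is required only up to some γ_e ∈ G_n (σ_U ∈ σ_A A ∩ γ_e σ_B B), and β_σ is inclusion followed by conjugation by γ_e; the literal condition on all edges can hold only if Γ_n is a tree. Taking every γ_e = 1 gives the literal text. *)

theory Defs
  imports
    "HOL-Library.Poly_Mapping"
    "HOL-Computational_Algebra.Polynomial"
    "HOL-Algebra.Group_Action"
    "Jordan_Normal_Form.DL_Rank"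
    "Graph_Theory.Digraph_Component"
begin

section \<open>The free associative algebra on two generators\<close>

text \<open>The free algebra is the monoid algebra of the free monoid of words, the latter
  written additively so that the convolution product of \<^type>\<open>poly_mapping\<close> applies.\<close>

datatype letter = LX | LY

datatype fword = Word (letters: "letter list")

instantiation fword :: monoid_add
begin

definition zero_fword :: fword where
  "zero_fword = Word []"

definition plus_fword :: "fword \<Rightarrow> fword \<Rightarrow> fword" where
  "plus_fword v w = Word (letters v @ letters w)"

instance
  by standard (simp_all add: zero_fword_def plus_fword_def)

end

type_synonym falg = "fword \<Rightarrow>\<^sub>0 complex"

definition scal :: "complex \<Rightarrow> falg" where
  "scal c = Poly_Mapping.single 0 c"

definition genx :: falg where
  "genx = Poly_Mapping.single (Word [LX]) 1"

definition geny :: falg where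
  "geny = Poly_Mapping.single (Word [LY]) 1"

definition algebra_aut :: "(falg \<Rightarrow> falg) \<Rightarrow> bool" where
  "algebra_aut \<sigma> \<longleftrightarrow> bij \<sigma> \<and> \<sigma> 1 = 1 \<and>
     (\<forall>p q. \<sigma> (p + q) = \<sigma> p + \<sigma> q) \<and>
     (\<forall>p q. \<sigma> (p * q) = \<sigma> p * \<sigma> q) \<and>
     (\<forall>c p. \<sigma> (scal c * p) = scal c * \<sigma> p)"

definition grpG :: "(falg \<Rightarrow> falg) monoid" where
  "grpG = \<lparr>carrier = {\<sigma>. algebra_aut \<sigma> \<and>
              \<sigma> (genx * geny - geny * genx) = genx * geny - geny * genx},
           monoid.mult = (\<circ>), one = id\<rparr>"

definition setA :: "(falg \<Rightarrow> falg) set" where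
  "setA = {\<sigma> \<in> carrier grpG. \<exists>a b c d e f. a * d - b * c = 1 \<and>
     \<sigma> genx = scal a * genx + scal b * geny + scal e \<and>
     \<sigma> geny = scal c * genx + scal d * geny + scal f}"

definition setB :: "(falg \<Rightarrow> falg) set" where
  "setB = {\<sigma> \<in> carrier grpG. \<exists>a h (q :: complex poly). a \<noteq> 0 \<and>
     \<sigma> genx = scal a * genx + (\<Sum>i\<le>degree q. scal (coeff q i) * geny ^ i) \<and>
     \<sigma> geny = scal (inverse a) * geny + scal h}"

definition setU :: "(falg \<Rightarrow> falg) set" where
  "setU = setA \<inter> setB"


section \<open>Calogero-Moser spaces\<close>

type_synonym mat_pair = "complex mat \<times> complex mat"

type_synonym cm_point = "mat_pair set"

definition word_mat :: "nat \<Rightarrow> mat_pair \<Rightarrow> fword \<Rightarrow> complex mat" where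
  "word_mat n P w =
     foldr (\<lambda>l M. (case l of LX \<Rightarrow> fst P | LY \<Rightarrow> snd P) * M) (letters w) (1\<^sub>m n)"

definition subst_mat :: "nat \<Rightarrow> mat_pair \<Rightarrow> falg \<Rightarrow> complex mat" where
  "subst_mat n P p = mat n n (\<lambda>ij. \<Sum>w\<in>Poly_Mapping.keys p.
     Poly_Mapping.lookup p w * (word_mat n P w $$ ij))"

text \<open>For \<open>n = 0\<close> the rank condition is dropped: no empty matrix has rank one, whereas
  \<open>cm_space 0\<close> is to consist of a single point.\<close>

definition cm_pairs :: "nat \<Rightarrow> mat_pair set" where
  "cm_pairs n = {(X, Y). X \<in> carrier_mat n n \<and> Y \<in> carrier_mat n n \<and>
     (n \<ge> 1 \<longrightarrow> vec_space.rank n (X * Y - Y * X + 1\<^sub>m n) = 1)}"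

definition cm_conj :: "nat \<Rightarrow> (mat_pair \<times> mat_pair) set" where
  "cm_conj n = {((X, Y), (X', Y')). (X, Y) \<in> cm_pairs n \<and> (X', Y') \<in> cm_pairs n \<and>
     (\<exists>P Q. similar_mat_wit X' X P Q \<and> similar_mat_wit Y' Y P Q)}"

definition cm_space :: "nat \<Rightarrow> cm_point set" where
  "cm_space n = cm_pairs n // cm_conj n"

definition cm_act :: "nat \<Rightarrow> (falg \<Rightarrow> falg) \<Rightarrow> cm_point \<Rightarrow> cm_point" where
  "cm_act n \<sigma> = (\<lambda>c\<in>cm_space n.
     (\<lambda>P. (subst_mat n P ((inv\<^bsub>grpG\<^esub> \<sigma>) genx), subst_mat n P ((inv\<^bsub>grpG\<^esub> \<sigma>) geny))) ` c)"

text \<open>Matrix indices start at \<open>0\<close> here.\<close>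

definition cm_base :: "nat \<Rightarrow> cm_point" where
  "cm_base n = cm_conj n ``
     {(mat n n (\<lambda>(i, j). if i = j + 1 then 1 else 0),
       mat n n (\<lambda>(i, j). if j = i + 1 then of_nat j - of_nat n else 0))}"

definition grpGn :: "nat \<Rightarrow> (falg \<Rightarrow> falg) monoid" where
  "grpGn n = grpG\<lparr>carrier := stabilizer grpG (cm_act n) (cm_base n)\<rparr>"

definition cm_orbit :: "nat \<Rightarrow> (falg \<Rightarrow> falg) set \<Rightarrow> cm_point \<Rightarrow> cm_point set" where
  "cm_orbit n H = orbit (grpG\<lparr>carrier := H\<rparr>) (cm_act n)"

definition cm_orbits :: "nat \<Rightarrow> (falg \<Rightarrow> falg) set \<Rightarrow> cm_point set set" where
  "cm_orbits n H = orbits (grpG\<lparr>carrier := H\<rparr>) (cm_space n) (cm_act n)"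


section \<open>Free products and free groups\<close>

inductive word_cong :: "'a set \<Rightarrow> ('a list \<times> 'a list) set \<Rightarrow> 'a list \<Rightarrow> 'a list \<Rightarrow> bool"
  for S R where
  refl: "w \<in> lists S \<Longrightarrow> word_cong S R w w"
| rel: "(u, v) \<in> R \<Longrightarrow> word_cong S R u v"
| sym: "word_cong S R u v \<Longrightarrow> word_cong S R v u"
| trans: "word_cong S R u v \<Longrightarrow> word_cong S R v w \<Longrightarrow> word_cong S R u w"
| app: "word_cong S R u u' \<Longrightarrow> word_cong S R v v' \<Longrightarrow> word_cong S R (u @ v) (u' @ v')"

definition word_class :: "'a set \<Rightarrow> ('a list \<times> 'a list) set \<Rightarrow> 'a list \<Rightarrow> 'a list set" where
  "word_class S R w = {v. word_cong S R w v}"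

definition presented :: "'a set \<Rightarrow> ('a list \<times> 'a list) set \<Rightarrow> 'a list set monoid" where
  "presented S R =
     \<lparr>carrier = word_class S R ` lists S,
      monoid.mult = (\<lambda>C D. \<Union>u\<in>C. \<Union>v\<in>D. word_class S R (u @ v)),
      one = word_class S R []\<rparr>"

text \<open>In words over \<open>S \<times> UNIV\<close> the letter \<open>(s, True)\<close> stands for \<open>s\<close> and \<open>(s, False)\<close>
  for its inverse.\<close>

definition free_group_rels :: "'s set \<Rightarrow> (('s \<times> bool) list \<times> ('s \<times> bool) list) set" where
  "free_group_rels S = {([(s, b), (s, \<not> b)], []) | s b. s \<in> S}"

definition free_group :: "'s set \<Rightarrow> ('s \<times> bool) list set monoid" where
  "free_group S = presented (S \<times> UNIV) (free_group_rels S)"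

definition free_group_gen :: "'s set \<Rightarrow> 's \<Rightarrow> ('s \<times> bool) list set" where
  "free_group_gen S s = word_class (S \<times> UNIV) (free_group_rels S) [(s, True)]"

definition mult_rels :: "('g \<Rightarrow> 'a) \<Rightarrow> 'g monoid \<Rightarrow> ('a list \<times> 'a list) set" where
  "mult_rels \<iota> H =
     {([\<iota> g, \<iota> h], [\<iota> (g \<otimes>\<^bsub>H\<^esub> h)]) | g h. g \<in> carrier H \<and> h \<in> carrier H} \<union>
     {([\<iota> \<one>\<^bsub>H\<^esub>], [])}"

definition free_prod :: "'i set \<Rightarrow> ('i \<Rightarrow> 'g monoid) \<Rightarrow> ('i \<times> 'g) list set monoid" where
  "free_prod I H = presented (SIGMA i:I. carrier (H i)) (\<Union>i\<in>I. mult_rels (Pair i) (H i))"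

definition free_prod_in :: "'i set \<Rightarrow> ('i \<Rightarrow> 'g monoid) \<Rightarrow> 'i \<Rightarrow> 'g \<Rightarrow> ('i \<times> 'g) list set" where
  "free_prod_in I H i g =
     word_class (SIGMA i:I. carrier (H i)) (\<Union>i\<in>I. mult_rels (Pair i) (H i)) [(i, g)]"

definition free_prod2 :: "'g monoid \<Rightarrow> 'h monoid \<Rightarrow> ('g + 'h) list set monoid" where
  "free_prod2 G H = presented (carrier G <+> carrier H) (mult_rels Inl G \<union> mult_rels Inr H)"

definition free_prod2_inl :: "'g monoid \<Rightarrow> 'h monoid \<Rightarrow> 'g \<Rightarrow> ('g + 'h) list set" where
  "free_prod2_inl G H g =
     word_class (carrier G <+> carrier H) (mult_rels Inl G \<union> mult_rels Inr H) [Inl g]"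

definition free_prod2_inr :: "'g monoid \<Rightarrow> 'h monoid \<Rightarrow> 'h \<Rightarrow> ('g + 'h) list set" where
  "free_prod2_inr G H h =
     word_class (carrier G <+> carrier H) (mult_rels Inl G \<union> mult_rels Inr H) [Inr h]"

definition normal_closure :: "('g, 'm) monoid_scheme \<Rightarrow> 'g set \<Rightarrow> 'g set" where
  "normal_closure G R = \<Inter>{N. N \<lhd> G \<and> R \<subseteq> N}"


section \<open>Maximal trees\<close>

text \<open>The notion of \<^const>\<open>Digraph_Component.tree\<close> only excludes directed cycles and ignores
  parallel arcs when testing connectedness; here paths may traverse an oriented edge
  in both directions (\<open>True\<close>: from \<^const>\<open>tail\<close> to \<^const>\<open>head\<close>), and two parallel edges
  form a circuit.\<close>

definition step_from :: "('v, 'e) pre_digraph \<Rightarrow> 'e \<times> bool \<Rightarrow> 'v" where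
  "step_from G s = (if snd s then tail G (fst s) else head G (fst s))"

definition step_to :: "('v, 'e) pre_digraph \<Rightarrow> 'e \<times> bool \<Rightarrow> 'v" where
  "step_to G s = (if snd s then head G (fst s) else tail G (fst s))"

primrec upath :: "('v, 'e) pre_digraph \<Rightarrow> 'v \<Rightarrow> ('e \<times> bool) list \<Rightarrow> 'v \<Rightarrow> bool" where
  "upath G u [] v \<longleftrightarrow> u \<in> verts G \<and> u = v"
| "upath G u (s # p) v \<longleftrightarrow> fst s \<in> arcs G \<and> step_from G s = u \<and> upath G (step_to G s) p v"

definition ucircuit :: "('v, 'e) pre_digraph \<Rightarrow> ('e \<times> bool) list \<Rightarrow> bool" where
  "ucircuit G p \<longleftrightarrow> p \<noteq> [] \<and> (\<exists>u. upath G u p u) \<and>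
     distinct (map fst p) \<and> distinct (map (step_from G) p)"

definition utree :: "('v, 'e) pre_digraph \<Rightarrow> bool" where
  "utree G \<longleftrightarrow> wf_digraph G \<and> verts G \<noteq> {} \<and>
     (\<forall>u\<in>verts G. \<forall>v\<in>verts G. \<exists>p. upath G u p v) \<and> (\<nexists>p. ucircuit G p)"

definition maximal_tree :: "('v, 'e) pre_digraph \<Rightarrow> ('v, 'e) pre_digraph \<Rightarrow> bool" where
  "maximal_tree T G \<longleftrightarrow> utree T \<and> subgraph T G \<and>
     (\<forall>T'. utree T' \<and> subgraph T' G \<and> subgraph T T' \<longrightarrow> T' = T)"


section \<open>Graphs of groups and their fundamental groups\<close>

record ('v, 'e, 'g, 'h) graph_of_groups =
  gg_graph :: "('v, 'e) pre_digraph"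
  gg_vgrp :: "'v \<Rightarrow> 'g monoid"
  gg_egrp :: "'e \<Rightarrow> 'h monoid"
  gg_alpha :: "'e \<Rightarrow> 'h \<Rightarrow> 'g"
  gg_beta :: "'e \<Rightarrow> 'h \<Rightarrow> 'g"

type_synonym ('v, 'e, 'g) pi1_word = "(('v \<times> 'g) list set + ('e \<times> bool) list set) list set"

definition pi1_cover :: "('v, 'e, 'g, 'h) graph_of_groups \<Rightarrow> ('v, 'e, 'g) pi1_word monoid" where
  "pi1_cover \<Gamma> =
     free_prod2 (free_prod (verts (gg_graph \<Gamma>)) (gg_vgrp \<Gamma>)) (free_group (arcs (gg_graph \<Gamma>)))"

definition pi1_vert ::
  "('v, 'e, 'g, 'h) graph_of_groups \<Rightarrow> 'v \<Rightarrow> 'g \<Rightarrow> ('v, 'e, 'g) pi1_word" where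
  "pi1_vert \<Gamma> v g =
     free_prod2_inl (free_prod (verts (gg_graph \<Gamma>)) (gg_vgrp \<Gamma>)) (free_group (arcs (gg_graph \<Gamma>)))
       (free_prod_in (verts (gg_graph \<Gamma>)) (gg_vgrp \<Gamma>) v g)"

definition pi1_edge ::
  "('v, 'e, 'g, 'h) graph_of_groups \<Rightarrow> 'e \<Rightarrow> ('v, 'e, 'g) pi1_word" where
  "pi1_edge \<Gamma> e =
     free_prod2_inr (free_prod (verts (gg_graph \<Gamma>)) (gg_vgrp \<Gamma>)) (free_group (arcs (gg_graph \<Gamma>)))
       (free_group_gen (arcs (gg_graph \<Gamma>)) e)"

definition pi1_rels ::
  "('v, 'e, 'g, 'h) graph_of_groups \<Rightarrow> ('v, 'e) pre_digraph \<Rightarrow> ('v, 'e, 'g) pi1_word set" where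
  "pi1_rels \<Gamma> T =
     {inv\<^bsub>pi1_cover \<Gamma>\<^esub> (pi1_edge \<Gamma> e)
        \<otimes>\<^bsub>pi1_cover \<Gamma>\<^esub> pi1_vert \<Gamma> (tail (gg_graph \<Gamma>) e) (gg_alpha \<Gamma> e g)
        \<otimes>\<^bsub>pi1_cover \<Gamma>\<^esub> pi1_edge \<Gamma> e
        \<otimes>\<^bsub>pi1_cover \<Gamma>\<^esub> inv\<^bsub>pi1_cover \<Gamma>\<^esub> (pi1_vert \<Gamma> (head (gg_graph \<Gamma>) e) (gg_beta \<Gamma> e g))
      | e g. e \<in> arcs (gg_graph \<Gamma>) \<and> g \<in> carrier (gg_egrp \<Gamma> e)} \<union>
     pi1_edge \<Gamma> ` arcs T"

definition pi1 ::
  "('v, 'e, 'g, 'h) graph_of_groups \<Rightarrow> ('v, 'e) pre_digraph \<Rightarrow> ('v, 'e, 'g) pi1_word set monoid"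
  where "pi1 \<Gamma> T = pi1_cover \<Gamma> Mod normal_closure (pi1_cover \<Gamma>) (pi1_rels \<Gamma> T)"

text \<open>The tree product along \<open>T\<close> is the fundamental group of the tree of groups obtained by
  restricting \<open>\<Gamma>\<close> to \<open>T\<close>.\<close>

definition tree_product ::
  "('v, 'e, 'g, 'h) graph_of_groups \<Rightarrow> ('v, 'e) pre_digraph \<Rightarrow> ('v, 'e, 'g) pi1_word set monoid"
  where "tree_product \<Gamma> T = pi1 (\<Gamma>\<lparr>gg_graph := T\<rparr>) T"

definition tree_product_in ::
  "('v, 'e, 'g, 'h) graph_of_groups \<Rightarrow> ('v, 'e) pre_digraph \<Rightarrow> 'v \<Rightarrow> 'g
    \<Rightarrow> ('v, 'e, 'g) pi1_word set" where
  "tree_product_in \<Gamma> T v g =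
     normal_closure (pi1_cover (\<Gamma>\<lparr>gg_graph := T\<rparr>)) (pi1_rels (\<Gamma>\<lparr>gg_graph := T\<rparr>) T)
       #>\<^bsub>pi1_cover (\<Gamma>\<lparr>gg_graph := T\<rparr>)\<^esub> pi1_vert (\<Gamma>\<lparr>gg_graph := T\<rparr>) v g"

type_synonym ('v, 'e, 'g) tree_pres_word =
  "(('v, 'e, 'g) pi1_word set + ('e \<times> bool) list set) list set"

definition tree_pres_cover ::
  "('v, 'e, 'g, 'h) graph_of_groups \<Rightarrow> ('v, 'e) pre_digraph
    \<Rightarrow> ('v, 'e, 'g) tree_pres_word monoid" where
  "tree_pres_cover \<Gamma> T =
     free_prod2 (tree_product \<Gamma> T) (free_group (arcs (gg_graph \<Gamma>) - arcs T))"

definition tree_pres_vert ::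
  "('v, 'e, 'g, 'h) graph_of_groups \<Rightarrow> ('v, 'e) pre_digraph \<Rightarrow> 'v \<Rightarrow> 'g
    \<Rightarrow> ('v, 'e, 'g) tree_pres_word" where
  "tree_pres_vert \<Gamma> T v g =
     free_prod2_inl (tree_product \<Gamma> T) (free_group (arcs (gg_graph \<Gamma>) - arcs T))
       (tree_product_in \<Gamma> T v g)"

definition tree_pres_edge ::
  "('v, 'e, 'g, 'h) graph_of_groups \<Rightarrow> ('v, 'e) pre_digraph \<Rightarrow> 'e
    \<Rightarrow> ('v, 'e, 'g) tree_pres_word" where
  "tree_pres_edge \<Gamma> T e =
     free_prod2_inr (tree_product \<Gamma> T) (free_group (arcs (gg_graph \<Gamma>) - arcs T))
       (free_group_gen (arcs (gg_graph \<Gamma>) - arcs T) e)"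

definition tree_pres_rels ::
  "('v, 'e, 'g, 'h) graph_of_groups \<Rightarrow> ('v, 'e) pre_digraph
    \<Rightarrow> ('v, 'e, 'g) tree_pres_word set" where
  "tree_pres_rels \<Gamma> T =
     {inv\<^bsub>tree_pres_cover \<Gamma> T\<^esub> (tree_pres_edge \<Gamma> T e)
        \<otimes>\<^bsub>tree_pres_cover \<Gamma> T\<^esub> tree_pres_vert \<Gamma> T (tail (gg_graph \<Gamma>) e) (gg_alpha \<Gamma> e g)
        \<otimes>\<^bsub>tree_pres_cover \<Gamma> T\<^esub> tree_pres_edge \<Gamma> T e
        \<otimes>\<^bsub>tree_pres_cover \<Gamma> T\<^esub> inv\<^bsub>tree_pres_cover \<Gamma> T\<^esub>
            (tree_pres_vert \<Gamma> T (head (gg_graph \<Gamma>) e) (gg_beta \<Gamma> e g))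
      | e g. e \<in> arcs (gg_graph \<Gamma>) - arcs T \<and> g \<in> carrier (gg_egrp \<Gamma> e)}"

definition tree_pres ::
  "('v, 'e, 'g, 'h) graph_of_groups \<Rightarrow> ('v, 'e) pre_digraph
    \<Rightarrow> ('v, 'e, 'g) tree_pres_word set monoid" where
  "tree_pres \<Gamma> T =
     tree_pres_cover \<Gamma> T Mod normal_closure (tree_pres_cover \<Gamma> T) (tree_pres_rels \<Gamma> T)"


section \<open>The graph of groups attached to a Calogero-Moser space\<close>

type_synonym cm_vertex = "cm_point set + cm_point set"

type_synonym cm_edge = "cm_point set"

text \<open>The set \<open>\<Union>p\<in>E. cm_orbit n setA p\<close> is the unique \<open>A\<close>-orbit containing the
  \<open>U\<close>-orbit \<open>E\<close>; similarly for \<open>B\<close>.\<close>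

definition orbA :: "nat \<Rightarrow> cm_edge \<Rightarrow> cm_point set" where
  "orbA n E = (\<Union>p\<in>E. cm_orbit n setA p)"

definition orbB :: "nat \<Rightarrow> cm_edge \<Rightarrow> cm_point set" where
  "orbB n E = (\<Union>p\<in>E. cm_orbit n setB p)"

definition cm_graph :: "nat \<Rightarrow> (cm_vertex, cm_edge) pre_digraph" where
  "cm_graph n =
     \<lparr>verts = cm_orbits n setA <+> cm_orbits n setB,
      arcs = cm_orbits n setU,
      tail = (\<lambda>E. Inl (orbA n E)),
      head = (\<lambda>E. Inr (orbB n E))\<rparr>"

definition conj_grp :: "nat \<Rightarrow> (falg \<Rightarrow> falg) set \<Rightarrow> (falg \<Rightarrow> falg) \<Rightarrow> (falg \<Rightarrow> falg) monoid" where
  "conj_grp n H \<sigma> =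
     grpG\<lparr>carrier := carrier (grpGn n) \<inter> ((\<sigma> <#\<^bsub>grpG\<^esub> H) #>\<^bsub>grpG\<^esub> (inv\<^bsub>grpG\<^esub> \<sigma>))\<rparr>"

text \<open>\<open>based n O p \<sigma>\<close>: \<open>p\<close> is a basepoint of the orbit \<open>O\<close> which \<open>\<sigma>\<close> moves to the
  basepoint of the whole space.\<close>

definition based :: "nat \<Rightarrow> cm_point set \<Rightarrow> cm_point \<Rightarrow> (falg \<Rightarrow> falg) \<Rightarrow> bool" where
  "based n O' p \<sigma> \<longleftrightarrow> p \<in> O' \<and> \<sigma> \<in> carrier grpG \<and> cm_act n \<sigma> p = cm_base n"

text \<open>
  The choices entering the graph of groups, relative to a maximal tree \<open>T\<close>: basepoints
  \<open>pA\<close>, \<open>pB\<close>, \<open>pU\<close> and elements \<open>\<sigma>A\<close>, \<open>\<sigma>B\<close>, \<open>\<sigma>U\<close> for all orbits.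

  For the edges \<open>E\<close> of \<open>T\<close> one asks for \<open>\<sigma>U \<in> \<sigma>A A \<inter> \<sigma>B B\<close>. Asking this of all edges
  would embed the whole graph into the tree of cosets of \<open>A\<close>, \<open>B\<close> and \<open>U\<close> in \<open>G\<close>, so no
  such choice exists unless the graph is itself a tree. As usual in Bass-Serre theory,
  at the remaining edges the condition on \<open>\<sigma>B B\<close> is therefore required up to translation
  by an element \<open>\<gamma> E\<close> of \<open>G\<^sub>n\<close>, and the embedding of \<open>U\<^sub>\<sigma>\<close> into \<open>B\<^sub>\<sigma>\<close> is the inclusion
  followed by conjugation by \<open>\<gamma> E\<close>. With \<open>\<gamma> E = id\<close> for all \<open>E\<close> the condition reads
  \<open>\<sigma>U \<in> \<sigma>A A \<inter> \<sigma>B B\<close> and both embeddings are inclusions everywhere.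
\<close>

definition cm_choice ::
  "nat \<Rightarrow> (cm_vertex, cm_edge) pre_digraph \<Rightarrow>
   (cm_point set \<Rightarrow> cm_point) \<Rightarrow> (cm_point set \<Rightarrow> falg \<Rightarrow> falg) \<Rightarrow>
   (cm_point set \<Rightarrow> cm_point) \<Rightarrow> (cm_point set \<Rightarrow> falg \<Rightarrow> falg) \<Rightarrow>
   (cm_edge \<Rightarrow> cm_point) \<Rightarrow> (cm_edge \<Rightarrow> falg \<Rightarrow> falg) \<Rightarrow> (cm_edge \<Rightarrow> falg \<Rightarrow> falg) \<Rightarrow> bool"
  where
  "cm_choice n T pA \<sigma>A pB \<sigma>B pU \<sigma>U \<gamma> \<longleftrightarrow>
     (\<forall>O' \<in> cm_orbits n setA. based n O' (pA O') (\<sigma>A O')) \<and>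
     (\<forall>O' \<in> cm_orbits n setB. based n O' (pB O') (\<sigma>B O')) \<and>
     (\<forall>E \<in> cm_orbits n setU. based n E (pU E) (\<sigma>U E) \<and>
        \<gamma> E \<in> carrier (grpGn n) \<and>
        \<sigma>U E \<in> (\<sigma>A (orbA n E) <#\<^bsub>grpG\<^esub> setA) \<inter>
                ((\<gamma> E \<otimes>\<^bsub>grpG\<^esub> \<sigma>B (orbB n E)) <#\<^bsub>grpG\<^esub> setB)) \<and>
     (\<forall>E \<in> arcs T. \<gamma> E = \<one>\<^bsub>grpG\<^esub>)"

definition cm_gog ::
  "nat \<Rightarrow> (cm_point set \<Rightarrow> falg \<Rightarrow> falg) \<Rightarrow> (cm_point set \<Rightarrow> falg \<Rightarrow> falg) \<Rightarrow>
   (cm_edge \<Rightarrow> falg \<Rightarrow> falg) \<Rightarrow> (cm_edge \<Rightarrow> falg \<Rightarrow> falg) \<Rightarrow>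
   (cm_vertex, cm_edge, falg \<Rightarrow> falg, falg \<Rightarrow> falg) graph_of_groups" where
  "cm_gog n \<sigma>A \<sigma>B \<sigma>U \<gamma> =
     \<lparr>gg_graph = cm_graph n,
      gg_vgrp = case_sum (\<lambda>O'. conj_grp n setA (\<sigma>A O')) (\<lambda>O'. conj_grp n setB (\<sigma>B O')),
      gg_egrp = (\<lambda>E. conj_grp n setU (\<sigma>U E)),
      gg_alpha = (\<lambda>E g. g),
      gg_beta = (\<lambda>E g. inv\<^bsub>grpG\<^esub> (\<gamma> E) \<otimes>\<^bsub>grpG\<^esub> g \<otimes>\<^bsub>grpG\<^esub> \<gamma> E)\<rparr>"

end

theory Submission
  imports Defs "HOL-Algebra.Generated_Groups"
begin

text \<open>
  Why the theorem holds. The group \<open>G\<close> is the amalgam of \<open>A\<close> and \<open>B\<close> along \<open>U\<close>: it is generated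
  by \<open>A \<union> B\<close> (\<open>generated_by_A_B\<close>), and a product of at least two factors taken alternately from
  \<open>A - B\<close> and \<open>B - A\<close> is never trivial (\<open>alternating_product_nontrivial\<close>). By Bass-Serre theory
  the stabilizer of a point in a transitive action of an amalgam is the fundamental group
  of the graph of groups formed by the \<open>A\<close>-, \<open>B\<close>- and \<open>U\<close>-orbits.

  Generation. Abelianizing an automorphism \<open>\<sigma>\<close> gives a pair of polynomials with constant
  Jacobian through which both variables can be expressed. Such a pair of total degree above
  \<open>2\<close> admits an elementary substitution that lowers the degree (\<open>degree_reduction\<close>, Jung's
  theorem), so elements of \<open>A \<union> B\<close> reduce \<open>\<sigma>\<close> to an automorphism with affine abelianization. What
  remains is that \<open>\<sigma>\<close> is trivial if it fixes the commutator \<open>c = xy - yx\<close> and has trivial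
  abelianization (\<open>trivial_abelianization_imp_id\<close>). There one compares the Euler derivation \<open>e\<close>
  with its conjugate \<open>E = \<sigma> e \<sigma>\<^sup>-\<^sup>1\<close>. Since \<open>e\<close> is locally finite so is \<open>E\<close>, hence the top
  homogeneous component \<open>D\<close> of \<open>E\<close>, if of positive degree, satisfies \<open>D\<^sup>n x = 0\<close> for large \<open>n\<close>. But a derivation
  that kills \<open>c\<close> and vanishes on \<open>x\<close> and \<open>y\<close> modulo commutators cannot be nilpotent on \<open>x\<close>
  unless it is zero (\<open>nilpotent_imp_zero\<close>). So \<open>E = e\<close>, and \<open>\<sigma>\<close> preserves the degree.

  The non-nilpotency is read off a faithful family of representations by triangular matrices
  with diagonals \<open>X\<close> and \<open>Y\<close>. In these, \<open>D\<close> acts on the first nonvanishing superdiagonal by an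
  explicit formula (\<open>ev_D_level\<close>), and the leading behaviour of \<open>D\<^sup>n x\<close> can be followed
  through all iterations.

  The stabilizer. The inclusions of the vertex groups and \<open>e \<mapsto> \<gamma> e\<close> define a homomorphism from
  the fundamental group to \<open>G\<^sub>n\<close>. In the other direction, each \<open>g \<in> A \<union> B\<close> and each point \<open>p\<close> give an
  element of the fundamental group, the value of a cocycle. The cocycle extends to all of \<open>G\<close> because
  words over \<open>A \<union> B\<close> with trivial product collapse by multiplications inside \<open>A\<close> or \<open>B\<close>. Restricted
  to the stabilizer it is, up to a conjugation, a section of the first map; it is onto because the maximal tree
  spans the graph (\<open>stabilizer_iso_pi1\<close>). The second presentation has the same universal property
  as the first one (\<open>pi1_iso_tree_pres\<close>).
\<close>


section \<open>The free algebra and its evaluations\<close>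

definition wd :: "letter list => falg" where
  "wd l = Poly_Mapping.single (Word l) 1"

abbreviation lkp :: "falg => fword => complex" where "lkp \<equiv> Poly_Mapping.lookup"
abbreviation supp :: "falg => fword set" where "supp \<equiv> Poly_Mapping.keys"

lemma letters_plus [simp]: "letters (v + w) = letters v @ letters w"
  by (simp add: plus_fword_def)

lemma letters_zero [simp]: "letters 0 = []"
  by (simp add: zero_fword_def)

lemma wd_Nil: "wd [] = 1"
  by (simp add: wd_def flip: zero_fword_def single_one)

lemma wd_append: "wd (l @ m) = wd l * wd m"
  by (simp add: wd_def mult_single plus_fword_def)

lemma genx_wd: "genx = wd [LX]" and geny_wd: "geny = wd [LY]"
  by (simp_all add: wd_def genx_def geny_def)

lemma wd_LX: "wd (LX # l) = genx * wd l" and wd_LY: "wd (LY # l) = geny * wd l"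
  using wd_append[of "[LX]" l] wd_append[of "[LY]" l] by (simp_all add: genx_wd geny_wd)

lemma scal_add: "scal (a + b) = scal a + scal b"
  by (simp add: scal_def single_add)

lemma scal_mult: "scal (a * b) = scal a * scal b"
  by (simp add: scal_def mult_single)

lemma scal_1 [simp]: "scal 1 = 1"
  by (simp add: scal_def)

lemma scal_0 [simp]: "scal 0 = 0"
  by (simp add: scal_def)

lemma scal_uminus: "scal (- a) = - scal a"
  by (simp add: scal_def single_uminus)

lemma scal_diff: "scal (a - b) = scal a - scal b"
  by (simp add: scal_def single_diff)

lemma scal_times_wd: "scal c * wd l = Poly_Mapping.single (Word l) c"
  by (simp add: scal_def wd_def mult_single)

lemma falg_induct [case_names zero add word]:
  assumes "P 0" "!!u v. P u ==> P v ==> P (u + v)" "!!c l. P (scal c * wd l)"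
  shows "P u"
proof (induction u rule: Poly_Mapping.update_induct)
  case const then show ?case by (rule assms)
next
  case (update f a b)
  have "Poly_Mapping.update a b f = f + scal b * wd (letters a)"
    using update(1) by (intro poly_mapping_eqI) (auto simp: lookup_update lookup_add scal_times_wd lookup_single when_def in_keys_iff)
  then show ?case using update assms by metis
qed

lemma scal_commute: "p * scal c = scal c * p"
  by (induction p rule: falg_induct) (simp_all add: algebra_simps scal_times_wd, simp add: scal_def mult_single ac_simps)

lemma word_times_word: "(scal c * wd l) * (scal d * wd m) = scal (c * d) * wd (l @ m)"
  by (simp add: scal_times_wd mult_single plus_fword_def)

text \<open>The linear extension of a function on words, for an arbitrary scalar multiplication
  on its target; all evaluations below are instances.\<close>

definition lin :: "(complex => 'v => 'v) => (letter list => 'v::ab_group_add) => falg => 'v" where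
  "lin s \<phi> u = (\<Sum>w\<in>supp u. s (lkp u w) (\<phi> (letters w)))"

locale cmod = module s for s :: "complex => 'v::ab_group_add => 'v"
begin

lemma lin_superset:
  assumes "finite S" "supp u \<subseteq> S"
  shows "lin s \<phi> u = (\<Sum>w\<in>S. s (lkp u w) (\<phi> (letters w)))"
  unfolding lin_def
  by (rule sum.mono_neutral_left) (use assms in \<open>auto simp: in_keys_iff\<close>)

lemma lin_0 [simp]: "lin s \<phi> 0 = 0"
  by (simp add: lin_def)

lemma lin_add: "lin s \<phi> (u + v) = lin s \<phi> u + lin s \<phi> v"
proof -
  let ?S = "supp u \<union> supp v"
  have "lin s \<phi> (u + v) = (\<Sum>w\<in>?S. s (lkp (u+v) w) (\<phi> (letters w)))"
    by (rule lin_superset) (use Poly_Mapping.keys_add[of u v] in auto)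
  also have "\<dots> = lin s \<phi> u + lin s \<phi> v"
    by (simp add: lin_superset[of ?S u] lin_superset[of ?S v] lookup_add scale_left_distrib sum.distrib)
  finally show ?thesis .
qed

lemma lin_word: "lin s \<phi> (scal c * wd l) = s c (\<phi> l)"
  by (cases "c = 0") (simp_all add: lin_def scal_times_wd)

lemma lin_wd [simp]: "lin s \<phi> (wd l) = \<phi> l"
  using lin_word[of \<phi> 1 l] by simp

lemma lin_scal: "lin s \<phi> (scal c * u) = s c (lin s \<phi> u)"
proof (induction u rule: falg_induct)
  case (word d l)
  then show ?case by (simp add: lin_word flip: mult.assoc scal_mult)
qed (simp_all add: lin_add distrib_left scale_right_distrib)

lemma lin_uminus: "lin s \<phi> (- u) = - lin s \<phi> u"
  using lin_add[of \<phi> u "-u"] by (simp add: eq_neg_iff_add_eq_0 add.commute)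

lemma lin_diff: "lin s \<phi> (u - v) = lin s \<phi> u - lin s \<phi> v"
  using lin_add[of \<phi> u "-v"] by (simp add: lin_uminus)

end

fun wprod :: "'r::ring_1 => 'r => letter list => 'r" where
  "wprod p q [] = 1"
| "wprod p q (LX # l) = p * wprod p q l"
| "wprod p q (LY # l) = q * wprod p q l"

lemma wprod_append: "wprod p q (l @ m) = wprod p q l * wprod p q m"
  by (induction p q l rule: wprod.induct) (simp_all add: mult.assoc)

text \<open>Algebras over the complex numbers, given by their scalar multiplication so that one
  ring can serve as target in several ways.\<close>

locale calg = cmod s for s :: "complex => 'r::ring_1 => 'r" +
  assumes scale_mult1: "s c (a * b) = s c a * b"
    and scale_mult2: "s c (a * b) = a * s c b"
begin

definition subst :: "'r => 'r => falg => 'r" where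
  "subst p q = lin s (wprod p q)"

lemma subst_add: "subst p q (u + v) = subst p q u + subst p q v"
  and subst_diff: "subst p q (u - v) = subst p q u - subst p q v"
  and subst_uminus: "subst p q (- u) = - subst p q u"
  and subst_scal_mult: "subst p q (scal c * u) = s c (subst p q u)"
  and subst_0 [simp]: "subst p q 0 = 0"
  and subst_wd: "subst p q (wd l) = wprod p q l"
  by (simp_all add: subst_def lin_add lin_diff lin_scal lin_uminus)

lemma subst_1 [simp]: "subst p q 1 = 1"
  using subst_wd[of p q "[]"] by (simp add: wd_Nil)

lemma subst_scal: "subst p q (scal c) = s c 1"
  using subst_scal_mult[of p q c 1] by simp

lemma subst_gen [simp]: "subst p q genx = p" "subst p q geny = q"
  by (simp_all add: genx_wd geny_wd subst_wd)

lemma subst_mult: "subst p q (u * v) = subst p q u * subst p q v"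
proof (induction u rule: falg_induct)
  case (word c l)
  show ?case
  proof (induction v rule: falg_induct)
    case (word d m)
    have "(scal c * wd l) * (scal d * wd m) = scal (c * d) * wd (l @ m)"
      by (rule word_times_word)
    moreover have "s c a * s d b = s (c * d) (a * b)" for a b :: 'r
    proof -
      have "s c a * s d b = s c (a * s d b)" by (rule scale_mult1[symmetric])
      also have "a * s d b = s d (a * b)" by (rule scale_mult2[symmetric])
      finally show ?thesis by simp
    qed
    ultimately show ?case
      by (simp add: subst_scal_mult subst_wd wprod_append)
  qed (simp_all add: distrib_left subst_add)
qed (simp_all add: distrib_right subst_add)

lemma subst_power: "subst p q (u ^ k) = subst p q u ^ k"
  by (induction k) (simp_all add: subst_mult)

lemma hom_eq_subst:
  assumes "!!u v. h (u + v) = h u + h v" "!!u v. h (u * v) = h u * h v"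
    "!!c u. h (scal c * u) = s c (h u)" "h 1 = 1"
  shows "h u = subst (h genx) (h geny) u"
proof (induction u rule: falg_induct)
  case zero
  show ?case using assms(1)[of 0 0] by simp
next
  case (word c l)
  have "h (wd l) = wprod (h genx) (h geny) l"
    by (induction l rule: wprod.induct[where ?a0.0="h genx" and ?a1.0="h geny", of "\<lambda>_ _ l. h (wd l) = wprod (h genx) (h geny) l", simplified])
       (auto simp: wd_Nil wd_LX wd_LY assms)
  then show ?case by (simp only: assms(3) subst_scal_mult subst_wd)
qed (simp_all add: assms subst_add)

end

interpretation cC: cmod "(*)" by unfold_locales (simp_all add: algebra_simps)

interpretation fA: calg "\<lambda>c u. scal c * (u::falg)"
  by unfold_locales
     (simp_all add: distrib_left distrib_right scal_add scal_mult mult.assoc, metis mult.assoc scal_commute)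

declare cC.scale_scale [simp del] fA.scale_scale [simp del]

interpretation pA: calg "Polynomial.smult :: complex => complex poly => complex poly"
  by unfold_locales (simp_all add: algebra_simps smult_add_left smult_add_right)

interpretation ppA: calg "\<lambda>c. Polynomial.smult [:c:] :: complex poly poly => complex poly poly"
  by unfold_locales (simp_all add: algebra_simps smult_add_left smult_add_right one_pCons[symmetric] flip: smult_add_left)

section \<open>Triangular representations and derivations\<close>

definition comm :: falg where "comm = genx * geny - geny * genx"

text \<open>The entry (i, j) of the image of a word under the representation that sends x to the
  infinite diagonal matrix of X, and y to the sum of the diagonal matrix of Y and the matrix
  with ones on the first superdiagonal. An index i is thought of as a site carrying the point (X
  i, Y i); the entry only sees the sites from i to j.\<close>

fun tri :: "(nat => complex) => (nat => complex) => letter list => nat => nat => complex" where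
  "tri X Y [] i j = (if i = j then 1 else 0)"
| "tri X Y (LX # l) i j = X i * tri X Y l i j"
| "tri X Y (LY # l) i j = Y i * tri X Y l i j + tri X Y l (Suc i) j"

lemma tri_lower: "j < i ==> tri X Y l i j = 0"
  by (induction X Y l i j rule: tri.induct) auto

lemma tri_append: "tri X Y (l @ m) i j = (\<Sum>k=i..j. tri X Y l i k * tri X Y m k j)"
proof (induction X Y l i j rule: tri.induct)
  case (1 X Y i j)
  have "(\<Sum>k=i..j. tri X Y [] i k * tri X Y m k j) = (\<Sum>k=i..j. if k = i then tri X Y m i j else 0)"
    by (rule sum.cong) auto
  also have "\<dots> = tri X Y m i j"
    using tri_lower[of j i X Y m] by (subst sum.delta) (auto simp del: tri.simps)
  finally show ?case by simp
next
  case (2 X Y l i j)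
  then show ?case by (simp add: sum_distrib_left mult.assoc)
next
  case (3 X Y l i j)
  have "(\<Sum>k=Suc i..j. tri X Y l (Suc i) k * tri X Y m k j) = (\<Sum>k=i..j. tri X Y l (Suc i) k * tri X Y m k j)"
    by (rule sum.mono_neutral_left) (auto simp: tri_lower not_less_eq_eq)
  then show ?case using 3 by (simp add: sum_distrib_left sum.distrib algebra_simps)
qed

lemma tri_shift:
  assumes "!!a. i \<le> a ==> X' a = X (a + d) \<and> Y' a = Y (a + d)"
  shows "tri X' Y' l i j = tri X Y l (i + d) (j + d)"
  using assms by (induction X' Y' l i j rule: tri.induct) (auto simp: )

lemma tri_cong:
  assumes "!!a. i \<le> a ==> a \<le> j ==> X' a = X a \<and> Y' a = Y a"
  shows "tri X' Y' l i j = tri X Y l i j"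
  using assms
proof (induction X' Y' l i j rule: tri.induct)
  case (2 X' Y' l i j)
  then show ?case by (cases "i \<le> j") (auto simp: tri_lower)
next
  case (3 X' Y' l i j)
  then show ?case by (cases "i \<le> j") (auto simp: tri_lower)
qed auto

definition ev :: "(nat => complex) => (nat => complex) => falg => nat => nat => complex" where
  "ev X Y u i j = lin (*) (\<lambda>l. tri X Y l i j) u"

lemma ev_add: "ev X Y (u + v) i j = ev X Y u i j + ev X Y v i j"
  and ev_diff: "ev X Y (u - v) i j = ev X Y u i j - ev X Y v i j"
  and ev_scal: "ev X Y (scal c * u) i j = c * ev X Y u i j"
  and ev_0 [simp]: "ev X Y 0 i j = 0"
  and ev_wd: "ev X Y (wd l) i j = tri X Y l i j"
  by (simp_all add: ev_def cC.lin_add cC.lin_diff cC.lin_scal)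

lemma ev_1: "ev X Y 1 i j = (if i = j then 1 else 0)"
  using ev_wd[of X Y "[]" i j] by (simp add: wd_Nil)

lemma ev_sum: "ev X Y (sum f I) i j = (\<Sum>t\<in>I. ev X Y (f t) i j)"
  by (induction I rule: infinite_finite_induct) (simp_all add: ev_add)

lemma ev_lower: "j < i ==> ev X Y u i j = 0"
  by (simp add: ev_def lin_def tri_lower)

lemma ev_mult: "ev X Y (u * v) i j = (\<Sum>k=i..j. ev X Y u i k * ev X Y v k j)"
proof (induction u rule: falg_induct)
  case (word c l)
  show ?case
  proof (induction v rule: falg_induct)
    case (word d m)
    have "(scal c * wd l) * (scal d * wd m) = scal (c * d) * wd (l @ m)"
      by (rule word_times_word)
    then have "ev X Y ((scal c * wd l) * (scal d * wd m)) i j = (\<Sum>k=i..j. c * d * (tri X Y l i k * tri X Y m k j))"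
      by (simp add: ev_scal ev_wd tri_append sum_distrib_left)
    also have "\<dots> = (\<Sum>k=i..j. ev X Y (scal c * wd l) i k * ev X Y (scal d * wd m) k j)"
      by (rule sum.cong) (simp_all add: ev_scal ev_wd)
    finally show ?case .
  qed (simp_all add: distrib_left ev_add sum.distrib)
qed (simp_all add: distrib_right ev_add sum.distrib)

lemma ev_genx: "ev X Y genx i j = (if i = j then X i else 0)"
  by (simp add: genx_wd ev_wd)

lemma ev_geny: "ev X Y geny i j = (if i = j then Y i else if j = Suc i then 1 else 0)"
  by (auto simp add: geny_wd ev_wd)

lemma ev_shift:
  assumes "!!a. i \<le> a ==> X' a = X (a + d) \<and> Y' a = Y (a + d)"
  shows "ev X' Y' u i j = ev X Y u (i + d) (j + d)"
  by (simp only: ev_def tri_shift[where X'=X' and X=X and Y'=Y' and Y=Y and d=d, OF assms])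

lemma ev_shift0: "ev X Y u i (i + j) = ev (\<lambda>a. X (a + i)) (\<lambda>a. Y (a + i)) u 0 j"
  by (subst ev_shift[where X=X and Y=Y and d=i]) (auto simp: add.commute)

lemma ev_cong:
  assumes "!!a. i \<le> a ==> a \<le> j ==> X' a = X a \<and> Y' a = Y a"
  shows "ev X' Y' u i j = ev X Y u i j"
  by (simp only: ev_def tri_cong[where X'=X' and X=X and Y'=Y' and Y=Y, OF assms])

lemma ev_genx_mult: "ev X Y (genx * u) i j = X i * ev X Y u i j"
proof -
  have "ev X Y (genx * u) i j = (\<Sum>k=i..j. if k = i then X i * ev X Y u i j else 0)"
    unfolding ev_mult by (rule sum.cong) (auto simp: ev_genx)
  then show ?thesis by (cases "i \<le> j") (auto simp: ev_lower)
qed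

lemma ev_mult_genx: "ev X Y (u * genx) i j = ev X Y u i j * X j"
proof -
  have "ev X Y (u * genx) i j = (\<Sum>k=i..j. if k = j then ev X Y u i j * X j else 0)"
    unfolding ev_mult by (rule sum.cong) (auto simp: ev_genx)
  then show ?thesis by (cases "i \<le> j") (auto simp: ev_lower)
qed

lemma ev_geny_mult: "ev X Y (geny * u) i j = Y i * ev X Y u i j + ev X Y u (Suc i) j"
  by (induction u rule: falg_induct)
     (auto simp: distrib_left ev_add ev_scal algebra_simps ev_wd scal_commute
        simp flip: wd_LY mult.assoc, simp add: ev_scal ev_wd algebra_simps mult.assoc flip: wd_LY)

lemma ev_mult_geny: "ev X Y (u * geny) i (Suc j) = ev X Y u i (Suc j) * Y (Suc j) + ev X Y u i j"
proof -
  have "ev X Y (u * geny) i (Suc j)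
      = (\<Sum>k=i..Suc j. (if k = Suc j then ev X Y u i (Suc j) * Y (Suc j) else 0) + (if k = j then ev X Y u i j else 0))"
    unfolding ev_mult by (rule sum.cong) (auto simp: ev_geny)
  moreover consider "i \<le> j" | "i = Suc j" | "i > Suc j" by linarith
  ultimately show ?thesis by cases (auto simp: ev_lower sum.distrib)
qed

definition derivation :: "(falg => falg) => bool" where
  "derivation D \<longleftrightarrow> (\<forall>u v. D (u + v) = D u + D v) \<and> (\<forall>u v. D (u * v) = D u * v + u * D v) \<and>
     (\<forall>c u. D (scal c * u) = scal c * D u)"

lemma derivation_1: "derivation D ==> D 1 = 0"
  unfolding derivation_def by (metis add_cancel_right_left mult.left_neutral mult.right_neutral)

lemma derivation_0: "derivation D ==> D 0 = 0"
  unfolding derivation_def by (metis add_cancel_right_left add_0)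

lemma derivation_uminus: "derivation D ==> D (- u) = - D u"
  using derivation_0[of D] unfolding derivation_def
  by (metis add.right_inverse eq_neg_iff_add_eq_0 add.commute)

lemma derivation_diff: "derivation D ==> D (u - v) = D u - D v"
  using derivation_uminus[of D] unfolding derivation_def
  by (metis diff_conv_add_uminus)

text \<open>Reindexing of the sites that removes those strictly between l and l'.\<close>

definition skip :: "nat => nat => nat => nat" where
  "skip l l' a = (if a \<le> l then a else a + (l' - l - 1))"

text \<open>If the representation is perturbed by adding \<epsilon> B to the image of y, then
  jump B is the derivative at \<epsilon> = 0: exactly one step goes from some l directly to some
  l', and the rest of the matrix entry is an entry for the sequence of sites without those in
  between.\<close>

definition jump :: "(nat => nat => complex) => (nat => complex) => (nat => complex) => falg => nat => nat => complex" where
  "jump B X Y u i j = (\<Sum>l=i..<j. \<Sum>l'=Suc l..j. B l l' * ev (X \<circ> skip l l') (Y \<circ> skip l l') u i (j + 1 + l - l'))"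

lemma jump_genx: "jump B X Y (genx * u) i j = X i * jump B X Y u i j"
  unfolding jump_def sum_distrib_left
  by (intro sum.cong HOL.refl) (auto simp: ev_genx_mult skip_def)

lemma jump_geny:
  "jump B X Y (geny * u) i j = Y i * jump B X Y u i j + jump B X Y u (Suc i) j
     + (\<Sum>l'=Suc i..j. B i l' * ev X Y u l' j)"
proof -
  have *: "ev (X \<circ> skip l l') (Y \<circ> skip l l') u (Suc i) (j + 1 + l - l') = ev X Y u l' j"
    if "l = i" "l' \<in> {Suc l..j}" for l l'
    using that by (subst ev_shift[where X=X and Y=Y and d="l' - i - 1"]) (auto simp: skip_def)
  have "jump B X Y (geny * u) i j =
     (\<Sum>l=i..<j. \<Sum>l'=Suc l..j. Y i * (B l l' * ev (X \<circ> skip l l') (Y \<circ> skip l l') u i (j + 1 + l - l')))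
   + (\<Sum>l=i..<j. \<Sum>l'=Suc l..j. B l l' * ev (X \<circ> skip l l') (Y \<circ> skip l l') u (Suc i) (j + 1 + l - l'))"
    unfolding jump_def sum.distrib[symmetric]
    by (intro sum.cong HOL.refl) (auto simp: ev_geny_mult skip_def algebra_simps)
  also have "(\<Sum>l=i..<j. \<Sum>l'=Suc l..j. Y i * (B l l' * ev (X \<circ> skip l l') (Y \<circ> skip l l') u i (j + 1 + l - l')))
     = Y i * jump B X Y u i j"
    by (simp add: jump_def sum_distrib_left)
  also have "(\<Sum>l=i..<j. \<Sum>l'=Suc l..j. B l l' * ev (X \<circ> skip l l') (Y \<circ> skip l l') u (Suc i) (j + 1 + l - l'))
     = jump B X Y u (Suc i) j + (\<Sum>l'=Suc i..j. B i l' * ev X Y u l' j)"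
  proof (cases "i < j")
    case True
    have "(\<Sum>l'=Suc i..j. B i l' * ev (X \<circ> skip i l') (Y \<circ> skip i l') u (Suc i) (j + 1 + i - l'))
        = (\<Sum>l'=Suc i..j. B i l' * ev X Y u l' j)"
      by (intro sum.cong HOL.refl) (simp only: *[OF HOL.refl])
    with True show ?thesis by (simp add: sum.atLeast_Suc_lessThan jump_def)
  qed (simp add: jump_def)
  finally show ?thesis by (simp add: add.assoc)
qed

lemma jump_1: "jump B X Y 1 i j = 0"
  unfolding jump_def by (intro sum.neutral ballI) (auto simp: ev_1)

lemma jump_add: "jump B X Y (u + v) i j = jump B X Y u i j + jump B X Y v i j"
  by (simp add: jump_def ev_add distrib_left sum.distrib)

lemma jump_scal: "jump B X Y (scal c * u) i j = c * jump B X Y u i j"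
  by (simp add: jump_def ev_scal sum_distrib_left algebra_simps)

lemma sum_shift_W:
  fixes f g :: "nat => complex"
  assumes "g (Suc j) = 0" "f i = 0"
  shows "(\<Sum>k=i..j. f k * g k) = (\<Sum>k=i..j. f (Suc k) * g (Suc k))"
proof (cases "i \<le> j")
  case True
  have "(\<Sum>k=i..j. f (Suc k) * g (Suc k)) = (\<Sum>k=Suc i..Suc j. f k * g k)"
    by (simp only: sum.shift_bounds_cl_Suc_ivl)
  also have "\<dots> = (\<Sum>k=Suc i..j. f k * g k)"
    using True assms by simp
  also have "\<dots> = (\<Sum>k=i..j. f k * g k)"
    using True assms by (simp add: sum.atLeast_Suc_atMost)
  finally show ?thesis by simp
qed auto

text \<open>A derivation is an infinitesimal deformation of the representation. Conjugation by 1
  + \<epsilon> W absorbs its effect on x; what is left is a change B of the image of y, which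
  enters through jump.\<close>

lemma ev_derivation:
  assumes D: "derivation D"
    and W: "!!i j. j \<le> i ==> W i j = 0"
    and A: "!!i j. j \<le> M ==> ev X Y (D genx) i j = (X i - X j) * W i j"
    and B: "!!i j. j \<le> M ==> i < j ==>
       ev X Y (D geny) i j = (Y i - Y j) * W i j + W (Suc i) j - W i (j - 1) + B i j"
    and B0: "!!i. ev X Y (D geny) i i = 0"
    and j: "j \<le> M"
  shows "ev X Y (D u) i j = (\<Sum>k=i..j. ev X Y u i k * W k j - W i k * ev X Y u k j) + jump B X Y u i j"
proof -
  have on_words: "ev X Y (D (wd l)) i j =
     (\<Sum>k=i..j. ev X Y (wd l) i k * W k j - W i k * ev X Y (wd l) k j) + jump B X Y (wd l) i j" for l
  proof (induction l arbitrary: i)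
    case Nil
    have "(\<Sum>k=i..j. ev X Y 1 i k * W k j - W i k * ev X Y 1 k j) =
      (\<Sum>k=i..j. (if k = i then W i j else 0) - (if k = j then W i j else 0))"
      by (rule sum.cong) (auto simp: ev_1)
    also have "\<dots> = 0"
      by (cases "i \<le> j") (auto simp: sum_subtractf)
    finally show ?case by (simp add: wd_Nil derivation_1[OF D] jump_1)
  next
    case (Cons a l)
    show ?case
    proof (cases a)
      case LX
      have "ev X Y (D (wd (LX # l))) i j = (\<Sum>k=i..j. (X i - X k) * W i k * ev X Y (wd l) k j)
          + X i * ev X Y (D (wd l)) i j"
        using D j by (simp add: wd_LX derivation_def ev_add ev_genx_mult ev_mult[of _ _ "D genx"] A)
      also have "\<dots> = (\<Sum>k=i..j. (X i - X k) * W i k * ev X Y (wd l) k j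
           + X i * (ev X Y (wd l) i k * W k j - W i k * ev X Y (wd l) k j)) + X i * jump B X Y (wd l) i j"
        by (simp add: Cons sum.distrib sum_distrib_left distrib_left)
      also have "\<dots> = (\<Sum>k=i..j. ev X Y (wd (LX # l)) i k * W k j - W i k * ev X Y (wd (LX # l)) k j) + jump B X Y (wd (LX # l)) i j"
        by (simp add: wd_LX ev_genx_mult jump_genx algebra_simps)
      finally show ?thesis using LX by simp
    next
      case LY
      let ?w = "wd l"
      have B': "ev X Y (D geny) i k * ev X Y ?w k j = ((Y i - Y k) * W i k + W (Suc i) k) * ev X Y ?w k j
           - W i (k - 1) * ev X Y ?w k j + (if k = i then 0 else B i k * ev X Y ?w k j)"
        if "k \<in> {i..j}" for k
        using that j by (cases "k = i") (auto simp: B0 B W algebra_simps)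
      have "(\<Sum>k=i..j. ev X Y (D geny) i k * ev X Y ?w k j) =
         (\<Sum>k=i..j. ((Y i - Y k) * W i k + W (Suc i) k) * ev X Y ?w k j)
          - (\<Sum>k=i..j. W i (k - 1) * ev X Y ?w k j) + (\<Sum>k=i..j. (if k = i then 0 else B i k * ev X Y ?w k j))"
        unfolding sum.distrib[symmetric] sum_subtractf[symmetric]
        by (rule sum.cong[OF HOL.refl]) (rule B')
      also have "(\<Sum>k=i..j. W i (k - 1) * ev X Y ?w k j) = (\<Sum>k=i..j. W i k * ev X Y ?w (Suc k) j)"
        using sum_shift_W[of "\<lambda>k. ev X Y ?w k j" j "\<lambda>k. W i (k - 1)" i] by (simp add: ev_lower W)
      also have "(\<Sum>k=i..j. (if k = i then 0 else B i k * ev X Y ?w k j)) = (\<Sum>k=Suc i..j. B i k * ev X Y ?w k j)"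
        by (rule sum.mono_neutral_cong_right) auto
      finally have 1: "(\<Sum>k=i..j. ev X Y (D geny) i k * ev X Y ?w k j) =
         (\<Sum>k=i..j. ((Y i - Y k) * W i k + W (Suc i) k) * ev X Y ?w k j)
          - (\<Sum>k=i..j. W i k * ev X Y ?w (Suc k) j) + (\<Sum>k=Suc i..j. B i k * ev X Y ?w k j)" .
      have 2: "(\<Sum>k=Suc i..j. ev X Y ?w (Suc i) k * W k j - W (Suc i) k * ev X Y ?w k j)
           = (\<Sum>k=i..j. ev X Y ?w (Suc i) k * W k j - W (Suc i) k * ev X Y ?w k j)"
        by (rule sum.mono_neutral_left) (auto simp: ev_lower W not_less_eq_eq)
      have "ev X Y (D (wd (LY # l))) i j = (\<Sum>k=i..j. ev X Y (D geny) i k * ev X Y ?w k j)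
          + Y i * ev X Y (D ?w) i j + ev X Y (D ?w) (Suc i) j"
        using D by (simp add: wd_LY derivation_def ev_add ev_geny_mult ev_mult[of _ _ "D geny"] add.assoc)
      also have "\<dots> = (\<Sum>k=i..j. (((Y i - Y k) * W i k + W (Suc i) k) * ev X Y ?w k j) - W i k * ev X Y ?w (Suc k) j
          + Y i * (ev X Y ?w i k * W k j - W i k * ev X Y ?w k j)
          + (ev X Y ?w (Suc i) k * W k j - W (Suc i) k * ev X Y ?w k j))
          + jump B X Y (wd (LY # l)) i j"
        unfolding 1 Cons.IH 2 wd_LY jump_geny
        by (simp add: sum.distrib sum_subtractf sum_distrib_left algebra_simps)
      also have "(\<Sum>k=i..j. (((Y i - Y k) * W i k + W (Suc i) k) * ev X Y ?w k j) - W i k * ev X Y ?w (Suc k) j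
          + Y i * (ev X Y ?w i k * W k j - W i k * ev X Y ?w k j)
          + (ev X Y ?w (Suc i) k * W k j - W (Suc i) k * ev X Y ?w k j))
         = (\<Sum>k=i..j. ev X Y (wd (LY # l)) i k * W k j - W i k * ev X Y (wd (LY # l)) k j)"
        by (rule sum.cong) (auto simp: wd_LY ev_geny_mult algebra_simps)
      finally show ?thesis using LY by simp
    qed
  qed
  show ?thesis
  proof (induction u rule: falg_induct)
    case (word c l)
    have "D (scal c * wd l) = scal c * D (wd l)"
      using D unfolding derivation_def by blast
    then show ?case
      unfolding ev_scal jump_scal by (simp only: on_words ev_scal distrib_left sum_distrib_left right_diff_distrib mult.left_commute mult.assoc)
  next
    case (add u v)
    have "(\<Sum>k=i..j. ev X Y (u + v) i k * W k j - W i k * ev X Y (u + v) k j)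
        = (\<Sum>k=i..j. ev X Y u i k * W k j - W i k * ev X Y u k j)
        + (\<Sum>k=i..j. ev X Y v i k * W k j - W i k * ev X Y v k j)"
      unfolding sum.distrib[symmetric] by (rule sum.cong) (auto simp: ev_add algebra_simps)
    moreover have "D (u + v) = D u + D v" using D unfolding derivation_def by blast
    ultimately show ?case
      by (simp only: ev_add jump_add add.IH add.assoc add.left_commute)
  qed (simp add: derivation_0[OF D] jump_def)
qed

section \<open>Normal forms and their symbols\<close>

definition mono :: "nat \<times> nat => falg" where "mono p = genx ^ fst p * geny ^ snd p"

text \<open>The normal form is s_0 c s_1 c \<dots> c s_k with c the commutator and ordered
  monomials s_i = x^a y^b, encoded by the list of exponent pairs; nft is the part that begins
  with a commutator.\<close>

fun nft :: "(nat \<times> nat) list => falg" where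
  "nft [] = 1"
| "nft (p # ps) = comm * (mono p * nft ps)"

definition nfl :: "(nat \<times> nat) list => falg" where
  "nfl L = mono (hd L) * nft (tl L)"

inductive nfspan :: "falg => bool" where
  zero: "nfspan 0"
| add: "nfspan u ==> nfspan v ==> nfspan (u + v)"
| nf: "L \<noteq> [] ==> nfspan (scal c * nfl L)"

lemma nfspan_nfl: "L \<noteq> [] ==> nfspan (nfl L)"
  using nfspan.nf[of L 1] by simp

lemma nfspan_scal: "nfspan u ==> nfspan (scal c * u)"
proof (induction rule: nfspan.induct)
  case (nf L d)
  then show ?case using nfspan.nf[of L "c * d"] by (simp add: scal_mult mult.assoc)
qed (auto simp: distrib_left intro: nfspan.intros)

lemma nfspan_diff: "nfspan u ==> nfspan v ==> nfspan (u - v)"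
  using nfspan.add[of u "scal (-1) * v"] nfspan_scal[of v "-1"] by (simp add: scal_uminus)

lemma mult_scal_left: "p * (scal c * q) = scal c * (p * q)"
  by (metis mult.assoc scal_commute)

lemma nfspan_genx: "nfspan u ==> nfspan (genx * u)"
proof (induction rule: nfspan.induct)
  case (nf L c)
  then obtain e f ps where L: "L = (e, f) # ps" by (cases L) auto
  have "genx * (scal c * nfl L) = scal c * nfl ((Suc e, f) # ps)"
    by (simp add: mult_scal_left L nfl_def mono_def mult.assoc)
  then show ?case using nfspan.nf[of "(Suc e, f) # ps" c] by simp
qed (auto simp: distrib_left intro: nfspan.intros)

text \<open>Moving y past a power of x produces commutators only, so the span is stable under
  multiplication by y from the left.\<close>

lemma nfspan_geny: "nfspan u ==> nfspan (geny * u)"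
proof (induction rule: nfspan.induct)
  case (nf L c)
  then obtain e f ps where L: "L = (e, f) # ps" by (cases L) auto
  have "nfspan (geny * nfl ((e, f) # ps))"
  proof (induction e)
    case 0
    have "geny * nfl ((0, f) # ps) = nfl ((0, Suc f) # ps)"
      by (simp add: nfl_def mono_def mult.assoc)
    then show ?case by (simp add: nfspan_nfl)
  next
    case (Suc e)
    let ?z = "nfl ((e, f) # ps)"
    have "geny * nfl ((Suc e, f) # ps) = geny * genx * ?z"
      by (simp add: nfl_def mono_def mult.assoc)
    also have "\<dots> = genx * (geny * ?z) - comm * ?z"
      by (simp add: comm_def algebra_simps)
    also have "comm * ?z = nfl ((0, 0) # (e, f) # ps)"
      by (simp add: nfl_def mono_def mult.assoc)
    finally show ?case
      using nfspan_diff[OF nfspan_genx[OF Suc] nfspan_nfl[of "(0, 0) # (e, f) # ps"]] by simp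
  qed
  then show ?case using nfspan_scal by (simp add: mult_scal_left L)
qed (auto simp: distrib_left intro: nfspan.intros)

lemma nfspan_all: "nfspan u"
proof (induction u rule: falg_induct)
  case (word c l)
  have "nfspan (wd l)"
  proof (induction l)
    case Nil
    then show ?case using nfspan_nfl[of "[(0, 0)]"] by (simp add: nfl_def mono_def wd_Nil)
  next
    case (Cons a l)
    then show ?case by (cases a) (simp_all add: wd_LX wd_LY nfspan_genx nfspan_geny)
  qed
  then show ?case by (rule nfspan_scal)
qed (auto intro: nfspan.intros)

lemma nf_expansion:
  obtains S g where "finite S" "!!L. L \<in> S ==> L \<noteq> [] \<and> g L \<noteq> 0" "u = (\<Sum>L\<in>S. scal (g L) * nfl L)"
proof -
  have "\<exists>S g. finite S \<and> [] \<notin> S \<and> u = (\<Sum>L\<in>S. scal (g L) * nfl L)"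
    using nfspan_all[of u]
  proof (induction rule: nfspan.induct)
    case zero
    then show ?case by (intro exI[of _ "{}"]) auto
  next
    case (nf L c)
    then show ?case by (intro exI[of _ "{L}"] exI[of _ "\<lambda>_. c"]) auto
  next
    case (add u v)
    then obtain S g T h where *: "finite S" "[] \<notin> S" "u = (\<Sum>L\<in>S. scal (g L) * nfl L)"
      "finite T" "[] \<notin> T" "v = (\<Sum>L\<in>T. scal (h L) * nfl L)" by blast
    let ?k = "\<lambda>L. (if L \<in> S then g L else 0) + (if L \<in> T then h L else 0)"
    have "u = (\<Sum>L\<in>S \<union> T. scal (if L \<in> S then g L else 0) * nfl L)"
      unfolding * using * by (intro sum.mono_neutral_cong_left) auto
    moreover have "v = (\<Sum>L\<in>S \<union> T. scal (if L \<in> T then h L else 0) * nfl L)"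
      unfolding * using * by (intro sum.mono_neutral_cong_left) auto
    ultimately have "u + v = (\<Sum>L\<in>S \<union> T. scal (?k L) * nfl L)"
      by (simp only: scal_add distrib_right sum.distrib)
    then show ?case using * by (intro exI[of _ "S \<union> T"] exI[of _ ?k]) auto
  qed
  then obtain S g where *: "finite S" "[] \<notin> S" "u = (\<Sum>L\<in>S. scal (g L) * nfl L)" by blast
  show ?thesis
  proof (rule that[of "{L\<in>S. g L \<noteq> 0}" g])
    show "u = (\<Sum>L | L \<in> S \<and> g L \<noteq> 0. scal (g L) * nfl L)"
      unfolding * using * by (intro sum.mono_neutral_cong_right) auto
  qed (use * in auto)
qed

text \<open>Vanishing below the m-th superdiagonal. These ideals form a multiplicative
  filtration that contains c in degree one.\<close>

definition low :: "(nat => complex) => (nat => complex) => nat => falg => bool" where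
  "low X Y m u \<longleftrightarrow> (\<forall>i j. j < i + m \<longrightarrow> ev X Y u i j = 0)"

lemma low_mult: "low X Y m u ==> low X Y n v ==> low X Y (m + n) (u * v)"
  unfolding low_def ev_mult
proof (intro allI impI sum.neutral ballI)
  fix i j k
  assume *: "\<forall>i j. j < i + m \<longrightarrow> ev X Y u i j = 0" "\<forall>i j. j < i + n \<longrightarrow> ev X Y v i j = 0"
    "j < i + (m + n)" "k \<in> {i..j}"
  then have "k < i + m \<or> j < k + n" by auto
  then show "ev X Y u i k * ev X Y v k j = 0" using * by auto
qed

lemma low_mono: "low X Y m u ==> n \<le> m ==> low X Y n u"
  by (auto simp: low_def)

lemma low_0: "low X Y 0 u"
  by (simp add: low_def ev_lower)

lemma ev_mult_low:
  assumes "low X Y m u" "low X Y n v"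
  shows "ev X Y (u * v) i (i + (m + n)) = ev X Y u i (i + m) * ev X Y v (i + m) (i + m + n)"
proof -
  have "ev X Y (u * v) i (i + (m + n)) = (\<Sum>k=i..i + (m + n). if k = i + m then ev X Y u i (i + m) * ev X Y v (i + m) (i + m + n) else 0)"
    unfolding ev_mult
  proof (rule sum.cong)
    fix k assume k: "k \<in> {i..i + (m + n)}"
    consider "k < i + m" | "k = i + m" | "k > i + m" by linarith
    then show "ev X Y u i k * ev X Y v k (i + (m + n)) =
      (if k = i + m then ev X Y u i (i + m) * ev X Y v (i + m) (i + m + n) else 0)"
      using assms by cases (auto simp: low_def add.assoc)
  qed simp
  then show ?thesis by simp
qed

lemma ev_comm: "ev X Y comm i j = (if j = Suc i then X i - X j else 0)"
proof -
  have 1: "ev X Y (genx * geny) i j = X i * ev X Y geny i j" by (simp add: ev_genx_mult)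
  have 2: "ev X Y (geny * genx) i j = ev X Y geny i j * X j" by (simp add: ev_mult_genx)
  show ?thesis unfolding comm_def ev_diff 1 2 by (auto simp: ev_geny algebra_simps)
qed

lemma low_comm: "low X Y 1 comm"
  by (simp add: low_def ev_comm)

lemma ev_diag_power: "ev X Y (u ^ n) i i = ev X Y u i i ^ n"
  by (induction n) (simp_all add: ev_1 ev_mult)

lemma ev_diag_mono: "ev X Y (mono p) i i = X i ^ fst p * Y i ^ snd p"
  by (simp add: mono_def ev_mult ev_diag_power ev_genx ev_geny)

definition mval :: "(nat => complex) => (nat => complex) => (nat \<times> nat) list => complex" where
  "mval X Y L = (\<Prod>t<length L. X t ^ fst (L ! t) * Y t ^ snd (L ! t))"

lemma mval_Nil [simp]: "mval X Y [] = 1"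
  by (simp add: mval_def)

lemma mval_Cons: "mval X Y (p # L) = X 0 ^ fst p * Y 0 ^ snd p * mval (X \<circ> Suc) (Y \<circ> Suc) L"
  unfolding mval_def by (simp add: prod.lessThan_Suc_shift del: prod.lessThan_Suc)

lemma low_nft: "low X Y (length L) (nft L)"
proof (induction L)
  case (Cons p L)
  have "low X Y (1 + (0 + length L)) (comm * (mono p * nft L))"
    by (intro low_mult low_comm low_0 Cons)
  then show ?case by simp
qed (simp add: low_0)

lemma low_nfl: "low X Y (length L - 1) (nfl L)"
proof -
  have "low X Y (0 + length (tl L)) (mono (hd L) * nft (tl L))"
    by (intro low_mult low_0 low_nft)
  then show ?thesis by (simp add: nfl_def)
qed

lemma ev_nft:
  "ev X Y (nft L) i (i + length L) = (\<Prod>t<length L. X (i + t) - X (Suc (i + t))) *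
     mval (\<lambda>t. X (Suc (i + t))) (\<lambda>t. Y (Suc (i + t))) L"
proof (induction L arbitrary: i)
  case Nil
  then show ?case by (simp add: ev_1)
next
  case (Cons p L)
  have "ev X Y (comm * (mono p * nft L)) i (i + (1 + (0 + length L)))
      = ev X Y comm i (i + 1) * ev X Y (mono p * nft L) (i + 1) (i + 1 + (0 + length L))"
    by (rule ev_mult_low) (intro low_comm low_mult low_0 low_nft)+
  also have "ev X Y (mono p * nft L) (i + 1) (i + 1 + (0 + length L)) =
      ev X Y (mono p) (i + 1) (i + 1 + 0) * ev X Y (nft L) (i + 1 + 0) (i + 1 + 0 + length L)"
    by (rule ev_mult_low) (intro low_0 low_nft)+
  finally have "ev X Y (nft (p # L)) i (i + length (p # L)) =
     (X i - X (Suc i)) * (X (Suc i) ^ fst p * Y (Suc i) ^ snd p) *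
     ((\<Prod>t<length L. X (Suc (i + t)) - X (Suc (Suc (i + t)))) *
      mval (\<lambda>t. X (Suc (Suc (i + t)))) (\<lambda>t. Y (Suc (Suc (i + t)))) L)"
    using Cons[of "Suc i"] by (simp add: ev_comm ev_diag_mono)
  then show ?case
    by (simp add: mval_Cons prod.lessThan_Suc_shift comp_def del: prod.lessThan_Suc)
qed

text \<open>Each factor c moves one superdiagonal up and each s_t acts on it by its value at the
  site t. Hence on the first possible superdiagonal a normal form is a product of differences
  times a monomial in separate pairs of variables.\<close>

lemma ev_nfl:
  assumes "length L = Suc k"
  shows "ev X Y (nfl L) 0 k = (\<Prod>t<k. X t - X (Suc t)) * mval X Y L"
proof -
  obtain p ps where L: "L = p # ps" "length ps = k" using assms by (cases L) auto
  have "ev X Y (mono p * nft ps) 0 (0 + (0 + length ps)) =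
      ev X Y (mono p) 0 (0 + 0) * ev X Y (nft ps) (0 + 0) (0 + 0 + length ps)"
    by (rule ev_mult_low) (intro low_0 low_nft)+
  then show ?thesis
    using ev_nft[of X Y ps 0] by (simp add: nfl_def L ev_diag_mono mval_Cons comp_def)
qed

lemma poly_sum_nonzero:
  fixes w :: "nat => complex"
  assumes "finite E" "e0 \<in> E" "w e0 \<noteq> 0" "finite Z"
  shows "\<exists>x. x \<notin> Z \<and> (\<Sum>e\<in>E. w e * x ^ e) \<noteq> 0"
proof -
  define p where "p = (\<Sum>e\<in>E. Polynomial.monom (w e) e)"
  have "poly.coeff p e0 = w e0"
    unfolding p_def using assms by (simp add: coeff_sum)
  then have "p \<noteq> 0" using assms by auto
  then have "finite ({x. poly p x = 0} \<union> Z)" using poly_roots_finite assms by auto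
  then obtain x where "x \<notin> {x. poly p x = 0} \<union> Z"
    using infinite_UNIV_char_0[where 'a=complex] by (metis UNIV_I finite_subset subsetI ex_new_if_finite)
  then show ?thesis unfolding p_def by (intro exI[of _ x]) (auto simp: poly_sum poly_monom)
qed

text \<open>Distinct lists of the same length give distinct monomials, so a nontrivial
  combination is nonzero at some point; the finite set Z to be avoided makes it possible to glue
  such points together with distinct coordinates.\<close>

lemma mval_sum_nonzero:
  fixes g :: "(nat \<times> nat) list => complex"
  assumes "finite S" "!!L. L \<in> S ==> length L = K" "L0 \<in> S" "g L0 \<noteq> 0" "finite Z"
  shows "\<exists>X Y. inj_on X {..<K} \<and> X ` {..<K} \<inter> Z = {} \<and> (\<Sum>L\<in>S. g L * mval X Y L) \<noteq> 0"
  using assms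
proof (induction K arbitrary: S g L0)
  case 0
  then have "S = {[]}" by auto
  then show ?case using 0 by auto
next
  case (Suc K)
  define p0 where "p0 = hd L0"
  define S' where "S' p = {l. p # l \<in> S}" for p
  have fS': "finite (S' p)" for p
    using finite_vimageI[OF Suc.prems(1), of "Cons p"] by (simp add: S'_def vimage_def)
  have "L0 \<noteq> []" using Suc.prems by fastforce
  then have t0: "tl L0 \<in> S' p0" "p0 # tl L0 = L0" using Suc.prems by (auto simp: S'_def p0_def)
  have "\<exists>X Y. inj_on X {..<K} \<and> X ` {..<K} \<inter> Z = {} \<and> (\<Sum>l\<in>S' p0. g (p0 # l) * mval X Y l) \<noteq> 0"
  proof (rule Suc.IH[OF fS' _ t0(1)])
    show "length l = K" if "l \<in> S' p0" for l
      using Suc.prems(2)[of "p0 # l"] that by (simp add: S'_def)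
  qed (use Suc.prems t0 in auto)
  then obtain X Y where XY: "inj_on X {..<K}" "X ` {..<K} \<inter> Z = {}"
    "(\<Sum>l\<in>S' p0. g (p0 # l) * mval X Y l) \<noteq> 0" by blast
  define v where "v p = (\<Sum>l\<in>S' p. g (p # l) * mval X Y l)" for p
  define P where "P = hd ` S"
  have fP: "finite P" using Suc.prems by (simp add: P_def)
  define F where "F = {f. (fst p0, f) \<in> P}"
  have fF: "finite F" using finite_vimageI[OF fP, of "Pair (fst p0)"] by (simp add: F_def vimage_def inj_on_def)
  have p0P: "p0 \<in> P" using Suc.prems by (auto simp: P_def p0_def)
  have "\<exists>y. y \<notin> {} \<and> (\<Sum>f\<in>F. v (fst p0, f) * y ^ f) \<noteq> 0"
    by (rule poly_sum_nonzero[OF fF, of "snd p0"]) (use p0P XY in \<open>auto simp: F_def v_def\<close>)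
  then obtain y where y: "(\<Sum>f\<in>F. v (fst p0, f) * y ^ f) \<noteq> 0" by blast
  have "\<exists>x. x \<notin> Z \<union> X ` {..<K} \<and> (\<Sum>e\<in>fst ` P. (\<Sum>f | (e, f) \<in> P. v (e, f) * y ^ f) * x ^ e) \<noteq> 0"
    by (rule poly_sum_nonzero[of _ "fst p0"]) (use fP p0P y Suc.prems in \<open>auto simp: F_def\<close>)
  then obtain x where x: "x \<notin> Z" "x \<notin> X ` {..<K}"
     "(\<Sum>e\<in>fst ` P. (\<Sum>f | (e, f) \<in> P. v (e, f) * y ^ f) * x ^ e) \<noteq> 0" by blast
  let ?X = "case_nat x X" and ?Y = "case_nat y Y"
  have sh: "?X \<circ> Suc = X" "?Y \<circ> Suc = Y" by auto
  have "(\<Sum>L\<in>S. g L * mval ?X ?Y L) = (\<Sum>(p, l)\<in>Sigma P S'. g (p # l) * mval ?X ?Y (p # l))"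
    by (rule sum.reindex_bij_witness[of _ "\<lambda>(p, l). p # l" "\<lambda>L. (hd L, tl L)"])
       (use Suc.prems(2) in \<open>auto simp: P_def S'_def\<close>, (metis length_0_conv list.collapse nat.distinct(1))+)
  also have "\<dots> = (\<Sum>p\<in>P. v p * (x ^ fst p * y ^ snd p))"
    unfolding v_def sum_distrib_right
    by (subst sum.Sigma[symmetric]) (auto simp: fP fS' mval_Cons sh simp del: sum.Sigma intro!: sum.cong)
  also have "\<dots> = (\<Sum>(e, f)\<in>(SIGMA e:fst ` P. {f. (e, f) \<in> P}). v (e, f) * y ^ f * x ^ e)"
    by (rule sum.reindex_bij_witness[of _ "\<lambda>p. p" "\<lambda>p. p"]) (auto simp: algebra_simps intro: rev_image_eqI)
  also have "\<dots> = (\<Sum>e\<in>fst ` P. (\<Sum>f | (e, f) \<in> P. v (e, f) * y ^ f) * x ^ e)"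
  proof -
    have "finite {f. (e, f) \<in> P}" for e
      using finite_vimageI[OF fP, of "Pair e"] by (simp add: vimage_def inj_on_def)
    then show ?thesis using fP by (simp add: sum.Sigma[symmetric] sum_distrib_right)
  qed
  finally have nz: "(\<Sum>L\<in>S. g L * mval ?X ?Y L) \<noteq> 0" using x by simp
  have "inj_on ?X {..<Suc K}"
    using XY(1) x(2) by (auto simp: inj_on_def split: nat.splits)
  moreover have "?X ` {..<Suc K} \<inter> Z = {}"
    using XY(2) x(1) by (auto simp: disjoint_iff split: nat.splits)
  ultimately show ?case using nz by blast
qed

text \<open>Here k is the least number of commutators among the normal forms that occur in
  u.\<close>

lemma nf_symbol:
  assumes "u \<noteq> 0"
  obtains k S g where "finite S" "S \<noteq> {}" "!!L. L \<in> S ==> length L = Suc k \<and> g L \<noteq> 0"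
    "!!X Y. low X Y k u"
    "!!X Y. ev X Y u 0 k = (\<Prod>t<k. X t - X (Suc t)) * (\<Sum>L\<in>S. g L * mval X Y L)"
proof -
  obtain S g where S: "finite S" "!!L. L \<in> S ==> L \<noteq> [] \<and> g L \<noteq> 0" "u = (\<Sum>L\<in>S. scal (g L) * nfl L)"
    using nf_expansion[of u] by metis
  have ne: "S \<noteq> {}" using S(3) assms by auto
  define k where "k = Min ((\<lambda>L. length L - 1) ` S)"
  have kmin: "k \<le> length L - 1" if "L \<in> S" for L
    using that S(1) by (auto simp: k_def)
  have "k \<in> (\<lambda>L. length L - 1) ` S" unfolding k_def using S ne by (intro Min_in) auto
  then obtain L1 where L1: "L1 \<in> S" "length L1 = Suc k" using S(2) by force
  have "low X Y k u" for X Y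
  proof -
    have "low X Y k (nfl L)" if "L \<in> S" for L
      using low_mono[OF low_nfl kmin[OF that]] .
    then show ?thesis by (simp add: S(3) low_def ev_sum ev_scal)
  qed
  moreover have "ev X Y u 0 k = (\<Prod>t<k. X t - X (Suc t)) * (\<Sum>L | L \<in> S \<and> length L = Suc k. g L * mval X Y L)" for X Y
  proof -
    have "ev X Y u 0 k = (\<Sum>L\<in>S. g L * ev X Y (nfl L) 0 k)"
      by (simp add: S(3) ev_sum ev_scal)
    also have "\<dots> = (\<Sum>L | L \<in> S \<and> length L = Suc k. g L * ev X Y (nfl L) 0 k)"
    proof (rule sum.mono_neutral_right)
      show "\<forall>L\<in>S - {L \<in> S. length L = Suc k}. g L * ev X Y (nfl L) 0 k = 0"
      proof
        fix L assume "L \<in> S - {L \<in> S. length L = Suc k}"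
        then have "k < 0 + (length L - 1)" using kmin[of L] S(2)[of L] by (cases L) auto
        then show "g L * ev X Y (nfl L) 0 k = 0" using low_nfl[of X Y L] unfolding low_def by auto
      qed
    qed (use S in auto)
    also have "\<dots> = (\<Sum>L | L \<in> S \<and> length L = Suc k. (\<Prod>t<k. X t - X (Suc t)) * (g L * mval X Y L))"
      by (rule sum.cong) (auto simp: ev_nfl)
    finally show ?thesis by (simp add: sum_distrib_left)
  qed
  ultimately show ?thesis
    using S L1 by (intro that[of "{L \<in> S. length L = Suc k}" k g]) auto
qed

lemma nf_symbol_nonzero:
  assumes "u \<noteq> 0"
  obtains S k g where "finite S" "S \<noteq> {}" "!!L. L \<in> S ==> length L = Suc k \<and> g L \<noteq> 0"
    "!!X Y. low X Y k u"
    "!!X Y. ev X Y u 0 k = (\<Prod>t<k. X t - X (Suc t)) * (\<Sum>L\<in>S. g L * mval X Y L)"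
    "\<exists>X Y. inj_on X {..k} \<and> ev X Y u 0 k \<noteq> 0"
proof -
  obtain S k g where *: "finite S" "S \<noteq> {}" "!!L. L \<in> S ==> length L = Suc k \<and> g L \<noteq> 0"
    "!!X Y. low X Y k u"
    "!!X Y. ev X Y u 0 k = (\<Prod>t<k. X t - X (Suc t)) * (\<Sum>L\<in>S. g L * mval X Y L)"
    by (rule nf_symbol[OF assms], rule that, assumption+)
  then obtain L0 where "L0 \<in> S" by auto
  then obtain X Y where XY: "inj_on X {..<Suc k}" "(\<Sum>L\<in>S. g L * mval X Y L) \<noteq> 0"
    using mval_sum_nonzero[of S "Suc k" L0 g "{}"] * by auto
  have "X t \<noteq> X (Suc t)" if "t < k" for t
    using inj_onD[OF XY(1), of t "Suc t"] that by auto
  then have "(\<Prod>t<k. X t - X (Suc t)) \<noteq> 0" by simp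
  then have "ev X Y u 0 k \<noteq> 0" using XY *(5) by simp
  then have "\<exists>X Y. inj_on X {..k} \<and> ev X Y u 0 k \<noteq> 0"
    using XY(1) unfolding lessThan_Suc_atMost by blast
  with * show ?thesis by (rule that)
qed

text \<open>The family of representations is faithful.\<close>

lemma ev_nonzero:
  assumes "u \<noteq> 0"
  obtains X Y k where "inj_on X {..k}" "ev X Y u 0 k \<noteq> 0"
proof -
  obtain k where "\<exists>X Y. inj_on X {..k} \<and> ev X Y u 0 k \<noteq> 0"
    by (rule nf_symbol_nonzero[OF assms], rule that, assumption)
  then show ?thesis using that by blast
qed

section \<open>Derivations that kill the commutator\<close>

text \<open>The last two assumptions say that D x and D y vanish in the abelianization, since
  diagonal entries only see commutative evaluation.\<close>

locale comm_derivation =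
  fixes D :: "falg => falg"
  assumes D: "derivation D" and D_comm: "D comm = 0"
    and ab_x: "!!X Y. ev X Y (D genx) 0 0 = 0" and ab_y: "!!X Y. ev X Y (D geny) 0 0 = 0"
begin

lemma diag_x: "ev X Y (D genx) i i = 0" and diag_y: "ev X Y (D geny) i i = 0"
  using ev_shift0[of X Y "D genx" i 0] ev_shift0[of X Y "D geny" i 0] ab_x ab_y by simp_all

abbreviation "a \<equiv> D genx"
abbreviation "b \<equiv> D geny"

text \<open>The equation D c = 0, that is [D x, y] + [x, D y] = 0, read off at one matrix
  entry.\<close>

lemma ev_ab_relation:
  "ev X Y a i (Suc j) * Y (Suc j) + ev X Y a i j - Y i * ev X Y a i (Suc j) - ev X Y a (Suc i) (Suc j)
     + (X i - X (Suc j)) * ev X Y b i (Suc j) = 0"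
proof -
  have "D comm = a * geny + genx * b - (b * genx + geny * a)"
    using D by (simp add: comm_def derivation_diff[OF D] derivation_def)
  then have "ev X Y (a * geny + genx * b - (b * genx + geny * a)) i (Suc j) = 0"
    using D_comm by simp
  then show ?thesis
    by (simp add: ev_diff ev_add ev_mult_geny ev_genx_mult ev_mult_genx ev_geny_mult algebra_simps)
qed

definition W :: "(nat => complex) => (nat => complex) => nat => nat => complex" where
  "W X Y i j = (if i < j then ev X Y a i j / (X i - X j) else 0)"

text \<open>The remaining change of the image of y, after D y has been eliminated with the help
  of the relation D c = 0. Only the values of D x enter.\<close>

definition B :: "(nat => complex) => (nat => complex) => nat => nat => complex" where
  "B X Y i j = ((X (j - 1) - X j) * W X Y i (j - 1) - (X i - X (Suc i)) * W X Y (Suc i) j) / (X i - X j)"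

lemma ev_D:
  assumes inj: "inj_on X {..M}" and j: "j \<le> M"
  shows "ev X Y (D u) i j = (\<Sum>k=i..j. ev X Y u i k * W X Y k j - W X Y i k * ev X Y u k j) + jump (B X Y) X Y u i j"
proof (rule ev_derivation[OF D, where M=M])
  show A: "ev X Y a i j = (X i - X j) * W X Y i j" if "j \<le> M" for i j
  proof (cases "i < j")
    case True
    then have "X i \<noteq> X j" using inj_onD[OF inj, of i j] that by auto
    then show ?thesis using True by (simp add: W_def)
  next
    case False
    then show ?thesis using diag_x ev_lower[of j i X Y a] by (cases "i = j") (auto simp: W_def)
  qed
  fix i j assume ij: "j \<le> M" "i < j"
  then obtain j' where j': "j = Suc j'" by (cases j) auto
  have ne: "X i \<noteq> X j" using inj_onD[OF inj, of i j] ij by auto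
  have "(X i - X j) * ev X Y b i j = (Y i - Y j) * ((X i - X j) * W X Y i j) + (X (Suc i) - X j) * W X Y (Suc i) j
     - (X i - X j') * W X Y i j'"
    using ev_ab_relation[of X Y i j'] ij unfolding j' by (simp add: A algebra_simps)
  then have "ev X Y b i j = ((Y i - Y j) * ((X i - X j) * W X Y i j) + (X (Suc i) - X j) * W X Y (Suc i) j
     - (X i - X j') * W X Y i j') / (X i - X j)"
    using ne by (simp add: field_simps)
  also have "\<dots> = (Y i - Y j) * W X Y i j + W X Y (Suc i) j - W X Y i (j - 1) + B X Y i j"
    using ne by (simp add: B_def j' divide_simps) (simp add: algebra_simps)
  finally show "ev X Y b i j = (Y i - Y j) * W X Y i j + W X Y (Suc i) j - W X Y i (j - 1) + B X Y i j" .
qed (auto simp: W_def diag_y j)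

end

lemma eq_zero_if_ev_zero:
  assumes "!!X Y k. inj_on X {..k} ==> ev X Y u 0 k = 0"
  shows "u = 0"
  using ev_nonzero[of u] assms by blast

text \<open>Like low, but at distinct sites, where W is meaningful. Entries are polynomial in
  the sites, so vanishing at all distinct sites is vanishing everywhere.\<close>

definition vanish :: "nat => falg => bool" where
  "vanish m u \<longleftrightarrow> (\<forall>X Y j. j < m \<longrightarrow> inj_on X {..j} \<longrightarrow> ev X Y u 0 j = 0)"

lemma vanishD:
  assumes "vanish m u" "j < i + m" "inj_on X {i..j}"
  shows "ev X Y u i j = 0"
proof (cases "i \<le> j")
  case True
  have "inj_on (\<lambda>t. X (t + i)) {..j - i}"
    by (rule inj_onI) (use inj_onD[OF assms(3)] True in force)
  then have "ev (\<lambda>t. X (t + i)) (\<lambda>t. Y (t + i)) u 0 (j - i) = 0"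
    using assms True unfolding vanish_def by auto
  then show ?thesis using ev_shift0[of X Y u i "j - i"] True by simp
qed (simp add: ev_lower)

lemma inj_on_skip:
  assumes "inj_on X {..m + (l' - l - 1)}"
  shows "inj_on (X \<circ> skip l l') {..m}"
proof (rule comp_inj_on)
  show "inj_on (skip l l') {..m}" by (auto simp: inj_on_def skip_def split: if_splits)
  show "inj_on X (skip l l' ` {..m})"
    using assms by (rule inj_on_subset) (auto simp: skip_def)
qed

text \<open>Here k is the order of D x, and the sum over S is its symbol.\<close>

locale comm_derivation_order = comm_derivation +
  fixes k S g
  assumes S: "finite S" "S \<noteq> {}" "!!L. L \<in> S ==> length L = Suc k \<and> g L \<noteq> 0"
    and low_a: "!!X Y. low X Y k a"
    and ev_a: "!!X Y. ev X Y a 0 k = (\<Prod>t<k. X t - X (Suc t)) * (\<Sum>L\<in>S. g L * mval X Y L)"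
begin

text \<open>The symbol of D x, as a polynomial function of the sites 0, \<dots>, k.\<close>

definition hat :: "(nat => complex) => (nat => complex) => complex" where
  "hat X Y = (\<Sum>L\<in>S. g L * mval X Y L)"

lemma hat_nonzero:
  assumes "finite Z"
  obtains X Y where "inj_on X {..k}" "X ` {..k} \<inter> Z = {}" "hat X Y \<noteq> 0"
proof -
  obtain L0 where "L0 \<in> S" using S by auto
  then show ?thesis
    using mval_sum_nonzero[of S "Suc k" L0 g Z] S assms that unfolding hat_def lessThan_Suc_atMost by blast
qed

lemma k_pos: "k > 0"
proof (rule ccontr)
  assume "\<not> k > 0"
  then have "ev X Y a 0 0 = hat X Y" for X Y using ev_a[of X Y] by (simp add: hat_def)
  moreover obtain X Y where "hat X Y \<noteq> 0" using hat_nonzero[OF finite.emptyI] by blast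
  ultimately show False using ab_x[of X Y] by simp
qed

lemma W_low: "j < i + k ==> W X Y i j = 0"
  using low_a[of X Y] by (simp add: W_def low_def)

lemma B_low: "j < i + k + 1 ==> i < j ==> B X Y i j = 0"
  by (simp add: B_def W_low)

text \<open>Applying D raises the order by k, and the new first superdiagonal depends on the old
  one through two boundary terms and the jumps over k sites.\<close>

lemma ev_D_level:
  assumes inj: "inj_on X {..m + k}" and u: "vanish m u"
  shows "ev X Y (D u) 0 (m + k) = ev X Y u 0 m * W X Y m (m + k) - W X Y 0 k * ev X Y u k (m + k)
     + (\<Sum>l<m. B X Y l (l + k + 1) * ev (X \<circ> skip l (l + k + 1)) (Y \<circ> skip l (l + k + 1)) u 0 m)"
proof -
  have sub: "inj_on X {i..j}" if "j \<le> m + k" for i j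
    using inj by (rule inj_on_subset) (use that in auto)
  have 1: "(\<Sum>t=0..m + k. ev X Y u 0 t * W X Y t (m + k)) = ev X Y u 0 m * W X Y m (m + k)"
  proof -
    have "(\<Sum>t=0..m + k. ev X Y u 0 t * W X Y t (m + k)) = (\<Sum>t\<in>{m}. ev X Y u 0 t * W X Y t (m + k))"
    proof (rule sum.mono_neutral_right)
      show "\<forall>i\<in>{0..m + k} - {m}. ev X Y u 0 i * W X Y i (m + k) = 0"
      proof
        fix i assume "i \<in> {0..m + k} - {m}"
        then consider "i < m" "i \<le> m + k" | "m < i" by force
        then show "ev X Y u 0 i * W X Y i (m + k) = 0"
          by cases (auto simp: W_low vanishD[OF u _ sub])
      qed
    qed auto
    then show ?thesis by simp
  qed
  have 2: "(\<Sum>t=0..m + k. W X Y 0 t * ev X Y u t (m + k)) = W X Y 0 k * ev X Y u k (m + k)"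
  proof -
    have "(\<Sum>t=0..m + k. W X Y 0 t * ev X Y u t (m + k)) = (\<Sum>t\<in>{k}. W X Y 0 t * ev X Y u t (m + k))"
    proof (rule sum.mono_neutral_right)
      show "\<forall>i\<in>{0..m + k} - {k}. W X Y 0 i * ev X Y u i (m + k) = 0"
      proof
        fix i assume "i \<in> {0..m + k} - {k}"
        then consider "i < k" "i \<le> m + k" | "k < i" by force
        then show "W X Y 0 i * ev X Y u i (m + k) = 0"
          by cases (auto simp: W_low vanishD[OF u _ sub])
      qed
    qed auto
    then show ?thesis by simp
  qed
  have 3: "jump (B X Y) X Y u 0 (m + k) =
     (\<Sum>l<m. B X Y l (l + k + 1) * ev (X \<circ> skip l (l + k + 1)) (Y \<circ> skip l (l + k + 1)) u 0 m)"
  proof -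
    let ?t = "\<lambda>l l'. B X Y l l' * ev (X \<circ> skip l l') (Y \<circ> skip l l') u 0 (m + k + 1 + l - l')"
    have z: "?t l l' = 0" if "l' \<in> {Suc l..m + k}" "l' \<noteq> l + k + 1" for l l'
    proof (cases "l' < l + k + 1")
      case True
      then show ?thesis using that B_low[of l' l] by simp
    next
      case False
      then have lt: "m + k + 1 + l - l' < m" using that by auto
      have "inj_on (X \<circ> skip l l') {..m + k + 1 + l - l'}"
        by (rule inj_on_skip) (rule inj_on_subset[OF inj], use that in auto)
      then show ?thesis using u lt by (simp add: vanish_def)
    qed
    have in1: "(\<Sum>l'=Suc l..m + k. ?t l l') = (if l < m then ?t l (l + k + 1) else 0)" for l
    proof -
      have "(\<Sum>l'=Suc l..m + k. ?t l l') = (\<Sum>l'\<in>{Suc l..m + k} \<inter> {l + k + 1}. ?t l l')"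
        by (rule sum.mono_neutral_right) (use z in auto)
      also have "{Suc l..m + k} \<inter> {l + k + 1} = (if l < m then {l + k + 1} else {})" by auto
      finally show ?thesis by (cases "l < m") (simp_all add: comp_def)
    qed
    have "jump (B X Y) X Y u 0 (m + k) = (\<Sum>l=0..<m + k. if l < m then ?t l (l + k + 1) else 0)"
      unfolding jump_def in1 ..
    also have "\<dots> = (\<Sum>l<m. ?t l (l + k + 1))"
      by (rule sum.mono_neutral_cong_right) auto
    finally show ?thesis by simp
  qed
  show ?thesis
    unfolding ev_D[OF inj le_refl] 3 sum_subtractf 1 2 by simp
qed

lemma vanish_D:
  assumes u: "vanish m u"
  shows "vanish (m + k) (D u)"
  unfolding vanish_def
proof (intro allI impI)
  fix X Y :: "nat => complex" and j
  assume j: "j < m + k" and inj: "inj_on X {..j}"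
  have sub: "inj_on X {i..j}" for i
    using inj by (rule inj_on_subset) auto
  have 1: "(\<Sum>t=0..j. ev X Y u 0 t * W X Y t j - W X Y 0 t * ev X Y u t j) = 0"
  proof (intro sum.neutral ballI)
    fix t assume t: "t \<in> {0..j}"
    have "inj_on X {0..t}" using inj by (rule inj_on_subset) (use t in auto)
    then have "ev X Y u 0 t * W X Y t j = 0"
      using vanishD[OF u, of t 0 X Y] W_low[of j t X Y] j by (cases "t < m") auto
    moreover have "W X Y 0 t * ev X Y u t j = 0"
      using vanishD[OF u _ sub, of t Y] W_low[of t 0 X Y] j by (cases "t < k") auto
    ultimately show "ev X Y u 0 t * W X Y t j - W X Y 0 t * ev X Y u t j = 0"
      by (simp only: diff_self)
  qed
  have 2: "jump (B X Y) X Y u 0 j = 0"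
    unfolding jump_def
  proof (intro sum.neutral ballI)
    fix l l' assume "l \<in> {0..<j}" and l': "l' \<in> {Suc l..j}"
    show "B X Y l l' * ev (X \<circ> skip l l') (Y \<circ> skip l l') u 0 (j + 1 + l - l') = 0"
    proof (cases "l' < l + k + 1")
      case True
      then show ?thesis using l' B_low[of l' l] by simp
    next
      case False
      then have lt: "j + 1 + l - l' < m" using l' j by auto
      have "inj_on (X \<circ> skip l l') {..j + 1 + l - l'}"
        by (rule inj_on_skip) (rule inj_on_subset[OF inj], use l' in auto)
      then show ?thesis using u lt by (simp add: vanish_def)
    qed
  qed
  show "ev X Y (D u) 0 j = 0"
    unfolding ev_D[OF inj le_refl] 1 2 by simp
qed

lemma vanish_x: "vanish (n * k) ((D ^^ n) genx)"
proof (induction n)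
  case 0
  then show ?case by (simp add: vanish_def)
next
  case (Suc n)
  then show ?case using vanish_D[OF Suc] by (simp add: add.commute)
qed

end

section \<open>Iterates along a ray: quadratic or higher growth\<close>

lemma pow_ratio_lim:
  assumes "e \<le> \<beta>"
  shows "(\<lambda>n. of_nat n ^ e / of_nat n ^ \<beta> :: complex) \<longlonglongrightarrow> (if e = \<beta> then 1 else 0)"
proof -
  have "(\<lambda>n. (1 / of_nat n :: complex) ^ (\<beta> - e)) \<longlonglongrightarrow> 0 ^ (\<beta> - e)"
    by (intro tendsto_power lim_1_over_n)
  moreover have "\<forall>\<^sub>F n in sequentially. (1 / of_nat n :: complex) ^ (\<beta> - e) = of_nat n ^ e / of_nat n ^ \<beta>"
    using eventually_gt_at_top[of 0]
  proof eventually_elim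
    case (elim n)
    then have "(of_nat n :: complex) ^ \<beta> = of_nat n ^ e * of_nat n ^ (\<beta> - e)"
      using assms by (simp flip: power_add)
    with elim show ?case by (simp add: field_simps)
  qed
  ultimately have "(\<lambda>n. of_nat n ^ e / of_nat n ^ \<beta> :: complex) \<longlonglongrightarrow> 0 ^ (\<beta> - e)"
    by (rule Lim_transform_eventually)
  then show ?thesis using assms by (auto simp: power_0_left)
qed

lemma lim_drop:
  fixes f :: "nat => complex"
  assumes "(\<lambda>n. f n / of_nat n ^ \<beta>) \<longlonglongrightarrow> r" "\<beta> < N"
  shows "(\<lambda>n. f n / of_nat n ^ N) \<longlonglongrightarrow> 0"
proof -
  have "(\<lambda>n. (f n / of_nat n ^ \<beta>) * (of_nat n ^ \<beta> / of_nat n ^ N)) \<longlonglongrightarrow> r * 0"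
    using pow_ratio_lim[of \<beta> N] assms by (intro tendsto_mult) auto
  moreover have "\<forall>\<^sub>F n in sequentially. (f n / of_nat n ^ \<beta>) * (of_nat n ^ \<beta> / of_nat n ^ N) = f n / of_nat n ^ N"
    using eventually_gt_at_top[of 0] by eventually_elim auto
  ultimately have "(\<lambda>n. f n / of_nat n ^ N) \<longlonglongrightarrow> r * 0"
    by (rule Lim_transform_eventually)
  then show ?thesis by simp
qed

lemma ratio_lim: "(\<lambda>n. (of_nat n - c) / (of_nat n - d) :: complex) \<longlonglongrightarrow> 1"
proof -
  have "(\<lambda>n. (1 - c * (1 / of_nat n)) / (1 - d * (1 / of_nat n)) :: complex) \<longlonglongrightarrow> (1 - c * 0) / (1 - d * 0)"
    by (intro tendsto_intros lim_1_over_n) auto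
  moreover have "\<forall>\<^sub>F n in sequentially. (1 - c * (1 / of_nat n)) / (1 - d * (1 / of_nat n)) = (of_nat n - c) / (of_nat n - d)"
    using eventually_gt_at_top[of 0]
  proof eventually_elim
    case (elim n)
    then have "(of_nat n - c) / (of_nat n - d) = (of_nat n * (1 - c * (1 / of_nat n))) / (of_nat n * (1 - d * (1 / of_nat n)))"
      by (simp add: right_diff_distrib)
    with elim show ?case by simp
  qed
  ultimately have "(\<lambda>n. (of_nat n - c) / (of_nat n - d)) \<longlonglongrightarrow> (1 - c * 0) / (1 - d * 0)"
    by (rule Lim_transform_eventually)
  then show ?thesis by simp
qed

lemma quotient_split:
  fixes N :: complex
  assumes "N \<noteq> 0"
  shows "(c * w - (N - x) * v) / (N - s) / P = (c * (w / (N * P)) - (N - x) / (N - 0) * (v / P)) * ((N - 0) / (N - s))"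
proof -
  have "(c * (w / (N * P)) - (N - x) / (N - 0) * (v / P)) * N = (c * w - (N - x) * v) / P"
    using assms by (cases "P = 0") (auto simp: divide_simps)
  then show ?thesis
    by (metis (no_types, opaque_lifting) diff_zero divide_divide_eq_left' mult.commute times_divide_eq_right divide_divide_eq_left)
qed

lemma fun_upd_skip: "X(0 := z) \<circ> skip l l' = (X \<circ> skip l l')(0 := z)"
  by (auto simp: skip_def fun_eq_iff)

text \<open>The point at site 0 runs to infinity along the line through (1, q) while the other
  sites stay fixed; r is the coefficient of t^\<beta> in the entry (0, m).\<close>

definition ray_limit :: "complex => falg => nat => nat => (nat => complex) => (nat => complex) => complex => bool" where
  "ray_limit q u m \<beta> X Y r \<longleftrightarrow>
     (\<lambda>n. ev (X(0 := of_nat n)) (Y(0 := q * of_nat n)) u 0 m / of_nat n ^ \<beta>) \<longlonglongrightarrow> r"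

lemma ray_limit_cong:
  assumes "!!t. t \<in> {1..m} ==> X t = X' t \<and> Y t = Y' t"
  shows "ray_limit q u m \<beta> X Y r \<longleftrightarrow> ray_limit q u m \<beta> X' Y' r"
proof -
  have "ev (X(0 := z)) (Y(0 := y)) u 0 m = ev (X'(0 := z)) (Y'(0 := y)) u 0 m" for y z
    by (rule ev_cong) (use assms in auto)
  then show ?thesis by (simp add: ray_limit_def)
qed

text \<open>The growth exponent is \<beta> for generic sites. Nonvanishing is required away from
  any finite set of coordinates so that two configurations can be concatenated.\<close>

definition Lead :: "complex => falg => nat => nat => bool" where
  "Lead q u m \<beta> \<longleftrightarrow>
     (\<forall>X Y. inj_on X {1..m} \<longrightarrow> (\<exists>r. ray_limit q u m \<beta> X Y r)) \<and>
     (\<forall>Z. finite Z \<longrightarrow> (\<exists>X Y r. inj_on X {1..m} \<and> X ` {1..m} \<inter> Z = {} \<and> r \<noteq> 0 \<and> ray_limit q u m \<beta> X Y r))"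

lemma Lead_nonzero:
  assumes "Lead q u m \<beta>"
  shows "u \<noteq> 0"
proof
  assume "u = 0"
  moreover have "\<exists>X Y r. inj_on X {1..m} \<and> X ` {1..m} \<inter> {} = {} \<and> r \<noteq> 0 \<and> ray_limit q u m \<beta> X Y r"
    using assms[unfolded Lead_def, THEN conjunct2, THEN spec, of "{}"] by simp
  then obtain X Y r where "r \<noteq> 0" "ray_limit q u m \<beta> X Y r" by (elim exE conjE)
  ultimately show False by (simp add: ray_limit_def LIMSEQ_const_iff)
qed

lemma inj_on_upd0:
  fixes X :: "nat => complex"
  assumes inj: "inj_on X {1..M}" and z: "z \<notin> X ` {1..M}"
  shows "inj_on (X(0 := z)) {..M}"
proof -
  have "inj_on (X(0 := z)) {1..M}" using inj by (subst inj_on_cong[of _ _ X]) auto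
  moreover have "(X(0 := z)) ` ({1..M} - {0}) = X ` {1..M}" by auto
  ultimately have "inj_on (X(0 := z)) (insert 0 {1..M})"
    unfolding inj_on_insert using z by simp
  then show ?thesis by (rule inj_on_subset) auto
qed

lemma eventually_inj_upd:
  fixes X :: "nat => complex"
  assumes "inj_on X {1..M}"
  shows "\<forall>\<^sub>F n in sequentially. inj_on (X(0 := of_nat n :: complex)) {..M}"
proof -
  have "inj (of_nat :: nat => complex)" by (simp add: inj_on_def)
  then have "finite ((of_nat :: nat => complex) -` (X ` {1..M}))"
    by (intro finite_vimageI) auto
  then have "finite {n::nat. of_nat n \<in> X ` {1..M}}" by (simp add: vimage_def)
  then have "\<forall>\<^sub>F n in sequentially. n \<notin> {n::nat. of_nat n \<in> X ` {1..M}}"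
    by (simp add: cofinite_eq_sequentially[symmetric] eventually_cofinite)
  then show ?thesis
  proof eventually_elim
    case (elim n)
    then show ?case by (intro inj_on_upd0[OF assms]) simp
  qed
qed

context comm_derivation_order
begin

definition hdeg :: "(nat \<times> nat) list => nat" where "hdeg L = fst (hd L) + snd (hd L)"

text \<open>The degree of the symbol in the variables of the site 0.\<close>

definition dmax :: nat where "dmax = Max (hdeg ` S)"

lemma hdeg_le: "L \<in> S ==> hdeg L \<le> dmax"
  unfolding dmax_def using S by auto

lemma S_Cons: "L \<in> S ==> L = hd L # tl L"
  using S(3)[of L] by (cases L) auto

lemma hat_upd:
  "hat (X(0 := z)) (Y(0 := y)) = (\<Sum>L\<in>S. g L * (z ^ fst (hd L) * y ^ snd (hd L) * mval (X \<circ> Suc) (Y \<circ> Suc) (tl L)))"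
  unfolding hat_def
proof (rule sum.cong[OF HOL.refl])
  fix L assume "L \<in> S"
  then have "mval (X(0 := z)) (Y(0 := y)) L = mval (X(0 := z)) (Y(0 := y)) (hd L # tl L)" using S_Cons by simp
  also have "\<dots> = z ^ fst (hd L) * y ^ snd (hd L) * mval (X \<circ> Suc) (Y \<circ> Suc) (tl L)"
    unfolding mval_Cons by (simp add: comp_def)
  finally show "g L * mval (X(0 := z)) (Y(0 := y)) L = g L * (z ^ fst (hd L) * y ^ snd (hd L) * mval (X \<circ> Suc) (Y \<circ> Suc) (tl L))"
    by simp
qed

definition omega :: "complex => (nat => complex) => (nat => complex) => complex" where
  "omega q X Y = (\<Sum>L | L \<in> S \<and> hdeg L = dmax. g L * (q ^ snd (hd L) * mval (X \<circ> Suc) (Y \<circ> Suc) (tl L)))"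

text \<open>The leading coefficient of W_0k along the ray; omega is the corresponding
  coefficient of the symbol.\<close>

definition Omega :: "complex => (nat => complex) => (nat => complex) => complex" where
  "Omega q X Y = (\<Prod>t\<in>{1..<k}. X t - X (Suc t)) * omega q X Y"

lemma hat_lim: "(\<lambda>n. hat (X(0 := of_nat n)) (Y(0 := q * of_nat n)) / of_nat n ^ dmax) \<longlonglongrightarrow> omega q X Y"
proof -
  let ?M = "\<lambda>L. mval (X \<circ> Suc) (Y \<circ> Suc) (tl L)"
  have "(\<lambda>n. \<Sum>L\<in>S. g L * q ^ snd (hd L) * ?M L * (of_nat n ^ hdeg L / of_nat n ^ dmax)) \<longlonglongrightarrow>
     (\<Sum>L\<in>S. g L * q ^ snd (hd L) * ?M L * (if hdeg L = dmax then 1 else 0))"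
    by (intro tendsto_sum tendsto_mult_left pow_ratio_lim hdeg_le)
  also have "(\<lambda>n. \<Sum>L\<in>S. g L * q ^ snd (hd L) * ?M L * (of_nat n ^ hdeg L / of_nat n ^ dmax))
     = (\<lambda>n. hat (X(0 := of_nat n)) (Y(0 := q * of_nat n)) / of_nat n ^ dmax)"
    unfolding hat_upd sum_divide_distrib
    by (intro ext sum.cong) (simp_all add: hdeg_def power_add power_mult_distrib)
  also have "(\<Sum>L\<in>S. g L * q ^ snd (hd L) * ?M L * (if hdeg L = dmax then 1 else 0)) = omega q X Y"
    unfolding omega_def using S(1) by (intro sum.mono_neutral_cong_right) auto
  finally show ?thesis .
qed

lemma ev_a_upd:
  "ev (X(0 := z)) (Y(0 := y)) a 0 k = (z - X 1) * (\<Prod>t\<in>{1..<k}. X t - X (Suc t)) * hat (X(0 := z)) (Y(0 := y))"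
proof -
  have "(\<Prod>t<k. (X(0 := z)) t - (X(0 := z)) (Suc t)) = (\<Prod>t\<in>insert 0 {1..<k}. (X(0 := z)) t - (X(0 := z)) (Suc t))"
    using k_pos by (intro prod.cong) auto
  also have "\<dots> = (z - X 1) * (\<Prod>t\<in>{1..<k}. X t - X (Suc t))"
    by (subst prod.insert) (auto intro!: prod.cong)
  finally show ?thesis unfolding ev_a hat_def by simp
qed

lemma ray_limit_a: "ray_limit q a k (Suc dmax) X Y (Omega q X Y)"
proof -
  let ?P = "\<Prod>t\<in>{1..<k}. X t - X (Suc t)"
  have "(\<lambda>n. (of_nat n - X 1) / (of_nat n - 0) * (?P * (hat (X(0 := of_nat n)) (Y(0 := q * of_nat n)) / of_nat n ^ dmax)))
      \<longlonglongrightarrow> 1 * (?P * omega q X Y)"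
    by (intro tendsto_mult ratio_lim tendsto_const hat_lim)
  then show ?thesis unfolding ray_limit_def Omega_def ev_a_upd by (simp add: ac_simps)
qed

lemma W_lim: "(\<lambda>n. W (X(0 := of_nat n)) (Y(0 := q * of_nat n)) 0 k / of_nat n ^ dmax) \<longlonglongrightarrow> Omega q X Y"
proof -
  let ?P = "\<Prod>t\<in>{1..<k}. X t - X (Suc t)"
  have "(\<lambda>n. (of_nat n - X 1) / (of_nat n - X k) * (?P * (hat (X(0 := of_nat n)) (Y(0 := q * of_nat n)) / of_nat n ^ dmax)))
      \<longlonglongrightarrow> 1 * (?P * omega q X Y)"
    by (intro tendsto_mult ratio_lim tendsto_const hat_lim)
  then show ?thesis unfolding Omega_def W_def ev_a_upd using k_pos by (simp add: ac_simps)
qed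

lemma W_upd: "0 < i ==> W (X(0 := z)) (Y(0 := y)) i j = W X Y i j"
  unfolding W_def by (subst ev_cong[of i j _ X _ Y]) auto

lemma B_upd: "0 < i ==> i < j ==> B (X(0 := z)) (Y(0 := y)) i j = B X Y i j"
  unfolding B_def by (simp add: W_upd)

text \<open>The slope q is chosen away from the zeros of the top form of the symbol in the
  variables of site 0.\<close>

lemma Omega_nonzero:
  obtains q where "!!Z. finite Z ==> \<exists>X Y. inj_on X {1..k} \<and> X ` {1..k} \<inter> Z = {} \<and> Omega q X Y \<noteq> 0"
proof -
  define S1 where "S1 = {L \<in> S. hdeg L = dmax}"
  have fS1: "finite S1" using S by (simp add: S1_def)
  have "dmax \<in> hdeg ` S" unfolding dmax_def using S by (intro Max_in) auto
  then obtain L0 where L0: "L0 \<in> S1" by (auto simp: S1_def)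
  define T where "T = {L \<in> S1. tl L = tl L0}"
  have fT: "finite T" using fS1 by (simp add: T_def)
  have injT: "inj_on (\<lambda>L. snd (hd L)) T"
  proof (rule inj_onI)
    fix L L' assume "L \<in> T" "L' \<in> T" and s: "snd (hd L) = snd (hd L')"
    then have *: "L \<in> S" "L' \<in> S" "hdeg L = hdeg L'" "tl L = tl L'" by (auto simp: T_def S1_def)
    then have "hd L = hd L'" using s by (simp add: hdeg_def prod_eq_iff)
    then show "L = L'" using * S_Cons by metis
  qed
  define w where "w f = g (the_inv_into T (\<lambda>L. snd (hd L)) f)" for f
  have w: "w (snd (hd L)) = g L" if "L \<in> T" for L
    unfolding w_def using the_inv_into_f_f[OF injT that] by simp
  have L0T: "L0 \<in> T" using L0 by (simp add: T_def)
  have "\<exists>q. q \<notin> {} \<and> (\<Sum>f\<in>(\<lambda>L. snd (hd L)) ` T. w f * q ^ f) \<noteq> 0"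
  proof (rule poly_sum_nonzero)
    show "snd (hd L0) \<in> (\<lambda>L. snd (hd L)) ` T" using L0T by auto
    show "w (snd (hd L0)) \<noteq> 0" using w[OF L0T] S(3) L0 by (auto simp: S1_def)
  qed (use fT in auto)
  then obtain q where q: "(\<Sum>f\<in>(\<lambda>L. snd (hd L)) ` T. w f * q ^ f) \<noteq> 0" by blast
  define G where "G l = (\<Sum>L | L \<in> S1 \<and> tl L = l. g L * q ^ snd (hd L))" for l
  have G0: "G (tl L0) \<noteq> 0"
    using q by (simp add: sum.reindex[OF injT] w G_def flip: T_def)
  have om: "omega q X Y = (\<Sum>l\<in>tl ` S1. G l * mval (X \<circ> Suc) (Y \<circ> Suc) l)" for X Y
  proof -
    have "omega q X Y = (\<Sum>L\<in>S1. g L * (q ^ snd (hd L) * mval (X \<circ> Suc) (Y \<circ> Suc) (tl L)))"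
      by (simp add: omega_def S1_def)
    also have "\<dots> = (\<Sum>l\<in>tl ` S1. \<Sum>L | L \<in> S1 \<and> tl L = l. g L * (q ^ snd (hd L) * mval (X \<circ> Suc) (Y \<circ> Suc) (tl L)))"
      using fS1 by (intro sum.group[symmetric]) auto
    also have "\<dots> = (\<Sum>l\<in>tl ` S1. G l * mval (X \<circ> Suc) (Y \<circ> Suc) l)"
      unfolding G_def sum_distrib_right by (intro sum.cong) auto
    finally show ?thesis .
  qed
  show ?thesis
  proof (rule that[of q])
    fix Z :: "complex set" assume Z: "finite Z"
    have "\<exists>X Y. inj_on X {..<k} \<and> X ` {..<k} \<inter> Z = {} \<and> (\<Sum>l\<in>tl ` S1. G l * mval X Y l) \<noteq> 0"
      by (rule mval_sum_nonzero[of _ _ "tl L0"]) (use fS1 L0 G0 Z S(3) in \<open>auto simp: S1_def\<close>)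
    then obtain X Y where XY: "inj_on X {..<k}" "X ` {..<k} \<inter> Z = {}" "(\<Sum>l\<in>tl ` S1. G l * mval X Y l) \<noteq> 0"
      by blast
    let ?X = "case_nat 0 X" and ?Y = "case_nat 0 Y"
    have inj: "inj_on ?X {1..k}"
      using XY(1) by (auto simp: inj_on_def Suc_le_eq split: nat.splits)
    have av: "?X ` {1..k} \<inter> Z = {}"
      using XY(2) by (auto simp: disjoint_iff Suc_le_eq split: nat.splits)
    have "?X t \<noteq> ?X (Suc t)" if "t \<in> {1..<k}" for t
      using inj_onD[OF inj, of t "Suc t"] that by auto
    then have "(\<Prod>t\<in>{1..<k}. ?X t - ?X (Suc t)) \<noteq> 0" by simp
    moreover have "omega q ?X ?Y \<noteq> 0"
      using XY(3) unfolding om by (simp add: comp_def)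
    ultimately have "Omega q ?X ?Y \<noteq> 0" by (simp add: Omega_def)
    then show "\<exists>X Y. inj_on X {1..k} \<and> X ` {1..k} \<inter> Z = {} \<and> Omega q X Y \<noteq> 0"
      using inj av by blast
  qed
qed

text \<open>Of all terms in ev_D_level only the jump at l = 0 grows with the exponent dmax +
  \<beta> - 1: the boundary terms grow with exponents \<beta> and dmax, which are smaller as
  dmax and \<beta> are both at least 2. Hence leading coefficients multiply.\<close>

lemma ray_limit_step:
  assumes u: "vanish m u" and m: "0 < m" and d: "dmax \<ge> 2" and \<beta>: "\<beta> \<ge> 2"
    and inj: "inj_on X {1..m + k}"
    and ex: "!!X Y. inj_on X {1..m} ==> \<exists>r. ray_limit q u m \<beta> X Y r"
    and r': "ray_limit q u m \<beta> (X \<circ> skip 0 (Suc k)) (Y \<circ> skip 0 (Suc k)) r'"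
  shows "ray_limit q (D u) (m + k) (dmax + \<beta> - 1) X Y ((X k - X (Suc k)) * Omega q X Y * r')"
proof -
  let ?X = "\<lambda>n::nat. X(0 := of_nat n)" and ?Y = "\<lambda>n::nat. Y(0 := q * of_nat n)"
  let ?N = "dmax + \<beta> - 1"
  have "inj_on X {1..m}" using inj by (rule inj_on_subset) auto
  then obtain r1 where r1: "ray_limit q u m \<beta> X Y r1" using ex by blast
  have T1: "(\<lambda>n. ev (?X n) (?Y n) u 0 m / of_nat n ^ ?N * W X Y m (m + k)) \<longlonglongrightarrow> 0 * W X Y m (m + k)"
    by (intro tendsto_mult tendsto_const lim_drop[OF r1[unfolded ray_limit_def]]) (use d in simp)
  have T2: "(\<lambda>n. W (?X n) (?Y n) 0 k / of_nat n ^ ?N * ev X Y u k (m + k)) \<longlonglongrightarrow> 0 * ev X Y u k (m + k)"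
    by (intro tendsto_mult tendsto_const lim_drop[OF W_lim]) (use \<beta> in simp)
  have T3: "(\<lambda>n. \<Sum>l\<in>{1..<m}. B X Y l (l + k + 1) * (ev ((X \<circ> skip l (l + k + 1))(0 := of_nat n)) ((Y \<circ> skip l (l + k + 1))(0 := q * of_nat n)) u 0 m / of_nat n ^ ?N))
      \<longlonglongrightarrow> (\<Sum>l\<in>{1..<m}. B X Y l (l + k + 1) * 0)"
  proof (intro tendsto_sum tendsto_mult tendsto_const)
    fix l assume l: "l \<in> {1..<m}"
    have "inj_on (X \<circ> skip l (l + k + 1)) {1..m}"
    proof (rule comp_inj_on)
      show "inj_on (skip l (l + k + 1)) {1..m}" by (auto simp: inj_on_def skip_def split: if_splits)
      show "inj_on X (skip l (l + k + 1) ` {1..m})"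
        using inj by (rule inj_on_subset) (auto simp: skip_def)
    qed
    then obtain r2 where "ray_limit q u m \<beta> (X \<circ> skip l (l + k + 1)) (Y \<circ> skip l (l + k + 1)) r2" using ex by blast
    then show "(\<lambda>n. ev ((X \<circ> skip l (l + k + 1))(0 := of_nat n)) ((Y \<circ> skip l (l + k + 1))(0 := q * of_nat n)) u 0 m / of_nat n ^ ?N) \<longlonglongrightarrow> 0"
      unfolding ray_limit_def by (rule lim_drop) (use d in simp)
  qed
  let ?c = "X k - X (Suc k)"
  have B0: "B (?X n) (?Y n) 0 (Suc k) / of_nat n ^ (dmax - 1) =
     (?c * (W (?X n) (?Y n) 0 k / of_nat n ^ dmax) - (of_nat n - X 1) / (of_nat n - 0) * (W X Y 1 (Suc k) / of_nat n ^ (dmax - 1)))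
      * ((of_nat n - 0) / (of_nat n - X (Suc k)))" if "n > 0" for n
  proof -
    have "(of_nat n :: complex) ^ dmax = of_nat n * of_nat n ^ (dmax - 1)"
      using d by (simp flip: power_Suc)
    moreover have "B (?X n) (?Y n) 0 (Suc k) =
        (?c * W (?X n) (?Y n) 0 k - (of_nat n - X 1) * W X Y 1 (Suc k)) / (of_nat n - X (Suc k))"
      unfolding B_def using k_pos W_upd[of 1 X "of_nat n" Y "q * of_nat n" "Suc k"] by simp
    ultimately show ?thesis
      using that by (simp only: quotient_split[of "of_nat n :: complex"] of_nat_eq_0_iff)
  qed
  have "(\<lambda>n. W X Y 1 (Suc k) / of_nat n ^ (dmax - 1)) \<longlonglongrightarrow> 0"
  proof (rule lim_drop[where \<beta> = 0])
    show "(\<lambda>n. W X Y 1 (Suc k) / of_nat n ^ 0) \<longlonglongrightarrow> W X Y 1 (Suc k)" by simp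
  qed (use d in auto)
  then have "(\<lambda>n. (?c * (W (?X n) (?Y n) 0 k / of_nat n ^ dmax) - (of_nat n - X 1) / (of_nat n - 0) * (W X Y 1 (Suc k) / of_nat n ^ (dmax - 1)))
      * ((of_nat n - 0) / (of_nat n - X (Suc k)))) \<longlonglongrightarrow> (?c * Omega q X Y - 1 * 0) * 1"
    by (intro tendsto_mult tendsto_diff tendsto_const W_lim ratio_lim)
  moreover have "\<forall>\<^sub>F n in sequentially. (?c * (W (?X n) (?Y n) 0 k / of_nat n ^ dmax) - (of_nat n - X 1) / (of_nat n - 0) * (W X Y 1 (Suc k) / of_nat n ^ (dmax - 1)))
      * ((of_nat n - 0) / (of_nat n - X (Suc k))) = B (?X n) (?Y n) 0 (Suc k) / of_nat n ^ (dmax - 1)"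
    using eventually_gt_at_top[of "0::nat"] by eventually_elim (rule B0[symmetric])
  ultimately have "(\<lambda>n. B (?X n) (?Y n) 0 (Suc k) / of_nat n ^ (dmax - 1)) \<longlonglongrightarrow> (?c * Omega q X Y - 1 * 0) * 1"
    by (rule Lim_transform_eventually)
  then have B1: "(\<lambda>n. B (?X n) (?Y n) 0 (Suc k) / of_nat n ^ (dmax - 1)) \<longlonglongrightarrow> ?c * Omega q X Y"
    by simp
  have T4: "(\<lambda>n. (B (?X n) (?Y n) 0 (Suc k) / of_nat n ^ (dmax - 1)) *
       (ev ((X \<circ> skip 0 (Suc k))(0 := of_nat n)) ((Y \<circ> skip 0 (Suc k))(0 := q * of_nat n)) u 0 m / of_nat n ^ \<beta>))
      \<longlonglongrightarrow> ?c * Omega q X Y * r'"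
    using r' unfolding ray_limit_def by (intro tendsto_mult B1)
  have pw: "(of_nat n :: complex) ^ ?N = of_nat n ^ (dmax - 1) * of_nat n ^ \<beta>" for n
    using d by (simp flip: power_add)
  have lim: "(\<lambda>n. ev (?X n) (?Y n) u 0 m / of_nat n ^ ?N * W X Y m (m + k)
       - W (?X n) (?Y n) 0 k / of_nat n ^ ?N * ev X Y u k (m + k)
       + ((B (?X n) (?Y n) 0 (Suc k) / of_nat n ^ (dmax - 1)) *
       (ev ((X \<circ> skip 0 (Suc k))(0 := of_nat n)) ((Y \<circ> skip 0 (Suc k))(0 := q * of_nat n)) u 0 m / of_nat n ^ \<beta>)
        + (\<Sum>l\<in>{1..<m}. B X Y l (l + k + 1) * (ev ((X \<circ> skip l (l + k + 1))(0 := of_nat n)) ((Y \<circ> skip l (l + k + 1))(0 := q * of_nat n)) u 0 m / of_nat n ^ ?N))))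
      \<longlonglongrightarrow> 0 * W X Y m (m + k) - 0 * ev X Y u k (m + k) + (?c * Omega q X Y * r' + (\<Sum>l\<in>{1..<m}. B X Y l (l + k + 1) * 0))"
    by (intro tendsto_add tendsto_diff T1 T2 T3 T4)
  have "\<forall>\<^sub>F n in sequentially. ev (?X n) (?Y n) u 0 m / of_nat n ^ ?N * W X Y m (m + k)
       - W (?X n) (?Y n) 0 k / of_nat n ^ ?N * ev X Y u k (m + k)
       + ((B (?X n) (?Y n) 0 (Suc k) / of_nat n ^ (dmax - 1)) *
       (ev ((X \<circ> skip 0 (Suc k))(0 := of_nat n)) ((Y \<circ> skip 0 (Suc k))(0 := q * of_nat n)) u 0 m / of_nat n ^ \<beta>)
        + (\<Sum>l\<in>{1..<m}. B X Y l (l + k + 1) * (ev ((X \<circ> skip l (l + k + 1))(0 := of_nat n)) ((Y \<circ> skip l (l + k + 1))(0 := q * of_nat n)) u 0 m / of_nat n ^ ?N)))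
      = ev (?X n) (?Y n) (D u) 0 (m + k) / of_nat n ^ ?N"
    using eventually_inj_upd[OF inj]
  proof eventually_elim
    case (elim n)
    have e1: "ev (?X n) (?Y n) u k (m + k) = ev X Y u k (m + k)"
      by (rule ev_cong) (use k_pos in auto)
    have "{..<m} = insert 0 {1..<m}" using m by auto
    then have e2: "(\<Sum>l<m. B (?X n) (?Y n) l (l + k + 1) * ev (?X n \<circ> skip l (l + k + 1)) (?Y n \<circ> skip l (l + k + 1)) u 0 m)
      = B (?X n) (?Y n) 0 (Suc k) * ev ((X \<circ> skip 0 (Suc k))(0 := of_nat n)) ((Y \<circ> skip 0 (Suc k))(0 := q * of_nat n)) u 0 m
       + (\<Sum>l\<in>{1..<m}. B X Y l (l + k + 1) * ev ((X \<circ> skip l (l + k + 1))(0 := of_nat n)) ((Y \<circ> skip l (l + k + 1))(0 := q * of_nat n)) u 0 m)"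
      by (simp add: fun_upd_skip B_upd)
    show ?case
      unfolding ev_D_level[OF elim u] e1 e2 W_upd[OF m]
      unfolding add_divide_distrib diff_divide_distrib sum_divide_distrib
      unfolding pw by simp
  qed
  with lim have "(\<lambda>n. ev (?X n) (?Y n) (D u) 0 (m + k) / of_nat n ^ ?N)
    \<longlonglongrightarrow> 0 * W X Y m (m + k) - 0 * ev X Y u k (m + k) + (?c * Omega q X Y * r' + (\<Sum>l\<in>{1..<m}. B X Y l (l + k + 1) * 0))"
    by (rule Lim_transform_eventually)
  then show ?thesis unfolding ray_limit_def by simp
qed

text \<open>The sites 1, \<dots>, k are taken from a point where Omega does not vanish, the
  following ones from a point where the limit for u does not vanish.\<close>

lemma Lead_step:
  assumes u: "vanish m u" and m: "0 < m" and d: "dmax \<ge> 2" and \<beta>: "\<beta> \<ge> 2"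
    and q: "!!Z. finite Z ==> \<exists>X Y. inj_on X {1..k} \<and> X ` {1..k} \<inter> Z = {} \<and> Omega q X Y \<noteq> 0"
    and L: "Lead q u m \<beta>"
  shows "Lead q (D u) (m + k) (dmax + \<beta> - 1)"
  unfolding Lead_def
proof (intro conjI allI impI)
  have ex: "\<exists>r. ray_limit q u m \<beta> X Y r" if "inj_on X {1..m}" for X Y
    using L that unfolding Lead_def by blast
  note step = ray_limit_step[OF u m d \<beta> _ ex]
  {
    fix X Y :: "nat => complex" assume inj: "inj_on X {1..m + k}"
    have "inj_on (X \<circ> skip 0 (Suc k)) {1..m}"
    proof (rule comp_inj_on)
      show "inj_on (skip 0 (Suc k)) {1..m}" by (auto simp: inj_on_def skip_def split: if_splits)
      show "inj_on X (skip 0 (Suc k) ` {1..m})"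
        using inj by (rule inj_on_subset) (auto simp: skip_def)
    qed
    then obtain r' where "ray_limit q u m \<beta> (X \<circ> skip 0 (Suc k)) (Y \<circ> skip 0 (Suc k)) r'" using ex by blast
    then show "\<exists>r. ray_limit q (D u) (m + k) (dmax + \<beta> - 1) X Y r" using step[OF inj] by blast
  }
  fix Z :: "complex set" assume Z: "finite Z"
  obtain X1 Y1 where 1: "inj_on X1 {1..k}" "X1 ` {1..k} \<inter> Z = {}" "Omega q X1 Y1 \<noteq> 0" using q[OF Z] by blast
  obtain X2 Y2 r where 2: "inj_on X2 {1..m}" "X2 ` {1..m} \<inter> (Z \<union> X1 ` {1..k}) = {}" "r \<noteq> 0" "ray_limit q u m \<beta> X2 Y2 r"
    using L Z unfolding Lead_def by (meson finite_UnI finite_imageI finite_atLeastAtMost)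
  \<comment> \<open>the site 0 is a dummy: it is overwritten by the point on the ray\<close>
  let ?X = "\<lambda>t. if t \<le> k then X1 t else X2 (t - k)" and ?Y = "\<lambda>t. if t \<le> k then Y1 t else Y2 (t - k)"
  have inj: "inj_on ?X {1..m + k}"
  proof (rule inj_onI)
    fix s t assume st: "s \<in> {1..m + k}" "t \<in> {1..m + k}" "?X s = ?X t"
    have cross: "X1 a \<noteq> X2 b" if "a \<in> {1..k}" "b \<in> {1..m}" for a b
    proof
      assume "X1 a = X2 b"
      then have "X2 b \<in> X2 ` {1..m} \<inter> (Z \<union> X1 ` {1..k})" using that by (auto intro: rev_image_eqI)
      then show False using 2(2) by blast
    qed
    consider "s \<le> k" "t \<le> k" | "s \<le> k" "t > k" | "s > k" "t \<le> k" | "s > k" "t > k" by linarith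
    then show "s = t"
    proof cases
      case 1 then show ?thesis using st inj_onD[OF \<open>inj_on X1 {1..k}\<close>, of s t] by auto
    next
      case 2
      then have "s \<in> {1..k}" "t - k \<in> {1..m}" using st(1,2) by auto
      then show ?thesis using st(3) 2 cross[of s "t - k"] by simp
    next
      case 3
      then have "t \<in> {1..k}" "s - k \<in> {1..m}" using st(1,2) by auto
      then show ?thesis using st(3) 3 cross[of t "s - k"] by simp
    next
      case 4
      then have "s - k \<in> {1..m}" "t - k \<in> {1..m}" using st(1,2) by auto
      then have "s - k = t - k" using st(3) 4 inj_onD[OF \<open>inj_on X2 {1..m}\<close>, of "s - k" "t - k"] by simp
      then show ?thesis using 4 by simp
    qed
  qed
  have av: "?X ` {1..m + k} \<inter> Z = {}"
  proof -
    have "?X t \<notin> Z" if "t \<in> {1..m + k}" for t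
    proof (cases "t \<le> k")
      case True
      then show ?thesis using 1(2) that by (auto simp: disjoint_iff)
    next
      case False
      then have "t - k \<in> {1..m}" using that by auto
      then show ?thesis using False 2(2) by (auto simp: disjoint_iff)
    qed
    then show ?thesis by blast
  qed
  have as: "ray_limit q u m \<beta> (?X \<circ> skip 0 (Suc k)) (?Y \<circ> skip 0 (Suc k)) r"
    using 2(4) by (subst ray_limit_cong[of m _ X2 _ Y2]) (auto simp: skip_def)
  have "mval (?X \<circ> Suc) (?Y \<circ> Suc) (tl L) = mval (X1 \<circ> Suc) (Y1 \<circ> Suc) (tl L)" if "L \<in> S" for L
    unfolding mval_def by (rule prod.cong) (use S(3)[OF that] in auto)
  then have "omega q ?X ?Y = omega q X1 Y1"
    unfolding omega_def by (intro sum.cong) auto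
  then have Om: "Omega q ?X ?Y \<noteq> 0"
    using 1(3) unfolding Omega_def by (auto intro!: prod.cong)
  have "?X k \<noteq> ?X (Suc k)"
    using inj_onD[OF inj, of k "Suc k"] k_pos m by auto
  then have "(?X k - ?X (Suc k)) * Omega q ?X ?Y * r \<noteq> 0" using Om 2(3) by auto
  then show "\<exists>X Y r. inj_on X {1..m + k} \<and> X ` {1..m + k} \<inter> Z = {} \<and> r \<noteq> 0 \<and> ray_limit q (D u) (m + k) (dmax + \<beta> - 1) X Y r"
    using ray_limit_step[OF u m d \<beta> inj ex as] inj av by blast
qed

lemma iterate_nonzero_I:
  assumes d: "dmax \<ge> 2"
  shows "(D ^^ n) genx \<noteq> 0"
proof -
  obtain q where q: "!!Z. finite Z ==> \<exists>X Y. inj_on X {1..k} \<and> X ` {1..k} \<inter> Z = {} \<and> Omega q X Y \<noteq> 0"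
    using Omega_nonzero by blast
  have "\<exists>\<beta>\<ge>2. Lead q ((D ^^ Suc n) genx) (Suc n * k) \<beta>" for n
  proof (induction n)
    case 0
    have "Lead q a k (Suc dmax)"
      unfolding Lead_def using q ray_limit_a by meson
    then show ?case using d by (intro exI[of _ "Suc dmax"]) auto
  next
    case (Suc n)
    then obtain \<beta> where \<beta>: "\<beta> \<ge> 2" "Lead q ((D ^^ Suc n) genx) (Suc n * k) \<beta>" by blast
    have "Lead q (D ((D ^^ Suc n) genx)) (Suc n * k + k) (dmax + \<beta> - 1)"
      by (rule Lead_step[OF vanish_x _ d \<beta>(1) q \<beta>(2)]) (use k_pos in auto)
    then show ?case using d \<beta>(1) by (intro exI[of _ "dmax + \<beta> - 1"]) (simp add: add.commute)
  qed
  then have "(D ^^ Suc n) genx \<noteq> 0" using Lead_nonzero by blast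
  then show ?thesis using derivation_0[OF D] by auto
qed

end

section \<open>Iterates in the case of linear growth\<close>

lemma mval_sum_poly:
  fixes g :: "(nat \<times> nat) list => complex"
  assumes "finite S" "!!L. L \<in> S ==> L \<noteq> []"
  shows "\<exists>P. \<forall>z. (\<Sum>L\<in>S. g L * mval (X(0 := z)) Y L) = poly P z"
proof -
  let ?P = "\<Sum>L\<in>S. Polynomial.monom (g L * (Y 0 ^ snd (hd L) * mval (X \<circ> Suc) (Y \<circ> Suc) (tl L))) (fst (hd L))"
  have "(\<Sum>L\<in>S. g L * mval (X(0 := z)) Y L) = poly ?P z" for z
    unfolding poly_sum
  proof (rule sum.cong[OF HOL.refl])
    fix L assume "L \<in> S"
    then have "L = hd L # tl L" using assms by simp
    then have "mval (X(0 := z)) Y L = z ^ fst (hd L) * Y 0 ^ snd (hd L) * mval (X \<circ> Suc) (Y \<circ> Suc) (tl L)"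
      using mval_Cons[of "X(0 := z)" Y "hd L" "tl L"] by (simp add: comp_def)
    then show "g L * mval (X(0 := z)) Y L = poly (Polynomial.monom (g L * (Y 0 ^ snd (hd L) * mval (X \<circ> Suc) (Y \<circ> Suc) (tl L))) (fst (hd L))) z"
      by (simp add: poly_monom)
  qed
  then show ?thesis by blast
qed

context comm_derivation_order
begin

text \<open>The relation D c = 0 on the first superdiagonal where D x does not vanish.\<close>

lemma ev_b_relation: "(Y k - Y 0) * ev X Y a 0 k + (X 0 - X k) * ev X Y b 0 k = 0"
proof -
  obtain k' where k': "k = Suc k'" using k_pos by (cases k) auto
  have "ev X Y a 0 k' = 0" "ev X Y a (Suc 0) (Suc k') = 0"
    using low_a[of X Y] by (simp_all add: low_def k')
  then show ?thesis using ev_ab_relation[of X Y 0 k'] by (simp add: k' algebra_simps)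
qed

lemma b_symbol:
  obtains S' g' where "finite S'" "!!L. L \<in> S' ==> length L = Suc k"
    "!!X Y. ev X Y b 0 k = (\<Prod>t<k. X t - X (Suc t)) * (\<Sum>L\<in>S'. g' L * mval X Y L)"
proof (cases "b = 0")
  case True
  then show ?thesis by (intro that[of "{}"]) auto
next
  case False
  obtain S' k' g' where *: "finite S'" "S' \<noteq> {}" "!!L. L \<in> S' ==> length L = Suc k' \<and> g' L \<noteq> 0"
    "!!X Y. low X Y k' b"
    "!!X Y. ev X Y b 0 k' = (\<Prod>t<k'. X t - X (Suc t)) * (\<Sum>L\<in>S'. g' L * mval X Y L)"
    "\<exists>X Y. inj_on X {..k'} \<and> ev X Y b 0 k' \<noteq> 0"
    by (rule nf_symbol_nonzero[OF False], rule that, assumption+)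
  then obtain X Y where XY: "inj_on X {..k'}" "ev X Y b 0 k' \<noteq> 0" by blast
  have "k' \<ge> k"
  proof (rule ccontr)
    assume "\<not> k' \<ge> k"
    then have lt: "k' < k" by simp
    show False
    proof (cases k')
      case 0
      then show False using XY diag_y by simp
    next
      case (Suc j)
      have "ev X Y a 0 (Suc j) = 0" "ev X Y a 0 j = 0" "ev X Y a (Suc 0) (Suc j) = 0"
        using low_a[of X Y] lt by (simp_all add: low_def Suc)
      then have "(X 0 - X k') * ev X Y b 0 k' = 0" using ev_ab_relation[of X Y 0 j] by (simp add: Suc)
      moreover have "X 0 \<noteq> X k'" using inj_onD[OF XY(1), of 0 k'] Suc by auto
      ultimately show False using XY by simp
    qed
  qed
  show ?thesis
  proof (cases "k' = k")
    case True
    then show ?thesis using * by (intro that[of S' g']) auto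
  next
    case False
    then have "ev X Y b 0 k = 0" for X Y using *(4)[of X Y] \<open>k' \<ge> k\<close> by (simp add: low_def)
    then show ?thesis by (intro that[of "{}"]) auto
  qed
qed

text \<open>The coefficient of X 0 in the symbol, a function of the sites 1, \<dots>, k.\<close>

definition wt :: "(nat => complex) => (nat => complex) => complex" where
  "wt X Y = (\<Sum>L | L \<in> S \<and> hd L = (1, 0). g L * mval (X \<circ> Suc) (Y \<circ> Suc) (tl L))"

lemma wt_cong:
  assumes "!!t. t \<in> {1..k} ==> X t = X' t \<and> Y t = Y' t"
  shows "wt X Y = wt X' Y'"
  unfolding wt_def
proof (rule sum.cong[OF HOL.refl])
  fix L assume "L \<in> {L \<in> S. hd L = (1, 0)}"
  then have "length (tl L) = k" using S(3) by auto
  then have "mval (X \<circ> Suc) (Y \<circ> Suc) (tl L) = mval (X' \<circ> Suc) (Y' \<circ> Suc) (tl L)"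
    unfolding mval_def using assms by (intro prod.cong) auto
  then show "g L * mval (X \<circ> Suc) (Y \<circ> Suc) (tl L) = g L * mval (X' \<circ> Suc) (Y' \<circ> Suc) (tl L)" by simp
qed

context
  assumes dmax1: "dmax \<le> 1"
begin

lemma hat_affine:
  obtains h0 h1 where "!!z y. hat (X(0 := z)) (Y(0 := y)) = h0 + wt X Y * z + h1 * y"
proof -
  let ?t = "\<lambda>L. g L * mval (X \<circ> Suc) (Y \<circ> Suc) (tl L)"
  have "hat (X(0 := z)) (Y(0 := y)) = (\<Sum>L | L \<in> S \<and> hd L = (0, 0). ?t L) + wt X Y * z + (\<Sum>L | L \<in> S \<and> hd L = (0, 1). ?t L) * y" for z y
  proof -
    have "hat (X(0 := z)) (Y(0 := y)) = (\<Sum>L\<in>S. (if hd L = (0, 0) then ?t L else 0) + (if hd L = (1, 0) then ?t L * z else 0)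
        + (if hd L = (0, 1) then ?t L * y else 0))"
      unfolding hat_upd
    proof (rule sum.cong[OF HOL.refl])
      fix L assume "L \<in> S"
      then have "hdeg L \<le> 1" using hdeg_le[of L] dmax1 by simp
      then have "hd L = (0, 0) \<or> hd L = (1, 0) \<or> hd L = (0, 1)"
        by (cases "hd L") (auto simp: hdeg_def)
      then show "g L * (z ^ fst (hd L) * y ^ snd (hd L) * mval (X \<circ> Suc) (Y \<circ> Suc) (tl L)) =
         (if hd L = (0, 0) then ?t L else 0) + (if hd L = (1, 0) then ?t L * z else 0) + (if hd L = (0, 1) then ?t L * y else 0)"
        by auto
    qed
    then show ?thesis
      using S(1) by (simp add: sum.distrib sum.inter_filter[symmetric] wt_def sum_distrib_right)
  qed
  then show ?thesis by (rule that)
qed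

text \<open>If the symbol is affine in the variables of site 0, it must be a multiple of X 0 - X
  k, because ev_b_relation makes it vanish for X 0 = X k and Y 0 \<noteq> Y k.\<close>

lemma hat_eq:
  assumes inj: "inj_on X {1..k}"
  shows "hat (X(0 := z)) (Y(0 := y)) = wt X Y * (z - X k)"
proof -
  obtain h0 h1 where h: "!!z y. hat (X(0 := z)) (Y(0 := y)) = h0 + wt X Y * z + h1 * y"
    using hat_affine by metis
  have at_k: "h0 + wt X Y * X k + h1 * y = 0" if y: "y \<noteq> Y k" for y
  proof -
    obtain S' g' where S': "finite S'" "!!L. L \<in> S' ==> length L = Suc k"
      "!!X Y. ev X Y b 0 k = (\<Prod>t<k. X t - X (Suc t)) * (\<Sum>L\<in>S'. g' L * mval X Y L)"
      by (rule b_symbol, rule that, assumption+)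
    have "\<exists>P. \<forall>z. (\<Sum>L\<in>S'. g' L * mval (X(0 := z)) (Y(0 := y)) L) = poly P z"
      by (rule mval_sum_poly[OF S'(1)]) (use S'(2) in fastforce)
    then obtain P where P: "!!z. (\<Sum>L\<in>S'. g' L * mval (X(0 := z)) (Y(0 := y)) L) = poly P z" by blast
    let ?Q = "[:(Y k - y) * (h0 + h1 * y), (Y k - y) * wt X Y:] + [:- X k, 1:] * P"
    have "poly ?Q z = 0" if z: "z \<notin> X ` {1..k}" for z
    proof -
      let ?X = "X(0 := z)" and ?Y = "Y(0 := y)"
      have "inj_on ?X {..k}" using inj z by (rule inj_on_upd0)
      then have "?X t \<noteq> ?X (Suc t)" if "t < k" for t
        using inj_onD[of ?X "{..k}" t "Suc t"] that by auto
      then have ne: "(\<Prod>t<k. ?X t - ?X (Suc t)) \<noteq> 0" by simp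
      have "(\<Prod>t<k. ?X t - ?X (Suc t)) * ((?Y k - ?Y 0) * hat ?X ?Y + (?X 0 - ?X k) * poly P z) = 0"
        using ev_b_relation[of ?Y ?X] unfolding ev_a S'(3) P hat_def by (simp only: algebra_simps)
      then have "(?Y k - ?Y 0) * hat ?X ?Y + (?X 0 - ?X k) * poly P z = 0" using ne by simp
      then show ?thesis using k_pos by (simp add: h algebra_simps)
    qed
    then have "UNIV \<subseteq> {z. poly ?Q z = 0} \<union> X ` {1..k}" by auto
    then have "infinite {z. poly ?Q z = 0}"
      using infinite_UNIV_char_0[where 'a=complex] finite_subset[of UNIV "{z. poly ?Q z = 0} \<union> X ` {1..k}"] by auto
    then have "?Q = 0" using poly_roots_finite by blast
    then have "poly ?Q (X k) = 0" by simp
    then have "(Y k - y) * (h0 + wt X Y * X k + h1 * y) = 0" by (simp add: algebra_simps)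
    then show ?thesis using y by simp
  qed
  have "h1 = (h0 + wt X Y * X k + h1 * (Y k + 2)) - (h0 + wt X Y * X k + h1 * (Y k + 1))"
    by (simp add: algebra_simps)
  also have "\<dots> = 0" using at_k[of "Y k + 1"] at_k[of "Y k + 2"] by simp
  finally have "h1 = 0" .
  moreover from this have "h0 = - wt X Y * X k" using at_k[of "Y k + 1"] by (simp add: eq_neg_iff_add_eq_0)
  ultimately show ?thesis by (simp add: h algebra_simps)
qed

lemma hat_eq': "inj_on X {1..k} ==> hat X Y = wt X Y * (X 0 - X k)"
  using hat_eq[of X "X 0" Y "Y 0"] by simp

text \<open>The relation D c = 0 one superdiagonal further up, with the site k + 1 placed on top
  of the site 0: the term with D y disappears, and the symbols at 0, \<dots>, k and 1, \<dots>,
  k + 1 agree.\<close>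

lemma wt_cyclic:
  assumes inj: "inj_on X {..k}" and X: "X (Suc k) = X 0" and Y: "Y (Suc k) = Y 0"
  shows "wt X Y = wt (X \<circ> Suc) (Y \<circ> Suc)"
proof -
  obtain k' where k': "k = Suc k'" using k_pos by (cases k) auto
  have ne: "X i \<noteq> X j" if "i \<le> k" "j \<le> k" "i \<noteq> j" for i j
    using inj_onD[OF inj, of i j] that by auto
  have inj1: "inj_on X {1..k}" using inj by (rule inj_on_subset) auto
  have inj2: "inj_on (X \<circ> Suc) {1..k}"
  proof (rule inj_onI)
    fix s t assume st: "s \<in> {1..k}" "t \<in> {1..k}" "(X \<circ> Suc) s = (X \<circ> Suc) t"
    then show "s = t" using ne[of "Suc s" "Suc t"] ne[of "Suc s" 0] ne[of "Suc t" 0] X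
      by (cases "s = k"; cases "t = k") auto
  qed
  have "ev X Y a 0 k = ev X Y a (Suc 0) (Suc k)"
    using ev_ab_relation[of X Y 0 k] by (simp add: X Y)
  also have "\<dots> = ev (X \<circ> Suc) (Y \<circ> Suc) a 0 k"
    by (subst ev_shift[where X=X and Y=Y and d=1]) auto
  finally have E: "(\<Prod>t<k. X t - X (Suc t)) * (wt X Y * (X 0 - X k)) =
      (\<Prod>t<k. X (Suc t) - X (Suc (Suc t))) * (wt (X \<circ> Suc) (Y \<circ> Suc) * (X 1 - X (Suc k)))"
    using hat_eq'[OF inj1, of Y] hat_eq'[OF inj2, of "Y \<circ> Suc"] unfolding ev_a hat_def by simp
  let ?P = "\<Prod>t<k'. X (Suc t) - X (Suc (Suc t))"
  have P1: "(\<Prod>t<k. X t - X (Suc t)) = (X 0 - X 1) * ?P"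
    unfolding k' by (simp only: prod.lessThan_Suc_shift One_nat_def comp_def)
  have P2: "(\<Prod>t<k. X (Suc t) - X (Suc (Suc t))) = ?P * (X k - X 0)"
    unfolding k' using X by (simp add: k')
  have P0: "?P \<noteq> 0" using ne k' by simp
  have "?P * ((X 0 - X 1) * (X 0 - X k) * wt X Y) = (X 0 - X 1) * ?P * (wt X Y * (X 0 - X k))"
    by (simp only: ac_simps)
  also have "\<dots> = ?P * (X k - X 0) * (wt (X \<circ> Suc) (Y \<circ> Suc) * (X 1 - X 0))"
    using E unfolding P1 P2 X .
  also have "\<dots> = ?P * ((X 0 - X 1) * (X 0 - X k) * wt (X \<circ> Suc) (Y \<circ> Suc))"
    by (simp add: algebra_simps)
  finally have "(X 0 - X 1) * (X 0 - X k) * wt X Y = (X 0 - X 1) * (X 0 - X k) * wt (X \<circ> Suc) (Y \<circ> Suc)"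
    using P0 by (simp only: mult_cancel_left)  simp
  moreover have "(X 0 - X 1) * (X 0 - X k) \<noteq> 0" using ne[of 0 1] ne[of 0 k] k_pos by auto
  ultimately show ?thesis by simp
qed

text \<open>Sliding the window 1, \<dots>, k by one step drops its first site and adds a new one
  at the end, which is the situation of wt_cyclic.\<close>

lemma wt_window:
  assumes inj: "inj_on X {1..l + k}"
  shows "wt (\<lambda>t. X (t + l)) (\<lambda>t. Y (t + l)) = wt X Y"
  using inj
proof (induction l)
  case (Suc l)
  have IH: "wt (\<lambda>t. X (t + l)) (\<lambda>t. Y (t + l)) = wt X Y"
    by (rule Suc.IH) (rule inj_on_subset[OF Suc.prems], auto)
  let ?X = "(\<lambda>t. X (t + l))(0 := X (Suc k + l))" and ?Y = "(\<lambda>t. Y (t + l))(0 := Y (Suc k + l))"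
  have "inj_on ?X {..k}"
  proof (rule inj_onI)
    fix s t assume st: "s \<in> {..k}" "t \<in> {..k}" "?X s = ?X t"
    let ?f = "\<lambda>s. if s = 0 then Suc k + l else s + l"
    have "?X s = X (?f s)" for s by auto
    then have "X (?f s) = X (?f t)" using st by metis
    then have "?f s = ?f t"
      using inj_onD[OF Suc.prems, of "?f s" "?f t"] st(1,2) by auto
    then show "s = t" using st(1,2) by (auto split: if_splits)
  qed
  then have "wt ?X ?Y = wt (?X \<circ> Suc) (?Y \<circ> Suc)"
    by (rule wt_cyclic) auto
  moreover have "wt ?X ?Y = wt (\<lambda>t. X (t + l)) (\<lambda>t. Y (t + l))"
    by (rule wt_cong) auto
  moreover have "wt (?X \<circ> Suc) (?Y \<circ> Suc) = wt (\<lambda>t. X (t + Suc l)) (\<lambda>t. Y (t + Suc l))"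
    by (rule wt_cong) auto
  ultimately show ?case using IH by simp
qed simp

lemma W_eq:
  assumes inj: "inj_on X {..l + k}"
  shows "W X Y l (l + k) = wt X Y * (\<Prod>t<k. X (l + t) - X (Suc (l + t)))"
proof -
  let ?X = "\<lambda>t. X (t + l)" and ?Y = "\<lambda>t. Y (t + l)"
  have inj': "inj_on ?X {1..k}"
    by (rule inj_onI) (use inj_onD[OF inj] in force)
  have "ev X Y a l (l + k) = ev ?X ?Y a 0 k"
    by (rule ev_shift0)
  also have "\<dots> = (\<Prod>t<k. ?X t - ?X (Suc t)) * (wt ?X ?Y * (?X 0 - ?X k))"
    using hat_eq'[OF inj', of ?Y] unfolding ev_a hat_def by simp
  also have "wt ?X ?Y = wt X Y"
    by (rule wt_window) (rule inj_on_subset[OF inj], auto)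
  finally have "ev X Y a l (l + k) = (\<Prod>t<k. X (l + t) - X (Suc (l + t))) * (wt X Y * (X l - X (l + k)))"
    by (simp add: add.commute)
  moreover have "X l \<noteq> X (l + k)" using inj_onD[OF inj, of l "l + k"] k_pos by auto
  ultimately show ?thesis using k_pos by (simp add: W_def)
qed

text \<open>As wt takes the same value on neighbouring windows, both terms in the definition of
  B are the same product of differences, so there are no jumps.\<close>

lemma B_eq_0:
  assumes inj: "inj_on X {..l + k + 1}"
  shows "B X Y l (l + k + 1) = 0"
proof -
  have "W X Y l (l + k) = wt X Y * (\<Prod>t<k. X (l + t) - X (Suc (l + t)))"
    by (rule W_eq) (rule inj_on_subset[OF inj], auto)
  moreover have "W X Y (Suc l) (Suc l + k) = wt X Y * (\<Prod>t<k. X (Suc l + t) - X (Suc (Suc l + t)))"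
    by (rule W_eq) (rule inj_on_subset[OF inj], auto)
  moreover have "(X (l + k) - X (Suc (l + k))) * (\<Prod>t<k. X (l + t) - X (Suc (l + t))) =
     (X l - X (Suc l)) * (\<Prod>t<k. X (Suc l + t) - X (Suc (Suc l + t)))"
  proof -
    have "(\<Prod>t<Suc k. X (l + t) - X (Suc (l + t))) = (X l - X (Suc l)) * (\<Prod>t<k. X (Suc l + t) - X (Suc (Suc l + t)))"
      by (simp only: prod.lessThan_Suc_shift comp_def) simp
    then show ?thesis by (simp add: mult.commute)
  qed
  ultimately show ?thesis unfolding B_def by (simp add: mult.left_commute)
qed

text \<open>Without jumps the recursion for the iterates is explicit. The correction h ignores
  the site 0, so that a suitable choice of X 0 makes the iterate nonzero.\<close>

lemma ev_iterate_II:
  "\<exists>h. (\<forall>X Y X' Y'. (\<forall>t\<ge>1. X t = X' t \<and> Y t = Y' t) \<longrightarrow> h X Y = h X' Y') \<and>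
    (\<forall>X Y. inj_on X {..n * k} \<longrightarrow> ev X Y ((D ^^ n) genx) 0 (n * k) =
       wt X Y ^ n * (\<Prod>t<n * k. X t - X (Suc t)) * (X 0 - h X Y))"
proof (induction n)
  case 0
  show ?case by (intro exI[of _ "\<lambda>_ _. 0"]) (simp add: ev_genx)
next
  case (Suc n)
  then obtain h where h1: "!!X Y X' Y'. (\<forall>t\<ge>1. X t = X' t \<and> Y t = Y' t) ==> h X Y = h X' Y'"
    and h2: "!!X Y. inj_on X {..n * k} ==> ev X Y ((D ^^ n) genx) 0 (n * k) =
       wt X Y ^ n * (\<Prod>t<n * k. X t - X (Suc t)) * (X 0 - h X Y)"
    by blast
  \<comment> \<open>the terms X 0 - h and X k - h of the two boundary contributions are
    subtracted\<close>
  let ?h = "\<lambda>X Y. h X Y + X k - h (\<lambda>t. X (t + k)) (\<lambda>t. Y (t + k))"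
  have 1: "?h X Y = ?h X' Y'" if "\<forall>t\<ge>1. X t = X' t \<and> Y t = Y' t" for X Y X' Y'
    using h1[of X X' Y Y'] h1[of "\<lambda>t. X (t + k)" "\<lambda>t. X' (t + k)" "\<lambda>t. Y (t + k)" "\<lambda>t. Y' (t + k)"] that k_pos
    by auto
  have 2: "ev X Y ((D ^^ Suc n) genx) 0 (Suc n * k) =
       wt X Y ^ Suc n * (\<Prod>t<Suc n * k. X t - X (Suc t)) * (X 0 - ?h X Y)"
    if inj: "inj_on X {..Suc n * k}" for X Y
  proof -
    let ?u = "(D ^^ n) genx"
    let ?m = "n * k"
    have inj': "inj_on X {..?m + k}" using inj by (simp add: add.commute)
    have "ev X Y (D ?u) 0 (?m + k) = ev X Y ?u 0 ?m * W X Y ?m (?m + k) - W X Y 0 k * ev X Y ?u k (?m + k)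
       + (\<Sum>l<?m. B X Y l (l + k + 1) * ev (X \<circ> skip l (l + k + 1)) (Y \<circ> skip l (l + k + 1)) ?u 0 ?m)"
      by (rule ev_D_level[OF inj' vanish_x])
    also have "(\<Sum>l<?m. B X Y l (l + k + 1) * ev (X \<circ> skip l (l + k + 1)) (Y \<circ> skip l (l + k + 1)) ?u 0 ?m) = 0"
    proof (intro sum.neutral ballI)
      fix l assume "l \<in> {..<?m}"
      then have "B X Y l (l + k + 1) = 0" by (intro B_eq_0 inj_on_subset[OF inj']) auto
      then show "B X Y l (l + k + 1) * ev (X \<circ> skip l (l + k + 1)) (Y \<circ> skip l (l + k + 1)) ?u 0 ?m = 0" by simp
    qed
    also have "W X Y ?m (?m + k) = wt X Y * (\<Prod>t<k. X (?m + t) - X (Suc (?m + t)))"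
      by (rule W_eq[OF inj'])
    also have "W X Y 0 k = wt X Y * (\<Prod>t<k. X t - X (Suc t))"
      using W_eq[of X 0 Y] inj_on_subset[OF inj', of "{..k}"] by auto
    also have "ev X Y ?u 0 ?m = wt X Y ^ n * (\<Prod>t<?m. X t - X (Suc t)) * (X 0 - h X Y)"
      by (rule h2) (rule inj_on_subset[OF inj'], auto)
    also have "ev X Y ?u k (?m + k) = wt X Y ^ n * (\<Prod>t<?m. X (k + t) - X (Suc (k + t))) * (X k - h (\<lambda>t. X (t + k)) (\<lambda>t. Y (t + k)))"
    proof -
      let ?X = "\<lambda>t. X (t + k)" and ?Y = "\<lambda>t. Y (t + k)"
      have "ev X Y ?u k (k + ?m) = ev ?X ?Y ?u 0 ?m" by (rule ev_shift0)
      also have "\<dots> = wt ?X ?Y ^ n * (\<Prod>t<?m. ?X t - ?X (Suc t)) * (?X 0 - h ?X ?Y)"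
        by (rule h2) (rule inj_onI, use inj_onD[OF inj'] in force)
      also have "wt ?X ?Y ^ n = wt X Y ^ n"
      proof (cases n)
        case (Suc n')
        have "wt ?X ?Y = wt X Y"
          by (rule wt_window) (rule inj_on_subset[OF inj'], auto simp: Suc)
        then show ?thesis by simp
      qed simp
      finally show ?thesis by (simp add: add.commute)
    qed
    finally have *: "ev X Y (D ?u) 0 (?m + k) =
      wt X Y ^ Suc n * ((\<Prod>t<?m. X t - X (Suc t)) * (\<Prod>t<k. X (?m + t) - X (Suc (?m + t)))) * (X 0 - h X Y)
      - wt X Y ^ Suc n * ((\<Prod>t<k. X t - X (Suc t)) * (\<Prod>t<?m. X (k + t) - X (Suc (k + t)))) * (X k - h (\<lambda>t. X (t + k)) (\<lambda>t. Y (t + k)))"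
      by (simp add: ac_simps)
    have sp: "(\<Prod>t<p. X t - X (Suc t)) * (\<Prod>t<q. X (p + t) - X (Suc (p + t))) = (\<Prod>t<p + q. X t - X (Suc t))" for p q
      by (induction q) (simp_all add: ac_simps)
    show ?thesis using * unfolding sp by (simp add: add.commute algebra_simps)
  qed
  show ?case by (intro exI[of _ ?h] conjI allI impI) (use 1 2 in blast)+
qed

lemma iterate_nonzero_II: "(D ^^ n) genx \<noteq> 0"
proof -
  obtain h where h1: "!!X Y X' Y'. (\<forall>t\<ge>1. X t = X' t \<and> Y t = Y' t) ==> h X Y = h X' Y'"
    and h2: "!!X Y. inj_on X {..n * k} ==> ev X Y ((D ^^ n) genx) 0 (n * k) =
       wt X Y ^ n * (\<Prod>t<n * k. X t - X (Suc t)) * (X 0 - h X Y)"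
    using ev_iterate_II[of n] by blast
  obtain X Y where XY: "inj_on X {..k}" "hat X Y \<noteq> 0" using hat_nonzero[OF finite.emptyI] by blast
  have "inj_on X {1..k}" using XY(1) by (rule inj_on_subset) auto
  then have w: "wt X Y \<noteq> 0" using hat_eq'[of X Y] XY(2) by auto
  \<comment> \<open>continue the sites beyond k by distinct values\<close>
  obtain f :: "nat => complex" where f: "inj f" "range f \<inter> X ` {..k} = {}"
  proof -
    have "infinite (UNIV - X ` {..k})" using infinite_UNIV_char_0[where 'a=complex] by (simp add: Diff_infinite_finite)
    then obtain f :: "nat => complex" where "inj f" "range f \<subseteq> UNIV - X ` {..k}"
      using infinite_countable_subset by blast
    then show ?thesis using that by blast
  qed
  define X1 where "X1 t = (if t \<le> k then X t else f t)" for t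
  have injX1: "inj_on X1 {1..}"
  proof (rule inj_onI)
    fix s t assume st: "s \<in> {1..}" "t \<in> {1..}" "X1 s = X1 t"
    have fx: "X i \<noteq> f j" if "i \<le> k" for i j using f(2) that by (metis IntI atMost_iff empty_iff image_eqI rangeI)
    show "s = t"
      using st fx[of s t] fx[of t s] inj_onD[OF XY(1), of s t] injD[OF f(1), of s t]
      by (auto simp: X1_def split: if_splits dest: sym)
  qed
  have "finite (X1 ` {1..n * k} \<union> {h X1 Y})" by simp
  then obtain z where z: "z \<notin> X1 ` {1..n * k} \<union> {h X1 Y}"
    using ex_new_if_finite[OF infinite_UNIV_char_0] by blast
  let ?X = "X1(0 := z)"
  have inj: "inj_on ?X {..n * k}"
    by (rule inj_on_upd0) (use inj_on_subset[OF injX1] z in auto)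
  have "h ?X Y = h X1 Y" by (rule h1) auto
  then have "?X 0 - h ?X Y \<noteq> 0" using z by auto
  moreover have "wt ?X Y = wt X Y" by (rule wt_cong) (auto simp: X1_def)
  moreover have "?X t \<noteq> ?X (Suc t)" if "t < n * k" for t
    using inj_onD[OF inj, of t "Suc t"] that by auto
  then have "(\<Prod>t<n * k. ?X t - ?X (Suc t)) \<noteq> 0" by simp
  ultimately have "ev ?X Y ((D ^^ n) genx) 0 (n * k) \<noteq> 0"
    using h2[OF inj, of Y] w by simp
  then show ?thesis by auto
qed

end

lemma iterate_nonzero: "(D ^^ n) genx \<noteq> 0"
  using iterate_nonzero_I[of n] iterate_nonzero_II[of n] by linarith

end

text \<open>If D x \<noteq> 0, then either case of the growth analysis shows that all iterates
  on x are nonzero. If D x = 0, then the relation D c = 0 forces D y to commute with x, and its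
  diagonal vanishes.\<close>

theorem (in comm_derivation) nilpotent_imp_zero:
  assumes "(D ^^ n) genx = 0"
  shows "D genx = 0" "D geny = 0"
proof -
  show a0: "D genx = 0"
  proof (rule ccontr)
    assume nz: "D genx \<noteq> 0"
    obtain S k g where *: "finite S" "S \<noteq> {}" "!!L. L \<in> S ==> length L = Suc k \<and> g L \<noteq> 0"
      "!!X Y. low X Y k (D genx)"
      "!!X Y. ev X Y (D genx) 0 k = (\<Prod>t<k. X t - X (Suc t)) * (\<Sum>L\<in>S. g L * mval X Y L)"
      by (rule nf_symbol[OF nz], rule that, assumption+)
    interpret comm_derivation_order D k S g
      by unfold_locales (use * in auto)
    show False using iterate_nonzero assms by blast
  qed
  show "D geny = 0"
  proof (rule eq_zero_if_ev_zero)
    fix X Y :: "nat => complex" and k assume inj: "inj_on X {..k}"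
    show "ev X Y (D geny) 0 k = 0"
    proof (cases k)
      case (Suc j)
      then have "X 0 \<noteq> X k" using inj_onD[OF inj, of 0 k] by auto
      then show ?thesis using ev_ab_relation[of X Y 0 j] a0 Suc by simp
    qed (simp add: diag_y)
  qed
qed

section \<open>Automorphisms with trivial abelianization\<close>

definition alg_hom :: "(falg => falg) => bool" where
  "alg_hom \<sigma> \<longleftrightarrow> (\<forall>u v. \<sigma> (u + v) = \<sigma> u + \<sigma> v) \<and> (\<forall>u v. \<sigma> (u * v) = \<sigma> u * \<sigma> v) \<and>
     (\<forall>c u. \<sigma> (scal c * u) = scal c * \<sigma> u) \<and> \<sigma> 1 = 1"

lemma alg_hom_add: "alg_hom \<sigma> ==> \<sigma> (u + v) = \<sigma> u + \<sigma> v"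
  and alg_hom_mult: "alg_hom \<sigma> ==> \<sigma> (u * v) = \<sigma> u * \<sigma> v"
  and alg_hom_scal: "alg_hom \<sigma> ==> \<sigma> (scal c * u) = scal c * \<sigma> u"
  and alg_hom_1: "alg_hom \<sigma> ==> \<sigma> 1 = 1"
  unfolding alg_hom_def by blast+

lemma alg_hom_0: "alg_hom \<sigma> ==> \<sigma> 0 = 0"
  using alg_hom_add[of \<sigma> 0 0] by simp

lemma alg_hom_diff: "alg_hom \<sigma> ==> \<sigma> (u - v) = \<sigma> u - \<sigma> v"
  using alg_hom_add[of \<sigma> "u - v" v] by (simp add: algebra_simps)

lemma alg_hom_subst: "alg_hom \<sigma> ==> \<sigma> u = fA.subst (\<sigma> genx) (\<sigma> geny) u"
  by (intro fA.hom_eq_subst alg_hom_add alg_hom_mult alg_hom_scal alg_hom_1)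

lemma alg_hom_eqI:
  assumes "alg_hom \<sigma>" "alg_hom \<tau>" "\<sigma> genx = \<tau> genx" "\<sigma> geny = \<tau> geny"
  shows "\<sigma> = \<tau>"
proof
  fix u show "\<sigma> u = \<tau> u"
    using alg_hom_subst[OF assms(1), of u] alg_hom_subst[OF assms(2), of u] assms(3,4) by simp
qed

fun derw :: "falg => falg => letter list => falg" where
  "derw p q [] = 0"
| "derw p q (LX # l) = p * wd l + genx * derw p q l"
| "derw p q (LY # l) = q * wd l + geny * derw p q l"

lemma derw_append: "derw p q (l @ m) = derw p q l * wd m + wd l * derw p q m"
  by (induction p q l rule: derw.induct) (simp_all add: wd_Nil wd_LX wd_LY wd_append algebra_simps)

text \<open>The derivation with prescribed values on the two generators.\<close>

definition Der :: "falg => falg => falg => falg" where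
  "Der p q = lin (\<lambda>c u. scal c * u) (derw p q)"

lemma Der_add: "Der p q (u + v) = Der p q u + Der p q v"
  and Der_scal: "Der p q (scal c * u) = scal c * Der p q u"
  and Der_wd: "Der p q (wd l) = derw p q l"
  and Der_0 [simp]: "Der p q 0 = 0"
  by (simp_all add: Der_def fA.lin_add fA.lin_scal)

lemma Der_gen [simp]: "Der p q genx = p" "Der p q geny = q"
  by (simp_all add: genx_wd geny_wd Der_wd wd_Nil)

lemma derivation_Der: "derivation (Der p q)"
proof -
  have "Der p q (u * v) = Der p q u * v + u * Der p q v" for u v
  proof (induction u rule: falg_induct)
    case (word c l)
    show ?case
    proof (induction v rule: falg_induct)
      case (word d m)
      have "Der p q ((scal c * wd l) * (scal d * wd m)) = scal c * (scal d * (derw p q l * wd m + wd l * derw p q m))"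
        unfolding word_times_word by (simp only: Der_scal Der_wd derw_append scal_mult mult.assoc)
      also have "\<dots> = Der p q (scal c * wd l) * (scal d * wd m) + (scal c * wd l) * Der p q (scal d * wd m)"
        by (simp only: Der_scal Der_wd distrib_left mult.assoc mult_scal_left[of "wd l"] mult_scal_left[of "derw p q l"])
      finally show ?case .
    qed (simp_all add: distrib_left Der_add ac_simps)
  qed (simp_all add: distrib_right Der_add ac_simps)
  then show ?thesis by (simp add: derivation_def Der_add Der_scal)
qed

lemma derivation_add: "derivation D ==> D (u + v) = D u + D v"
  and derivation_mult: "derivation D ==> D (u * v) = D u * v + u * D v"
  and derivation_scal: "derivation D ==> D (scal c * u) = scal c * D u"
  unfolding derivation_def by blast+

lemma derivation_eq_Der:
  assumes D: "derivation D"
  shows "D u = Der (D genx) (D geny) u"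
proof (induction u rule: falg_induct)
  case zero
  show ?case by (simp add: derivation_0[OF D])
next
  case (add u v)
  then show ?case by (simp add: derivation_add[OF D] Der_add)
next
  case (word c l)
  have "D (wd l) = derw (D genx) (D geny) l"
  proof (induction l)
    case Nil show ?case by (simp add: wd_Nil derivation_1[OF D])
  next
    case (Cons a l) then show ?case by (cases a) (simp_all add: wd_LX wd_LY derivation_mult[OF D])
  qed
  then show ?case by (simp only: derivation_scal[OF D] Der_scal Der_wd)
qed

text \<open>The homogeneous component of a given degree.\<close>

definition gr :: "nat => falg => falg" where
  "gr r = lin (\<lambda>c u. scal c * u) (\<lambda>l. if length l = r then wd l else 0)"

lemma gr_add: "gr r (u + v) = gr r u + gr r v"
  and gr_diff: "gr r (u - v) = gr r u - gr r v"
  and gr_scal: "gr r (scal c * u) = scal c * gr r u"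
  and gr_wd: "gr r (wd l) = (if length l = r then wd l else 0)"
  and gr_0 [simp]: "gr r 0 = 0"
  by (simp_all add: gr_def fA.lin_add fA.lin_scal fA.lin_diff)

lemma gr_sum: "gr r (sum f I) = (\<Sum>i\<in>I. gr r (f i))"
  by (induction I rule: infinite_finite_induct) (simp_all add: gr_add)

lemma gr_genx: "gr r genx = (if r = 1 then genx else 0)"
  and gr_geny: "gr r geny = (if r = 1 then geny else 0)"
  by (auto simp: genx_wd geny_wd gr_wd)

lemma gr_mult: "gr n (u * v) = (\<Sum>i\<le>n. gr i u * gr (n - i) v)"
proof (induction u rule: falg_induct)
  case (word c l)
  show ?case
  proof (induction v rule: falg_induct)
    case (word d m)
    have "(\<Sum>i\<le>n. gr i (scal c * wd l) * gr (n - i) (scal d * wd m)) =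
      (\<Sum>i\<le>n. if i = length l then (if length m = n - length l then scal (c * d) * wd (l @ m) else 0) else 0)"
      by (rule sum.cong) (auto simp: gr_scal gr_wd word_times_word)
    also have "\<dots> = gr n ((scal c * wd l) * (scal d * wd m))"
      by (auto simp: word_times_word gr_scal gr_wd)
    finally show ?case ..
  qed (simp_all add: distrib_left gr_add sum.distrib)
qed (simp_all add: distrib_right gr_add sum.distrib)

definition degle :: "nat => falg => bool" where
  "degle n u \<longleftrightarrow> (\<forall>r>n. gr r u = 0)"

lemma degle_0 [simp]: "degle n 0"
  by (simp add: degle_def)

lemma degle_add: "degle n u ==> degle n v ==> degle n (u + v)"
  and degle_diff: "degle n u ==> degle n v ==> degle n (u - v)"
  and degle_scal: "degle n u ==> degle n (scal c * u)"
  and degle_mono: "degle n u ==> n \<le> m ==> degle m u"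
  and degle_wd: "length l \<le> n ==> degle n (wd l)"
  by (auto simp: degle_def gr_add gr_diff gr_scal gr_wd)

lemma degle_sum: "(!!i. i \<in> I ==> degle n (f i)) ==> degle n (sum f I)"
  by (induction I rule: infinite_finite_induct) (auto intro: degle_add)

lemma degle_gen: "degle 1 genx" "degle 1 geny"
  by (simp_all add: degle_def gr_genx gr_geny)

lemma degle_mult: "degle m u ==> degle n v ==> degle (m + n) (u * v)"
  unfolding degle_def gr_mult
proof (intro allI impI sum.neutral ballI)
  fix r i assume *: "\<forall>r>m. gr r u = 0" "\<forall>r>n. gr r v = 0" "m + n < r" "i \<in> {..r}"
  then have "m < i \<or> n < r - i" by auto
  then show "gr i u * gr (r - i) v = 0" using * by auto
qed

lemma gr_mult_top:
  assumes "degle m u" "degle n v"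
  shows "gr (m + n) (u * v) = gr m u * gr n v"
proof -
  have "gr (m + n) (u * v) = (\<Sum>i\<le>m + n. if i = m then gr m u * gr n v else 0)"
    unfolding gr_mult
  proof (rule sum.cong[OF HOL.refl])
    fix i assume "i \<in> {..m + n}"
    then consider "i < m" "m + n - i > n" | "i = m" | "i > m" by fastforce
    then show "gr i u * gr (m + n - i) v = (if i = m then gr m u * gr n v else 0)"
      using assms by cases (auto simp: degle_def)
  qed
  then show ?thesis by simp
qed

lemma degle_exists: "\<exists>n. degle n u"
proof (induction u rule: falg_induct)
  case (add u v)
  then obtain m n where "degle m u" "degle n v" by blast
  then have "degle (max m n) (u + v)" by (intro degle_add) (auto elim: degle_mono)
  then show ?case ..
qed (auto intro: degle_scal degle_wd)

lemma gr_decomp: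
  assumes "degle n u"
  shows "u = (\<Sum>r\<le>n. gr r u)"
proof -
  have "\<exists>N. \<forall>m\<ge>N. u = (\<Sum>r\<le>m. gr r u)"
  proof (induction u rule: falg_induct)
    case (add u v)
    then obtain M N where "\<forall>m\<ge>M. u = (\<Sum>r\<le>m. gr r u)" "\<forall>m\<ge>N. v = (\<Sum>r\<le>m. gr r v)" by blast
    then have "\<forall>m\<ge>max M N. u + v = (\<Sum>r\<le>m. gr r (u + v))"
      by (simp add: gr_add sum.distrib)
    then show ?case ..
  next
    case (word c l)
    have "\<forall>m\<ge>length l. scal c * wd l = (\<Sum>r\<le>m. gr r (scal c * wd l))"
      by (auto simp: gr_scal gr_wd if_distrib[of "\<lambda>z. _ * z"] cong: if_cong)
    then show ?case ..
  qed simp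
  then obtain N where N: "\<forall>m\<ge>N. u = (\<Sum>r\<le>m. gr r u)" by blast
  have "u = (\<Sum>r\<le>max N n. gr r u)" using N by simp
  also have "\<dots> = (\<Sum>r\<le>n. gr r u)"
    by (rule sum.mono_neutral_right) (use assms in \<open>auto simp: degle_def\<close>)
  finally show ?thesis .
qed

text \<open>The Euler derivation multiplies a homogeneous element by its degree.\<close>

definition euler :: "falg => falg" where "euler = Der genx geny"

lemma derw_euler: "derw genx geny l = scal (of_nat (length l)) * wd l"
proof (induction l)
  case (Cons a l)
  then show ?case
    by (cases a) (simp_all add: wd_LX wd_LY mult_scal_left scal_add distrib_right)
qed simp

lemma scal_scal: "scal a * (scal b * w) = scal (a * b) * w"
  by (simp add: scal_mult mult.assoc)

lemma euler_zero [simp]: "euler 0 = 0"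
  and euler_add: "euler (u + v) = euler u + euler v"
  and euler_scal: "euler (scal c * u) = scal c * euler u"
  and euler_wd: "euler (wd l) = scal (of_nat (length l)) * wd l"
  by (simp_all add: euler_def Der_add Der_scal Der_wd derw_euler)

lemma euler_comp: "euler (gr r u) = scal (of_nat r) * gr r u"
proof (induction u rule: falg_induct)
  case (word c l)
  show ?case
    by (cases "length l = r") (auto simp: gr_scal euler_scal gr_wd euler_wd intro: mult_scal_left)
qed (simp_all add: gr_add euler_add distrib_left euler_zero)

lemma gr_euler: "gr r (euler u) = scal (of_nat r) * gr r u"
proof (induction u rule: falg_induct)
  case (word c l)
  show ?case
    by (cases "length l = r") (auto simp: gr_scal euler_scal gr_wd euler_wd intro: mult_scal_left)
qed (simp_all add: gr_add euler_add distrib_left euler_zero)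

lemma euler_comm: "euler comm = scal 2 * comm"
proof -
  have d: "derivation euler" by (simp add: euler_def derivation_Der)
  have "scal 2 = (1 + 1 :: falg)" using scal_add[of 1 1] by simp
  then show ?thesis
    by (simp add: comm_def derivation_diff[OF d] derivation_mult[OF d]) (simp add: euler_def algebra_simps mult_2)
qed

lemma tri_scale: "tri (\<lambda>i. t * X i) (\<lambda>i. t * Y i) l 0 0 = t ^ length l * tri X Y l 0 0"
proof (induction l)
  case (Cons a l)
  then show ?case by (cases a) (simp_all add: tri_lower)
qed simp

lemma ev_comp_scale: "ev (\<lambda>i. t * X i) (\<lambda>i. t * Y i) (gr r u) 0 0 = t ^ r * ev X Y (gr r u) 0 0"
  by (induction u rule: falg_induct) (auto simp: gr_add ev_add distrib_left gr_scal ev_scal gr_wd ev_wd tri_scale)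

lemma ev_comp_zero:
  assumes "!!X Y. ev X Y u 0 0 = 0"
  shows "ev X Y (gr r u) 0 0 = 0"
proof -
  obtain n where n: "degle n u" using degle_exists by blast
  let ?P = "\<Sum>r\<le>n. Polynomial.monom (ev X Y (gr r u) 0 0) r"
  have "poly ?P t = 0" for t
  proof -
    have "ev (\<lambda>i. t * X i) (\<lambda>i. t * Y i) (\<Sum>r\<le>n. gr r u) 0 0 = 0"
      using assms gr_decomp[OF n] by simp
    then show ?thesis by (simp add: ev_sum ev_comp_scale poly_sum poly_monom mult.commute)
  qed
  then have "?P = 0" using poly_all_0_iff_0 by blast
  then have "poly.coeff ?P r = 0" by simp
  then show ?thesis using n by (cases "r \<le> n") (auto simp: coeff_sum degle_def)
qed

lemma gr_0_eq: "gr 0 u = scal (ev X Y (gr 0 u) 0 0)"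
  by (induction u rule: falg_induct)
     (auto simp: gr_add ev_add scal_add gr_scal ev_scal gr_wd ev_wd wd_Nil scal_mult ev_1)

lemma gr_1_eq: "\<exists>c d. gr 1 u = scal c * genx + scal d * geny"
proof (induction u rule: falg_induct)
  case zero
  show ?case by (intro exI[of _ 0]) simp
next
  case (add u v)
  then obtain c d c' d' where "gr 1 u = scal c * genx + scal d * geny" "gr 1 v = scal c' * genx + scal d' * geny"
    by blast
  then show ?case by (intro exI[of _ "c + c'"] exI[of _ "d + d'"]) (simp add: gr_add scal_add algebra_simps)
next
  case (word c l)
  show ?case
  proof (cases "length l = 1")
    case False
    then show ?thesis by (intro exI[of _ 0]) (simp add: gr_scal gr_wd)
  next
    case True
    then obtain a where l: "l = [a]" by (cases l) auto
    show ?thesis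
    proof (cases a)
      case LX
      then show ?thesis by (intro exI[of _ c] exI[of _ 0]) (simp add: gr_scal gr_wd l genx_wd)
    next
      case LY
      then show ?thesis by (intro exI[of _ 0] exI[of _ c]) (simp add: gr_scal gr_wd l geny_wd)
    qed
  qed
qed

lemma gr_01_zero:
  assumes "!!X Y. ev X Y u 0 0 = 0"
  shows "gr 0 u = 0" "gr 1 u = 0"
proof -
  show "gr 0 u = 0" using gr_0_eq[of u "\<lambda>_. 0" "\<lambda>_. 0"] ev_comp_zero[OF assms] by simp
  obtain c d where cd: "gr 1 u = scal c * genx + scal d * geny" using gr_1_eq by blast
  have "c * X 0 + d * Y 0 = 0" for X Y :: "nat => complex"
    using ev_comp_zero[OF assms, of X Y 1] unfolding cd by (simp add: ev_add ev_scal ev_genx ev_geny)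
  from this[of "\<lambda>_. 1" "\<lambda>_. 0"] this[of "\<lambda>_. 0" "\<lambda>_. 1"] have "c = 0" "d = 0" by simp_all
  then show "gr 1 u = 0" unfolding cd by simp
qed

text \<open>The top homogeneous part of a derivation is a derivation, and it computes the top
  component of the values.\<close>

lemma derivation_top:
  assumes E: "derivation E" and dx: "degle (Suc N) (E genx)" and dy: "degle (Suc N) (E geny)"
  defines "D \<equiv> Der (gr (Suc N) (E genx)) (gr (Suc N) (E geny))"
  assumes u: "degle r u"
  shows "degle (r + N) (E u) \<and> gr (r + N) (E u) = D (gr r u)"
proof -
  have D: "derivation D" unfolding D_def by (rule derivation_Der)
  have wds: "degle (length l + N) (E (wd l)) \<and> gr (length l + N) (E (wd l)) = D (wd l)" for l
  proof (induction l)
    case Nil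
    then show ?case by (simp add: wd_Nil derivation_1[OF E] derivation_1[OF D])
  next
    case (Cons a l)
    have step: "degle (Suc (length l) + N) (E p * wd l + p * E (wd l)) \<and>
       gr (Suc (length l) + N) (E p * wd l + p * E (wd l)) = gr (Suc N) (E p) * wd l + p * D (wd l)"
      if "degle (Suc N) (E p)" "degle 1 p" "gr 1 p = p" for p
    proof -
      have 1: "degle (Suc N + length l) (E p * wd l)" "gr (Suc N + length l) (E p * wd l) = gr (Suc N) (E p) * gr (length l) (wd l)"
        using degle_mult[OF that(1) degle_wd[OF le_refl]] gr_mult_top[OF that(1) degle_wd[OF le_refl]] by blast+
      have 2: "degle (1 + (length l + N)) (p * E (wd l))" "gr (1 + (length l + N)) (p * E (wd l)) = gr 1 p * gr (length l + N) (E (wd l))"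
        using degle_mult[OF that(2) conjunct1[OF Cons]] gr_mult_top[OF that(2) conjunct1[OF Cons]] by blast+
      have "Suc N + length l = Suc (length l) + N" "1 + (length l + N) = Suc (length l) + N" by auto
      with 1 2 Cons that show ?thesis by (simp only: gr_add gr_wd if_True HOL.simp_thms) (auto intro: degle_add)
    qed
    show ?case
    proof (cases a)
      case LX
      then show ?thesis using step[OF dx degle_gen(1)] by (simp add: wd_LX derivation_mult[OF E] derivation_mult[OF D] gr_genx) (simp add: D_def)
    next
      case LY
      then show ?thesis using step[OF dy degle_gen(2)] by (simp add: wd_LY derivation_mult[OF E] derivation_mult[OF D] gr_geny) (simp add: D_def)
    qed
  qed
  have homog: "degle (i + N) (E (gr i v)) \<and> gr (i + N) (E (gr i v)) = D (gr i v)" for i v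
  proof (induction v rule: falg_induct)
    case (word c l)
    have "gr i (scal c * wd l) = (if length l = i then scal c * wd l else 0)" by (simp add: gr_scal gr_wd)
    then show ?case using wds[of l] by (auto simp: derivation_scal[OF E] derivation_scal[OF D] gr_scal degle_scal derivation_0[OF E] derivation_0[OF D])
  qed (auto simp: derivation_0[OF E] derivation_0[OF D] gr_add derivation_add[OF E] derivation_add[OF D] intro: degle_add)
  have Esum: "E (sum f I) = (\<Sum>i\<in>I. E (f i))" for f and I :: "nat set"
    by (induction I rule: infinite_finite_induct) (simp_all add: derivation_0[OF E] derivation_add[OF E])
  have Eu: "E u = (\<Sum>i\<le>r. E (gr i u))"
    using gr_decomp[OF u] Esum[of "\<lambda>i. gr i u" "{..r}"] by simp
  have "degle (r + N) (E (gr i u))" if "i \<le> r" for i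
    using homog[of i u] that by (auto elim: degle_mono)
  moreover have "gr (r + N) (E (gr i u)) = (if i = r then D (gr r u) else 0)" if "i \<le> r" for i
    using homog[of i u] that by (auto simp: degle_def)
  ultimately show ?thesis
    unfolding Eu by (auto intro!: degle_sum simp: gr_sum)
qed

text \<open>Diagonal entries depend only on the abelianization.\<close>

lemma ev_subst_ab:
  assumes \<sigma>: "alg_hom \<sigma>" and x: "!!X Y. ev X Y (\<sigma> genx) 0 0 = X 0" and y: "!!X Y. ev X Y (\<sigma> geny) 0 0 = Y 0"
  shows "ev X Y (\<sigma> u) 0 0 = ev X Y u 0 0"
proof (induction u rule: falg_induct)
  case (word c l)
  have "ev X Y (\<sigma> (wd l)) 0 0 = ev X Y (wd l) 0 0"
  proof (induction l)
    case Nil show ?case by (simp add: wd_Nil alg_hom_1[OF \<sigma>])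
  next
    case (Cons a l)
    then show ?case by (cases a) (simp_all add: wd_LX wd_LY alg_hom_mult[OF \<sigma>] ev_mult x y ev_genx ev_geny)
  qed
  then show ?case by (simp only: alg_hom_scal[OF \<sigma>] ev_scal)
qed (simp_all add: alg_hom_0[OF \<sigma>] alg_hom_add[OF \<sigma>] ev_add)

text \<open>Let E be the conjugate of the Euler derivation. It agrees with the Euler derivation
  modulo commutators and multiplies c by 2, so its top part, if of positive degree, kills c and
  is zero in the abelianization. Since E^n x stays in bounded degree, the top part is nilpotent
  on x, hence zero. So E is the Euler derivation and \<sigma> respects the grading.\<close>

theorem trivial_abelianization_imp_id:
  assumes \<sigma>: "alg_hom \<sigma>" and \<tau>: "alg_hom \<tau>" and \<sigma>\<tau>: "!!u. \<sigma> (\<tau> u) = u" and \<tau>\<sigma>: "!!u. \<tau> (\<sigma> u) = u"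
    and c: "\<sigma> comm = comm"
    and x: "!!X Y. ev X Y (\<sigma> genx) 0 0 = X 0" and y: "!!X Y. ev X Y (\<sigma> geny) 0 0 = Y 0"
  shows "\<sigma> u = u"
proof -
  define E where "E u = \<sigma> (euler (\<tau> u))" for u
  have e: "derivation euler" by (simp add: euler_def derivation_Der)
  have E: "derivation E"
    unfolding derivation_def E_def
  proof (intro conjI allI)
    fix u v c
    show "\<sigma> (euler (\<tau> (u + v))) = \<sigma> (euler (\<tau> u)) + \<sigma> (euler (\<tau> v))"
      by (simp only: alg_hom_add[OF \<sigma>] alg_hom_add[OF \<tau>] euler_add)
    show "\<sigma> (euler (\<tau> (u * v))) = \<sigma> (euler (\<tau> u)) * v + u * \<sigma> (euler (\<tau> v))"
      by (simp only: alg_hom_mult[OF \<sigma>] alg_hom_mult[OF \<tau>] alg_hom_add[OF \<sigma>] derivation_mult[OF e] \<sigma>\<tau>)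
    show "\<sigma> (euler (\<tau> (scal c * u))) = scal c * \<sigma> (euler (\<tau> u))"
      by (simp only: alg_hom_scal[OF \<sigma>] alg_hom_scal[OF \<tau>] euler_scal)
  qed
  have ab: "ev X Y (\<sigma> u) 0 0 = ev X Y u 0 0" for X Y u
    by (rule ev_subst_ab[OF \<sigma> x y])
  have ab': "ev X Y (\<tau> u) 0 0 = ev X Y u 0 0" for X Y u
    using ab[of X Y "\<tau> u"] by (simp add: \<sigma>\<tau>)
  have abE: "ev X Y (E u - euler u) 0 0 = 0" for X Y u
  proof -
    let ?d = "\<tau> u - u"
    obtain n where n: "degle n ?d" using degle_exists by blast
    have "ev X Y (euler ?d) 0 0 = (\<Sum>r\<le>n. ev X Y (euler (gr r ?d)) 0 0)"
    proof -
      have "euler (sum f I) = (\<Sum>i\<in>I. euler (f i))" for f and I :: "nat set"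
        by (induction I rule: infinite_finite_induct) (simp_all add: derivation_0[OF e] derivation_add[OF e])
      from this[of "\<lambda>r. gr r ?d" "{..n}"] show ?thesis using gr_decomp[OF n] by (simp add: ev_sum)
    qed
    also have "\<dots> = 0"
    proof (intro sum.neutral ballI)
      fix r
      have "ev X Y (gr r ?d) 0 0 = 0" by (rule ev_comp_zero) (simp add: ev_diff ab')
      then show "ev X Y (euler (gr r ?d)) 0 0 = 0" by (simp add: euler_comp ev_scal)
    qed
    finally show ?thesis by (simp add: E_def ev_diff ab derivation_diff[OF e])
  qed
  have Ec: "E comm = scal 2 * comm"
    using c \<tau>\<sigma>[of comm] by (simp add: E_def euler_comm alg_hom_scal[OF \<sigma>])
  have bounded: "\<exists>M. \<forall>n. degle M (\<sigma> ((euler ^^ n) v))" for v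
  proof (induction v rule: falg_induct)
    case zero
    have "(euler ^^ n) 0 = 0" for n by (induction n) (simp_all add: derivation_0[OF e])
    then show ?case by (simp add: alg_hom_0[OF \<sigma>])
  next
    case (add u v)
    then obtain M M' where "\<forall>n. degle M (\<sigma> ((euler ^^ n) u))" "\<forall>n. degle M' (\<sigma> ((euler ^^ n) v))" by blast
    moreover have "(euler ^^ n) (u + v) = (euler ^^ n) u + (euler ^^ n) v" for n
      by (induction n) (simp_all add: derivation_add[OF e])
    ultimately have "\<forall>n. degle (max M M') (\<sigma> ((euler ^^ n) (u + v)))"
      by (auto simp: alg_hom_add[OF \<sigma>] intro!: degle_add intro: degle_mono[of M] degle_mono[of M'])
    then show ?case ..
  next
    case (word c l)
    obtain M where M: "degle M (\<sigma> (wd l))" using degle_exists by blast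
    have "(euler ^^ n) (scal c * wd l) = scal (c * of_nat (length l) ^ n) * wd l" for n
    proof (induction n)
      case (Suc n)
      then show ?case
        by (simp add: euler_scal euler_wd scal_scal ac_simps)
    qed simp
    then have "\<forall>n. degle M (\<sigma> ((euler ^^ n) (scal c * wd l)))"
      using M by (simp add: alg_hom_scal[OF \<sigma>] degle_scal)
    then show ?case ..
  qed
  have En: "(E ^^ n) u = \<sigma> ((euler ^^ n) (\<tau> u))" for n u
    by (induction n) (simp_all add: \<sigma>\<tau> \<tau>\<sigma> E_def)
  have deg1: "gr r (E genx) = 0 \<and> gr r (E geny) = 0" if "r \<ge> 2" for r
  proof (rule ccontr)
    assume nz: "\<not> (gr r (E genx) = 0 \<and> gr r (E geny) = 0)"
    let ?R = "{r. \<not> (gr r (E genx) = 0 \<and> gr r (E geny) = 0)}"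
    obtain n n' where n: "degle n (E genx)" "degle n' (E geny)" using degle_exists by blast
    have "?R \<subseteq> {..max n n'}"
      using n unfolding degle_def by (auto simp: le_max_iff_disj) (meson not_le)+
    then have fin: "finite ?R" by (rule finite_subset) simp
    define m where "m = Max ?R"
    have "m \<in> ?R" unfolding m_def using fin nz by (intro Max_in) auto
    moreover have "m \<ge> 2" using Max_ge[OF fin, of r] nz that by (simp add: m_def)
    moreover have above: "gr s (E genx) = 0 \<and> gr s (E geny) = 0" if "s > m" for s
      using Max_ge[OF fin, of s] that unfolding m_def by fastforce
    ultimately obtain N where N: "m = Suc N" "N \<ge> 1" by (cases m) auto
    have d: "degle (Suc N) (E genx)" "degle (Suc N) (E geny)" using above N by (auto simp: degle_def)
    let ?D = "Der (gr (Suc N) (E genx)) (gr (Suc N) (E geny))"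
    note top = derivation_top[OF E d]
    have zero: "ev X Y (gr (Suc N) (E p)) 0 0 = 0" if "gr (Suc N) (euler p) = 0" for X Y p
      using ev_comp_zero[OF abE, of X Y "Suc N" p] that by (simp add: gr_diff)
    have eg: "gr (Suc N) (euler genx) = 0" "gr (Suc N) (euler geny) = 0"
      using N by (simp_all add: euler_def gr_genx gr_geny)
    interpret comm_derivation ?D
    proof
      show "derivation ?D" by (rule derivation_Der)
      have c2: "degle 2 comm" "gr 2 comm = comm"
        by (auto simp: comm_def degle_def gr_diff genx_wd geny_wd gr_wd simp flip: wd_append)
      \<comment> \<open>E c = 2 c has degree 2 < 2 + N\<close>
  have "?D comm = gr (2 + N) (E comm)" using top[OF c2(1)] c2(2) by simp
      also have "\<dots> = 0" using c2 N by (simp add: Ec gr_scal degle_def)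
      finally show "?D comm = 0" .
      show "ev X Y (?D genx) 0 0 = 0" "ev X Y (?D geny) 0 0 = 0" for X Y
        using zero eg by simp_all
    qed
    obtain M where M: "!!n. degle M (\<sigma> ((euler ^^ n) (\<tau> genx)))" using bounded by blast
    have pw: "degle (1 + n * N) ((E ^^ n) genx) \<and> gr (1 + n * N) ((E ^^ n) genx) = (?D ^^ n) genx" for n
    proof (induction n)
      case 0 show ?case using degle_gen(1) by (simp add: gr_genx)
    next
      case (Suc n)
      then show ?case using top[of "1 + n * N" "(E ^^ n) genx"] by (simp add: ac_simps)
    qed
    have "(?D ^^ M) genx = gr (1 + M * N) ((E ^^ M) genx)" using pw[of M] by simp
    also have "\<dots> = 0"
    proof -
      have "M < 1 + M * N" using N by (simp add: less_Suc_eq_le)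
      then show ?thesis using M[of M] unfolding En degle_def by blast
    qed
    finally have "?D genx = 0" "?D geny = 0" by (rule nilpotent_imp_zero)+
    then show False using \<open>m \<in> ?R\<close> N by simp
  qed
  have Egen: "E p = p" if p: "euler p = p" and d: "!!r. r \<ge> 2 ==> gr r (E p) = 0" for p
  proof -
    have "gr 0 p = 0" using gr_euler[of 0 p] p by simp
    have dp: "gr r p = 0" if "r \<noteq> 1" for r
    proof -
      have "scal (of_nat r - 1) * gr r p = 0" using gr_euler[of r p] p by (simp add: scal_diff left_diff_distrib)
      then have "scal (inverse (of_nat r - 1)) * (scal (of_nat r - 1) * gr r p) = 0" by simp
      moreover have "of_nat r - 1 \<noteq> (0 :: complex)" using that by (metis eq_iff_diff_eq_0 of_nat_1 of_nat_eq_iff)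
      ultimately show ?thesis by (simp flip: mult.assoc scal_mult)
    qed
    have "gr r (E p - p) = 0" for r
    proof -
      have z: "!!X Y. ev X Y (E p - p) 0 0 = 0" using abE[of _ _ p] p by simp
      consider "r = 0" | "r = 1" | "r \<ge> 2" by linarith
      then show ?thesis using gr_01_zero[OF z] d dp by cases (auto simp: gr_diff)
    qed
    moreover obtain n where "degle n (E p - p)" using degle_exists by blast
    ultimately have "E p - p = 0" using gr_decomp by (metis sum.neutral)
    then show ?thesis by simp
  qed
  have "E genx = genx" "E geny = geny"
    using deg1 by (auto intro!: Egen simp: euler_def)
  then have "E u = euler u" for u
    using derivation_eq_Der[OF E, of u] by (simp add: euler_def)
  then have comm_e: "euler (\<sigma> u) = \<sigma> (euler u)" for u
    using \<tau>\<sigma> E_def by metis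
  have fixes_gen: "\<sigma> p = p" if p: "euler p = p" "!!X Y. ev X Y (\<sigma> p - p) 0 0 = 0" for p
  proof -
    have h: "euler (\<sigma> p - p) = \<sigma> p - p" using comm_e[of p] p by (simp add: derivation_diff[OF e])
    have "gr r (\<sigma> p - p) = 0" for r
    proof (cases "r = 1")
      case True
      then show ?thesis using gr_01_zero[OF p(2)] by simp
    next
      case False
      have "scal (of_nat r - 1) * gr r (\<sigma> p - p) = 0"
        using gr_euler[of r "\<sigma> p - p"] h by (simp add: scal_diff left_diff_distrib)
      then have "scal (inverse (of_nat r - 1)) * (scal (of_nat r - 1) * gr r (\<sigma> p - p)) = 0" by simp
      moreover have "of_nat r - 1 \<noteq> (0 :: complex)" using False by (metis eq_iff_diff_eq_0 of_nat_1 of_nat_eq_iff)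
      ultimately show ?thesis by (simp flip: mult.assoc scal_mult)
    qed
    moreover obtain n where "degle n (\<sigma> p - p)" using degle_exists by blast
    ultimately have "\<sigma> p - p = 0" using gr_decomp by (metis sum.neutral)
    then show ?thesis by simp
  qed
  have "\<sigma> genx = genx" "\<sigma> geny = geny"
    by (rule fixes_gen; simp add: euler_def ev_diff x y ev_genx ev_geny)+
  moreover have "alg_hom (\<lambda>u. u)" by (simp add: alg_hom_def)
  ultimately have "\<sigma> = (\<lambda>u. u)" by (intro alg_hom_eqI[OF \<sigma>]) auto
  then show ?thesis by simp
qed

section \<open>Polynomials in two commuting variables\<close>

type_synonym cpp = "complex poly poly"

text \<open>Evaluation of bivariate polynomials in a ring that receives the constants through
  \<kappa>. The values will be complex numbers, bivariate polynomials (composition) or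
  polynomials over these (homogenization).\<close>

locale const_hom =
  fixes \<kappa> :: "complex => 'r::comm_ring_1"
  assumes \<kappa>_add: "\<kappa> (a + b) = \<kappa> a + \<kappa> b" and \<kappa>_mult: "\<kappa> (a * b) = \<kappa> a * \<kappa> b" and \<kappa>_1: "\<kappa> 1 = 1"
begin

lemma \<kappa>_0: "\<kappa> 0 = 0"
  using \<kappa>_add[of 0 0] by simp

definition ev1 :: "'r => complex poly => 'r" where
  "ev1 x p = poly (map_poly \<kappa> p) x"

definition ev2 :: "'r => 'r => cpp => 'r" where
  "ev2 x y F = poly (map_poly (ev1 x) F) y"

lemma ev1_add: "ev1 x (p + q) = ev1 x p + ev1 x q"
proof -
  have "map_poly \<kappa> (p + q) = map_poly \<kappa> p + map_poly \<kappa> q"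
    by (rule poly_eqI) (simp add: coeff_map_poly \<kappa>_0 \<kappa>_add)
  then show ?thesis by (simp add: ev1_def)
qed

lemma \<kappa>_sum: "\<kappa> (sum f I) = (\<Sum>i\<in>I. \<kappa> (f i))"
  by (induction I rule: infinite_finite_induct) (simp_all add: \<kappa>_0 \<kappa>_add)

lemma ev1_0: "ev1 x 0 = 0"
  by (simp add: ev1_def)

lemma ev1_sum: "ev1 x (sum f I) = (\<Sum>i\<in>I. ev1 x (f i))"
  by (induction I rule: infinite_finite_induct) (simp_all add: ev1_0 ev1_add)

lemma ev1_mult: "ev1 x (p * q) = ev1 x p * ev1 x q"
proof -
  have "map_poly \<kappa> (p * q) = map_poly \<kappa> p * map_poly \<kappa> q"
    by (rule poly_eqI) (simp add: coeff_map_poly \<kappa>_0 coeff_mult \<kappa>_sum \<kappa>_mult)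
  then show ?thesis by (simp add: ev1_def)
qed

lemma ev2_add: "ev2 x y (F + G) = ev2 x y F + ev2 x y G"
proof -
  have "map_poly (ev1 x) (F + G) = map_poly (ev1 x) F + map_poly (ev1 x) G"
    by (rule poly_eqI) (simp add: coeff_map_poly ev1_0 ev1_add)
  then show ?thesis by (simp add: ev2_def)
qed

lemma ev2_mult: "ev2 x y (F * G) = ev2 x y F * ev2 x y G"
proof -
  have "map_poly (ev1 x) (F * G) = map_poly (ev1 x) F * map_poly (ev1 x) G"
    by (rule poly_eqI) (simp add: coeff_map_poly ev1_0 coeff_mult ev1_sum ev1_mult)
  then show ?thesis by (simp add: ev2_def)
qed

lemma ev2_0: "ev2 x y 0 = 0"
  by (simp add: ev2_def)

lemma ev2_sum: "ev2 x y (sum f I) = (\<Sum>i\<in>I. ev2 x y (f i))"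
  by (induction I rule: infinite_finite_induct) (simp_all add: ev2_0 ev2_add)

lemma ev1_monom: "ev1 x (Polynomial.monom c i) = \<kappa> c * x ^ i"
  by (simp add: ev1_def map_poly_monom \<kappa>_0 poly_monom)

end

text \<open>Bivariate polynomials are polynomials in Y whose coefficients are polynomials in
  X.\<close>

definition mon :: "complex => nat => nat => cpp" where
  "mon c i j = Polynomial.monom (Polynomial.monom c i) j"

abbreviation vX :: cpp where "vX \<equiv> mon 1 1 0"
abbreviation vY :: cpp where "vY \<equiv> mon 1 0 1"
abbreviation cst :: "complex => cpp" where "cst c \<equiv> mon c 0 0"

definition cf :: "cpp => nat => nat => complex" where
  "cf F i j = poly.coeff (poly.coeff F j) i"

lemma cf_add: "cf (F + G) i j = cf F i j + cf G i j"
  and cf_mon: "cf (mon c a b) i j = (if i = a \<and> j = b then c else 0)"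
  by (auto simp: cf_def mon_def)

lemma cpp_eqI: "(!!i j. cf F i j = cf G i j) ==> F = G"
  by (simp add: cf_def poly_eq_iff)

lemma mon_mult: "mon c i j * mon d k l = mon (c * d) (i + k) (j + l)"
  by (simp add: mon_def mult_monom)

lemma mon_power: "mon c i j ^ n = mon (c ^ n) (n * i) (n * j)"
  by (simp add: mon_def monom_power mult.commute)

lemma finite_cf: "finite {(i, j). cf F i j \<noteq> 0}"
proof -
  have "{(i, j). cf F i j \<noteq> 0} \<subseteq> (SIGMA i:(\<Union>j\<le>degree F. {..degree (poly.coeff F j)}). {..degree F})"
    by (auto simp: cf_def) (metis atMost_iff coeff_0 le_degree)+
  then show ?thesis by (rule finite_subset) auto
qed

lemma cf_sum: "cf (sum f I) i j = (\<Sum>t\<in>I. cf (f t) i j)"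
  by (simp add: cf_def coeff_sum)

lemma cpp_expand: "F = (\<Sum>(i, j) | cf F i j \<noteq> 0. mon (cf F i j) i j)"
proof (rule cpp_eqI)
  fix i j
  have "cf (\<Sum>(i, j) | cf F i j \<noteq> 0. mon (cf F i j) i j) i j = (\<Sum>t | (case t of (i, j) => cf F i j \<noteq> 0). if t = (i, j) then cf F i j else 0)"
    unfolding cf_sum by (rule sum.cong) (auto simp: cf_mon split: if_splits)
  also have "\<dots> = cf F i j"
    using finite_cf[of F] by (simp add: sum.delta)
  finally show "cf F i j = cf (\<Sum>(i, j) | cf F i j \<noteq> 0. mon (cf F i j) i j) i j" ..
qed

lemma cpp_induct [case_names zero add mon]:
  assumes "P 0" "!!F G. P F ==> P G ==> P (F + G)" "!!c i j. P (mon c i j)"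
  shows "P F"
proof -
  have "P (\<Sum>(i, j)\<in>S. mon (cf F i j) i j)" for S
    by (induction S rule: infinite_finite_induct) (auto intro: assms)
  then have "P (\<Sum>(i, j) | cf F i j \<noteq> 0. mon (cf F i j) i j)" .
  then show ?thesis by (simp only: cpp_expand[symmetric])
qed

context const_hom
begin

lemma ev2_mon: "ev2 x y (mon c i j) = \<kappa> c * x ^ i * y ^ j"
  by (simp add: ev2_def mon_def map_poly_monom ev1_0 poly_monom ev1_monom)

lemma ev2_power: "ev2 x y (F ^ n) = ev2 x y F ^ n"
proof (induction n)
  case 0
  have "ev2 x y (mon 1 0 0) = 1" by (simp add: ev2_mon \<kappa>_1)
  then show ?case by (simp add: mon_def monom_0 flip: one_pCons)
qed (simp add: ev2_mult)

end

definition dX :: "cpp => cpp" where "dX = map_poly pderiv"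
definition dY :: "cpp => cpp" where "dY = pderiv"

lemma dX_add: "dX (F + G) = dX F + dX G"
  by (rule poly_eqI) (simp add: dX_def coeff_map_poly pderiv_add)

lemma dY_add: "dY (F + G) = dY F + dY G"
  by (simp add: dY_def pderiv_add)

lemma dX_0: "dX 0 = 0" and dY_0: "dY 0 = 0"
  by (simp_all add: dX_def dY_def)

lemma dX_mon: "dX (mon c i j) = mon (of_nat i * c) (i - 1) j"
  by (simp add: dX_def mon_def map_poly_monom pderiv_monom)

lemma dY_mon: "dY (mon c i j) = mon (of_nat j * c) i (j - 1)"
  by (simp add: dY_def mon_def pderiv_monom of_nat_poly mult_monom flip: monom_0)

lemma pderiv_sum': "pderiv (sum f I) = (\<Sum>i\<in>I. pderiv (f i))"
  by (induction I rule: infinite_finite_induct) (simp_all add: pderiv_add)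

lemma dX_mult: "dX (F * G) = dX F * G + F * dX G"
proof (rule poly_eqI)
  fix n
  have "poly.coeff (dX (F * G)) n = (\<Sum>i\<le>n. pderiv (poly.coeff F i * poly.coeff G (n - i)))"
    by (simp add: dX_def coeff_map_poly coeff_mult pderiv_sum')
  also have "\<dots> = (\<Sum>i\<le>n. pderiv (poly.coeff F i) * poly.coeff G (n - i)) + (\<Sum>i\<le>n. poly.coeff F i * pderiv (poly.coeff G (n - i)))"
    unfolding sum.distrib[symmetric] by (rule sum.cong) (simp_all add: pderiv_mult)
  finally show "poly.coeff (dX (F * G)) n = poly.coeff (dX F * G + F * dX G) n"
    by (simp add: dX_def coeff_map_poly coeff_mult)
qed

lemma dY_mult: "dY (F * G) = dY F * G + F * dY G"
  by (simp add: dY_def pderiv_mult algebra_simps)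

lemma deriv_power:
  fixes d :: "cpp => cpp"
  assumes "!!F G. d (F * G) = d F * G + F * d G" "d 1 = 0"
  shows "d (F ^ n) = of_nat n * F ^ (n - 1) * d F"
proof (induction n)
  case (Suc n)
  then show ?case using assms(1)[of F "F ^ n"] by (cases n) (simp_all add: algebra_simps)
qed (simp add: assms)

lemma dX_1: "dX 1 = 0" and dY_1: "dY 1 = 0"
  using dX_mon[of 1 0 0] dY_mon[of 1 0 0] by (simp_all add: mon_def monom_0 flip: one_pCons)

lemmas dX_power = deriv_power[of dX, OF dX_mult dX_1]
lemmas dY_power = deriv_power[of dY, OF dY_mult dY_1]

definition jac :: "cpp => cpp => cpp" where
  "jac F G = dX F * dY G - dY F * dX G"

lemma jac_add: "jac F (G + K) = jac F G + jac F K"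
  by (simp add: jac_def dX_add dY_add algebra_simps)

lemma jac_mult: "jac F (G * K) = jac F G * K + G * jac F K"
  by (simp add: jac_def dX_mult dY_mult algebra_simps)

definition \<kappa>2 :: "complex => cpp" where "\<kappa>2 c = mon c 0 0"
definition \<kappa>3 :: "complex => cpp poly" where "\<kappa>3 c = [:mon c 0 0:]"

lemma cst_simps: "mon 0 i j = 0" "mon 1 0 0 = 1" "mon c i j + mon d i j = mon (c + d) i j"
  by (simp_all add: mon_def monom_0 add_monom flip: one_pCons)

interpretation k2: const_hom \<kappa>2
  by unfold_locales (simp_all add: \<kappa>2_def cst_simps mon_mult)

interpretation k3: const_hom \<kappa>3
  by unfold_locales (simp_all add: \<kappa>3_def cst_simps mon_mult mult.commute flip: one_pCons)

text \<open>The substitution X \<mapsto> T X, Y \<mapsto> T Y: the coefficient of T^k is the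
  homogeneous component of degree k. Degrees and leading forms thus become those of univariate
  polynomials over a domain.\<close>

definition homog :: "cpp => cpp poly" where
  "homog = k3.ev2 (Polynomial.monom vX 1) (Polynomial.monom vY 1)"

lemma homog_add: "homog (F + G) = homog F + homog G" and homog_mult: "homog (F * G) = homog F * homog G"
  and homog_0: "homog 0 = 0" and homog_power: "homog (F ^ n) = homog F ^ n"
  by (simp_all add: homog_def k3.ev2_add k3.ev2_mult k3.ev2_0 k3.ev2_power)

lemma homog_mon: "homog (mon c i j) = Polynomial.monom (mon c i j) (i + j)"
  by (simp add: homog_def k3.ev2_mon \<kappa>3_def monom_power mult_monom mon_power mon_mult flip: monom_0)

lemma homog_uminus: "homog (- F) = - homog F"
  using homog_add[of F "- F"] by (simp add: homog_0 eq_neg_iff_add_eq_0 add.commute)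

lemma homog_diff: "homog (F - G) = homog F - homog G"
  using homog_add[of F "- G"] by (simp add: homog_uminus)

lemma homog_at_1: "poly (homog F) 1 = F"
  by (induction F rule: cpp_induct) (simp_all add: homog_0 homog_add homog_mon poly_monom)

lemma homog_eq_0: "homog F = 0 \<longleftrightarrow> F = 0"
  using homog_at_1[of F] by (auto simp: homog_0)

definition tdeg :: "cpp => nat" where "tdeg F = degree (homog F)"
definition lead_form :: "cpp => cpp" where "lead_form F = lead_coeff (homog F)"

lemma lead_form_eq_0: "lead_form F = 0 \<longleftrightarrow> F = 0"
  by (simp add: lead_form_def homog_eq_0)

lemma homog_dX: "poly.coeff (homog (dX F)) k = dX (poly.coeff (homog F) (Suc k))"
proof (induction F rule: cpp_induct)
  case (mon c i j)
  then show ?case by (cases i) (auto simp: homog_mon dX_mon dX_0 cst_simps homog_0)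
qed (simp_all add: dX_0 homog_0 dX_add homog_add)

lemma homog_dY: "poly.coeff (homog (dY F)) k = dY (poly.coeff (homog F) (Suc k))"
proof (induction F rule: cpp_induct)
  case (mon c i j)
  then show ?case by (cases j) (auto simp: homog_mon dY_mon dY_0 cst_simps homog_0)
qed (simp_all add: dY_0 homog_0 dY_add homog_add)

lemma euler_hom: "vX * dX (poly.coeff (homog F) k) + vY * dY (poly.coeff (homog F) k) = cst (of_nat k) * poly.coeff (homog F) k"
proof (induction F rule: cpp_induct)
  case (mon c i j)
  have "vX * dX (mon c i j) + vY * dY (mon c i j) = cst (of_nat (i + j)) * mon c i j"
    by (cases i; cases j) (simp_all add: dX_mon dY_mon mon_mult cst_simps algebra_simps)
  then show ?case by (auto simp: homog_mon dX_0 dY_0)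
next
  case (add F G)
  have "vX * dX (poly.coeff (homog (F + G)) k) + vY * dY (poly.coeff (homog (F + G)) k)
      = (vX * dX (poly.coeff (homog F) k) + vY * dY (poly.coeff (homog F) k)) + (vX * dX (poly.coeff (homog G) k) + vY * dY (poly.coeff (homog G) k))"
    by (simp add: homog_add dX_add dY_add distrib_left)
  also have "\<dots> = cst (of_nat k) * poly.coeff (homog (F + G)) k"
    unfolding add by (simp add: homog_add distrib_left)
  finally show ?case .
qed (simp_all add: homog_0 dX_0 dY_0)

lemma coeff_mult_sum:
  fixes p q :: "'a::comm_semiring_0 poly"
  assumes "degree p \<le> a" "degree q \<le> b"
  shows "poly.coeff (p * q) (a + b) = poly.coeff p a * poly.coeff q b"
proof -
  have "poly.coeff (p * q) (a + b) = (\<Sum>i\<le>a + b. if i = a then poly.coeff p a * poly.coeff q b else 0)"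
    unfolding coeff_mult
  proof (rule sum.cong[OF HOL.refl])
    fix i assume "i \<in> {..a + b}"
    then consider "i < a" "a + b - i > b" | "i = a" | "i > a" by fastforce
    then show "poly.coeff p i * poly.coeff q (a + b - i) = (if i = a then poly.coeff p a * poly.coeff q b else 0)"
      using assms by cases (auto simp: coeff_eq_0)
  qed
  then show ?thesis by simp
qed

text \<open>Differentiation lowers the degree by one, so the Jacobian of the leading forms is
  the component of the Jacobian in the highest possible degree.\<close>

lemma homog_jac:
  assumes "tdeg F = Suc m" "tdeg G = Suc n"
  shows "degree (homog (jac F G)) \<le> m + n" "poly.coeff (homog (jac F G)) (m + n) = jac (lead_form F) (lead_form G)"
proof -
  have dF: "degree (homog (dX F)) \<le> m" "degree (homog (dY F)) \<le> m" "degree (homog (dX G)) \<le> n" "degree (homog (dY G)) \<le> n"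
    using assms by (auto intro!: degree_le simp: homog_dX homog_dY tdeg_def coeff_eq_0 dX_0 dY_0)
  have eq: "homog (jac F G) = homog (dX F) * homog (dY G) - homog (dY F) * homog (dX G)"
    by (simp add: jac_def homog_diff homog_mult)
  show "degree (homog (jac F G)) \<le> m + n"
    unfolding eq using dF by (intro degree_diff_le degree_mult_le[THEN order.trans]) auto
  show "poly.coeff (homog (jac F G)) (m + n) = jac (lead_form F) (lead_form G)"
    unfolding eq by (simp add: coeff_mult_sum[OF dF(1) dF(4)] coeff_mult_sum[OF dF(2) dF(3)] homog_dX homog_dY jac_def lead_form_def assms flip: tdeg_def)
qed

lemma tdeg_0_iff: "tdeg F = 0 \<longleftrightarrow> (\<exists>c. F = cst c)"
proof
  assume "tdeg F = 0"
  then have z: "poly.coeff (homog F) k = 0" if "k > 0" for k using that by (simp add: tdeg_def coeff_eq_0)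
  have "cf (poly.coeff (homog F) (i + j)) i j = cf F i j" for i j
    by (induction F rule: cpp_induct) (auto simp: homog_0 cf_mon homog_mon homog_add cf_add, simp add: cf_def)
  then have "cf F i j = 0" if "i + j > 0" for i j
    using z[OF that] by (metis cf_def coeff_0)
  then have "F = cst (cf F 0 0)" by (intro cpp_eqI) (auto simp: cf_mon)
  then show "\<exists>c. F = cst c" ..
next
  assume "\<exists>c. F = cst c"
  then show "tdeg F = 0" by (auto simp: tdeg_def homog_mon monom_0)
qed

lemma jac_cst: "jac (cst c) G = 0" "jac F (cst c) = 0"
  by (simp_all add: jac_def dX_mon dY_mon cst_simps)

lemma tdeg_jac:
  assumes "jac F G \<noteq> 0"
  shows "tdeg (jac F G) + 2 \<le> tdeg F + tdeg G"
proof -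
  have "tdeg F \<noteq> 0" "tdeg G \<noteq> 0" using assms jac_cst by (auto simp: tdeg_0_iff)
  then obtain m n where "tdeg F = Suc m" "tdeg G = Suc n" by (meson not0_implies_Suc)
  then show ?thesis using homog_jac(1)[of F m G n] by (simp add: tdeg_def)
qed

text \<open>In characteristic zero the vanishing of the Wronskian means proportionality.\<close>

lemma wronskian_zero:
  fixes p q :: "'a::{idom,ring_char_0} poly"
  assumes eq: "q * pderiv p = p * pderiv q" and nz: "p \<noteq> 0" "q \<noteq> 0"
  shows "Polynomial.smult (lead_coeff q) p = Polynomial.smult (lead_coeff p) q"
proof -
  have deg: "degree p = degree q" if eq: "q * pderiv p = p * pderiv q" and nz: "p \<noteq> 0" "q \<noteq> 0" for p q :: "'a poly"
  proof (cases "degree p = 0 \<or> degree q = 0")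
    case True
    then show ?thesis
    proof
      assume "degree p = 0"
      then have "pderiv q = 0" using eq nz by (simp add: pderiv_eq_0_iff[symmetric])
      then show ?thesis using \<open>degree p = 0\<close> by (simp add: pderiv_eq_0_iff)
    next
      assume "degree q = 0"
      then have "pderiv p = 0" using eq nz by (simp add: pderiv_eq_0_iff[symmetric])
      then show ?thesis using \<open>degree q = 0\<close> by (simp add: pderiv_eq_0_iff)
    qed
  next
    case False
    then obtain a b where ab: "degree p = Suc a" "degree q = Suc b" by (meson not0_implies_Suc)
    have d: "degree (pderiv p) \<le> a" "degree (pderiv q) \<le> b" using ab by (simp_all add: degree_pderiv)
    have "poly.coeff (q * pderiv p) (Suc b + a) = lead_coeff q * (of_nat (Suc a) * lead_coeff p)"
      using coeff_mult_sum[of q "Suc b" "pderiv p" a] ab d by (simp add: coeff_pderiv)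
    moreover have "poly.coeff (p * pderiv q) (Suc a + b) = lead_coeff p * (of_nat (Suc b) * lead_coeff q)"
      using coeff_mult_sum[of p "Suc a" "pderiv q" b] ab d by (simp add: coeff_pderiv)
    ultimately have "lead_coeff q * (of_nat (Suc a) * lead_coeff p) = lead_coeff p * (of_nat (Suc b) * lead_coeff q)"
      using eq by (simp add: add.commute)
    then have "(lead_coeff p * lead_coeff q) * of_nat (Suc a) = (lead_coeff p * lead_coeff q) * of_nat (Suc b)"
      by (simp only: ac_simps)
    then have "of_nat (Suc a) = (of_nat (Suc b) :: 'a)" using nz by (subst (asm) mult_cancel_left) simp
    then show ?thesis using ab by (simp only: of_nat_eq_iff)
  qed
  have dpq: "degree p = degree q" using deg[OF eq nz] .
  define r where "r = Polynomial.smult (lead_coeff q) p - Polynomial.smult (lead_coeff p) q"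
  have "q * pderiv r = r * pderiv q"
    using eq by (simp add: r_def pderiv_diff pderiv_smult algebra_simps)
  have "r = 0"
  proof (rule ccontr)
    assume r: "r \<noteq> 0"
    then have "degree r = degree q" using deg[OF \<open>q * pderiv r = r * pderiv q\<close>] nz by blast
    moreover have "poly.coeff r (degree q) = 0" using dpq by (simp add: r_def mult.commute)
    ultimately show False using r by (metis leading_coeff_0_iff)
  qed
  then show ?thesis by (simp add: r_def)
qed

text \<open>The quotient p / q has zero derivatives in both variables.\<close>

lemma proportional:
  assumes X: "q * dX p = p * dX q" and Y: "q * dY p = p * dY q" and nz: "p \<noteq> 0" "q \<noteq> 0"
  shows "\<exists>c. c \<noteq> 0 \<and> p = cst c * q"
proof -
  let ?l = "lead_coeff p" and ?k = "lead_coeff q"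
  have 1: "Polynomial.smult ?k p = Polynomial.smult ?l q"
    using wronskian_zero[OF Y[unfolded dY_def] nz] .
  have dpq: "degree p = degree q"
    using arg_cong[OF 1, of degree] nz by simp
  have d: "degree (dX p) \<le> degree p" "degree (dX q) \<le> degree q"
    unfolding dX_def by (auto intro!: degree_le simp: coeff_map_poly coeff_eq_0)
  have "poly.coeff (q * dX p) (degree q + degree p) = ?k * pderiv ?l"
    using coeff_mult_sum[OF le_refl d(1), of q] by (simp add: dX_def coeff_map_poly)
  moreover have "poly.coeff (p * dX q) (degree p + degree q) = ?l * pderiv ?k"
    using coeff_mult_sum[OF le_refl d(2), of p] by (simp add: dX_def coeff_map_poly)
  ultimately have "?k * pderiv ?l = ?l * pderiv ?k" using X by (simp add: add.commute)
  then have 2: "Polynomial.smult (lead_coeff ?k) ?l = Polynomial.smult (lead_coeff ?l) ?k"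
    by (rule wronskian_zero) (use nz in auto)
  let ?a = "lead_coeff ?k" and ?b = "lead_coeff ?l"
  have ab: "?a \<noteq> 0" "?b \<noteq> 0" using nz by simp_all
  have l: "?l = Polynomial.smult (?b / ?a) ?k"
    using arg_cong[OF 2, of "Polynomial.smult (inverse ?a)"] ab by (simp add: divide_inverse mult.commute)
  have "Polynomial.smult ?k p = Polynomial.smult ?k (cst (?b / ?a) * q)"
    using 1 l by (simp add: mon_def monom_0)
  then have "p = cst (?b / ?a) * q"
    using nz by (metis leading_coeff_0_iff smult_cancel)
  then show ?thesis using ab by (intro exI[of _ "?b / ?a"]) auto
qed

section \<open>Degree reduction for pairs with constant Jacobian\<close>

lemma pderiv_iterate_at_root:
  fixes p :: "'a::{idom,ring_char_0} poly"
  shows "poly ((pderiv ^^ q) ([:- a, 1:] ^ q * p)) a = fact q * poly p a"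
proof (induction q arbitrary: p)
  case (Suc q)
  have "pderiv ([:- a, 1:] ^ Suc q * p) = [:- a, 1:] ^ q * (of_nat (Suc q) * p + [:- a, 1:] * pderiv p)"
  proof -
    define L where "L = [:- a, 1:]"
    have "pderiv L = 1" by (simp add: L_def pderiv_pCons)
    then have "pderiv (L ^ Suc q) = Polynomial.smult (of_nat (Suc q)) (L ^ q)"
      unfolding pderiv_power_Suc by simp
    then show ?thesis
      unfolding L_def[symmetric] pderiv_mult of_nat_poly by (simp add: algebra_simps)
  qed
  then have "poly ((pderiv ^^ Suc q) ([:- a, 1:] ^ Suc q * p)) a
      = poly ((pderiv ^^ q) ([:- a, 1:] ^ q * (of_nat (Suc q) * p + [:- a, 1:] * pderiv p))) a"
    by (simp add: funpow_swap1 del: power_Suc)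
  also have "\<dots> = fact q * poly (of_nat (Suc q) * p + [:- a, 1:] * pderiv p) a"
    by (rule Suc.IH)
  also have "\<dots> = fact (Suc q) * poly p a"
    by (simp add: of_nat_poly algebra_simps)
  finally show ?case .
qed simp

lemma pcompose_monom': "pcompose (Polynomial.monom c n) q = Polynomial.smult c (q ^ n)"
  by (induction n) (simp_all add: monom_0 monom_Suc pcompose_pCons)

lemma pcompose_power': "pcompose (p ^ n) q = pcompose p q ^ n" for p q :: "'a::comm_ring_1 poly"
  by (induction n) (simp_all add: pcompose_mult pcompose_1)

text \<open>Such a polynomial is V^j p_2(V^r); its multiplicity at a \<noteq> 0 is that of p_2
  at a^r, because V^r - a^r has only simple roots.\<close>

lemma multiplicity_mod_class:
  fixes p :: "'a::{idom,ring_char_0} poly"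
  assumes nz: "p \<noteq> 0" and r: "r > 0" and cls: "!!j. poly.coeff p j \<noteq> 0 ==> j mod r = j1" and a: "a \<noteq> 0"
  obtains q where "r * q \<le> degree p" "poly ((pderiv ^^ q) p) a \<noteq> 0"
proof -
  define p2 where "p2 = Abs_poly (\<lambda>n. poly.coeff p (j1 + r * n))"
  have "\<forall>\<^sub>\<infinity>n. poly.coeff p (j1 + r * n) = 0"
  proof -
    have "poly.coeff p (j1 + r * n) = 0" if "n > degree p" for n
    proof (rule coeff_eq_0)
      have "n \<le> r * n" using r by simp
      then show "degree p < j1 + r * n" using that by linarith
    qed
    then show ?thesis unfolding MOST_nat by blast
  qed
  then have c2: "poly.coeff p2 n = poly.coeff p (j1 + r * n)" for n
    unfolding p2_def by (simp add: Abs_poly_inverse)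
  obtain j0 where "poly.coeff p j0 \<noteq> 0" using nz by (metis leading_coeff_0_iff)
  then have j1: "j1 < r" using cls r by (metis mod_less_divisor)
  have decomp: "p = Polynomial.monom 1 j1 * pcompose p2 (Polynomial.monom 1 r)"
  proof -
    have pc: "pcompose p2 (Polynomial.monom 1 r) = (\<Sum>n\<le>degree p2. Polynomial.monom (poly.coeff p2 n) (r * n))"
    proof -
      have "pcompose p2 (Polynomial.monom 1 r) = pcompose (\<Sum>n\<le>degree p2. Polynomial.monom (poly.coeff p2 n) n) (Polynomial.monom 1 r)"
        by (simp only: poly_as_sum_of_monoms)
      then show ?thesis by (simp add: pcompose_sum pcompose_monom' monom_power smult_monom mult.commute)
    qed
    have "poly.coeff (pcompose p2 (Polynomial.monom 1 r)) m = (if r dvd m then poly.coeff p2 (m div r) else 0)" for m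
    proof -
      have "poly.coeff (pcompose p2 (Polynomial.monom 1 r)) m = (\<Sum>n\<le>degree p2. if n = m div r \<and> r dvd m then poly.coeff p2 n else 0)"
        unfolding pc coeff_sum using r by (intro sum.cong) auto
      also have "\<dots> = (if r dvd m then poly.coeff p2 (m div r) else 0)"
        by (auto simp: coeff_eq_0)
      finally show ?thesis .
    qed
    then have cc: "poly.coeff (Polynomial.monom 1 j1 * pcompose p2 (Polynomial.monom 1 r)) m =
       (if m < j1 then 0 else if r dvd (m - j1) then poly.coeff p (j1 + r * ((m - j1) div r)) else 0)" for m
      by (simp add: coeff_monom_mult c2)
    show ?thesis
    proof (rule poly_eqI)
      fix m
      show "poly.coeff p m = poly.coeff (Polynomial.monom 1 j1 * pcompose p2 (Polynomial.monom 1 r)) m"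
      proof (cases "m mod r = j1")
        case True
        then have "m \<ge> j1" "r dvd (m - j1)" using mod_less_eq_dividend[of m r] by (auto simp: mod_eq_dvd_iff_nat minus_mod_eq_mult_div)
        then show ?thesis unfolding cc by simp
      next
        case False
        then have "poly.coeff p m = 0" using cls by blast
        moreover have "\<not> (j1 \<le> m \<and> r dvd (m - j1))"
          using False j1 by (metis le_add_diff_inverse mod_less mod_mult_self2 dvdE)
        ultimately show ?thesis unfolding cc by auto
      qed
    qed
  qed
  have p2: "p2 \<noteq> 0" using decomp nz by auto
  define q where "q = order (a ^ r) p2"
  obtain p3 where p3: "p2 = [:- (a ^ r), 1:] ^ q * p3" "poly p3 (a ^ r) \<noteq> 0"
    using order_decomp[OF p2, of "a ^ r"] unfolding q_def by (metis poly_eq_0_iff_dvd)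
  have "[:- a, 1:] dvd (Polynomial.monom 1 r - [:a ^ r:])"
    by (simp add: poly_eq_0_iff_dvd[symmetric] poly_monom)
  then obtain s where s: "Polynomial.monom 1 r - [:a ^ r:] = [:- a, 1:] * s" by (elim dvdE)
  have "poly (pderiv (Polynomial.monom 1 r - [:a ^ r:])) a = poly s a"
    unfolding s pderiv_mult by (simp add: pderiv_pCons)
  then have sa: "poly s a = of_nat r * a ^ (r - 1)"
    by (simp add: pderiv_diff pderiv_monom poly_monom pderiv_pCons)
  have "poly s a \<noteq> 0" unfolding sa using r a by simp
  define p4 where "p4 = Polynomial.monom 1 j1 * (s ^ q * pcompose p3 (Polynomial.monom 1 r))"
  have "pcompose [:- (a ^ r), 1:] (Polynomial.monom 1 r) = [:- a, 1:] * s"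
    unfolding s[symmetric] by (simp add: pcompose_pCons)
  then have "p = [:- a, 1:] ^ q * p4"
    unfolding decomp p4_def p3(1) pcompose_mult pcompose_power'
    by (simp only: power_mult_distrib ac_simps)
  moreover have "poly p4 a \<noteq> 0"
    using p3(2) \<open>poly s a \<noteq> 0\<close> a by (simp add: p4_def poly_monom poly_pcompose)
  ultimately have "poly ((pderiv ^^ q) p) a \<noteq> 0"
    using pderiv_iterate_at_root[of q a p4] by simp
  moreover have "r * q \<le> degree p"
  proof -
    have "q \<le> degree p2" unfolding q_def using p2 by (rule order_degree)
    moreover have "pcompose p2 (Polynomial.monom 1 r) \<noteq> 0" using decomp nz by auto
    then have "degree p = j1 + degree p2 * r"
      using decomp by (simp add: degree_mult_eq degree_monom_eq monom_eq_0_iff degree_pcompose)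
    ultimately show ?thesis by (simp add: mult.commute trans_le_add2)
  qed
  ultimately show ?thesis using that by blast
qed

lemma ev2_mon: "k2.ev2 F G (mon c i j) = cst c * F ^ i * G ^ j"
  unfolding k2.ev2_mon by (simp add: \<kappa>2_def)

lemma homog_1: "homog 1 = 1"
  using homog_mon[of 1 0 0] by (simp add: cst_simps)

lemma of_nat_cst: "of_nat j * cst c = cst (of_nat j * c)"
  by (simp add: mon_def monom_0 of_nat_poly)

text \<open>The weight of X^i Y^j is the degree that one expects after substituting polynomials
  of degrees m and n.\<close>

definition wtle :: "nat => nat => nat => cpp => bool" where
  "wtle m n \<Omega> Q \<longleftrightarrow> (\<forall>i j. cf Q i j \<noteq> 0 \<longrightarrow> i * m + j * n \<le> \<Omega>)"

text \<open>The part of weight \<Omega> with f substituted for X, as a polynomial in Y. Its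
  derivatives in Y detect cancellations of leading forms.\<close>

definition wpart :: "nat => nat => cpp => nat => cpp => cpp poly" where
  "wpart m n f \<Omega> Q = (\<Sum>(i, j) | cf Q i j \<noteq> 0. if i * m + j * n = \<Omega> then Polynomial.monom (cst (cf Q i j) * f ^ i) j else 0)"

lemma wpart_superset:
  assumes "finite S" "{(i, j). cf Q i j \<noteq> 0} \<subseteq> S"
  shows "wpart m n f \<Omega> Q = (\<Sum>(i, j)\<in>S. if i * m + j * n = \<Omega> then Polynomial.monom (cst (cf Q i j) * f ^ i) j else 0)"
  unfolding wpart_def
  by (rule sum.mono_neutral_left) (use assms in \<open>auto simp: cst_simps split: if_splits\<close>)

lemma cf_0 [simp]: "cf 0 i j = 0"
  by (simp add: cf_def)

lemma wpart_add: "wpart m n f \<Omega> (P + Q) = wpart m n f \<Omega> P + wpart m n f \<Omega> Q"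
proof -
  let ?S = "{(i, j). cf P i j \<noteq> 0} \<union> {(i, j). cf Q i j \<noteq> 0}"
  have fin: "finite ?S" using finite_cf by blast
  have 1: "wpart m n f \<Omega> (P + Q) = (\<Sum>(i, j)\<in>?S. if i * m + j * n = \<Omega> then Polynomial.monom (cst (cf (P + Q) i j) * f ^ i) j else 0)"
    by (rule wpart_superset[OF fin]) (auto simp: cf_add)
  have 2: "wpart m n f \<Omega> P = (\<Sum>(i, j)\<in>?S. if i * m + j * n = \<Omega> then Polynomial.monom (cst (cf P i j) * f ^ i) j else 0)"
    "wpart m n f \<Omega> Q = (\<Sum>(i, j)\<in>?S. if i * m + j * n = \<Omega> then Polynomial.monom (cst (cf Q i j) * f ^ i) j else 0)"
    by (rule wpart_superset[OF fin]; auto)+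
  show ?thesis unfolding 1 2 sum.distrib[symmetric]
    by (rule sum.cong) (auto simp: cf_add add_monom distrib_right simp flip: cst_simps(3))
qed

lemma wpart_mon: "wpart m n f \<Omega> (mon c i j) = (if i * m + j * n = \<Omega> then Polynomial.monom (cst c * f ^ i) j else 0)"
  by (subst wpart_superset[of "{(i, j)}"]) (auto simp: cf_mon split: if_splits)

lemma wpart_0: "wpart m n f \<Omega> 0 = 0"
  by (simp add: wpart_def)

lemma homog_power_lead:
  "degree (homog (F ^ i)) \<le> i * tdeg F" "poly.coeff (homog (F ^ i)) (i * tdeg F) = lead_form F ^ i"
proof -
  show "degree (homog (F ^ i)) \<le> i * tdeg F"
    by (metis degree_power_le homog_power mult.commute tdeg_def)
  show "poly.coeff (homog (F ^ i)) (i * tdeg F) = lead_form F ^ i"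
  proof (cases "F = 0")
    case True
    then show ?thesis by (cases i) (simp_all add: homog_0 homog_1 tdeg_def lead_form_def homog_power)
  next
    case False
    then have "degree (homog (F ^ i)) = i * tdeg F"
      by (simp add: homog_power tdeg_def degree_power_eq homog_eq_0)
    then show ?thesis by (metis homog_power lead_coeff_power lead_form_def)
  qed
qed

lemma homog_cst: "homog (cst c) = [:cst c:]"
  by (simp add: homog_mon monom_0)

lemma homog_ev2_mon:
  fixes F G
  defines "w \<equiv> \<lambda>i j. i * tdeg F + j * tdeg G"
  shows "degree (homog (k2.ev2 F G (mon c i j))) \<le> w i j"
    "poly.coeff (homog (k2.ev2 F G (mon c i j))) (w i j) = cst c * lead_form F ^ i * lead_form G ^ j"
proof -
  have eq: "homog (k2.ev2 F G (mon c i j)) = Polynomial.smult (cst c) (homog (F ^ i) * homog (G ^ j))"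
    by (simp add: ev2_mon homog_mult homog_cst)
  show "degree (homog (k2.ev2 F G (mon c i j))) \<le> w i j"
    unfolding eq w_def
    by (rule order.trans[OF degree_smult_le order.trans[OF degree_mult_le add_mono[OF homog_power_lead(1) homog_power_lead(1)]]])
  show "poly.coeff (homog (k2.ev2 F G (mon c i j))) (w i j) = cst c * lead_form F ^ i * lead_form G ^ j"
    unfolding eq w_def
    by (simp add: coeff_mult_sum[OF homog_power_lead(1) homog_power_lead(1)] homog_power_lead(2) mult.assoc)
qed

text \<open>If the second polynomial has leading form g, the component of degree \<Omega> of the
  composition is the value of wpart at g; the degree drops exactly if g is a root.\<close>

lemma homog_ev2:
  assumes "wtle (tdeg F) (tdeg G) \<Omega> Q"
  shows "degree (homog (k2.ev2 F G Q)) \<le> \<Omega>"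
    "poly.coeff (homog (k2.ev2 F G Q)) \<Omega> = poly (wpart (tdeg F) (tdeg G) (lead_form F) \<Omega> Q) (lead_form G)"
proof -
  let ?S = "{(i, j). cf Q i j \<noteq> 0}"
  have hs: "homog (sum f I) = (\<Sum>t\<in>I. homog (f t))" for f and I :: "(nat \<times> nat) set"
    by (induction I rule: infinite_finite_induct) (simp_all add: homog_0 homog_add)
  have "k2.ev2 F G Q = k2.ev2 F G (\<Sum>(i, j)\<in>?S. mon (cf Q i j) i j)"
    by (simp only: cpp_expand[symmetric])
  then have eq: "homog (k2.ev2 F G Q) = (\<Sum>(i, j)\<in>?S. homog (k2.ev2 F G (mon (cf Q i j) i j)))"
    by (simp add: k2.ev2_sum hs case_prod_unfold)
  have le: "i * tdeg F + j * tdeg G \<le> \<Omega>" if "(i, j) \<in> ?S" for i j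
    using assms that by (auto simp: wtle_def)
  show "degree (homog (k2.ev2 F G Q)) \<le> \<Omega>"
    unfolding eq
    by (intro degree_sum_le[OF finite_cf]) (auto intro: order.trans[OF homog_ev2_mon(1) le])
  have co: "poly.coeff (homog (k2.ev2 F G (mon (cf Q i j) i j))) \<Omega> =
     (if i * tdeg F + j * tdeg G = \<Omega> then cst (cf Q i j) * lead_form F ^ i * lead_form G ^ j else 0)"
    if "(i, j) \<in> ?S" for i j
  proof (cases "i * tdeg F + j * tdeg G = \<Omega>")
    case True
    then show ?thesis using homog_ev2_mon(2)[of F G "cf Q i j" i j] by simp
  next
    case False
    then have "degree (homog (k2.ev2 F G (mon (cf Q i j) i j))) < \<Omega>"
      using homog_ev2_mon(1)[of F G "cf Q i j" i j] le[OF that] by linarith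
    then show ?thesis using False by (simp add: coeff_eq_0)
  qed
  show "poly.coeff (homog (k2.ev2 F G Q)) \<Omega> = poly (wpart (tdeg F) (tdeg G) (lead_form F) \<Omega> Q) (lead_form G)"
    unfolding eq wpart_def poly_sum coeff_sum
    by (rule sum.cong) (auto simp: co poly_monom)
qed

lemma cf_dY: "cf (dY Q) i j = of_nat (Suc j) * cf Q i (Suc j)"
  by (simp add: cf_def dY_def coeff_pderiv of_nat_poly)

lemma wtle_dY:
  assumes "wtle m n \<Omega> Q"
  shows "wtle m n (\<Omega> - n) (dY Q)"
  unfolding wtle_def
proof (intro allI impI)
  fix i j assume "cf (dY Q) i j \<noteq> 0"
  then have "cf Q i (Suc j) \<noteq> 0" by (auto simp: cf_dY)
  then have "i * m + Suc j * n \<le> \<Omega>" using assms unfolding wtle_def by blast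
  then show "i * m + j * n \<le> \<Omega> - n" by simp
qed

lemma wpart_dY:
  assumes "n \<le> \<Omega>" "n > 0"
  shows "wpart m n f (\<Omega> - n) (dY Q) = pderiv (wpart m n f \<Omega> Q)"
proof (induction Q rule: cpp_induct)
  case (mon c i j)
  show ?case
  proof (cases j)
    case 0
    then show ?thesis by (simp add: dY_mon cst_simps wpart_0 wpart_mon monom_0)
  next
    case (Suc j')
    have "i * m + j' * n = \<Omega> - n \<longleftrightarrow> i * m + j * n = \<Omega>" using assms Suc by auto
    then show ?thesis using Suc of_nat_cst[of "Suc j'" c]
      by (auto simp: dY_mon wpart_mon pderiv_monom simp del: of_nat_Suc)
  qed
qed (simp_all add: dY_0 wpart_0 dY_add wpart_add pderiv_add)

text \<open>The operator jac F is a derivation that kills F, so on compositions with F and G it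
  is \<partial>/\<partial>Y up to the factor jac F G.\<close>

lemma jac_ev2: "jac F (k2.ev2 F G Q) = k2.ev2 F G (dY Q) * jac F G"
proof (induction Q rule: cpp_induct)
  case (mon c i j)
  have jp: "jac F (K ^ n) = of_nat n * K ^ (n - 1) * jac F K" for K n
    by (simp add: jac_def dX_power dY_power algebra_simps)
  have "jac F F = 0" by (simp add: jac_def mult.commute)
  have "jac F (cst c * F ^ i * G ^ j) = cst c * F ^ i * (of_nat j * G ^ (j - 1) * jac F G)"
    by (simp add: jac_mult jp jac_cst \<open>jac F F = 0\<close>)
  also have "\<dots> = (of_nat j * cst c) * F ^ i * G ^ (j - 1) * jac F G"
    by (simp only: ac_simps)
  finally show ?case by (simp only: dY_mon ev2_mon of_nat_cst)
next
  case zero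
  then show ?case by (simp add: k2.ev2_0 dY_0 jac_def dX_0)
qed (simp_all add: k2.ev2_add dY_add jac_add distrib_right)

text \<open>Write X = P(F, G) with P of weight \<Omega>, and let q be the first order of a
  derivative of the top part of P that does not vanish at the leading form of G. Then
  (\<partial>^q P/\<partial>Y^q)(F, G) has degree at least \<Omega> - q n. On the other hand it
  arises from X by q applications of jac F, each raising the degree by at most m - 2. The
  exponents of the top part lie in one class modulo r, whence q is at most \<Omega> / (r n); for
  r, s \<ge> 2 these bounds are incompatible.\<close>

theorem degree_estimate_contradiction:
  assumes jac: "jac F G = cst j" "j \<noteq> 0" and X: "k2.ev2 F G P = vX"
    and deg: "tdeg F = r * d" "tdeg G = s * d" and rs: "coprime r s" "r \<ge> 2" "s \<ge> 2" and d: "d \<ge> 1"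
  shows False
proof -
  let ?m = "tdeg F" and ?n = "tdeg G"
  have mn: "?m \<ge> 2" "?n \<ge> 2" using mult_le_mono[OF rs(2) d] mult_le_mono[OF rs(3) d] deg by simp_all
  have P0: "P \<noteq> 0" using X by (auto simp: k2.ev2_0 mon_def)
  let ?S = "{(i, j). cf P i j \<noteq> 0}"
  let ?w = "\<lambda>(i, j). i * ?m + j * ?n"
  have ne: "?S \<noteq> {}" using P0 cpp_eqI[of P 0] by auto
  define \<Omega> where "\<Omega> = Max (?w ` ?S)"
  have fin: "finite ?S" by (rule finite_cf)
  have wt: "wtle ?m ?n \<Omega> P" unfolding wtle_def \<Omega>_def using fin by (auto intro!: Max_ge)
  have "\<Omega> \<in> ?w ` ?S" unfolding \<Omega>_def using fin ne by (intro Max_in) auto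
  then obtain i0 j0 where ij0: "cf P i0 j0 \<noteq> 0" "i0 * ?m + j0 * ?n = \<Omega>" by auto
  have tF: "lead_form F \<noteq> 0" "lead_form G \<noteq> 0" using mn by (auto simp: lead_form_eq_0 tdeg_def homog_0)
  let ?p = "wpart ?m ?n (lead_form F) \<Omega> P"
  have coeff_p: "poly.coeff ?p j = (\<Sum>(i, j') | cf P i j' \<noteq> 0. if i * ?m + j' * ?n = \<Omega> \<and> j' = j then cst (cf P i j') * lead_form F ^ i else 0)" for j
    unfolding wpart_def coeff_sum by (rule sum.cong) auto
  have c0: "poly.coeff ?p j0 = cst (cf P i0 j0) * lead_form F ^ i0"
  proof -
    have "poly.coeff ?p j0 = (\<Sum>(i, j')\<in>{(i0, j0)}. if i * ?m + j' * ?n = \<Omega> \<and> j' = j0 then cst (cf P i j') * lead_form F ^ i else 0)"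
      unfolding coeff_p
    proof (rule sum.mono_neutral_right[OF fin])
      show "\<forall>t\<in>?S - {(i0, j0)}. (case t of (i, j') => if i * ?m + j' * ?n = \<Omega> \<and> j' = j0 then cst (cf P i j') * lead_form F ^ i else 0) = 0"
        using ij0 mn by (auto split: if_splits)
    qed (use ij0 in auto)
    then show ?thesis using ij0 by simp
  qed
  have cst_nz: "cst c \<noteq> 0" if "c \<noteq> 0" for c using that by (simp add: mon_def monom_0)
  have p0: "?p \<noteq> 0" using c0 ij0 tF cst_nz by auto
  have mem: "\<exists>i. i * ?m + j * ?n = \<Omega>" if "poly.coeff ?p j \<noteq> 0" for j
  proof (rule ccontr)
    assume "\<nexists>i. i * ?m + j * ?n = \<Omega>"
    then have "poly.coeff ?p j = 0" unfolding coeff_p by (intro sum.neutral) auto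
    then show False using that by simp
  qed
  \<comment> \<open>i r + j s is constant on the top part, and r and s are coprime\<close>
  have cls: "j mod r = j0 mod r" if nz: "poly.coeff ?p j \<noteq> 0" for j
  proof -
    obtain i where "i * ?m + j * ?n = \<Omega>" using mem[OF nz] by blast
    then have "d * (i * r + j * s) = d * (i0 * r + j0 * s)" using ij0 by (simp add: deg algebra_simps)
    then have "i * r + j * s = i0 * r + j0 * s" using d by simp
    then have "int (i * r + j * s) = int (i0 * r + j0 * s)" by (simp only:)
    then have "(int j - int j0) * int s = int r * (int i0 - int i)" by (simp add: algebra_simps)
    then have "int r dvd (int j - int j0) * int s" by (metis dvd_triv_left)
    then have "int r dvd int j - int j0" using rs(1) by (simp add: coprime_dvd_mult_left_iff)
    then have "int j mod int r = int j0 mod int r" by (simp add: mod_eq_dvd_iff)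
    then show ?thesis by (simp flip: zmod_int)
  qed
  obtain q where q: "r * q \<le> degree ?p" "poly ((pderiv ^^ q) ?p) (lead_form G) \<noteq> 0"
    using multiplicity_mod_class[OF p0 _ cls tF(2)] rs by auto
  have "\<exists>i. i * ?m + degree ?p * ?n = \<Omega>" by (rule mem) (use p0 in simp)
  then have \<Omega>1: "degree ?p * ?n \<le> \<Omega>" by auto
  then have \<Omega>2: "r * q * ?n \<le> \<Omega>" using q(1) by (meson mult_le_mono1 order.trans)
  define h where "h t = k2.ev2 F G ((dY ^^ t) P)" for t
  have tn: "t * ?n \<le> \<Omega>" if "t \<le> q" for t
  proof -
    have "t * ?n \<le> r * q * ?n" using that rs by (intro mult_le_mono1) (metis le_trans mult_le_mono1 mult_1 one_le_numeral order.trans)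
    then show ?thesis using \<Omega>2 by (rule order.trans)
  qed
  have iter: "wtle ?m ?n (\<Omega> - t * ?n) ((dY ^^ t) P) \<and> wpart ?m ?n (lead_form F) (\<Omega> - t * ?n) ((dY ^^ t) P) = (pderiv ^^ t) ?p"
    if "t \<le> q" for t
    using that
  proof (induction t)
    case (Suc t)
    then have "?n \<le> \<Omega> - t * ?n" using tn[of "Suc t"] by simp
    then show ?case
      using Suc wtle_dY[of ?m ?n "\<Omega> - t * ?n" "(dY ^^ t) P"] wpart_dY[of ?n "\<Omega> - t * ?n" ?m "lead_form F" "(dY ^^ t) P"] mn
      by (simp add: diff_diff_left add.commute)
  qed (simp add: wt)
  have hq: "poly.coeff (homog (h q)) (\<Omega> - q * ?n) \<noteq> 0"
    using iter[of q] homog_ev2(2)[of F G "\<Omega> - q * ?n" "(dY ^^ q) P"] q(2) by (simp add: h_def)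
  then have dq: "tdeg (h q) \<ge> \<Omega> - q * ?n" and hq0: "h q \<noteq> 0"
    unfolding tdeg_def by (auto intro: le_degree simp: homog_0)
  have step: "jac F (h t) = h (Suc t) * cst j" for t
    unfolding h_def using jac_ev2[of F G "(dY ^^ t) P"] jac by simp
  have tcst: "tdeg (K * cst j) = tdeg K" for K
    using jac(2) by (simp add: tdeg_def homog_mult homog_cst cst_nz mult.commute)
  have nz: "h t \<noteq> 0" if "t \<le> q" for t
    using that
  proof (induction "q - t" arbitrary: t)
    case 0
    then show ?case using hq0 by simp
  next
    case (Suc x)
    then have "h (Suc t) \<noteq> 0" by auto
    then have "jac F (h t) \<noteq> 0" using step[of t] cst_nz[OF jac(2)] by simp
    then show ?case by (auto simp: jac_def dX_0 dY_0)
  qed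
  have down: "tdeg (h t) + 2 * t \<le> t * ?m + tdeg (h 0)" if "t \<le> q" for t
    using that
  proof (induction t)
    case (Suc t)
    have "jac F (h t) \<noteq> 0" using step[of t] nz[of "Suc t"] Suc.prems cst_nz[OF jac(2)] by simp
    then have "tdeg (h (Suc t)) + 2 \<le> ?m + tdeg (h t)" using tdeg_jac[of F "h t"] step[of t] tcst by simp
    then show ?case using Suc by simp
  qed simp
  have h0: "tdeg (h 0) = 1" by (simp add: h_def X tdeg_def homog_mon) (simp add: degree_monom_eq mon_def monom_eq_0_iff)
  have final: "\<Omega> + 2 * q \<le> q * ?m + q * ?n + 1"
    using down[of q] dq h0 tn[of q] by simp
  show False
  proof (cases "q = 0")
    case True
    have w1: "i * ?m + j * ?n \<le> 1" if "cf P i j \<noteq> 0" for i j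
      using wt that final True unfolding wtle_def by (metis add.commute add_0 le_trans mult_0 mult_0_right)
    have "i = 0 \<and> j = 0" if "cf P i j \<noteq> 0" for i j
      using w1[OF that] mn by (cases i; cases j) auto
    then have "P = cst (cf P 0 0)" by (intro cpp_eqI) (auto simp: cf_mon)
    then have "k2.ev2 F G P = cst (cf P 0 0)" by (metis ev2_mon mult.right_neutral power_0)
    then have "vX = cst (cf P 0 0)" using X by simp
    then have "cf vX 1 0 = cf (cst (cf P 0 0)) 1 0" by simp
    then show False by (simp add: cf_mon)
  next
    case False
    have "r \<noteq> s" using rs by auto
    obtain a b where ab: "r = a + 2" "s = b + 2" using rs by (metis add.commute le_Suc_ex)
    have "a + b \<ge> 1" using ab \<open>r \<noteq> s\<close> by auto
    then have "r + s + 1 \<le> r * s" unfolding ab by (simp add: algebra_simps)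
    then have "q * d * (r + s + 1) \<le> q * d * (r * s)" by (rule mult_le_mono2)
    also have "\<dots> = r * q * ?n" by (simp add: deg)
    also have "\<dots> \<le> \<Omega>" by (rule \<Omega>2)
    finally have "q * ?m + q * ?n + q * d \<le> \<Omega>" by (simp add: deg algebra_simps)
    then have "q * d + 2 * q \<le> 1" using final by linarith
    then show False using False by simp
  qed
qed

text \<open>The leading forms f, g have zero Jacobian, so f^s and g^r are proportional. By the
  previous estimate one of r, s equals 1, so one leading form is a multiple of a power of the
  other.\<close>

theorem degree_reduction:
  assumes jac: "jac F G = cst j" "j \<noteq> 0" and X: "k2.ev2 F G P = vX"
    and big: "tdeg F + tdeg G > 2"
  shows "(\<exists>c k. tdeg (F - cst c * G ^ k) < tdeg F) \<or> (\<exists>c k. tdeg (G - cst c * F ^ k) < tdeg G)"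
proof -
  let ?m = "tdeg F" and ?n = "tdeg G"
  have j0: "cst j \<noteq> 0" using jac(2) by (simp add: mon_def monom_0)
  have "?m \<noteq> 0" "?n \<noteq> 0" using jac(1) j0 jac_cst by (auto simp: tdeg_0_iff)
  then obtain m' n' where m': "?m = Suc m'" "?n = Suc n'" by (meson not0_implies_Suc)
  have "m' + n' > 0" using big m' by simp
  then have J0: "jac (lead_form F) (lead_form G) = 0"
    using homog_jac(2)[OF m'] jac(1) by (simp add: homog_cst coeff_pCons split: nat.splits)
  have tF: "lead_form F \<noteq> 0" "lead_form G \<noteq> 0" using m' by (auto simp: lead_form_eq_0 tdeg_def homog_0)
  define d where "d = gcd ?m ?n"
  obtain r s where rs: "?m = r * d" "?n = s * d" "coprime r s"
    using gcd_coprime_exists[of ?m ?n] m' unfolding d_def by auto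
  have d: "d \<ge> 1" "r \<ge> 1" "s \<ge> 1" using rs m' by (cases d; cases r; cases s; auto)+
  let ?f = "lead_form F" and ?g = "lead_form G"
  have ef: "vX * dX ?f + vY * dY ?f = cst (of_nat ?m) * ?f" "vX * dX ?g + vY * dY ?g = cst (of_nat ?n) * ?g"
    using euler_hom[of F ?m] euler_hom[of G ?n] by (simp_all add: lead_form_def tdeg_def)
  have J: "dX ?f * dY ?g = dY ?f * dX ?g" using J0 by (simp add: jac_def)
  have c: "cst (of_nat (a * d)) = cst (of_nat d) * cst (of_nat a)" for a by (simp add: mon_mult mult.commute)
  have dnz: "cst (of_nat d) \<noteq> 0" using d by (simp add: mon_def monom_0)
  have eX: "cst (of_nat r) * ?f * dX ?g = cst (of_nat s) * ?g * dX ?f"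
  proof -
    have "cst (of_nat ?m) * ?f * dX ?g = vX * dX ?f * dX ?g + vY * (dY ?f * dX ?g)"
      unfolding ef(1)[symmetric] by (simp add: algebra_simps)
    also have "\<dots> = (vX * dX ?g + vY * dY ?g) * dX ?f" unfolding J[symmetric] by (simp add: algebra_simps)
    also have "\<dots> = cst (of_nat ?n) * ?g * dX ?f" by (simp only: ef(2))
    finally have "cst (of_nat d) * (cst (of_nat r) * ?f * dX ?g) = cst (of_nat d) * (cst (of_nat s) * ?g * dX ?f)"
      unfolding rs c by (simp only: ac_simps)
    then show ?thesis using dnz by simp
  qed
  have eY: "cst (of_nat r) * ?f * dY ?g = cst (of_nat s) * ?g * dY ?f"
  proof -
    have "cst (of_nat ?m) * ?f * dY ?g = vY * dY ?f * dY ?g + vX * (dX ?f * dY ?g)"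
      unfolding ef(1)[symmetric] by (simp add: algebra_simps)
    also have "\<dots> = (vX * dX ?g + vY * dY ?g) * dY ?f" unfolding J by (simp add: algebra_simps)
    also have "\<dots> = cst (of_nat ?n) * ?g * dY ?f" by (simp only: ef(2))
    finally have "cst (of_nat d) * (cst (of_nat r) * ?f * dY ?g) = cst (of_nat d) * (cst (of_nat s) * ?g * dY ?f)"
      unfolding rs c by (simp only: ac_simps)
    then show ?thesis using dnz by simp
  qed
  have ofn: "(of_nat a :: cpp) = cst (of_nat a)" for a by (simp add: mon_def monom_0 of_nat_poly)
  obtain r' s' where rs': "r = Suc r'" "s = Suc s'" using d by (cases r; cases s) auto
  have pr: "?g ^ r * (of_nat s * ?f ^ (s - 1) * df) = ?f ^ s * (of_nat r * ?g ^ (r - 1) * dg)"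
    if "cst (of_nat r) * ?f * dg = cst (of_nat s) * ?g * df" for df dg
  proof -
    have "?g ^ r * (of_nat s * ?f ^ (s - 1) * df) = ?g ^ r' * ?f ^ s' * (cst (of_nat s) * ?g * df)"
      unfolding rs' ofn by (simp add: ac_simps)
    also have "\<dots> = ?g ^ r' * ?f ^ s' * (cst (of_nat r) * ?f * dg)" by (simp only: that)
    also have "\<dots> = ?f ^ s * (of_nat r * ?g ^ (r - 1) * dg)"
      unfolding rs' ofn by (simp add: ac_simps)
    finally show ?thesis .
  qed
  have "\<exists>c. c \<noteq> 0 \<and> ?f ^ s = cst c * ?g ^ r"
    by (rule proportional) (use tF in \<open>simp_all only: dX_power dY_power pr[OF eX] pr[OF eY] power_not_zero not_False_eq_True\<close>)
  then obtain \<kappa> where \<kappa>: "\<kappa> \<noteq> 0" "?f ^ s = cst \<kappa> * ?g ^ r" by blast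
  have red: "tdeg (K - cst c * L ^ k) < tdeg K" if "tdeg K = k * tdeg L" "lead_form K = cst c * lead_form L ^ k" "tdeg K > 0" for K L c k
  proof -
    have h: "homog (K - cst c * L ^ k) = homog K - Polynomial.smult (cst c) (homog (L ^ k))"
      by (simp add: homog_diff homog_mult homog_cst)
    have "degree (homog (K - cst c * L ^ k)) \<le> tdeg K"
      unfolding h using that homog_power_lead(1)[of L k]
      by (intro degree_diff_le order.trans[OF degree_smult_le]) (simp_all add: tdeg_def)
    moreover have "poly.coeff (homog (K - cst c * L ^ k)) (tdeg K) = 0"
      unfolding h using that homog_power_lead(2)[of L k] by (simp add: lead_form_def tdeg_def)
    ultimately show ?thesis using that(3) unfolding tdeg_def
      by (metis degree_0 leading_coeff_0_iff le_neq_implies_less)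
  qed
  consider "r = 1" | "s = 1" | "r \<ge> 2" "s \<ge> 2" using d by linarith
  then show ?thesis
  proof cases
    case 1
    have "?g = cst (inverse \<kappa>) * ?f ^ s"
      using \<kappa> 1 by (simp add: mon_mult cst_simps flip: mult.assoc)
    then have "tdeg (G - cst (inverse \<kappa>) * F ^ s) < ?n"
      by (intro red) (use rs 1 m' d in auto)
    then show ?thesis by blast
  next
    case 2
    have "tdeg (F - cst \<kappa> * G ^ r) < ?m"
      by (intro red) (use \<kappa> rs 2 m' d in auto)
    then show ?thesis by blast
  next
    case 3
    then show ?thesis using degree_estimate_contradiction[OF jac X rs(1,2,3)] d by blast
  qed
qed

section \<open>Generation by affine and triangular automorphisms\<close>

lemma algebra_aut_iff: "algebra_aut \<sigma> \<longleftrightarrow> bij \<sigma> \<and> alg_hom \<sigma>"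
  unfolding algebra_aut_def alg_hom_def by blast

lemma mem_G: "\<sigma> \<in> carrier grpG \<longleftrightarrow> alg_hom \<sigma> \<and> bij \<sigma> \<and> \<sigma> comm = comm"
  unfolding grpG_def comm_def by (auto simp: algebra_aut_iff)

lemma mult_G [simp]: "\<sigma> \<otimes>\<^bsub>grpG\<^esub> \<tau> = \<sigma> \<circ> \<tau>" and one_G [simp]: "\<one>\<^bsub>grpG\<^esub> = id"
  by (simp_all add: grpG_def)

lemma alg_homI:
  assumes "!!u v. \<sigma> (u + v) = \<sigma> u + \<sigma> v" "!!u v. \<sigma> (u * v) = \<sigma> u * \<sigma> v"
    "!!c u. \<sigma> (scal c * u) = scal c * \<sigma> u" "\<sigma> 1 = 1"
  shows "alg_hom \<sigma>"
  using assms unfolding alg_hom_def by blast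

lemma alg_hom_comp:
  assumes "alg_hom \<sigma>" "alg_hom \<tau>"
  shows "alg_hom (\<sigma> \<circ> \<tau>)"
proof (rule alg_homI)
  fix u v c
  show "(\<sigma> \<circ> \<tau>) (u + v) = (\<sigma> \<circ> \<tau>) u + (\<sigma> \<circ> \<tau>) v"
    by (simp only: comp_apply alg_hom_add[OF assms(1)] alg_hom_add[OF assms(2)])
  show "(\<sigma> \<circ> \<tau>) (u * v) = (\<sigma> \<circ> \<tau>) u * (\<sigma> \<circ> \<tau>) v"
    by (simp only: comp_apply alg_hom_mult[OF assms(1)] alg_hom_mult[OF assms(2)])
  show "(\<sigma> \<circ> \<tau>) (scal c * u) = scal c * (\<sigma> \<circ> \<tau>) u"
    by (simp only: comp_apply alg_hom_scal[OF assms(1)] alg_hom_scal[OF assms(2)])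
  show "(\<sigma> \<circ> \<tau>) 1 = 1"
    by (simp only: comp_apply alg_hom_1[OF assms(1)] alg_hom_1[OF assms(2)])
qed

lemma alg_hom_inverse:
  assumes \<sigma>: "alg_hom \<sigma>" and b: "!!u. \<sigma> (\<tau> u) = u" "!!u. \<tau> (\<sigma> u) = u"
  shows "alg_hom \<tau>"
  unfolding alg_hom_def
proof (intro conjI allI)
  fix u v c
  show "\<tau> (u + v) = \<tau> u + \<tau> v" using b alg_hom_add[OF \<sigma>, of "\<tau> u" "\<tau> v"] by metis
  show "\<tau> (u * v) = \<tau> u * \<tau> v" using b alg_hom_mult[OF \<sigma>, of "\<tau> u" "\<tau> v"] by metis
  show "\<tau> (scal c * u) = scal c * \<tau> u" using b alg_hom_scal[OF \<sigma>, of c "\<tau> u"] by metis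
  show "\<tau> 1 = 1" using b alg_hom_1[OF \<sigma>] by metis
qed

lemma inverse_in_G:
  assumes "\<sigma> \<in> carrier grpG"
  obtains \<tau> where "\<tau> \<in> carrier grpG" "\<tau> \<circ> \<sigma> = id" "\<sigma> \<circ> \<tau> = id"
proof -
  let ?t = "inv_into UNIV \<sigma>"
  have \<sigma>: "alg_hom \<sigma>" "bij \<sigma>" "\<sigma> comm = comm" using assms by (auto simp: mem_G)
  have b: "\<sigma> (?t u) = u" "?t (\<sigma> u) = u" for u
    using \<sigma>(2) by (simp_all add: bij_is_surj surj_f_inv_f bij_is_inj inv_into_f_f)
  have "?t comm = comm" using b(2)[of comm] \<sigma>(3) by simp
  then have "?t \<in> carrier grpG"
    unfolding mem_G using alg_hom_inverse[OF \<sigma>(1) b] bij_imp_bij_inv[OF \<sigma>(2)] by blast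
  then show ?thesis using that[of ?t] b by (auto simp: fun_eq_iff)
qed

lemma group_G: "group grpG"
proof (rule groupI)
  fix \<sigma> \<tau> assume "\<sigma> \<in> carrier grpG" "\<tau> \<in> carrier grpG"
  then show "\<sigma> \<otimes>\<^bsub>grpG\<^esub> \<tau> \<in> carrier grpG"
    by (auto simp: mem_G alg_hom_comp bij_comp)
next
  show "\<one>\<^bsub>grpG\<^esub> \<in> carrier grpG" by (simp add: mem_G alg_hom_def)
next
  fix \<sigma> assume "\<sigma> \<in> carrier grpG"
  then show "\<exists>\<tau>\<in>carrier grpG. \<tau> \<otimes>\<^bsub>grpG\<^esub> \<sigma> = \<one>\<^bsub>grpG\<^esub>"
    by (metis inverse_in_G mult_G one_G)
qed (auto simp: comp_assoc)

interpretation G: group grpG by (rule group_G)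

abbreviation (input) gmult (infixl "\<odot>" 70) where "\<sigma> \<odot> \<tau> \<equiv> \<sigma> \<otimes>\<^bsub>grpG\<^esub> \<tau>"
abbreviation (input) ginv where "ginv \<sigma> \<equiv> inv\<^bsub>grpG\<^esub> \<sigma>"

lemma inv_G:
  assumes "\<sigma> \<in> carrier grpG"
  shows "(ginv \<sigma>) (\<sigma> u) = u" "\<sigma> ((ginv \<sigma>) u) = u"
  using G.l_inv[OF assms] G.r_inv[OF assms] by (simp_all add: fun_eq_iff)

lemma G_alg_hom: "\<sigma> \<in> carrier grpG ==> alg_hom \<sigma>"
  by (simp add: mem_G)

lemma alg_hom_fA_subst: "alg_hom (fA.subst p q)"
  by (rule alg_homI) (rule fA.subst_add fA.subst_mult fA.subst_scal_mult fA.subst_1)+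

lemma alg_hom_id: "alg_hom id"
  by (simp add: alg_hom_def)

lemma subst_in_G:
  assumes "fA.subst p q p' = genx" "fA.subst p q q' = geny" "fA.subst p' q' p = genx" "fA.subst p' q' q = geny"
    and "p * q - q * p = comm"
  shows "fA.subst p q \<in> carrier grpG"
proof -
  have 1: "fA.subst p q \<circ> fA.subst p' q' = id"
    by (rule alg_hom_eqI[OF alg_hom_comp[OF alg_hom_fA_subst alg_hom_fA_subst] alg_hom_id]) (simp_all add: assms)
  have 2: "fA.subst p' q' \<circ> fA.subst p q = id"
    by (rule alg_hom_eqI[OF alg_hom_comp[OF alg_hom_fA_subst alg_hom_fA_subst] alg_hom_id]) (simp_all add: assms)
  have "fA.subst p q comm = p * q - q * p"
    by (simp add: comm_def fA.subst_diff fA.subst_mult)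
  then show ?thesis
    unfolding mem_G using alg_hom_fA_subst o_bij[OF 2 1] assms by simp
qed

text \<open>The embedding of the polynomials in one variable, Y \<mapsto> y.\<close>

definition polyY :: "complex poly => falg" where
  "polyY h = (\<Sum>i\<le>degree h. scal (poly.coeff h i) * geny ^ i)"

lemma polyY_superset:
  assumes "degree h \<le> n"
  shows "polyY h = (\<Sum>i\<le>n. scal (poly.coeff h i) * geny ^ i)"
  unfolding polyY_def
  by (rule sum.mono_neutral_left) (use assms in \<open>auto simp: coeff_eq_0\<close>)

lemma polyY_add: "polyY (p + q) = polyY p + polyY q"
proof -
  let ?n = "max (degree p) (degree q)"
  have "polyY (p + q) = (\<Sum>i\<le>?n. scal (poly.coeff (p + q) i) * geny ^ i)"
    by (rule polyY_superset) (rule degree_add_le_max)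
  also have "\<dots> = polyY p + polyY q"
    by (simp add: polyY_superset[of p ?n] polyY_superset[of q ?n] scal_add distrib_right sum.distrib)
  finally show ?thesis .
qed

lemma polyY_pCons: "polyY (pCons c p) = scal c + polyY p * geny"
proof -
  have "polyY (pCons c p) = (\<Sum>i\<le>Suc (degree p). scal (poly.coeff (pCons c p) i) * geny ^ i)"
    by (rule polyY_superset) simp
  also have "\<dots> = scal c + (\<Sum>i\<le>degree p. scal (poly.coeff p i) * geny ^ Suc i)"
    by (simp add: sum.atMost_Suc_shift del: sum.atMost_Suc power_Suc)
  also have "(\<Sum>i\<le>degree p. scal (poly.coeff p i) * geny ^ Suc i) = polyY p * geny"
    unfolding polyY_def sum_distrib_right by (rule sum.cong) (simp_all add: mult.assoc power_commutes)
  finally show ?thesis .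
qed

lemma polyY_0 [simp]: "polyY 0 = 0"
  by (simp add: polyY_def)

lemma polyY_monom: "polyY (Polynomial.monom c k) = scal c * geny ^ k"
  by (induction k) (simp_all add: monom_0 monom_Suc polyY_pCons power_commutes mult.assoc)

lemma polyY_smult: "polyY (Polynomial.smult c p) = scal c * polyY p"
  by (induction p) (simp_all add: polyY_pCons distrib_left scal_mult mult.assoc)

lemma polyY_uminus: "polyY (- p) = - polyY p"
  using polyY_smult[of "-1" p] by (simp add: scal_uminus)

lemma alg_hom_scal0: "alg_hom \<sigma> ==> \<sigma> (scal c) = scal c"
  using alg_hom_scal[of \<sigma> c 1] alg_hom_1[of \<sigma>] by simp

lemma alg_hom_polyY_affine:
  assumes \<sigma>: "alg_hom \<sigma>" and y: "\<sigma> geny = scal a * geny + scal h"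
  shows "\<sigma> (polyY p) = polyY (pcompose p [:h, a:])"
proof (induction p)
  case 0
  then show ?case by (simp add: alg_hom_0[OF \<sigma>])
next
  case (pCons c p)
  have "polyY (q * [:h, a:]) = polyY q * (scal a * geny + scal h)" for q
  proof -
    have "polyY (q * [:h, a:]) = scal h * polyY q + scal a * (polyY q * geny)"
      by (simp add: polyY_add polyY_smult polyY_pCons mult.assoc)
    then show ?thesis
      by (simp only: distrib_left mult_scal_left scal_commute[of "polyY q"] add.commute)
  qed
  then have "polyY (pcompose (pCons c p) [:h, a:]) = scal c + polyY (pcompose p [:h, a:]) * (scal a * geny + scal h)"
    by (simp add: pcompose_pCons polyY_add polyY_pCons mult.commute)
  then show ?case
    by (simp add: polyY_pCons alg_hom_add[OF \<sigma>] alg_hom_mult[OF \<sigma>] alg_hom_scal0[OF \<sigma>] y pCons.IH)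
qed

lemma setB_iff: "\<sigma> \<in> setB \<longleftrightarrow> \<sigma> \<in> carrier grpG \<and> (\<exists>a h q. a \<noteq> 0 \<and>
     \<sigma> genx = scal a * genx + polyY q \<and> \<sigma> geny = scal (inverse a) * geny + scal h)"
  unfolding setB_def polyY_def by blast

lemma setA_iff: "\<sigma> \<in> setA \<longleftrightarrow> \<sigma> \<in> carrier grpG \<and> (\<exists>a b c d e f. a * d - b * c = 1 \<and>
     \<sigma> genx = scal a * genx + scal b * geny + scal e \<and>
     \<sigma> geny = scal c * genx + scal d * geny + scal f)"
  unfolding setA_def by blast

lemma elementary_in_B:
  obtains \<beta> where "\<beta> \<in> setB" "\<beta> genx = genx + scal c * geny ^ k" "\<beta> geny = geny"
proof -
  let ?p = "scal c * geny ^ k"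
  have sp: "fA.subst p geny (scal d * geny ^ k) = scal d * geny ^ k" for p d
    by (simp add: fA.subst_scal_mult fA.subst_power)
  have comm: "(genx + ?p) * geny - geny * (genx + ?p) = comm"
  proof -
    have "?p * geny = geny * ?p" by (simp add: mult_scal_left mult.assoc power_commutes)
    then show ?thesis by (simp add: comm_def distrib_left distrib_right)
  qed
  have "fA.subst (genx + ?p) geny \<in> carrier grpG"
    by (rule subst_in_G[where p' = "genx - ?p" and q' = geny])
       (simp_all add: fA.subst_add fA.subst_diff sp comm)
  moreover have "?p = polyY (Polynomial.monom c k)" by (simp add: polyY_monom)
  ultimately have "fA.subst (genx + ?p) geny \<in> setB"
    unfolding setB_iff by (intro conjI exI[of _ 1] exI[of _ 0] exI[of _ "Polynomial.monom c k"]) simp_all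
  then show ?thesis by (rule that) simp_all
qed

lemma affine_combination:
  "scal r * (scal a1 * genx + scal b1 * geny + scal e1) + scal s * (scal a2 * genx + scal b2 * geny + scal e2) + scal t
     = scal (r * a1 + s * a2) * genx + scal (r * b1 + s * b2) * geny + scal (r * e1 + s * e2 + t)"
  by (simp add: scal_add scal_mult distrib_left distrib_right mult.assoc)

lemma affine_in_A:
  assumes det: "a * d - b * c = 1"
  obtains \<alpha> where "\<alpha> \<in> setA" "\<alpha> genx = scal a * genx + scal b * geny + scal e"
    "\<alpha> geny = scal c * genx + scal d * geny + scal f"
proof -
  let ?p = "scal a * genx + scal b * geny + scal e" and ?q = "scal c * genx + scal d * geny + scal f"
  let ?p' = "scal d * genx + scal (- b) * geny + scal (b * f - d * e)"
  let ?q' = "scal (- c) * genx + scal a * geny + scal (c * e - a * f)"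
  note lin = affine_combination
  have sub: "fA.subst p q (scal r * genx + scal s * geny + scal t) = scal r * p + scal s * q + scal t" for p q r s t
    by (simp add: fA.subst_add fA.subst_scal_mult fA.subst_scal)
  have cm: "?p * ?q - ?q * ?p = scal (a * d - b * c) * comm"
  proof -
    let ?u = "scal a * genx + scal b * geny" and ?v = "scal c * genx + scal d * geny"
    have m: "(scal r * u) * (scal s * v) = scal (r * s) * (u * v)" for r s u v
      by (simp only: mult.assoc mult_scal_left[of u] scal_scal)
    have "?p * ?q - ?q * ?p = ?u * ?v - ?v * ?u"
      using scal_commute[of ?u f] scal_commute[of ?v e] scal_commute[of "scal e" f]
      by (simp add: distrib_left[of "_ + scal _"] distrib_right[of _ "scal _"] distrib_left[of _ "_ + _" "scal _"])
    also have "\<dots> = (scal (a * d) - scal (b * c)) * (genx * geny) - (scal (a * d) - scal (b * c)) * (geny * genx)"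
      by (simp only: distrib_left distrib_right m left_diff_distrib mult.commute[of c] mult.commute[of d]) (simp add: algebra_simps)
    finally show ?thesis by (simp add: comm_def scal_diff right_diff_distrib)
  qed
  have "fA.subst ?p ?q \<in> carrier grpG"
  proof (rule subst_in_G[where p' = ?p' and q' = ?q'])
    show "fA.subst ?p ?q ?p' = genx" "fA.subst ?p ?q ?q' = geny" "fA.subst ?p' ?q' ?p = genx" "fA.subst ?p' ?q' ?q = geny"
    proof -
      have ad: "a * d = 1 + b * c" using det by (simp add: diff_eq_eq)
      have adz: "a * (d * z) = z + b * (c * z)" for z
      proof -
        have "a * (d * z) = a * d * z" by (simp only: mult.assoc)
        also have "\<dots> = z + b * (c * z)" unfolding ad by (simp add: algebra_simps)
        finally show ?thesis .
      qed
      show "fA.subst ?p ?q ?p' = genx" "fA.subst ?p ?q ?q' = geny" "fA.subst ?p' ?q' ?p = genx" "fA.subst ?p' ?q' ?q = geny"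
        unfolding sub lin using ad by (simp_all add: algebra_simps adz)
    qed
    show "?p * ?q - ?q * ?p = comm" unfolding cm det by simp
  qed
  then have "fA.subst ?p ?q \<in> setA"
    unfolding setA_iff using det by (intro conjI exI) auto
  then show ?thesis by (rule that) simp_all
qed

definition ab :: "falg => cpp" where "ab = ppA.subst vX vY"

lemma smult_cst: "Polynomial.smult [:c:] p = cst c * p"
  by (simp add: mon_def monom_0)

lemma ab_add: "ab (u + v) = ab u + ab v" and ab_mult: "ab (u * v) = ab u * ab v"
  and ab_scal_mult: "ab (scal c * u) = cst c * ab u" and ab_1: "ab 1 = 1"
  and ab_gen [simp]: "ab genx = vX" "ab geny = vY" and ab_diff: "ab (u - v) = ab u - ab v"
  and ab_power: "ab (u ^ n) = ab u ^ n" and ab_uminus: "ab (- u) = - ab u"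
  using ppA.subst_scal_mult[of vX vY c u]
  by (simp_all only: ab_def ppA.subst_add ppA.subst_mult ppA.subst_diff ppA.subst_power ppA.subst_uminus
      ppA.subst_1 ppA.subst_gen) (simp add: mon_def monom_0)

lemma ab_scal: "ab (scal c) = cst c"
  using ab_scal_mult[of c 1] by (simp add: ab_1)

lemma ab_alg_hom:
  assumes \<sigma>: "alg_hom \<sigma>"
  shows "ab (\<sigma> u) = k2.ev2 (ab (\<sigma> genx)) (ab (\<sigma> geny)) (ab u)"
proof -
  let ?F = "ab (\<sigma> genx)" and ?G = "ab (\<sigma> geny)"
  have 1: "ab (\<sigma> u) = ppA.subst ?F ?G u"
  proof (rule ppA.hom_eq_subst[where h = "\<lambda>u. ab (\<sigma> u)"])
    fix u v c
    show "ab (\<sigma> (u + v)) = ab (\<sigma> u) + ab (\<sigma> v)" by (simp only: alg_hom_add[OF \<sigma>] ab_add)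
    show "ab (\<sigma> (u * v)) = ab (\<sigma> u) * ab (\<sigma> v)" by (simp only: alg_hom_mult[OF \<sigma>] ab_mult)
    show "ab (\<sigma> (scal c * u)) = Polynomial.smult [:c:] (ab (\<sigma> u))"
      by (simp only: alg_hom_scal[OF \<sigma>] ab_scal_mult smult_cst)
  qed (simp add: alg_hom_1[OF \<sigma>] ab_1)
  have x: "k2.ev2 ?F ?G (ab genx) = ?F" "k2.ev2 ?F ?G (ab geny) = ?G"
    unfolding ab_gen ev2_mon by (simp_all add: cst_simps)
  have e1: "k2.ev2 ?F ?G 1 = 1" using ev2_mon[of ?F ?G 1 0 0] by (simp add: cst_simps)
  have ec: "k2.ev2 ?F ?G (cst c) = cst c" for c using ev2_mon[of ?F ?G c 0 0] by simp
  have "k2.ev2 ?F ?G (ab u) = ppA.subst (k2.ev2 ?F ?G (ab genx)) (k2.ev2 ?F ?G (ab geny)) u"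
  proof (rule ppA.hom_eq_subst[where h = "\<lambda>u. k2.ev2 ?F ?G (ab u)"])
    fix u v c
    show "k2.ev2 ?F ?G (ab (u + v)) = k2.ev2 ?F ?G (ab u) + k2.ev2 ?F ?G (ab v)" by (simp only: ab_add k2.ev2_add)
    show "k2.ev2 ?F ?G (ab (u * v)) = k2.ev2 ?F ?G (ab u) * k2.ev2 ?F ?G (ab v)" by (simp only: ab_mult k2.ev2_mult)
    show "k2.ev2 ?F ?G (ab (scal c * u)) = Polynomial.smult [:c:] (k2.ev2 ?F ?G (ab u))"
      by (simp only: ab_scal_mult smult_cst k2.ev2_mult ec)
  qed (simp add: ab_1 e1)
  then show ?thesis using 1 x by simp
qed

lemma chain_rule:
  "dX (k2.ev2 F G P) = k2.ev2 F G (dX P) * dX F + k2.ev2 F G (dY P) * dX G"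
  "dY (k2.ev2 F G P) = k2.ev2 F G (dX P) * dY F + k2.ev2 F G (dY P) * dY G"
proof -
  have gen: "d (k2.ev2 F G P) = k2.ev2 F G (dX P) * d F + k2.ev2 F G (dY P) * d G"
    if d: "!!A B. d (A * B) = d A * B + A * d B" "!!A B. d (A + B) = d A + d B" "!!c. d (cst c) = 0"
    for d :: "cpp => cpp"
  proof (induction P rule: cpp_induct)
    case zero
    have "d 0 = 0" using d(3)[of 0] by (simp add: cst_simps)
    then show ?case by (simp add: k2.ev2_0 dX_0 dY_0)
  next
    case (add P Q)
    then show ?case by (simp add: k2.ev2_add d(2) dX_add dY_add algebra_simps)
  next
    case (mon c i j)
    have d1: "d 1 = 0" using d(3)[of 1] by (simp add: cst_simps)
    note dp = deriv_power[of d, OF d(1) d1]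
    have "d (cst c * F ^ i * G ^ j) = cst c * (of_nat i * F ^ (i - 1) * d F) * G ^ j + cst c * F ^ i * (of_nat j * G ^ (j - 1) * d G)"
      by (simp add: d(1,3) dp)
    also have "\<dots> = (of_nat i * cst c) * F ^ (i - 1) * G ^ j * d F + (of_nat j * cst c) * F ^ i * G ^ (j - 1) * d G"
      by (simp only: ac_simps)
    finally show ?case by (simp only: dX_mon dY_mon ev2_mon of_nat_cst)
  qed
  show "dX (k2.ev2 F G P) = k2.ev2 F G (dX P) * dX F + k2.ev2 F G (dY P) * dX G"
    by (rule gen) (simp_all add: dX_mult dX_add dX_mon cst_simps)
  show "dY (k2.ev2 F G P) = k2.ev2 F G (dX P) * dY F + k2.ev2 F G (dY P) * dY G"
    by (rule gen) (simp_all add: dY_mult dY_add dY_mon cst_simps)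
qed

text \<open>The Jacobian is a unit by the chain rule, hence of degree zero.\<close>

lemma jac_constant:
  assumes "\<sigma> \<in> carrier grpG"
  obtains j where "j \<noteq> 0" "jac (ab (\<sigma> genx)) (ab (\<sigma> geny)) = cst j"
proof -
  let ?F = "ab (\<sigma> genx)" and ?G = "ab (\<sigma> geny)"
  obtain \<tau> where t: "\<sigma> \<circ> \<tau> = id" using inverse_in_G[OF assms] by blast
  then have st: "\<sigma> (\<tau> u) = u" for u by (simp add: fun_eq_iff)
  note h = G_alg_hom[OF assms]
  have X: "vX = k2.ev2 ?F ?G (ab (\<tau> genx))" and Y: "vY = k2.ev2 ?F ?G (ab (\<tau> geny))"
    using ab_alg_hom[OF h, of "\<tau> genx"] ab_alg_hom[OF h, of "\<tau> geny"] st by simp_all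
  have "jac vX vY = 1" by (simp add: jac_def dX_mon dY_mon cst_simps)
  then have "1 = jac (k2.ev2 ?F ?G (ab (\<tau> genx))) (k2.ev2 ?F ?G (ab (\<tau> geny)))" using X Y by simp
  also have "\<dots> = k2.ev2 ?F ?G (jac (ab (\<tau> genx)) (ab (\<tau> geny))) * jac ?F ?G" (is "_ = ?K * _")
  proof -
    have m: "k2.ev2 ?F ?G (A - B) = k2.ev2 ?F ?G A - k2.ev2 ?F ?G B" for A B
      using k2.ev2_add[of ?F ?G "A - B" B] by (simp add: algebra_simps)
    show ?thesis unfolding jac_def chain_rule m k2.ev2_mult by (simp add: algebra_simps)
  qed
  finally have e: "?K * jac ?F ?G = 1" by simp
  then have "homog ?K * homog (jac ?F ?G) = 1" by (metis homog_mult homog_1)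
  moreover have "?K \<noteq> 0" "jac ?F ?G \<noteq> 0" using e by auto
  ultimately have "tdeg (jac ?F ?G) = 0"
    unfolding tdeg_def by (metis add_is_0 degree_1 degree_mult_eq homog_eq_0)
  then obtain j where "jac ?F ?G = cst j" by (auto simp: tdeg_0_iff)
  moreover from this have "j \<noteq> 0" using \<open>jac ?F ?G \<noteq> 0\<close> by (auto simp: cst_simps)
  ultimately show ?thesis using that by blast
qed

lemma cf_ab_linear: "cf (ab u) 1 0 = lkp u (Word [LX])" "cf (ab u) 0 1 = lkp u (Word [LY])"
proof -
  have w: "ab (wd l) = mon 1 (count_list l LX) (count_list l LY)" for l
  proof (induction l)
    case Nil
    then show ?case by (simp add: wd_Nil ab_1 cst_simps)
  next
    case (Cons x l)
    then show ?case by (cases x) (simp_all add: wd_LX wd_LY ab_mult mon_mult)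
  qed
  have len: "length l = count_list l LX + count_list l LY" for l
  proof (induction l)
    case (Cons x l)
    then show ?case by (cases x) auto
  qed simp
  have l1: "(1 = count_list l LX \<and> 0 = count_list l LY) = (l = [LX])" "(0 = count_list l LX \<and> 1 = count_list l LY) = (l = [LY])" for l
  proof -
    have "\<exists>x. l = [x]" if "length l = 1" using that by (cases l) auto
    then show "(1 = count_list l LX \<and> 0 = count_list l LY) = (l = [LX])" "(0 = count_list l LX \<and> 1 = count_list l LY) = (l = [LY])"
      using len[of l] by (auto split: if_splits)
  qed
  have s: "lkp (scal c * wd l) (Word m) = (if m = l then c else 0)" for c l m
    by (auto simp: scal_times_wd lookup_single when_def)
  show "cf (ab u) 1 0 = lkp u (Word [LX])"
  proof (induction u rule: falg_induct)
    case (word c l)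
    then show ?case unfolding ab_scal_mult w s mon_mult cf_mon using l1(1)[of l] by auto
  qed (simp_all add: ab_add cf_add lookup_add, simp add: ab_def cf_def)
  show "cf (ab u) 0 1 = lkp u (Word [LY])"
  proof (induction u rule: falg_induct)
    case (word c l)
    then show ?case unfolding ab_scal_mult w s mon_mult cf_mon using l1(2)[of l] by auto
  qed (simp_all add: ab_add cf_add lookup_add, simp add: ab_def cf_def)
qed

lemma lkp_xy: "lkp (u * v) (Word [LX, LY]) =
   lkp u (Word []) * lkp v (Word [LX, LY]) + lkp u (Word [LX]) * lkp v (Word [LY]) + lkp u (Word [LX, LY]) * lkp v (Word [])"
proof -
  have s: "lkp (scal c * wd l) (Word m) = (if m = l then c else 0)" for c l m
    by (auto simp: scal_times_wd lookup_single when_def)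
  show ?thesis
  proof (induction u rule: falg_induct)
    case (word c l)
    show ?case
    proof (induction v rule: falg_induct)
      case (word d m)
      have "[LX, LY] = l @ m \<longleftrightarrow> l = [] \<and> m = [LX, LY] \<or> l = [LX] \<and> m = [LY] \<or> l = [LX, LY] \<and> m = []"
        by (cases l; cases "tl l") (auto simp: Cons_eq_append_conv)
      then show ?case unfolding word_times_word s by auto
    qed (simp_all add: distrib_left lookup_add algebra_simps)
  qed (simp_all add: distrib_right lookup_add algebra_simps)
qed

text \<open>The coefficient of the word xy in \<sigma> c = c.\<close>

lemma det_eq_1:
  assumes "\<sigma> \<in> carrier grpG"
  shows "cf (ab (\<sigma> genx)) 1 0 * cf (ab (\<sigma> geny)) 0 1 - cf (ab (\<sigma> genx)) 0 1 * cf (ab (\<sigma> geny)) 1 0 = 1"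
proof -
  have h: "alg_hom \<sigma>" "\<sigma> comm = comm" using assms by (simp_all add: mem_G)
  have "\<sigma> genx * \<sigma> geny - \<sigma> geny * \<sigma> genx = comm"
    using h(2) by (simp add: comm_def alg_hom_diff[OF h(1)] alg_hom_mult[OF h(1)])
  moreover have "lkp comm (Word [LX, LY]) = 1"
    by (simp add: comm_def lookup_minus genx_wd geny_wd wd_def mult_single plus_fword_def lookup_single when_def)
  ultimately have "lkp (\<sigma> genx * \<sigma> geny - \<sigma> geny * \<sigma> genx) (Word [LX, LY]) = 1" by simp
  then show ?thesis
    unfolding cf_ab_linear lookup_minus lkp_xy by (simp add: algebra_simps)
qed

lemma cf_tdeg: "cf F i j \<noteq> 0 ==> i + j \<le> tdeg F"
proof -
  assume nz: "cf F i j \<noteq> 0"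
  have "cf (poly.coeff (homog F) (i + j)) i j = cf F i j"
    by (induction F rule: cpp_induct) (auto simp: homog_0 cf_mon homog_mon homog_add cf_add)
  then have "poly.coeff (homog F) (i + j) \<noteq> 0" using nz by auto
  then show ?thesis unfolding tdeg_def by (rule le_degree)
qed

lemma affine_form:
  assumes "tdeg F \<le> 1"
  shows "F = cst (cf F 1 0) * vX + cst (cf F 0 1) * vY + cst (cf F 0 0)"
proof (rule cpp_eqI)
  fix i j
  have "cf F i j = 0" if "i + j > 1" using cf_tdeg[of F i j] assms that by fastforce
  then show "cf F i j = cf (cst (cf F 1 0) * vX + cst (cf F 0 1) * vY + cst (cf F 0 0)) i j"
    by (cases "i + j > 1") (auto simp: mon_mult cf_add cf_mon, (cases i; cases j; simp)+)
qed

interpretation k1: const_hom "\<lambda>c::complex. c"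
  by unfold_locales simp_all

lemma ev_diag_ab: "ev X Y u 0 0 = k1.ev2 (X 0) (Y 0) (ab u)"
proof (induction u rule: falg_induct)
  case (word c l)
  have "ev X Y (wd l) 0 0 = k1.ev2 (X 0) (Y 0) (ab (wd l))"
  proof (induction l)
    case Nil
    have "k1.ev2 (X 0) (Y 0) (mon 1 0 0) = 1" unfolding k1.ev2_mon by simp
    then show ?case by (simp add: wd_Nil ab_1 ev_1 cst_simps)
  next
    case (Cons x l)
    then show ?case
      by (cases x) (simp_all add: wd_LX wd_LY ab_mult ev_mult ev_genx ev_geny k1.ev2_mult k1.ev2_mon)
  qed
  moreover have "k1.ev2 (X 0) (Y 0) (cst c) = c" unfolding k1.ev2_mon by simp
  ultimately show ?case unfolding ab_scal_mult ev_scal k1.ev2_mult by simp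
qed (simp_all add: ab_add ev_add k1.ev2_add, simp add: ab_def k1.ev2_0)

lemma trivial_ab_imp_one:
  assumes "\<sigma> \<in> carrier grpG" "ab (\<sigma> genx) = vX" "ab (\<sigma> geny) = vY"
  shows "\<sigma> = id"
proof -
  obtain \<tau> where t: "\<tau> \<in> carrier grpG" "\<tau> \<circ> \<sigma> = id" "\<sigma> \<circ> \<tau> = id" using inverse_in_G[OF assms(1)] by blast
  have "\<sigma> u = u" for u
  proof (rule trivial_abelianization_imp_id)
    show "alg_hom \<sigma>" "alg_hom \<tau>" "\<sigma> comm = comm" using assms(1) t(1) by (simp_all add: mem_G)
    show "\<sigma> (\<tau> u) = u" "\<tau> (\<sigma> u) = u" for u using t by (simp_all add: fun_eq_iff)
    show "ev X Y (\<sigma> genx) 0 0 = X 0" "ev X Y (\<sigma> geny) 0 0 = Y 0" for X Y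
      unfolding ev_diag_ab assms k1.ev2_mon by simp_all
  qed
  then show ?thesis by (simp add: fun_eq_iff)
qed

lemma setA_G: "setA \<subseteq> carrier grpG" and setB_G: "setB \<subseteq> carrier grpG"
  by (auto simp: setA_iff setB_iff)

text \<open>After composing with the affine automorphism that has the same abelianization the
  previous theory of automorphisms with trivial abelianization applies.\<close>

lemma affine_ab_imp_A:
  assumes \<sigma>: "\<sigma> \<in> carrier grpG" and deg: "tdeg (ab (\<sigma> genx)) \<le> 1" "tdeg (ab (\<sigma> geny)) \<le> 1"
  shows "\<sigma> \<in> setA"
proof -
  let ?F = "ab (\<sigma> genx)" and ?G = "ab (\<sigma> geny)"
  define a b e c d f where coeffs: "a = cf ?F 1 0" "b = cf ?F 0 1" "e = cf ?F 0 0" "c = cf ?G 1 0" "d = cf ?G 0 1" "f = cf ?G 0 0"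
  have det: "a * d - b * c = 1" using det_eq_1[OF \<sigma>] by (simp only: coeffs)
  have F: "?F = cst a * vX + cst b * vY + cst e" "?G = cst c * vX + cst d * vY + cst f"
    unfolding coeffs by (rule affine_form[OF deg(1)], rule affine_form[OF deg(2)])
  obtain \<alpha> where \<alpha>: "\<alpha> \<in> setA" "\<alpha> genx = scal a * genx + scal b * geny + scal e" "\<alpha> geny = scal c * genx + scal d * geny + scal f"
    using affine_in_A[OF det] by blast
  then have \<alpha>G: "\<alpha> \<in> carrier grpG" using setA_G by blast
  obtain \<beta> where \<beta>: "\<beta> \<in> carrier grpG" "\<beta> \<circ> \<alpha> = id" "\<alpha> \<circ> \<beta> = id" using inverse_in_G[OF \<alpha>G] by blast
  note hb = G_alg_hom[OF \<beta>(1)]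
  have bx: "scal a * \<beta> genx + scal b * \<beta> geny + scal e = genx" "scal c * \<beta> genx + scal d * \<beta> geny + scal f = geny"
    using arg_cong[OF \<alpha>(2), of \<beta>] arg_cong[OF \<alpha>(3), of \<beta>] \<beta>(2)
    by (simp_all add: fun_eq_iff alg_hom_add[OF hb] alg_hom_scal[OF hb] alg_hom_scal0[OF hb] del: scal_1)
  define \<tau> where "\<tau> = \<sigma> \<circ> \<beta>"
  have \<tau>: "\<tau> \<in> carrier grpG" using G.m_closed[OF \<sigma> \<beta>(1)] by (simp add: \<tau>_def)
  note hs = G_alg_hom[OF \<sigma>]
  have t: "scal a * \<tau> genx + scal b * \<tau> geny + scal e = \<sigma> genx" "scal c * \<tau> genx + scal d * \<tau> geny + scal f = \<sigma> geny"
    using arg_cong[OF bx(1), of \<sigma>] arg_cong[OF bx(2), of \<sigma>]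
    by (simp_all add: \<tau>_def alg_hom_add[OF hs] alg_hom_scal[OF hs] alg_hom_scal0[OF hs])
  let ?P = "ab (\<tau> genx)" and ?Q = "ab (\<tau> geny)"
  have e1: "cst a * ?P + cst b * ?Q = cst a * vX + cst b * vY" "cst c * ?P + cst d * ?Q = cst c * vX + cst d * vY"
    using arg_cong[OF t(1), of ab] arg_cong[OF t(2), of ab] unfolding F by (simp_all add: ab_add ab_scal_mult ab_scal)
  have cdet: "cst a * cst d - cst b * cst c = 1"
    using det by (simp add: mon_def monom_0 one_pCons)
  have "?P = (cst a * cst d - cst b * cst c) * ?P" by (simp add: cdet)
  also have "\<dots> = cst d * (cst a * ?P + cst b * ?Q) - cst b * (cst c * ?P + cst d * ?Q)" by (simp add: algebra_simps)
  also have "\<dots> = (cst a * cst d - cst b * cst c) * vX" unfolding e1 by (simp add: algebra_simps)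
  finally have P: "?P = vX" by (simp add: cdet)
  have "?Q = (cst a * cst d - cst b * cst c) * ?Q" by (simp add: cdet)
  also have "\<dots> = cst a * (cst c * ?P + cst d * ?Q) - cst c * (cst a * ?P + cst b * ?Q)" by (simp add: algebra_simps)
  also have "\<dots> = (cst a * cst d - cst b * cst c) * vY" unfolding e1 by (simp add: algebra_simps)
  finally have Q: "?Q = vY" by (simp add: cdet)
  have "\<tau> = id" by (rule trivial_ab_imp_one[OF \<tau> P Q])
  then have "\<sigma> = \<alpha>" unfolding \<tau>_def using \<beta>(2) by (metis comp_assoc comp_id id_comp)
  then show ?thesis using \<alpha> by simp
qed

text \<open>Induction on the sum of the degrees of the two polynomials in the abelianization. A
  reduction of the first polynomial is effected by an elementary element of B, one of the second
  polynomial after exchanging the variables by an element of A.\<close>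

theorem generated_by_A_B:
  assumes "\<sigma> \<in> carrier grpG"
  shows "\<sigma> \<in> generate grpG (setA \<union> setB)"
  using assms
proof (induction "tdeg (ab (\<sigma> genx)) + tdeg (ab (\<sigma> geny))" arbitrary: \<sigma> rule: less_induct)
  case less
  let ?F = "ab (\<sigma> genx)" and ?G = "ab (\<sigma> geny)"
  let ?H = "generate grpG (setA \<union> setB)"
  have sub: "subgroup ?H grpG" by (rule G.generate_is_subgroup) (use setA_G setB_G in blast)
  have cancel: "\<sigma> \<in> ?H" if "\<rho> \<in> ?H" "\<sigma> \<circ> \<rho> \<in> ?H" for \<rho>
  proof -
    have r: "\<rho> \<in> carrier grpG" using that(1) sub by (metis subgroup.mem_carrier)
    have "\<sigma> = (\<sigma> \<odot> \<rho>) \<odot> ginv \<rho>"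
      using less.prems r by (simp add: G.m_assoc del: mult_G one_G)
    also have "\<dots> \<in> ?H" using subgroup.m_closed[OF sub that(2) subgroup.m_inv_closed[OF sub that(1)]] by simp
    finally show ?thesis .
  qed
  note h = G_alg_hom[OF less.prems]
  have elem: "\<exists>\<rho>\<in>?H. \<rho> \<in> carrier grpG \<and> \<rho> genx = genx + scal c * geny ^ k \<and> \<rho> geny = geny" for c k
  proof -
    obtain \<beta> where "\<beta> \<in> setB" "\<beta> genx = genx + scal c * geny ^ k" "\<beta> geny = geny" using elementary_in_B by blast
    then show ?thesis using setB_G by (intro bexI[of _ \<beta>]) (auto intro: generate.incl)
  qed
  have swap: "\<exists>\<rho>\<in>?H. \<rho> \<in> carrier grpG \<and> \<rho> genx = geny \<and> \<rho> geny = - genx"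
  proof -
    obtain \<alpha> where "\<alpha> \<in> setA" "\<alpha> genx = scal 0 * genx + scal 1 * geny + scal 0" "\<alpha> geny = scal (-1) * genx + scal 0 * geny + scal 0"
      by (rule affine_in_A[of 0 0 1 "-1" 0 0]) auto
    then show ?thesis using setA_G by (intro bexI[of _ \<alpha>]) (auto intro: generate.incl simp: scal_uminus)
  qed
  have fx: "\<sigma> (u + scal c * v ^ k) = \<sigma> u + scal c * \<sigma> v ^ k" for u v c k
  proof -
    have "\<sigma> (v ^ k) = \<sigma> v ^ k" by (induction k) (simp_all add: alg_hom_1[OF h] alg_hom_mult[OF h])
    then show ?thesis by (simp add: alg_hom_add[OF h] alg_hom_scal[OF h])
  qed
  have tneg: "tdeg (- K) = tdeg K" for K by (simp add: tdeg_def homog_uminus)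
  have neg: "\<sigma> (- u) = - \<sigma> u" for u using alg_hom_diff[OF h, of 0 u] by (simp add: alg_hom_0[OF h])
  show ?case
  proof (cases "tdeg ?F + tdeg ?G > 2")
    case True
    obtain j where j: "j \<noteq> 0" "jac ?F ?G = cst j" using jac_constant[OF less.prems] by blast
    obtain \<tau> where "\<sigma> \<circ> \<tau> = id" using inverse_in_G[OF less.prems] by blast
    then have "k2.ev2 ?F ?G (ab (\<tau> genx)) = vX"
      using ab_alg_hom[OF h, of "\<tau> genx"] by (simp add: fun_eq_iff)
    from degree_reduction[OF j(2,1) this True] show ?thesis
    proof (elim disjE exE)
      fix c k assume lt: "tdeg (?F - cst c * ?G ^ k) < tdeg ?F"
      obtain \<rho> where \<rho>: "\<rho> \<in> ?H" "\<rho> \<in> carrier grpG" "\<rho> genx = genx + scal (- c) * geny ^ k" "\<rho> geny = geny"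
        using elem[of "- c" k] by blast
      have "ab (\<sigma> (\<rho> genx)) = ?F - cst c * ?G ^ k"
        unfolding \<rho>(3) fx ab_add ab_scal_mult ab_power by (simp add: mon_def monom_0)
      then have "\<sigma> \<circ> \<rho> \<in> ?H"
        using lt G.m_closed[OF less.prems \<rho>(2)] by (intro less.hyps) (simp_all add: \<rho>(4))
      then show ?thesis using cancel \<rho>(1) by blast
    next
      fix c k assume lt: "tdeg (?G - cst c * ?F ^ k) < tdeg ?G"
      obtain \<rho> where \<rho>: "\<rho> \<in> ?H" "\<rho> \<in> carrier grpG" "\<rho> genx = genx + scal (- c * (- 1) ^ k) * geny ^ k" "\<rho> geny = geny"
        using elem[of "- c * (- 1) ^ k" k] by blast
      obtain w where w: "w \<in> ?H" "w \<in> carrier grpG" "w genx = geny" "w geny = - genx" using swap by blast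
      have "ab (\<sigma> (w (\<rho> genx))) = ?G - cst c * ?F ^ k"
      proof -
        note hw = G_alg_hom[OF w(2)]
        have wp: "w (geny ^ k) = (- genx) ^ k" by (induction k) (simp_all add: alg_hom_1[OF hw] alg_hom_mult[OF hw] w)
        have "w (\<rho> genx) = geny + scal (- c * (- 1) ^ k) * (- genx) ^ k"
          by (simp only: \<rho>(3) alg_hom_add[OF hw] alg_hom_scal[OF hw] w wp)
        then have "ab (\<sigma> (w (\<rho> genx))) = ?G + cst (- c * (- 1) ^ k) * (- ?F) ^ k"
          by (simp only: fx neg ab_add ab_scal_mult ab_power ab_uminus)
        also have "\<dots> = ?G - cst c * ?F ^ k"
        proof -
          have "cst (- c * (- 1) ^ k) = - (cst c * (- 1) ^ k)"
            by (cases "even k") (simp_all add: mon_def monom_0)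
          moreover have "(- ?F) ^ k = (- 1) ^ k * ?F ^ k" by (rule power_minus)
          ultimately show ?thesis by (cases "even k") simp_all
        qed
        finally show ?thesis .
      qed
      moreover have "ab (\<sigma> (w (\<rho> geny))) = - ?F" by (simp add: \<rho>(4) w(4) neg ab_uminus)
      moreover have wr: "w \<circ> \<rho> \<in> ?H" "w \<circ> \<rho> \<in> carrier grpG"
        using subgroup.m_closed[OF sub w(1) \<rho>(1)] G.m_closed[OF w(2) \<rho>(2)] by simp_all
      ultimately have "\<sigma> \<circ> (w \<circ> \<rho>) \<in> ?H"
        using lt G.m_closed[OF less.prems wr(2)] by (intro less.hyps) (simp_all add: tneg)
      then show ?thesis using cancel wr(1) by blast
    qed
  next
    case False
    obtain j where j: "j \<noteq> 0" "jac ?F ?G = cst j" using jac_constant[OF less.prems] by blast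
    have "cst j \<noteq> 0" using j by (simp add: mon_def monom_0)
    then have "tdeg ?F \<noteq> 0" "tdeg ?G \<noteq> 0" using j jac_cst by (auto simp: tdeg_0_iff)
    then have "\<sigma> \<in> setA" using False by (intro affine_ab_imp_A less.prems) auto
    then show ?thesis by (auto intro: generate.incl)
  qed
qed

section \<open>Amalgams and cocycles\<close>

definition lprod :: "('g, 'm) monoid_scheme => 'g list => 'g" where
  "lprod G w = foldr (\<lambda>g h. g \<otimes>\<^bsub>G\<^esub> h) w \<one>\<^bsub>G\<^esub>"

lemma lprod_simps [simp]: "lprod G [] = \<one>\<^bsub>G\<^esub>" "lprod G (g # w) = g \<otimes>\<^bsub>G\<^esub> lprod G w"
  by (simp_all add: lprod_def)

lemma (in monoid) lprod_closed_carrier: "set w \<subseteq> carrier G ==> lprod G w \<in> carrier G"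
  by (induction w) auto

lemma (in monoid) lprod_append_carrier:
  "set v \<subseteq> carrier G ==> set w \<subseteq> carrier G ==> lprod G (v @ w) = lprod G v \<otimes> lprod G w"
  by (induction v) (auto simp: m_assoc lprod_closed_carrier)

text \<open>Neighbouring factors lie in different ones of the two sets, and none lies in
  both.\<close>

definition alternating :: "'g set => 'g set => 'g list => bool" where
  "alternating A B w \<longleftrightarrow> set w \<subseteq> A \<union> B \<and> successively (\<lambda>g h. \<not> (g \<in> A \<and> h \<in> A) \<and> \<not> (g \<in> B \<and> h \<in> B)) w"

text \<open>By the normal form theorem these conditions characterize the amalgamated products of
  A and B along A \<inter> B inside a group.\<close>

locale amalgam = group G for G (structure) +
  fixes A B :: "'a set"
  assumes A: "subgroup A G" and B: "subgroup B G"
    and gen: "carrier G = generate G (A \<union> B)"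
    and reduced: "!!w. alternating A B w ==> 2 \<le> length w ==> lprod G w \<noteq> \<one>"
begin

lemma AB_carrier: "A \<subseteq> carrier G" "B \<subseteq> carrier G"
  using A B by (simp_all add: subgroup.subset)

lemma lprod_closed: "set w \<subseteq> A \<union> B ==> lprod G w \<in> carrier G"
  by (rule lprod_closed_carrier) (use AB_carrier in auto)

lemma lprod_append:
  assumes "set v \<subseteq> A \<union> B" "set w \<subseteq> A \<union> B"
  shows "lprod G (v @ w) = lprod G v \<otimes> lprod G w"
  by (rule lprod_append_carrier) (use assms AB_carrier in auto)

lemma word_exists:
  assumes "g \<in> carrier G"
  obtains w where "set w \<subseteq> A \<union> B" "lprod G w = g"
proof -
  have "g \<in> generate G (A \<union> B)" using assms gen by simp
  then have "\<exists>w. set w \<subseteq> A \<union> B \<and> lprod G w = g"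
  proof (induction rule: generate.induct)
    case one
    show ?case by (intro exI[of _ "[]"]) simp
  next
    case (incl h)
    then show ?case using AB_carrier by (intro exI[of _ "[h]"]) auto
  next
    case (inv h)
    then have "inv h \<in> A \<union> B" using A B by (auto simp: subgroup.m_inv_closed)
    then show ?case using AB_carrier by (intro exI[of _ "[inv h]"]) auto
  next
    case (eng h1 h2)
    then obtain v w where "set v \<subseteq> A \<union> B" "lprod G v = h1" "set w \<subseteq> A \<union> B" "lprod G w = h2" by blast
    then show ?case using lprod_append by (intro exI[of _ "v @ w"]) auto
  qed
  then show ?thesis using that by blast
qed

end

text \<open>Two cocycles on the subgroups that agree on the intersection. In the groupoid of the
  action they are the data of a functor to P on a generating part.\<close>

locale amalgam_action = amalgam G A B + P: group P
  for G (structure) and A B and P :: "('p, 'n) monoid_scheme" +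
  fixes X :: "'x set" and act :: "'a => 'x => 'x" and cA cB :: "'a => 'x => 'p"
  assumes act_closed: "!!g x. g \<in> carrier G ==> x \<in> X ==> act g x \<in> X"
    and act_one: "!!x. x \<in> X ==> act \<one> x = x"
    and act_mult: "!!g h x. g \<in> carrier G ==> h \<in> carrier G ==> x \<in> X ==> act (g \<otimes> h) x = act g (act h x)"
    and cA_closed: "!!g x. g \<in> A ==> x \<in> X ==> cA g x \<in> carrier P"
    and cA_mult: "!!g h x. g \<in> A ==> h \<in> A ==> x \<in> X ==> cA (g \<otimes> h) x = cA g (act h x) \<otimes>\<^bsub>P\<^esub> cA h x"
    and cB_closed: "!!g x. g \<in> B ==> x \<in> X ==> cB g x \<in> carrier P"
    and cB_mult: "!!g h x. g \<in> B ==> h \<in> B ==> x \<in> X ==> cB (g \<otimes> h) x = cB g (act h x) \<otimes>\<^bsub>P\<^esub> cB h x"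
    and cAB: "!!g x. g \<in> A ==> g \<in> B ==> x \<in> X ==> cA g x = cB g x"
begin

definition c1 :: "'a => 'x => 'p" where
  "c1 g x = (if g \<in> A then cA g x else cB g x)"

lemma c1_A: "g \<in> A ==> c1 g x = cA g x" and c1_B: "g \<in> B ==> x \<in> X ==> c1 g x = cB g x"
  by (auto simp: c1_def cAB)

lemma c1_closed: "g \<in> A \<union> B ==> x \<in> X ==> c1 g x \<in> carrier P"
  by (auto simp: c1_def cA_closed cB_closed)

lemma c1_mult:
  assumes "g \<in> A \<and> h \<in> A \<or> g \<in> B \<and> h \<in> B" "x \<in> X"
  shows "c1 (g \<otimes> h) x = c1 g (act h x) \<otimes>\<^bsub>P\<^esub> c1 h x"
  using assms(1)
proof
  assume "g \<in> A \<and> h \<in> A"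
  then show ?thesis using assms(2) subgroup.m_closed[OF A] by (simp add: c1_A cA_mult)
next
  assume gh: "g \<in> B \<and> h \<in> B"
  then have "act h x \<in> X" using AB_carrier assms(2) by (intro act_closed) auto
  then show ?thesis using gh assms(2) subgroup.m_closed[OF B] by (simp add: c1_B cB_mult)
qed

lemma c1_one: "x \<in> X ==> c1 \<one> x = \<one>\<^bsub>P\<^esub>"
proof -
  assume x: "x \<in> X"
  have o: "\<one> \<in> A" using A by (simp add: subgroup.one_closed)
  then have "c1 (\<one> \<otimes> \<one>) x = c1 \<one> (act \<one> x) \<otimes>\<^bsub>P\<^esub> c1 \<one> x" using x by (intro c1_mult) auto
  then have "c1 \<one> x = c1 \<one> x \<otimes>\<^bsub>P\<^esub> c1 \<one> x" using x by (simp add: act_one)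
  moreover have "c1 \<one> x \<in> carrier P" using c1_closed x o by simp
  ultimately show ?thesis by (metis P.l_cancel_one')
qed

fun cw :: "'a list => 'x => 'p" where
  "cw [] x = \<one>\<^bsub>P\<^esub>"
| "cw (g # w) x = c1 g (act (lprod G w) x) \<otimes>\<^bsub>P\<^esub> cw w x"

lemma cw_closed: "set w \<subseteq> A \<union> B ==> x \<in> X ==> cw w x \<in> carrier P"
  by (induction w) (auto simp: c1_closed act_closed lprod_closed)

lemma cw_append:
  assumes "set v \<subseteq> A \<union> B" "set w \<subseteq> A \<union> B" "x \<in> X"
  shows "cw (v @ w) x = cw v (act (lprod G w) x) \<otimes>\<^bsub>P\<^esub> cw w x"
  using assms(1)
proof (induction v)
  case (Cons g v)
  have x': "act (lprod G w) x \<in> X" using assms by (simp add: act_closed lprod_closed)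
  have "act (lprod G (v @ w)) x = act (lprod G v) (act (lprod G w) x)"
    using Cons.prems assms by (simp add: lprod_append act_mult lprod_closed)
  moreover have "c1 g (act (lprod G v) (act (lprod G w) x)) \<in> carrier P"
    using Cons.prems by (intro c1_closed act_closed[OF _ x'] lprod_closed) auto
  ultimately show ?case
    using Cons x' assms by (simp add: P.m_assoc cw_closed)
qed (use assms cw_closed in simp)

text \<open>A word with trivial product of length at least two is not alternating, so two
  neighbours can be multiplied inside A or inside B, which changes neither the product nor the
  value.\<close>

lemma cw_trivial:
  assumes "set w \<subseteq> A \<union> B" "lprod G w = \<one>" "x \<in> X"
  shows "cw w x = \<one>\<^bsub>P\<^esub>"
  using assms
proof (induction "length w" arbitrary: w rule: less_induct)
  case less
  consider "w = []" | g where "w = [g]" | "2 \<le> length w"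
    by (cases w; cases "tl w") auto
  then show ?case
  proof cases
    case 2
    then have "g = \<one>" using less.prems AB_carrier by auto
    then show ?thesis using 2 less.prems by (simp add: c1_one act_one)
  next
    case 3
    then have "\<not> alternating A B w" using reduced less.prems by blast
    then have "\<not> successively (\<lambda>g h. \<not> (g \<in> A \<and> h \<in> A) \<and> \<not> (g \<in> B \<and> h \<in> B)) w"
      using less.prems by (simp add: alternating_def)
    then obtain v g h w' where w: "w = v @ g # h # w'" and gh: "g \<in> A \<and> h \<in> A \<or> g \<in> B \<and> h \<in> B"
    proof -
      have "\<exists>v g h w'. w = v @ g # h # w' \<and> (g \<in> A \<and> h \<in> A \<or> g \<in> B \<and> h \<in> B)"
        if "\<not> successively (\<lambda>g h. \<not> (g \<in> A \<and> h \<in> A) \<and> \<not> (g \<in> B \<and> h \<in> B)) w" for w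
        using that
      proof (induction w rule: induct_list012)
        case (3 g h w)
        show ?case
        proof (cases "g \<in> A \<and> h \<in> A \<or> g \<in> B \<and> h \<in> B")
          case True
          then show ?thesis by (intro exI[of _ "[]"]) auto
        next
          case False
          then have "\<not> successively (\<lambda>g h. \<not> (g \<in> A \<and> h \<in> A) \<and> \<not> (g \<in> B \<and> h \<in> B)) (h # w)" using 3(3) by auto
          then obtain v a b w' where "h # w = v @ a # b # w'" "a \<in> A \<and> b \<in> A \<or> a \<in> B \<and> b \<in> B" using 3 by blast
          then show ?thesis by (intro exI[of _ "g # v"]) auto
        qed
      qed auto
      then show ?thesis using that \<open>\<not> successively _ w\<close> by blast
    qed
    let ?w = "v @ (g \<otimes> h) # w'"
    have gh': "g \<otimes> h \<in> A \<union> B" using gh A B by (auto simp: subgroup.m_closed)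
    have sub: "set v \<subseteq> A \<union> B" "set w' \<subseteq> A \<union> B" "g \<in> A \<union> B" "h \<in> A \<union> B" using less.prems w by auto
    have ghc: "g \<in> carrier G" "h \<in> carrier G" using sub AB_carrier by auto
    have s1: "set (g # h # w') \<subseteq> A \<union> B" "set ((g \<otimes> h) # w') \<subseteq> A \<union> B" using sub gh' by auto
    have "lprod G ((g \<otimes> h) # w') = lprod G (g # h # w')"
      using ghc lprod_closed[OF sub(2)] by (simp add: m_assoc)
    then have l: "lprod G ?w = \<one>"
      using less.prems(2) lprod_append[OF sub(1) s1(1)] lprod_append[OF sub(1) s1(2)] w by simp
    have x': "act (lprod G w') x \<in> X" using less.prems sub by (simp add: act_closed lprod_closed)
    have "cw ((g \<otimes> h) # w') x = cw (g # h # w') x"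
    proof -
      have "act (lprod G (h # w')) x = act h (act (lprod G w') x)"
        using ghc lprod_closed[OF sub(2)] less.prems by (simp add: act_mult)
      then show ?thesis
        using c1_mult[OF gh x'] c1_closed sub x' act_closed[OF ghc(2) x'] cw_closed[OF sub(2) less.prems(3)]
        by (simp add: P.m_assoc)
    qed
    then have "cw w x = cw ?w x"
      using cw_append[OF sub(1) s1(1) less.prems(3)] cw_append[OF sub(1) s1(2) less.prems(3)] w ghc lprod_closed[OF sub(2)]
      by (simp add: m_assoc)
    also have "\<dots> = \<one>\<^bsub>P\<^esub>"
      by (rule less.hyps) (use w l sub gh' less.prems in auto)
    finally show ?thesis .
  qed simp
qed

lemma cw_unique:
  assumes "set v \<subseteq> A \<union> B" "set w \<subseteq> A \<union> B" "lprod G v = lprod G w" "x \<in> X"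
  shows "cw v x = cw w x"
proof -
  obtain u where u: "set u \<subseteq> A \<union> B" "lprod G u = inv (lprod G w)"
    using word_exists[of "inv (lprod G w)"] lprod_closed[OF assms(2)] by auto
  have wc: "lprod G w \<in> carrier G" using lprod_closed assms by blast
  have y: "act (lprod G w) x \<in> X" using wc assms by (simp add: act_closed)
  have "cw (u @ v) x = \<one>\<^bsub>P\<^esub>" "cw (u @ w) x = \<one>\<^bsub>P\<^esub>"
    using u assms wc by (auto intro!: cw_trivial simp: lprod_append)
  then have "cw u (act (lprod G w) x) \<otimes>\<^bsub>P\<^esub> cw v x = cw u (act (lprod G w) x) \<otimes>\<^bsub>P\<^esub> cw w x"
    using cw_append[OF u(1) assms(1,4)] cw_append[OF u(1) assms(2,4)] assms(3) by simp
  then show ?thesis using cw_closed[OF u(1) y] cw_closed[OF assms(1,4)] cw_closed[OF assms(2,4)] by simp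
qed

text \<open>The common extension of the two given cocycles.\<close>

definition cocycle :: "'a => 'x => 'p" where
  "cocycle g x = cw (SOME w. set w \<subseteq> A \<union> B \<and> lprod G w = g) x"

lemma cocycle_word:
  assumes "set w \<subseteq> A \<union> B" "lprod G w = g" "x \<in> X"
  shows "cocycle g x = cw w x"
proof -
  have "set (SOME w. set w \<subseteq> A \<union> B \<and> lprod G w = g) \<subseteq> A \<union> B \<and> lprod G (SOME w. set w \<subseteq> A \<union> B \<and> lprod G w = g) = g"
    by (rule someI[of _ w]) (use assms in auto)
  then show ?thesis unfolding cocycle_def using assms by (intro cw_unique) auto
qed

lemma cocycle_closed:
  assumes "g \<in> carrier G" "x \<in> X"
  shows "cocycle g x \<in> carrier P"
proof -
  obtain w where "set w \<subseteq> A \<union> B" "lprod G w = g" using word_exists[OF assms(1)] by blast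
  then show ?thesis using cocycle_word assms cw_closed by metis
qed

lemma cocycle_mult:
  assumes "g \<in> carrier G" "h \<in> carrier G" "x \<in> X"
  shows "cocycle (g \<otimes> h) x = cocycle g (act h x) \<otimes>\<^bsub>P\<^esub> cocycle h x"
proof -
  obtain v where v: "set v \<subseteq> A \<union> B" "lprod G v = g" using word_exists[OF assms(1)] by blast
  obtain w where w: "set w \<subseteq> A \<union> B" "lprod G w = h" using word_exists[OF assms(2)] by blast
  have "cocycle (g \<otimes> h) x = cw (v @ w) x"
    by (rule cocycle_word) (use v w assms lprod_append in auto)
  also have "\<dots> = cw v (act h x) \<otimes>\<^bsub>P\<^esub> cw w x" using cw_append v w assms by metis
  finally show ?thesis using cocycle_word[OF v act_closed[OF assms(2,3)]] cocycle_word[OF w assms(3)] by simp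
qed

lemma cocycle_A: "g \<in> A ==> x \<in> X ==> cocycle g x = cA g x"
  using cocycle_word[of "[g]" g x] AB_carrier cA_closed by (auto simp: c1_A act_one)

lemma cocycle_B: "g \<in> B ==> x \<in> X ==> cocycle g x = cB g x"
  using cocycle_word[of "[g]" g x] AB_carrier cB_closed by (auto simp: c1_B act_one)

lemma cocycle_one: "x \<in> X ==> cocycle \<one> x = \<one>\<^bsub>P\<^esub>"
  using cocycle_word[of "[]" "\<one>" x] by simp

lemma cocycle_induct:
  assumes "g \<in> carrier G" "x \<in> X"
    and "!!x. x \<in> X ==> Q \<one> x \<one>\<^bsub>P\<^esub>"
    and "!!g x. g \<in> A ==> x \<in> X ==> Q g x (cA g x)"
    and "!!g x. g \<in> B ==> x \<in> X ==> Q g x (cB g x)"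
    and "!!g h x z z'. g \<in> carrier G ==> h \<in> carrier G ==> x \<in> X ==> z \<in> carrier P ==> z' \<in> carrier P ==>
        Q g (act h x) z ==> Q h x z' ==> Q (g \<otimes> h) x (z \<otimes>\<^bsub>P\<^esub> z')"
  shows "Q g x (cocycle g x)"
proof -
  obtain w where w: "set w \<subseteq> A \<union> B" "lprod G w = g" using word_exists[OF assms(1)] by blast
  have "Q (lprod G w) x (cw w x)" using w(1)
  proof (induction w)
    case Nil
    then show ?case using assms(2,3) by simp
  next
    case (Cons g w)
    have y: "act (lprod G w) x \<in> X" using Cons assms by (simp add: act_closed lprod_closed)
    have "Q g (act (lprod G w) x) (c1 g (act (lprod G w) x))"
      using Cons.prems assms(4,5) y by (cases "g \<in> A") (auto simp: c1_A c1_B)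
    then show ?case
      using Cons AB_carrier y assms(2) by (auto intro!: assms(6) lprod_closed c1_closed cw_closed)
  qed
  then show ?thesis using cocycle_word[OF w assms(2)] w(2) by simp
qed

end

section \<open>Alternating products of affine and triangular automorphisms\<close>

lemma alternating_Cons_Cons:
  "alternating A B (g # h # w) \<longleftrightarrow> g \<in> A \<union> B \<and> \<not> (g \<in> A \<and> h \<in> A) \<and> \<not> (g \<in> B \<and> h \<in> B) \<and> alternating A B (h # w)"
  by (auto simp: alternating_def)

lemma pA_subst_polyY:
  assumes "alg_hom \<sigma>"
  shows "pA.subst p q (\<sigma> (polyY h)) = pcompose h (pA.subst p q (\<sigma> geny))"
proof (induction h)
  case (pCons c h)
  then show ?case
    by (simp add: polyY_pCons alg_hom_add[OF assms] alg_hom_mult[OF assms] alg_hom_scal0[OF assms]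
        pA.subst_add pA.subst_mult pA.subst_scal pcompose_pCons mult.commute one_pCons)
qed (simp add: alg_hom_0[OF assms])

lemma A_not_U:
  assumes "\<alpha> \<in> setA" "\<alpha> \<notin> setB"
  obtains a b c d e f where "c \<noteq> 0" "\<alpha> genx = scal a * genx + scal b * geny + scal e"
    "\<alpha> geny = scal c * genx + scal d * geny + scal f"
proof -
  obtain a b c d e f where *: "\<alpha> \<in> carrier grpG" "a * d - b * c = 1" "\<alpha> genx = scal a * genx + scal b * geny + scal e"
    "\<alpha> geny = scal c * genx + scal d * geny + scal f"
    using assms(1) unfolding setA_iff by blast
  have "c \<noteq> 0"
  proof
    assume c: "c = 0"
    then have ad: "a * d = 1" using * by simp
    then have "a \<noteq> 0" "d = inverse a" using inverse_unique[OF ad] by auto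
    moreover have "scal b * geny + scal e = polyY [:e, b:]" by (simp add: polyY_pCons add.commute)
    ultimately have "\<alpha> \<in> setB" unfolding setB_iff using * c
      by (intro conjI exI[of _ a] exI[of _ f] exI[of _ "[:e, b:]"]) (simp_all add: add.assoc)
    then show False using assms(2) by simp
  qed
  then show ?thesis using * that by blast
qed

lemma B_not_U:
  assumes "\<beta> \<in> setB" "\<beta> \<notin> setA"
  obtains a h q where "a \<noteq> 0" "degree q \<ge> 2" "\<beta> genx = scal a * genx + polyY q"
    "\<beta> geny = scal (inverse a) * geny + scal h"
proof -
  obtain a h q where *: "\<beta> \<in> carrier grpG" "a \<noteq> 0" "\<beta> genx = scal a * genx + polyY q"
    "\<beta> geny = scal (inverse a) * geny + scal h"
    using assms(1) unfolding setB_iff by blast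
  have "degree q \<ge> 2"
  proof (rule ccontr)
    assume "\<not> degree q \<ge> 2"
    then have "degree q \<le> 1" by simp
    then have "polyY q = scal (poly.coeff q 0) + scal (poly.coeff q 1) * geny"
      using polyY_superset[of q 1] by (simp add: atMost_Suc)
    then have x: "\<beta> genx = scal a * genx + scal (poly.coeff q 1) * geny + scal (poly.coeff q 0)"
      unfolding *(3) by (simp only: add.assoc add.commute[of "scal (poly.coeff q 0)"])
    have y: "\<beta> geny = scal 0 * genx + scal (inverse a) * geny + scal h" using *(4) by simp
    have "a * inverse a - poly.coeff q 1 * 0 = 1" using *(2) by simp
    then have "\<beta> \<in> setA" unfolding setA_iff using *(1) x y by blast
    then show False using assms(2) by simp
  qed
  then show ?thesis using * that by blast
qed

text \<open>Map the free algebra to \<complex>[t] and follow the degrees of the images of x and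
  y. If x has the larger degree, a factor from A - B gives y this degree; if y has at least the
  degree of x, a factor from B - A multiplies it by at least 2 in the image of x. So the degrees
  never return to 1.\<close>

lemma degree_growth:
  assumes "\<sigma> \<in> carrier grpG" "alternating setA setB w"
    and "(1 \<le> degree (pA.subst p q (\<sigma> geny)) \<and> degree (pA.subst p q (\<sigma> geny)) < degree (pA.subst p q (\<sigma> genx)) \<and> (w \<noteq> [] \<longrightarrow> hd w \<notin> setB)) \<or>
      (1 \<le> degree (pA.subst p q (\<sigma> geny)) \<and> degree (pA.subst p q (\<sigma> genx)) \<le> degree (pA.subst p q (\<sigma> geny)) \<and> (w \<noteq> [] \<longrightarrow> hd w \<notin> setA)
        \<and> (w = [] \<longrightarrow> 2 \<le> degree (pA.subst p q (\<sigma> geny))))"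
  shows "2 \<le> max (degree (pA.subst p q ((\<sigma> \<circ> lprod grpG w) genx))) (degree (pA.subst p q ((\<sigma> \<circ> lprod grpG w) geny)))"
  using assms
proof (induction w arbitrary: \<sigma>)
  case Nil
  then show ?case by auto
next
  case (Cons g w)
  let ?P = "pA.subst p q (\<sigma> genx)" and ?Q = "pA.subst p q (\<sigma> geny)"
  note h = G_alg_hom[OF Cons.prems(1)]
  have gAB: "g \<in> setA \<union> setB" and alt: "alternating setA setB w"
    using Cons.prems(2) by (auto simp: alternating_def successively_Cons)
  have next_letter: "\<not> (g \<in> setA \<and> hd w \<in> setA) \<and> \<not> (g \<in> setB \<and> hd w \<in> setB)" if "w \<noteq> []"
    using Cons.prems(2) that by (cases w) (auto simp: alternating_def)
  have gG: "g \<in> carrier grpG" using gAB setA_G setB_G by blast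
  have sg: "\<sigma> \<circ> g \<in> carrier grpG" using G.m_closed[OF Cons.prems(1) gG] by simp
  have assoc: "\<sigma> \<circ> lprod grpG (g # w) = (\<sigma> \<circ> g) \<circ> lprod grpG w" by (simp add: comp_assoc)
  from Cons.prems(3) show ?case
  proof (elim disjE conjE)
    assume d: "1 \<le> degree ?Q" "degree ?Q < degree ?P" "g # w \<noteq> [] \<longrightarrow> hd (g # w) \<notin> setB"
    then have gA: "g \<in> setA" "g \<notin> setB" using gAB by auto
    obtain a b c d' e f where g: "c \<noteq> 0" "g genx = scal a * genx + scal b * geny + scal e"
      "g geny = scal c * genx + scal d' * geny + scal f"
      by (rule A_not_U[OF gA], rule that, assumption+)
    have "pA.subst p q (\<sigma> (g geny)) = Polynomial.smult c ?P + (Polynomial.smult d' ?Q + [:f:])"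
      by (simp add: g alg_hom_add[OF h] alg_hom_scal[OF h] alg_hom_scal0[OF h] pA.subst_add pA.subst_scal_mult pA.subst_scal one_pCons)
    moreover have "degree (Polynomial.smult d' ?Q + [:f:]) < degree (Polynomial.smult c ?P)"
      using d g(1) by (intro degree_add_less) (auto intro: le_less_trans[OF degree_smult_le])
    ultimately have dQ: "degree (pA.subst p q (\<sigma> (g geny))) = degree ?P"
      using g(1) by (simp add: degree_add_eq_left)
    have "pA.subst p q (\<sigma> (g genx)) = Polynomial.smult a ?P + Polynomial.smult b ?Q + [:e:]"
      by (simp add: g alg_hom_add[OF h] alg_hom_scal[OF h] alg_hom_scal0[OF h] pA.subst_add pA.subst_scal_mult pA.subst_scal one_pCons)
    then have "degree (pA.subst p q (\<sigma> (g genx))) \<le> degree ?P"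
      using d by (auto intro!: degree_add_le intro: order.trans[OF degree_smult_le])
    then have "2 \<le> max (degree (pA.subst p q (((\<sigma> \<circ> g) \<circ> lprod grpG w) genx))) (degree (pA.subst p q (((\<sigma> \<circ> g) \<circ> lprod grpG w) geny)))"
      by (intro Cons.IH sg alt) (use dQ d next_letter gA in auto)
    then show ?thesis unfolding assoc .
  next
    assume d: "1 \<le> degree ?Q" "degree ?P \<le> degree ?Q" "g # w \<noteq> [] \<longrightarrow> hd (g # w) \<notin> setA"
    then have gB: "g \<in> setB" "g \<notin> setA" using gAB by auto
    obtain a t r where g: "a \<noteq> 0" "degree r \<ge> 2" "g genx = scal a * genx + polyY r"
      "g geny = scal (inverse a) * geny + scal t"
      by (rule B_not_U[OF gB], rule that, assumption+)
    have "pA.subst p q (\<sigma> (g geny)) = Polynomial.smult (inverse a) ?Q + [:t:]"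
      by (simp add: g alg_hom_add[OF h] alg_hom_scal[OF h] alg_hom_scal0[OF h] pA.subst_add pA.subst_scal_mult pA.subst_scal one_pCons)
    then have dQ: "degree (pA.subst p q (\<sigma> (g geny))) = degree ?Q"
      using g(1) d(1) by (simp add: degree_add_eq_left)
    have "pA.subst p q (\<sigma> (g genx)) = Polynomial.smult a ?P + pcompose r ?Q"
      by (simp add: g alg_hom_add[OF h] alg_hom_scal[OF h] pA.subst_add pA.subst_scal_mult pA_subst_polyY[OF h])
    moreover have lt: "degree ?Q < degree (pcompose r ?Q)"
    proof -
      have "degree ?Q < 2 * degree ?Q" using d(1) by simp
      also have "\<dots> \<le> degree r * degree ?Q" using g(2) by (rule mult_le_mono1)
      finally show ?thesis by (simp add: degree_pcompose)
    qed
    ultimately have dP: "degree ?Q < degree (pA.subst p q (\<sigma> (g genx)))"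
      using d(2) g(1) by (simp add: degree_add_eq_right)
    then have "2 \<le> max (degree (pA.subst p q (((\<sigma> \<circ> g) \<circ> lprod grpG w) genx))) (degree (pA.subst p q (((\<sigma> \<circ> g) \<circ> lprod grpG w) geny)))"
      by (intro Cons.IH sg alt) (use dQ d next_letter gB in auto)
    then show ?thesis unfolding assoc .
  qed
qed

text \<open>The evaluation is x, y \<mapsto> t if the first factor is in B, and x \<mapsto> t, y
  \<mapsto> 0 if it is in A: after that factor the hypotheses on the degrees are satisfied,
  whereas the identity would leave the degrees at most 1.\<close>

theorem alternating_product_nontrivial:
  assumes alt: "alternating setA setB w" and len: "2 \<le> length w"
  shows "lprod grpG w \<noteq> \<one>\<^bsub>grpG\<^esub>"
proof
  assume one: "lprod grpG w = \<one>\<^bsub>grpG\<^esub>"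
  obtain g h w' where w: "w = g # h # w'" using len by (cases w; cases "tl w") auto
  have gh: "g \<in> setA \<union> setB" "\<not> (g \<in> setA \<and> h \<in> setA)" "\<not> (g \<in> setB \<and> h \<in> setB)" "h \<in> setA \<union> setB"
    and alt': "alternating setA setB (h # w')"
    using alt unfolding w by (auto simp: alternating_Cons_Cons) (auto simp: alternating_def)
  have gG: "g \<in> carrier grpG" using gh setA_G setB_G by blast
  let ?t = "[:0, 1:] :: complex poly"
  have eq: "(g \<circ> lprod grpG (h # w')) u = u" for u using one by (simp add: w fun_eq_iff)
  show False
  proof (cases "g \<in> setB")
    case True
    then have gB: "g \<in> setB" "g \<notin> setA" "h \<notin> setB" using gh by auto
    obtain a t r where g: "a \<noteq> 0" "degree r \<ge> 2" "g genx = scal a * genx + polyY r"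
      "g geny = scal (inverse a) * geny + scal t"
      by (rule B_not_U[OF gB(1,2)], rule that, assumption+)
    have Q: "pA.subst ?t ?t (g geny) = Polynomial.smult (inverse a) ?t + [:t:]"
      by (simp add: g pA.subst_add pA.subst_scal_mult pA.subst_scal one_pCons)
    have "pA.subst ?t ?t (g genx) = Polynomial.smult a ?t + pcompose r ?t"
      using pA_subst_polyY[OF alg_hom_id, of ?t ?t r] by (simp add: g pA.subst_add pA.subst_scal_mult)
    moreover have "degree (pcompose r ?t) = degree r" by (simp add: degree_pcompose)
    ultimately have "degree (pA.subst ?t ?t (g genx)) = degree r"
      using g(1,2) by (simp add: degree_add_eq_right)
    moreover have "degree (pA.subst ?t ?t (g geny)) = 1" unfolding Q using g(1) by simp
    ultimately have "2 \<le> max (degree (pA.subst ?t ?t ((g \<circ> lprod grpG (h # w')) genx))) (degree (pA.subst ?t ?t ((g \<circ> lprod grpG (h # w')) geny)))"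
      using g(2) gB by (intro degree_growth gG alt') auto
    then show False unfolding eq by simp
  next
    case False
    then have gA: "g \<in> setA" "g \<notin> setB" "h \<notin> setA" using gh by auto
    obtain a b c d e f where g: "c \<noteq> 0" "g genx = scal a * genx + scal b * geny + scal e"
      "g geny = scal c * genx + scal d * geny + scal f"
      by (rule A_not_U[OF gA(1,2)], rule that, assumption+)
    have "pA.subst ?t 0 (g geny) = [:f, c:]" "pA.subst ?t 0 (g genx) = [:e, a:]"
      by (simp_all add: g pA.subst_add pA.subst_scal_mult pA.subst_scal one_pCons)
    then have "2 \<le> max (degree (pA.subst ?t 0 ((g \<circ> lprod grpG (h # w')) genx))) (degree (pA.subst ?t 0 ((g \<circ> lprod grpG (h # w')) geny)))"
      using g(1) gA by (intro degree_growth gG alt') auto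
    then show False unfolding eq by simp
  qed
qed

lemma subgroup_A: "subgroup setA grpG"
proof (rule G.subgroupI)
  show "setA \<subseteq> carrier grpG" by (rule setA_G)
  show "setA \<noteq> {}"
  proof -
    obtain \<alpha> where "\<alpha> \<in> setA" by (rule affine_in_A[of 1 1 0 0 0 0]) auto
    then show ?thesis by blast
  qed
next
  fix \<alpha> assume \<alpha>: "\<alpha> \<in> setA"
  then obtain a b c d e f where *: "\<alpha> \<in> carrier grpG" "a * d - b * c = 1" "\<alpha> genx = scal a * genx + scal b * geny + scal e"
    "\<alpha> geny = scal c * genx + scal d * geny + scal f"
    unfolding setA_iff by blast
  have det: "d * a - (- b) * (- c) = 1" using *(2) by (simp add: mult.commute)
  obtain \<beta> where \<beta>: "\<beta> \<in> setA" "\<beta> genx = scal d * genx + scal (- b) * geny + scal (b * f - d * e)"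
    "\<beta> geny = scal (- c) * genx + scal a * geny + scal (c * e - a * f)"
    by (rule affine_in_A[OF det], rule that, assumption+)
  have \<beta>G: "\<beta> \<in> carrier grpG" using \<beta> setA_G by blast
  note h = G_alg_hom[OF *(1)]
  have ad: "a * d = 1 + b * c" using *(2) by (simp add: diff_eq_eq)
  have adz: "a * (d * z) = z + b * (c * z)" for z
  proof -
    have "a * (d * z) = a * d * z" by (simp only: mult.assoc)
    also have "\<dots> = z + b * (c * z)" unfolding ad by (simp add: algebra_simps)
    finally show ?thesis .
  qed
  note lin = affine_combination
  have "\<alpha> \<circ> \<beta> = id"
  proof (rule alg_hom_eqI[OF alg_hom_comp[OF h G_alg_hom[OF \<beta>G]] alg_hom_id])
    show "(\<alpha> \<circ> \<beta>) genx = id genx" "(\<alpha> \<circ> \<beta>) geny = id geny"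
      unfolding comp_apply \<beta> alg_hom_add[OF h] alg_hom_scal[OF h] alg_hom_scal0[OF h] * lin
      using ad by (simp_all add: algebra_simps adz)
  qed
  then have "ginv \<beta> = \<alpha>" by (intro G.inv_equality \<beta>G *(1)) simp
  then have "ginv \<alpha> = \<beta>" using G.inv_inv[OF \<beta>G] by simp
  then show "ginv \<alpha> \<in> setA" using \<beta> by simp
next
  fix \<alpha> \<beta> assume "\<alpha> \<in> setA" "\<beta> \<in> setA"
  then obtain a b c d e f a' b' c' d' e' f' where *: "\<alpha> \<in> carrier grpG" "a * d - b * c = 1" "\<alpha> genx = scal a * genx + scal b * geny + scal e"
    "\<alpha> geny = scal c * genx + scal d * geny + scal f"
    and **: "\<beta> \<in> carrier grpG" "a' * d' - b' * c' = 1" "\<beta> genx = scal a' * genx + scal b' * geny + scal e'"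
    "\<beta> geny = scal c' * genx + scal d' * geny + scal f'"
    unfolding setA_iff by blast
  note h = G_alg_hom[OF *(1)]
  note lin = affine_combination
  have "(\<alpha> \<circ> \<beta>) genx = scal (a' * a + b' * c) * genx + scal (a' * b + b' * d) * geny + scal (a' * e + b' * f + e')"
    "(\<alpha> \<circ> \<beta>) geny = scal (c' * a + d' * c) * genx + scal (c' * b + d' * d) * geny + scal (c' * e + d' * f + f')"
    unfolding comp_apply ** alg_hom_add[OF h] alg_hom_scal[OF h] alg_hom_scal0[OF h] * lin by simp_all
  moreover have "(a' * a + b' * c) * (c' * b + d' * d) - (a' * b + b' * d) * (c' * a + d' * c) = (a * d - b * c) * (a' * d' - b' * c')"
    by (simp add: algebra_simps)
  then have "(a' * a + b' * c) * (c' * b + d' * d) - (a' * b + b' * d) * (c' * a + d' * c) = 1"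
    using * ** by simp
  moreover have "\<alpha> \<circ> \<beta> \<in> carrier grpG" using G.m_closed[OF *(1) **(1)] by simp
  ultimately show "\<alpha> \<odot> \<beta> \<in> setA" unfolding setA_iff mult_G by blast
qed

lemma subgroup_B: "subgroup setB grpG"
proof (rule G.subgroupI)
  show "setB \<subseteq> carrier grpG" by (rule setB_G)
  show "setB \<noteq> {}"
  proof -
    obtain \<beta> where "\<beta> \<in> setB" by (rule elementary_in_B[of 0 0])
    then show ?thesis by blast
  qed
next
  fix \<beta> assume \<beta>: "\<beta> \<in> setB"
  then obtain a t q where *: "\<beta> \<in> carrier grpG" "a \<noteq> 0" "\<beta> genx = scal a * genx + polyY q"
    "\<beta> geny = scal (inverse a) * geny + scal t"
    unfolding setB_iff by blast
  let ?\<gamma> = "ginv \<beta>"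
  have \<gamma>: "?\<gamma> \<in> carrier grpG" using *(1) by simp
  note h = G_alg_hom[OF \<gamma>]
  have y: "?\<gamma> geny = scal (inverse (inverse a)) * geny + scal (- a * t)"
  proof -
    have "geny = ?\<gamma> (scal (inverse a) * geny + scal t)" using inv_G(1)[OF *(1), of geny] *(4) by simp
    also have "\<dots> = scal (inverse a) * ?\<gamma> geny + scal t" by (simp add: alg_hom_add[OF h] alg_hom_scal[OF h] alg_hom_scal0[OF h])
    finally have "scal a * geny = scal a * (scal (inverse a) * ?\<gamma> geny) + scal (a * t)" by (metis distrib_left scal_mult)
    then have "scal a * geny = ?\<gamma> geny + scal (a * t)" using *(2) by (simp add: scal_scal)
    then show ?thesis by (simp add: scal_uminus algebra_simps)
  qed
  have y': "?\<gamma> geny = scal a * geny + scal (- a * t)" using y by simp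
  have x: "?\<gamma> genx = scal (inverse a) * genx + polyY (Polynomial.smult (- inverse a) (pcompose q [:- a * t, a:]))"
  proof -
    have "genx = ?\<gamma> (scal a * genx + polyY q)" using inv_G(1)[OF *(1), of genx] *(3) by simp
    also have "\<dots> = scal a * ?\<gamma> genx + polyY (pcompose q [:- a * t, a:])"
      by (simp add: alg_hom_add[OF h] alg_hom_scal[OF h] alg_hom_polyY_affine[OF h y'])
    finally have "scal (inverse a) * genx = scal (inverse a) * (scal a * ?\<gamma> genx) + scal (inverse a) * polyY (pcompose q [:- a * t, a:])"
      by (metis distrib_left)
    then have "scal (inverse a) * genx = ?\<gamma> genx + scal (inverse a) * polyY (pcompose q [:- a * t, a:])"
      using *(2) by (simp add: scal_scal)
    then show ?thesis by (simp add: polyY_smult polyY_uminus scal_uminus algebra_simps)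
  qed
  show "?\<gamma> \<in> setB" unfolding setB_iff using \<gamma> *(2) x y
    by (intro conjI exI[of _ "inverse a"] exI[of _ "- a * t"] exI[of _ "Polynomial.smult (- inverse a) (pcompose q [:- a * t, a:])"]) simp_all
next
  fix \<alpha> \<beta> assume "\<alpha> \<in> setB" "\<beta> \<in> setB"
  then obtain a t q a' t' q' where *: "\<alpha> \<in> carrier grpG" "a \<noteq> 0" "\<alpha> genx = scal a * genx + polyY q"
    "\<alpha> geny = scal (inverse a) * geny + scal t"
    and **: "\<beta> \<in> carrier grpG" "a' \<noteq> 0" "\<beta> genx = scal a' * genx + polyY q'"
    "\<beta> geny = scal (inverse a') * geny + scal t'"
    unfolding setB_iff by blast
  note h = G_alg_hom[OF *(1)]
  have "(\<alpha> \<circ> \<beta>) genx = scal (a' * a) * genx + polyY (Polynomial.smult a' q + pcompose q' [:t, inverse a:])"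
    by (simp add: ** alg_hom_add[OF h] alg_hom_scal[OF h] alg_hom_polyY_affine[OF h *(4)] *(3) polyY_add polyY_smult distrib_left scal_scal add.assoc)
  moreover have "(\<alpha> \<circ> \<beta>) geny = scal (inverse (a' * a)) * geny + scal (inverse a' * t + t')"
    by (simp add: ** alg_hom_add[OF h] alg_hom_scal[OF h] alg_hom_scal0[OF h] *(4) scal_add distrib_left scal_scal scal_mult[symmetric] add.assoc)
  moreover have "\<alpha> \<circ> \<beta> \<in> carrier grpG" using G.m_closed[OF *(1) **(1)] by simp
  moreover have "a' * a \<noteq> 0" using * ** by simp
  ultimately show "\<alpha> \<odot> \<beta> \<in> setB" unfolding setB_iff mult_G by blast
qed

section \<open>The action on Calogero-Moser spaces\<close>

abbreviation (input) square_pair :: "nat => mat_pair => bool" where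
  "square_pair n P \<equiv> fst P \<in> carrier_mat n n \<and> snd P \<in> carrier_mat n n"

lemma word_mat_Cons:
  "word_mat n P (Word (c # l)) = (case c of LX => fst P | LY => snd P) * word_mat n P (Word l)"
  and word_mat_Nil: "word_mat n P (Word []) = 1\<^sub>m n"
  by (simp_all add: word_mat_def)

lemma word_mat_closed: "square_pair n P ==> word_mat n P (Word l) \<in> carrier_mat n n"
  by (induction l) (auto simp: word_mat_Cons word_mat_Nil split: letter.split)

lemma word_mat_append:
  assumes "square_pair n P"
  shows "word_mat n P (Word (l @ m)) = word_mat n P (Word l) * word_mat n P (Word m)"
proof (induction l)
  case Nil
  show ?case by (simp add: word_mat_Nil left_mult_one_mat[OF word_mat_closed[OF assms]])
next
  case (Cons c l)
  have "(case c of LX => fst P | LY => snd P) \<in> carrier_mat n n" using assms by (simp split: letter.split)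
  then show ?case
    using Cons assoc_mult_mat[OF _ word_mat_closed[OF assms] word_mat_closed[OF assms]] by (simp add: word_mat_Cons)
qed

lemma subst_mat_closed [simp]: "subst_mat n P u \<in> carrier_mat n n"
  and subst_mat_dim [simp]: "dim_row (subst_mat n P u) = n" "dim_col (subst_mat n P u) = n"
  by (simp_all add: subst_mat_def)

lemma subst_mat_entry:
  "i < n ==> j < n ==> subst_mat n P u $$ (i, j) = lin (*) (\<lambda>l. word_mat n P (Word l) $$ (i, j)) u"
  by (simp add: subst_mat_def lin_def)

lemma subst_mat_0 [simp]: "subst_mat n P 0 = 0\<^sub>m n n"
  by (rule eq_matI) (simp_all add: subst_mat_entry)

lemma subst_mat_add: "subst_mat n P (u + v) = subst_mat n P u + subst_mat n P v"
  by (rule eq_matI) (simp_all add: subst_mat_entry cC.lin_add)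

lemma subst_mat_diff: "subst_mat n P (u - v) = subst_mat n P u - subst_mat n P v"
  by (rule eq_matI) (simp_all add: subst_mat_entry cC.lin_diff)

lemma subst_mat_scal: "subst_mat n P (scal c * u) = c \<cdot>\<^sub>m subst_mat n P u"
  by (rule eq_matI) (simp_all add: subst_mat_entry cC.lin_scal)

lemma subst_mat_wd: "square_pair n P ==> subst_mat n P (wd l) = word_mat n P (Word l)"
  using word_mat_closed[of P n l] by (intro eq_matI) (simp_all add: subst_mat_entry)

lemma subst_mat_mult:
  assumes P: "square_pair n P"
  shows "subst_mat n P (u * v) = subst_mat n P u * subst_mat n P v"
proof (induction u rule: falg_induct)
  case zero
  show ?case using left_mult_zero_mat[OF subst_mat_closed] by simp
next
  case (add u u')
  then show ?case
    by (simp add: distrib_right subst_mat_add add_mult_distrib_mat[OF subst_mat_closed subst_mat_closed subst_mat_closed])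
next
  case (word c l)
  show ?case
  proof (induction v rule: falg_induct)
    case zero
    show ?case using right_mult_zero_mat[OF subst_mat_closed] by simp
  next
    case (add v v')
    then show ?case
      by (simp add: distrib_left subst_mat_add mult_add_distrib_mat[OF subst_mat_closed subst_mat_closed subst_mat_closed])
  next
    case (word d m)
    note W = word_mat_closed[OF P]
    have "(c \<cdot>\<^sub>m word_mat n P (Word l)) * (d \<cdot>\<^sub>m word_mat n P (Word m)) = c \<cdot>\<^sub>m (word_mat n P (Word l) * (d \<cdot>\<^sub>m word_mat n P (Word m)))"
      by (rule mult_smult_assoc_mat[OF W smult_carrier_mat[OF W]])
    also have "\<dots> = c \<cdot>\<^sub>m (d \<cdot>\<^sub>m (word_mat n P (Word l) * word_mat n P (Word m)))"
      by (subst mult_smult_distrib[OF W W]) simp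
    also have "\<dots> = (c * d) \<cdot>\<^sub>m (word_mat n P (Word l) * word_mat n P (Word m))"
      by (rule eq_matI) (auto simp: mult.assoc)
    finally show ?case unfolding word_times_word
      by (simp add: subst_mat_scal subst_mat_wd[OF P] word_mat_append[OF P])
  qed
qed

lemma subst_mat_1: "square_pair n P ==> subst_mat n P 1 = 1\<^sub>m n"
  using subst_mat_wd[of P n "[]"] by (simp add: wd_Nil word_mat_Nil)

lemma subst_mat_gen:
  assumes "square_pair n P"
  shows "subst_mat n P genx = fst P" "subst_mat n P geny = snd P"
  using assms right_mult_one_mat[of "fst P" n n] right_mult_one_mat[of "snd P" n n]
  by (simp_all add: genx_wd geny_wd subst_mat_wd word_mat_Cons word_mat_Nil)

text \<open>The effect on pairs of matrices of the inverse of \<sigma>. It is a right action,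
  see transl_comp.\<close>

definition transl :: "nat => (falg => falg) => mat_pair => mat_pair" where
  "transl n \<sigma> P = (subst_mat n P (\<sigma> genx), subst_mat n P (\<sigma> geny))"

lemma transl_square [simp]: "fst (transl n \<sigma> P) \<in> carrier_mat n n" "snd (transl n \<sigma> P) \<in> carrier_mat n n"
  by (simp_all add: transl_def)

lemma subst_mat_transl:
  assumes P: "square_pair n P" and \<sigma>: "alg_hom \<sigma>"
  shows "subst_mat n (transl n \<sigma> P) u = subst_mat n P (\<sigma> u)"
proof (induction u rule: falg_induct)
  case zero
  show ?case by (simp add: alg_hom_0[OF \<sigma>])
next
  case (add u v)
  then show ?case by (simp add: subst_mat_add alg_hom_add[OF \<sigma>])
next
  case (word c l)
  have "subst_mat n (transl n \<sigma> P) (wd l) = subst_mat n P (\<sigma> (wd l))"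
  proof (induction l)
    case Nil
    show ?case using P by (simp add: wd_Nil subst_mat_1 alg_hom_1[OF \<sigma>])
  next
    case (Cons a l)
    show ?case
    proof (cases a)
      case LX
      then show ?thesis using Cons P
        by (simp add: wd_LX subst_mat_mult subst_mat_gen alg_hom_mult[OF \<sigma>]) (simp add: transl_def)
    next
      case LY
      then show ?thesis using Cons P
        by (simp add: wd_LY subst_mat_mult subst_mat_gen alg_hom_mult[OF \<sigma>]) (simp add: transl_def)
    qed
  qed
  then show ?case by (simp add: subst_mat_scal alg_hom_scal[OF \<sigma>])
qed

lemma transl_id: "square_pair n P ==> transl n id P = P"
  by (simp add: transl_def subst_mat_gen)

lemma transl_comp: "square_pair n P ==> alg_hom \<sigma> ==> transl n \<tau> (transl n \<sigma> P) = transl n (\<sigma> \<circ> \<tau>) P"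
  by (simp add: subst_mat_transl transl_def[of n \<tau>] transl_def[of n "\<sigma> \<circ> \<tau>"])

lemma cm_pairs_iff: "P \<in> cm_pairs n \<longleftrightarrow> square_pair n P \<and>
    (n \<ge> 1 \<longrightarrow> vec_space.rank n (fst P * snd P - snd P * fst P + 1\<^sub>m n) = 1)"
  by (cases P) (simp add: cm_pairs_def)

text \<open>The commutator [X, Y] is the value of c, which is fixed.\<close>

lemma transl_cm_pairs:
  assumes \<sigma>: "\<sigma> \<in> carrier grpG" and P: "P \<in> cm_pairs n"
  shows "transl n \<sigma> P \<in> cm_pairs n"
proof -
  have sq: "square_pair n P" using P by (simp add: cm_pairs_iff)
  note h = G_alg_hom[OF \<sigma>]
  have c: "subst_mat n Q comm = fst Q * snd Q - snd Q * fst Q" if "square_pair n Q" for Q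
    using that by (simp add: comm_def subst_mat_diff subst_mat_mult subst_mat_gen)
  have "fst (transl n \<sigma> P) * snd (transl n \<sigma> P) - snd (transl n \<sigma> P) * fst (transl n \<sigma> P) = subst_mat n P (\<sigma> comm)"
    using c[of "transl n \<sigma> P"] subst_mat_transl[OF sq h, of comm] by simp
  also have "\<dots> = fst P * snd P - snd P * fst P"
    using \<sigma> c[OF sq] by (simp add: mem_G)
  finally show ?thesis using P by (simp add: cm_pairs_iff)
qed

lemma cm_conj_iff: "(P, Q) \<in> cm_conj n \<longleftrightarrow> P \<in> cm_pairs n \<and> Q \<in> cm_pairs n \<and>
    (\<exists>S S'. similar_mat_wit (fst Q) (fst P) S S' \<and> similar_mat_wit (snd Q) (snd P) S S')"
  by (cases P; cases Q) (simp add: cm_conj_def)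

text \<open>Substitution commutes with simultaneous conjugation.\<close>

lemma subst_mat_conj:
  assumes P: "square_pair n P" and Q: "square_pair n Q"
    and sim: "similar_mat_wit (fst Q) (fst P) S S'" "similar_mat_wit (snd Q) (snd P) S S'"
  shows "similar_mat_wit (subst_mat n Q u) (subst_mat n P u) S S'"
proof -
  have fQ: "fst Q \<in> carrier_mat n n" and sQ: "snd Q \<in> carrier_mat n n" using Q by auto
  note w1 = similar_mat_witD2[OF fQ sim(1)] and w2 = similar_mat_witD2[OF sQ sim(2)]
  have SS: "S * S' = 1\<^sub>m n" "S' * S = 1\<^sub>m n" and S: "S \<in> carrier_mat n n" "S' \<in> carrier_mat n n"
    using w1 by auto
  have prod: "S * (A * B) * S' = (S * A * S') * (S * B * S')" if A: "A \<in> carrier_mat n n" and B: "B \<in> carrier_mat n n" for A B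
  proof -
    have "(S * A * S') * (S * B * S') = S * A * (S' * (S * B * S'))"
      by (rule assoc_mult_mat) (use A B S in auto)
    also have "S' * (S * B * S') = S' * (S * (B * S'))"
      using assoc_mult_mat[OF S(1) B S(2)] by simp
    also have "\<dots> = S' * S * (B * S')" using assoc_mult_mat[OF S(2) S(1), of "B * S'" n] B S by simp
    also have "\<dots> = B * S'" using SS B S by simp
    also have "S * A * (B * S') = S * A * B * S'"
      by (rule assoc_mult_mat[symmetric]) (use A B S in auto)
    also have "S * A * B = S * (A * B)" by (rule assoc_mult_mat) (use A B S in auto)
    finally show ?thesis ..
  qed
  have "subst_mat n Q u = S * subst_mat n P u * S'"
  proof (induction u rule: falg_induct)
    case zero
    show ?case using S by simp
  next
    case (add u v)
    have "S * (subst_mat n P u + subst_mat n P v) * S' = (S * subst_mat n P u + S * subst_mat n P v) * S'"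
      by (subst mult_add_distrib_mat[OF S(1) subst_mat_closed subst_mat_closed]) simp
    also have "\<dots> = S * subst_mat n P u * S' + S * subst_mat n P v * S'"
      by (rule add_mult_distrib_mat[of _ n n]) (use S in auto)
    finally show ?case using add by (simp add: subst_mat_add)
  next
    case (word c l)
    have "word_mat n Q (Word l) = S * word_mat n P (Word l) * S'"
    proof (induction l)
      case Nil
      then show ?case using S SS by (simp add: word_mat_Nil)
    next
      case (Cons a l)
      then show ?case using prod[of "fst P"] prod[of "snd P"] word_mat_closed[OF P, of l] P w1(3) w2(3)
        by (cases a) (simp_all add: word_mat_Cons)
    qed
    moreover have "S * (c \<cdot>\<^sub>m word_mat n P (Word l)) * S' = c \<cdot>\<^sub>m (S * word_mat n P (Word l) * S')"
      using mult_smult_distrib[OF S(1) word_mat_closed[OF P], of c l]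
        mult_smult_assoc_mat[OF mult_carrier_mat[OF S(1) word_mat_closed[OF P]] S(2), of c l] by simp
    ultimately show ?case by (simp add: subst_mat_scal subst_mat_wd[OF P] subst_mat_wd[OF Q])
  qed
  then show ?thesis using SS S by (intro similar_mat_witI[of _ _ n]) auto
qed

lemma transl_conj:
  assumes \<sigma>: "\<sigma> \<in> carrier grpG" and PQ: "(P, Q) \<in> cm_conj n"
  shows "(transl n \<sigma> P, transl n \<sigma> Q) \<in> cm_conj n"
proof -
  obtain S S' where *: "P \<in> cm_pairs n" "Q \<in> cm_pairs n"
    "similar_mat_wit (fst Q) (fst P) S S'" "similar_mat_wit (snd Q) (snd P) S S'"
    using PQ unfolding cm_conj_iff by blast
  then have "square_pair n P" "square_pair n Q" by (auto simp: cm_pairs_iff)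
  from subst_mat_conj[OF this *(3,4)] show ?thesis
    unfolding cm_conj_iff using transl_cm_pairs[OF \<sigma>] * by (auto simp: transl_def)
qed

lemma transl_class:
  assumes \<sigma>: "\<sigma> \<in> carrier grpG" and P: "P \<in> cm_pairs n"
  shows "transl n \<sigma> ` (cm_conj n `` {P}) = cm_conj n `` {transl n \<sigma> P}"
proof (intro equalityI subsetI)
  fix R assume "R \<in> transl n \<sigma> ` (cm_conj n `` {P})"
  then show "R \<in> cm_conj n `` {transl n \<sigma> P}" using transl_conj[OF \<sigma>] by auto
next
  fix R assume "R \<in> cm_conj n `` {transl n \<sigma> P}"
  then have R: "(transl n \<sigma> P, R) \<in> cm_conj n" by simp
  let ?\<tau> = "ginv \<sigma>"
  have \<tau>: "?\<tau> \<in> carrier grpG" using \<sigma> by simp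
  have i: "\<sigma> \<circ> ?\<tau> = id" "?\<tau> \<circ> \<sigma> = id" using inv_G[OF \<sigma>] by (auto simp: fun_eq_iff)
  have "(transl n ?\<tau> (transl n \<sigma> P), transl n ?\<tau> R) \<in> cm_conj n" by (rule transl_conj[OF \<tau> R])
  moreover have "transl n ?\<tau> (transl n \<sigma> P) = P"
    using P by (simp add: transl_comp G_alg_hom[OF \<sigma>] i transl_id cm_pairs_iff)
  moreover have "R = transl n \<sigma> (transl n ?\<tau> R)"
  proof -
    have "R \<in> cm_pairs n" using R by (simp add: cm_conj_iff)
    then show ?thesis by (simp add: transl_comp G_alg_hom[OF \<tau>] i transl_id cm_pairs_iff)
  qed
  ultimately show "R \<in> transl n \<sigma> ` (cm_conj n `` {P})" by (metis Image_singleton_iff imageI)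
qed

lemma cm_act_class:
  assumes \<sigma>: "\<sigma> \<in> carrier grpG" and P: "P \<in> cm_pairs n"
  shows "cm_act n \<sigma> (cm_conj n `` {P}) = cm_conj n `` {transl n (ginv \<sigma>) P}"
proof -
  have "cm_conj n `` {P} \<in> cm_space n" unfolding cm_space_def using P by (rule quotientI)
  then have "cm_act n \<sigma> (cm_conj n `` {P}) = transl n (ginv \<sigma>) ` (cm_conj n `` {P})"
    by (simp add: cm_act_def transl_def[abs_def])
  then show ?thesis using transl_class[OF _ P, of "ginv \<sigma>"] \<sigma> by simp
qed

lemma cm_space_cases:
  assumes "c \<in> cm_space n"
  obtains P where "P \<in> cm_pairs n" "c = cm_conj n `` {P}"
  using assms unfolding cm_space_def by (rule quotientE) blast

lemma cm_act_closed: "\<sigma> \<in> carrier grpG ==> c \<in> cm_space n ==> cm_act n \<sigma> c \<in> cm_space n"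
  by (erule cm_space_cases) (auto simp: cm_act_class cm_space_def intro!: quotientI transl_cm_pairs)

lemma cm_act_one: "c \<in> cm_space n ==> cm_act n id c = c"
proof (erule cm_space_cases)
  fix P assume P: "P \<in> cm_pairs n" "c = cm_conj n `` {P}"
  then show ?thesis
    using cm_act_class[OF G.one_closed P(1)] G.inv_one by (simp add: transl_id cm_pairs_iff)
qed

lemma cm_act_mult:
  assumes \<sigma>: "\<sigma> \<in> carrier grpG" and \<tau>: "\<tau> \<in> carrier grpG" and c: "c \<in> cm_space n"
  shows "cm_act n (\<sigma> \<circ> \<tau>) c = cm_act n \<sigma> (cm_act n \<tau> c)"
proof -
  obtain P where P: "P \<in> cm_pairs n" "c = cm_conj n `` {P}" by (rule cm_space_cases[OF c])
  have \<tau>': "ginv \<tau> \<in> carrier grpG" using \<tau> by simp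
  have "cm_act n \<sigma> (cm_act n \<tau> c) = cm_conj n `` {transl n (ginv \<sigma>) (transl n (ginv \<tau>) P)}"
    using P \<sigma> \<tau> \<tau>' by (simp add: cm_act_class transl_cm_pairs)
  also have "\<dots> = cm_conj n `` {transl n (ginv (\<sigma> \<circ> \<tau>)) P}"
    using P(1) G_alg_hom[OF \<tau>'] G.inv_mult_group[OF \<sigma> \<tau>] by (simp add: transl_comp cm_pairs_iff)
  also have "\<dots> = cm_act n (\<sigma> \<circ> \<tau>) c"
    using P cm_act_class[OF G.m_closed[OF \<sigma> \<tau>] P(1)] by simp
  finally show ?thesis ..
qed

section \<open>Groups given by generators and relations\<close>

declare in_lists_conv_set [simp del] in_listsD [rule del] in_listsI [rule del]

lemma word_cong_lists:
  assumes "R \<subseteq> lists S \<times> lists S" "word_cong S R u v"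
  shows "u \<in> lists S \<and> v \<in> lists S"
  using assms(2) by induction (use assms(1) in \<open>auto simp: in_lists_conv_set\<close>)

lemma word_class_eq_iff:
  assumes "u \<in> lists S" "v \<in> lists S"
  shows "word_class S R u = word_class S R v \<longleftrightarrow> word_cong S R u v"
proof
  assume "word_class S R u = word_class S R v"
  moreover have "v \<in> word_class S R v" using assms by (simp add: word_class_def word_cong.refl)
  ultimately have "v \<in> word_class S R u" by blast
  then show "word_cong S R u v" by (simp add: word_class_def)
next
  assume "word_cong S R u v"
  then show "word_class S R u = word_class S R v"
    by (auto simp: word_class_def intro: word_cong.trans word_cong.sym)
qed

text \<open>As every letter has a letter that is inverse to it from the left, words modulo the
  congruence form a group.\<close>

locale presentation =
  fixes S :: "'a set" and R :: "('a list \<times> 'a list) set"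
  assumes rels: "R \<subseteq> lists S \<times> lists S"
    and letter_inverse: "!!s. s \<in> S ==> \<exists>t\<in>S. word_cong S R [t, s] []"
begin

abbreviation cls :: "'a list => 'a list set" where "cls \<equiv> word_class S R"

lemma cls_rel: "(u, v) \<in> R ==> cls u = cls v"
  using rels by (subst word_class_eq_iff) (auto intro: word_cong.rel)

lemma cls_mult:
  assumes "u \<in> lists S" "v \<in> lists S"
  shows "cls u \<otimes>\<^bsub>presented S R\<^esub> cls v = cls (u @ v)"
proof -
  have "cls (u' @ v') = cls (u @ v)" if "word_cong S R u u'" "word_cong S R v v'" for u' v'
    using that word_cong_lists[OF rels] assms by (subst word_class_eq_iff) (auto intro: word_cong.app word_cong.sym)
  moreover have "u \<in> cls u" "v \<in> cls v" using assms by (simp_all add: word_class_def word_cong.refl)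
  ultimately have "(\<Union>u'\<in>cls u. \<Union>v'\<in>cls v. cls (u' @ v')) = cls (u @ v)"
    unfolding word_class_def[of S R u] word_class_def[of S R v] by blast
  then show ?thesis by (simp add: presented_def)
qed

lemma carrier_presented: "carrier (presented S R) = cls ` lists S"
  and one_presented: "\<one>\<^bsub>presented S R\<^esub> = cls []"
  by (simp_all add: presented_def)

lemma word_inverse: "w \<in> lists S ==> \<exists>v\<in>lists S. word_cong S R (v @ w) []"
proof (induction w)
  case (Cons s w)
  then obtain v t where v: "v \<in> lists S" "word_cong S R (v @ w) []" and t: "t \<in> S" "word_cong S R [t, s] []"
    using letter_inverse[of s] by auto
  have "word_cong S R (v @ ([t, s] @ w)) (v @ ([] @ w))"
    by (intro word_cong.app word_cong.refl t v) (use Cons.prems in auto)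
  then have "word_cong S R ((v @ [t]) @ s # w) []" using v(2) by (auto intro: word_cong.trans)
  then show ?case using v(1) t(1) by (intro bexI[of _ "v @ [t]"]) auto
qed (auto intro: word_cong.refl)

lemma group_presented: "group (presented S R)"
proof (rule groupI)
  fix x assume "x \<in> carrier (presented S R)"
  then obtain w where w: "w \<in> lists S" "x = cls w" by (auto simp: carrier_presented)
  then show "\<one>\<^bsub>presented S R\<^esub> \<otimes>\<^bsub>presented S R\<^esub> x = x" by (simp add: one_presented cls_mult)
  obtain v where v: "v \<in> lists S" "word_cong S R (v @ w) []" using word_inverse w(1) by blast
  then have "cls v \<otimes>\<^bsub>presented S R\<^esub> x = \<one>\<^bsub>presented S R\<^esub>"
    using w by (simp add: cls_mult one_presented word_class_eq_iff)
  then show "\<exists>y\<in>carrier (presented S R). y \<otimes>\<^bsub>presented S R\<^esub> x = \<one>\<^bsub>presented S R\<^esub>"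
    using v(1) by (auto simp: carrier_presented)
qed (auto simp: carrier_presented one_presented cls_mult)

lemma presented_generated: "carrier (presented S R) = generate (presented S R) ((\<lambda>s. cls [s]) ` S)"
proof
  interpret G: group "presented S R" by (rule group_presented)
  have gens: "(\<lambda>s. cls [s]) ` S \<subseteq> carrier (presented S R)" by (auto simp: carrier_presented)
  then show "generate (presented S R) ((\<lambda>s. cls [s]) ` S) \<subseteq> carrier (presented S R)" by (rule G.generate_incl)
  have "cls w \<in> generate (presented S R) ((\<lambda>s. cls [s]) ` S)" if "w \<in> lists S" for w
    using that
  proof (induction w)
    case Nil
    then show ?case using generate.one[of "presented S R"] by (simp add: one_presented)
  next
    case (Cons s w)
    then have "cls (s # w) = cls [s] \<otimes>\<^bsub>presented S R\<^esub> cls w" using cls_mult[of "[s]" w] by simp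
    then show ?case using Cons by (auto intro: generate.intros)
  qed
  then show "carrier (presented S R) \<subseteq> generate (presented S R) ((\<lambda>s. cls [s]) ` S)"
    by (auto simp: carrier_presented)
qed

lemma presented_universal:
  assumes P: "group P" and f: "f \<in> S \<rightarrow> carrier P"
    and resp: "!!u v. (u, v) \<in> R ==> lprod P (map f u) = lprod P (map f v)"
  obtains F where "F \<in> hom (presented S R) P" "!!s. s \<in> S ==> F (cls [s]) = f s"
proof -
  interpret P: group P by (rule P)
  have closed: "lprod P (map f w) \<in> carrier P" if "w \<in> lists S" for w
    by (rule P.lprod_closed_carrier) (use that f in \<open>auto simp: in_lists_conv_set Pi_iff\<close>)
  have app: "lprod P (map f (u @ v)) = lprod P (map f u) \<otimes>\<^bsub>P\<^esub> lprod P (map f v)" if "u \<in> lists S" "v \<in> lists S" for u v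
    unfolding map_append by (rule P.lprod_append_carrier) (use that f in \<open>auto simp: in_lists_conv_set Pi_iff\<close>)
  have cong: "lprod P (map f u) = lprod P (map f v)" if "word_cong S R u v" for u v
    using that
  proof induction
    case (app u u' v v')
    then show ?case using word_cong_lists[OF rels app(1)] word_cong_lists[OF rels app(2)]
      by (simp only: \<open>!!v u. u \<in> lists S ==> v \<in> lists S ==> lprod P (map f (u @ v)) = lprod P (map f u) \<otimes>\<^bsub>P\<^esub> lprod P (map f v)\<close>)
  qed (auto simp: resp)
  define F where "F C = lprod P (map f (SOME w. w \<in> C))" for C
  have F: "F (cls w) = lprod P (map f w)" if "w \<in> lists S" for w
  proof -
    have "w \<in> cls w" using that by (simp add: word_class_def word_cong.refl)
    then have "(SOME v. v \<in> cls w) \<in> cls w" by (rule someI)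
    then have "word_cong S R w (SOME v. v \<in> cls w)" by (simp add: word_class_def)
    then show ?thesis using cong unfolding F_def by simp
  qed
  have "F \<in> hom (presented S R) P"
    by (rule homI) (auto simp: carrier_presented cls_mult F closed app simp del: map_append)
  moreover have "F (cls [s]) = f s" if "s \<in> S" for s
    using that f P.r_one by (subst F) (auto simp: Pi_iff)
  ultimately show ?thesis by (rule that)
qed

end

lemma hom_eq_on_generate:
  assumes "group G" "group H" "F \<in> hom G H" "F' \<in> hom G H" "K \<subseteq> carrier G"
    and eq: "!!x. x \<in> K ==> F x = F' x" and x: "x \<in> generate G K"
  shows "F x = F' x"
proof -
  interpret F: group_hom G H F using assms by (simp add: group_hom_def group_hom_axioms_def)
  interpret F': group_hom G H F' using assms by (simp add: group_hom_def group_hom_axioms_def)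
  show ?thesis using x
  proof induction
    case (inv h)
    then have "h \<in> carrier G" using assms by blast
    then show ?case using eq[OF inv] by simp
  next
    case (eng h1 h2)
    then show ?case using F.G.generate_in_carrier[OF assms(5)] by simp
  qed (simp_all add: eq)
qed

text \<open>It suffices to check on generators that two homomorphisms are inverse to each
  other.\<close>

lemma iso_by_inverse_homs:
  assumes G: "group G" and H: "group H" and F: "F \<in> hom G H" and F': "F' \<in> hom H G"
    and gG: "carrier G = generate G K" "K \<subseteq> carrier G" and gH: "carrier H = generate H L" "L \<subseteq> carrier H"
    and "!!x. x \<in> K ==> F' (F x) = x" "!!y. y \<in> L ==> F (F' y) = y"
  shows "G \<cong> H"
proof -
  have idG: "(\<lambda>x. x) \<in> hom G G" and idH: "(\<lambda>x. x) \<in> hom H H" by (auto simp: hom_def)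
  have "(F' \<circ> F) \<in> hom G G" "(F \<circ> F') \<in> hom H H"
    using hom_compose[OF F F'] hom_compose[OF F' F] by simp_all
  then have "(F' \<circ> F) x = x" if "x \<in> carrier G" for x
    using hom_eq_on_generate[OF G G \<open>(F' \<circ> F) \<in> hom G G\<close> idG gG(2)] assms(9) that gG(1) by auto
  moreover have "(F \<circ> F') x = x" if "x \<in> carrier H" for x
    using hom_eq_on_generate[OF H H \<open>(F \<circ> F') \<in> hom H H\<close> idH gH(2)] assms(10) that gH(1) by auto
  ultimately have "bij_betw F (carrier G) (carrier H)"
    using F F' by (intro bij_betw_byWitness[where f' = F']) (auto simp: hom_def)
  then show ?thesis using F by (auto simp: is_iso_def iso_def)
qed

lemma normal_closure_normal:
  assumes "group G" "R \<subseteq> carrier G"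
  shows "normal_closure G R \<lhd> G" "R \<subseteq> normal_closure G R"
proof -
  interpret group G by (rule assms)
  have "carrier G \<lhd> G" by (rule normal_invI) (auto simp: subgroup_self)
  then have ne: "{N. N \<lhd> G \<and> R \<subseteq> N} \<noteq> {}" using assms by blast
  show "normal_closure G R \<lhd> G"
  proof (rule normal_invI)
    show "subgroup (normal_closure G R) G" unfolding normal_closure_def
      by (rule subgroups_Inter[OF _ ne]) (auto simp: normal_inv_iff)
  qed (auto simp: normal_closure_def normal_inv_iff)
  show "R \<subseteq> normal_closure G R" by (auto simp: normal_closure_def)
qed

locale quotient_presentation = group G for G (structure) +
  fixes R :: "'a set"
  assumes R_carrier: "R \<subseteq> carrier G"
begin

abbreviation N where "N \<equiv> normal_closure G R"

lemma normal_N: "N \<lhd> G" using normal_closure_normal R_carrier is_group by blast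

sublocale N: normal N G by (rule normal_N)

lemma group_quotient: "group (G Mod N)" by (rule N.factorgroup_is_group)

lemma projection_hom: "(\<lambda>g. N #> g) \<in> hom G (G Mod N)"
  by (rule N.r_coset_hom_Mod)

lemma projection_surj: "(\<lambda>g. N #> g) ` carrier G = carrier (G Mod N)"
  by (auto simp: FactGroup_def RCOSETS_def)

lemma relator_trivial: "r \<in> R ==> N #> r = \<one>\<^bsub>G Mod N\<^esub>"
proof -
  assume "r \<in> R"
  then have "r \<in> N" using normal_closure_normal(2)[OF is_group R_carrier] by blast
  then show ?thesis using coset_join2[OF _ N.is_subgroup] N.subset by (auto simp: FactGroup_def)
qed

lemma relator_equation:
  assumes e: "e \<in> carrier G" and x: "x \<in> carrier G" and y: "y \<in> carrier G"
    and r: "inv e \<otimes> x \<otimes> e \<otimes> inv y \<in> R"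
  shows "inv\<^bsub>G Mod N\<^esub> (N #> e) \<otimes>\<^bsub>G Mod N\<^esub> (N #> x) \<otimes>\<^bsub>G Mod N\<^esub> (N #> e) = N #> y" (is "?l = _")
proof -
  interpret p: group_hom G "G Mod N" "\<lambda>g. N #> g"
    using is_group group_quotient projection_hom by (simp add: group_hom_def group_hom_axioms_def)
  have "?l \<otimes>\<^bsub>G Mod N\<^esub> inv\<^bsub>G Mod N\<^esub> (N #> y) = \<one>\<^bsub>G Mod N\<^esub>"
    using relator_trivial[OF r] e x y by simp
  moreover have "?l \<in> carrier (G Mod N)" by (intro p.H.m_closed p.H.inv_closed p.hom_closed e x)
  ultimately have "inv\<^bsub>G Mod N\<^esub> (inv\<^bsub>G Mod N\<^esub> (N #> y)) = ?l"
    by (intro p.H.inv_equality p.H.inv_closed p.hom_closed y)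
  then show ?thesis using p.H.inv_inv[OF p.hom_closed[OF y]] by (metis)
qed

lemma quotient_generated:
  assumes "carrier G = generate G K" "K \<subseteq> carrier G"
  shows "carrier (G Mod N) = generate (G Mod N) ((\<lambda>g. N #> g) ` K)"
proof -
  interpret p: group_hom G "G Mod N" "\<lambda>g. N #> g"
    using is_group group_quotient projection_hom by (simp add: group_hom_def group_hom_axioms_def)
  show ?thesis using p.generate_img[OF assms(2)] assms(1) projection_surj by simp
qed

lemma quotient_universal:
  assumes P: "group P" and f: "f \<in> hom G P" and triv: "!!r. r \<in> R ==> f r = \<one>\<^bsub>P\<^esub>"
  obtains F where "F \<in> hom (G Mod N) P" "!!g. g \<in> carrier G ==> F (N #> g) = f g"
proof -
  interpret f: group_hom G P f using is_group P f by (simp add: group_hom_def group_hom_axioms_def)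
  have "R \<subseteq> kernel G P f" using triv R_carrier by (auto simp: kernel_def)
  then have NK: "N \<subseteq> kernel G P f" using f.normal_kernel unfolding normal_closure_def by blast
  define F where "F C = f (SOME g. g \<in> C)" for C
  have F: "F (N #> g) = f g" if g: "g \<in> carrier G" for g
  proof -
    have "g \<in> N #> g" using g by (rule rcos_self[OF _ N.is_subgroup])
    then have "(SOME h. h \<in> N #> g) \<in> N #> g" by (rule someI)
    then obtain m where m: "m \<in> N" "(SOME h. h \<in> N #> g) = m \<otimes> g" by (auto simp: r_coset_def)
    then have "m \<in> carrier G" "f m = \<one>\<^bsub>P\<^esub>" using NK by (auto simp: kernel_def)
    then show ?thesis using g m(2) by (simp add: F_def)
  qed
  have "F \<in> hom (G Mod N) P"
  proof (rule homI)
    fix C assume "C \<in> carrier (G Mod N)"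
    then show "F C \<in> carrier P" using F by (auto simp: projection_surj[symmetric])
  next
    fix C D assume "C \<in> carrier (G Mod N)" "D \<in> carrier (G Mod N)"
    then obtain g h where gh: "g \<in> carrier G" "C = N #> g" "h \<in> carrier G" "D = N #> h"
      by (auto simp: projection_surj[symmetric])
    then have "C \<otimes>\<^bsub>G Mod N\<^esub> D = N #> (g \<otimes> h)" by (simp add: FactGroup_def N.rcos_sum)
    then show "F (C \<otimes>\<^bsub>G Mod N\<^esub> D) = F C \<otimes>\<^bsub>P\<^esub> F D" using gh by (simp add: F)
  qed
  then show ?thesis using F that by blast
qed

end

section \<open>Free products and free groups\<close>

lemma mult_rels_lists: "\<iota> ` carrier H \<subseteq> S ==> group H ==> mult_rels \<iota> H \<subseteq> lists S \<times> lists S"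
  by (auto simp: mult_rels_def group.subgroup_self subgroup.m_closed[OF group.subgroup_self] subgroup.one_closed[OF group.subgroup_self])

lemma mult_rels_inverse:
  assumes "group H" "g \<in> carrier H" "mult_rels \<iota> H \<subseteq> R"
  shows "word_cong S R [\<iota> (inv\<^bsub>H\<^esub> g), \<iota> g] []"
proof -
  interpret group H by (rule assms)
  have "([\<iota> (inv\<^bsub>H\<^esub> g), \<iota> g], [\<iota> \<one>\<^bsub>H\<^esub>]) \<in> mult_rels \<iota> H"
    unfolding mult_rels_def using assms(2)
    by (intro UnI1 CollectI exI[of _ "inv\<^bsub>H\<^esub> g"] exI[of _ g]) simp
  moreover have "([\<iota> \<one>\<^bsub>H\<^esub>], []) \<in> mult_rels \<iota> H" by (simp add: mult_rels_def)
  ultimately show ?thesis using assms(3) by (blast intro: word_cong.trans word_cong.rel)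
qed

lemma mult_rels_respected:
  fixes P :: "('p, 'n) monoid_scheme" and f :: "'a => 'p"
  assumes P: "group P" and "(u, v) \<in> mult_rels \<iota> H" "group H" "(\<lambda>g. f (\<iota> g)) \<in> hom H P"
  shows "lprod P (map f u) = lprod P (map f v)"
proof -
  interpret P: group P by (rule P)
  interpret h: group_hom H P "\<lambda>g. f (\<iota> g)" using assms by (simp add: group_hom_def group_hom_axioms_def)
  show ?thesis using assms(2) h.hom_one h.hom_closed h.hom_mult by (auto simp: mult_rels_def)
qed

text \<open>The free product is studied through its universal property; the same pattern recurs
  for free groups and binary free products.\<close>

locale free_product_of =
  fixes I :: "'i set" and H :: "'i => 'g monoid"
  assumes factors: "!!i. i \<in> I ==> group (H i)"
begin

sublocale pres: presentation "SIGMA i:I. carrier (H i)" "\<Union>i\<in>I. mult_rels (Pair i) (H i)"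
proof
  show "(\<Union>i\<in>I. mult_rels (Pair i) (H i)) \<subseteq> lists (SIGMA i:I. carrier (H i)) \<times> lists (SIGMA i:I. carrier (H i))"
    by (intro UN_least mult_rels_lists factors) auto
next
  fix s assume "s \<in> (SIGMA i:I. carrier (H i))"
  then obtain i g where s: "s = (i, g)" "i \<in> I" "g \<in> carrier (H i)" by auto
  show "\<exists>t\<in>SIGMA i:I. carrier (H i). word_cong (SIGMA i:I. carrier (H i)) (\<Union>i\<in>I. mult_rels (Pair i) (H i)) [t, s] []"
    unfolding s(1)
    by (rule bexI[of _ "(i, inv\<^bsub>H i\<^esub> g)"], rule mult_rels_inverse[OF factors[OF s(2)] s(3)])
       (use s group.inv_closed[OF factors[OF s(2)] s(3)] in auto)
qed

lemma group_free_prod: "group (free_prod I H)"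
  unfolding free_prod_def by (rule pres.group_presented)

lemma free_prod_in_hom: "i \<in> I ==> free_prod_in I H i \<in> hom (H i) (free_prod I H)"
proof (rule homI)
  fix g assume "i \<in> I" "g \<in> carrier (H i)"
  then show "free_prod_in I H i g \<in> carrier (free_prod I H)"
    by (auto simp: free_prod_in_def free_prod_def pres.carrier_presented)
next
  fix g h assume *: "i \<in> I" "g \<in> carrier (H i)" "h \<in> carrier (H i)"
  then have "([(i, g), (i, h)], [(i, g \<otimes>\<^bsub>H i\<^esub> h)]) \<in> (\<Union>i\<in>I. mult_rels (Pair i) (H i))"
    by (auto simp: mult_rels_def)
  then show "free_prod_in I H i (g \<otimes>\<^bsub>H i\<^esub> h) = free_prod_in I H i g \<otimes>\<^bsub>free_prod I H\<^esub> free_prod_in I H i h"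
    using * pres.cls_rel[of "[(i, g), (i, h)]"] unfolding free_prod_in_def free_prod_def by (subst pres.cls_mult) auto
qed

lemma free_prod_generated:
  "carrier (free_prod I H) = generate (free_prod I H) {free_prod_in I H i g | i g. i \<in> I \<and> g \<in> carrier (H i)}"
proof -
  have "(\<lambda>s. pres.cls [s]) ` (SIGMA i:I. carrier (H i)) = {free_prod_in I H i g | i g. i \<in> I \<and> g \<in> carrier (H i)}"
    by (auto simp: free_prod_in_def)
  then show ?thesis using pres.presented_generated by (simp add: free_prod_def)
qed

lemma free_prod_universal:
  assumes P: "group P" and f: "!!i. i \<in> I ==> f i \<in> hom (H i) P"
  obtains F where "F \<in> hom (free_prod I H) P"
    "!!i g. i \<in> I ==> g \<in> carrier (H i) ==> F (free_prod_in I H i g) = f i g"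
proof -
  have closed: "case_prod f \<in> (SIGMA i:I. carrier (H i)) \<rightarrow> carrier P" using f by (auto simp: hom_def Pi_iff)
  have resp: "lprod P (map (case_prod f) u) = lprod P (map (case_prod f) v)"
    if "(u, v) \<in> (\<Union>i\<in>I. mult_rels (Pair i) (H i))" for u v
  proof -
    from that obtain i where "i \<in> I" "(u, v) \<in> mult_rels (Pair i) (H i)" by blast
    then show ?thesis using f factors by (intro mult_rels_respected[OF P]) auto
  qed
  obtain F where "F \<in> hom (free_prod I H) P" "!!s. s \<in> (SIGMA i:I. carrier (H i)) ==> F (pres.cls [s]) = case_prod f s"
    using pres.presented_universal[OF P closed resp] unfolding free_prod_def by blast
  then show ?thesis by (intro that[of F]) (auto simp: free_prod_in_def)
qed

end

interpretation free: presentation "S \<times> UNIV" "free_group_rels S" for S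
proof
  show "free_group_rels S \<subseteq> lists (S \<times> UNIV) \<times> lists (S \<times> UNIV)" by (auto simp: free_group_rels_def)
next
  fix s :: "'a \<times> bool" assume "s \<in> S \<times> UNIV"
  then have "fst s \<in> S" by auto
  then have "([(fst s, \<not> snd s), (fst s, \<not> \<not> snd s)], []) \<in> free_group_rels S" unfolding free_group_rels_def by blast
  then show "\<exists>t\<in>S \<times> UNIV. word_cong (S \<times> UNIV) (free_group_rels S) [t, s] []"
    using \<open>fst s \<in> S\<close> by (intro bexI[of _ "(fst s, \<not> snd s)"]) (auto intro: word_cong.rel)
qed

lemma group_free_group: "group (free_group S)"
  unfolding free_group_def by (rule free.group_presented)

lemma free_group_gen_closed: "s \<in> S ==> free_group_gen S s \<in> carrier (free_group S)"
  by (auto simp: free_group_gen_def free_group_def free.carrier_presented)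

lemma free_group_inverse_letter:
  assumes "s \<in> S"
  shows "free.cls S [(s, False)] = inv\<^bsub>free_group S\<^esub> free_group_gen S s"
proof (rule group.inv_equality[OF group_free_group, symmetric])
  have "([(s, False), (s, \<not> False)], []) \<in> free_group_rels S" using assms unfolding free_group_rels_def by blast
  then show "free.cls S [(s, False)] \<otimes>\<^bsub>free_group S\<^esub> free_group_gen S s = \<one>\<^bsub>free_group S\<^esub>"
    using assms free.cls_rel[of "[(s, False), (s, True)]" "[]" S]
    by (simp add: free_group_def free_group_gen_def free.cls_mult free.one_presented)
  show "free_group_gen S s \<in> carrier (free_group S)" using assms by (rule free_group_gen_closed)
  show "free.cls S [(s, False)] \<in> carrier (free_group S)"
    using assms by (auto simp: free_group_def free.carrier_presented)
qed

lemma free_group_generated: "carrier (free_group S) = generate (free_group S) (free_group_gen S ` S)"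
proof
  interpret G: group "free_group S" by (rule group_free_group)
  have sub: "free_group_gen S ` S \<subseteq> carrier (free_group S)" by (auto simp: free_group_gen_closed)
  then show "generate (free_group S) (free_group_gen S ` S) \<subseteq> carrier (free_group S)" by (rule G.generate_incl)
  have "(\<lambda>s. free.cls S [s]) ` (S \<times> UNIV) \<subseteq> generate (free_group S) (free_group_gen S ` S)"
  proof safe
    fix s b assume s: "s \<in> S"
    then show "free.cls S [(s, b)] \<in> generate (free_group S) (free_group_gen S ` S)"
    proof (cases b)
      case True
      then show ?thesis using s by (auto simp: free_group_gen_def intro: generate.incl)
    next
      case False
      then show ?thesis using s free_group_inverse_letter[OF s] by (auto intro: generate.inv)
    qed
  qed
  then show "carrier (free_group S) \<subseteq> generate (free_group S) (free_group_gen S ` S)"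
    using G.generate_subgroup_incl[OF _ G.generate_is_subgroup[OF sub]] free.presented_generated[of S]
    by (simp add: free_group_def)
qed

lemma free_group_universal:
  assumes P: "group P" and t: "!!s. s \<in> S ==> t s \<in> carrier P"
  obtains F where "F \<in> hom (free_group S) P" "!!s. s \<in> S ==> F (free_group_gen S s) = t s"
proof -
  interpret P: group P by (rule P)
  define f where "f = (\<lambda>(s, b). if b then t s else inv\<^bsub>P\<^esub> t s)"
  have closed: "f \<in> S \<times> UNIV \<rightarrow> carrier P" using t by (auto simp: f_def)
  have resp: "lprod P (map f u) = lprod P (map f v)" if "(u, v) \<in> free_group_rels S" for u v
    using that t by (auto simp: free_group_rels_def f_def)
  obtain F where "F \<in> hom (free_group S) P" "!!s. s \<in> S \<times> UNIV ==> F (free.cls S [s]) = f s"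
    using free.presented_universal[OF P closed resp] unfolding free_group_def by blast
  then show ?thesis by (intro that[of F]) (auto simp: free_group_gen_def f_def)
qed

locale free_product2_of = fixes G :: "'g monoid" and H :: "'h monoid"
  assumes G: "group G" and H: "group H"
begin

sublocale pres: presentation "carrier G <+> carrier H" "mult_rels Inl G \<union> mult_rels Inr H"
proof
  show "mult_rels Inl G \<union> mult_rels Inr H \<subseteq> lists (carrier G <+> carrier H) \<times> lists (carrier G <+> carrier H)"
    by (intro Un_least mult_rels_lists G H) auto
next
  fix s assume "s \<in> carrier G <+> carrier H"
  then consider g where "s = Inl g" "g \<in> carrier G" | h where "s = Inr h" "h \<in> carrier H" by auto
  then show "\<exists>t\<in>carrier G <+> carrier H. word_cong (carrier G <+> carrier H) (mult_rels Inl G \<union> mult_rels Inr H) [t, s] []"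
  proof cases
    case 1
    then show ?thesis using mult_rels_inverse[OF G 1(2) Un_upper1] group.inv_closed[OF G 1(2)]
      by (intro bexI[of _ "Inl (inv\<^bsub>G\<^esub> g)"]) auto
  next
    case 2
    then show ?thesis using mult_rels_inverse[OF H 2(2) Un_upper2] group.inv_closed[OF H 2(2)]
      by (intro bexI[of _ "Inr (inv\<^bsub>H\<^esub> h)"]) auto
  qed
qed

lemma group_free_prod2: "group (free_prod2 G H)"
  unfolding free_prod2_def by (rule pres.group_presented)

lemma free_prod2_inl_hom: "free_prod2_inl G H \<in> hom G (free_prod2 G H)"
proof (rule homI)
  fix g assume "g \<in> carrier G"
  then show "free_prod2_inl G H g \<in> carrier (free_prod2 G H)"
    by (auto simp: free_prod2_inl_def free_prod2_def pres.carrier_presented)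
next
  fix g h assume *: "g \<in> carrier G" "h \<in> carrier G"
  then have "([Inl g, Inl h], [Inl (g \<otimes>\<^bsub>G\<^esub> h)]) \<in> mult_rels Inl G \<union> mult_rels Inr H"
    by (auto simp: mult_rels_def)
  then have "pres.cls [Inl g, Inl h] = pres.cls [Inl (g \<otimes>\<^bsub>G\<^esub> h)]" by (rule pres.cls_rel)
  then show "free_prod2_inl G H (g \<otimes>\<^bsub>G\<^esub> h) = free_prod2_inl G H g \<otimes>\<^bsub>free_prod2 G H\<^esub> free_prod2_inl G H h"
    using * unfolding free_prod2_inl_def free_prod2_def by (subst pres.cls_mult) auto
qed

lemma free_prod2_inr_hom: "free_prod2_inr G H \<in> hom H (free_prod2 G H)"
proof (rule homI)
  fix g assume "g \<in> carrier H"
  then show "free_prod2_inr G H g \<in> carrier (free_prod2 G H)"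
    by (auto simp: free_prod2_inr_def free_prod2_def pres.carrier_presented)
next
  fix g h assume *: "g \<in> carrier H" "h \<in> carrier H"
  then have "([Inr g, Inr h], [Inr (g \<otimes>\<^bsub>H\<^esub> h)]) \<in> mult_rels Inl G \<union> mult_rels Inr H"
    by (auto simp: mult_rels_def)
  then have "pres.cls [Inr g, Inr h] = pres.cls [Inr (g \<otimes>\<^bsub>H\<^esub> h)]" by (rule pres.cls_rel)
  then show "free_prod2_inr G H (g \<otimes>\<^bsub>H\<^esub> h) = free_prod2_inr G H g \<otimes>\<^bsub>free_prod2 G H\<^esub> free_prod2_inr G H h"
    using * unfolding free_prod2_inr_def free_prod2_def by (subst pres.cls_mult) (auto dest: pres.cls_rel)
qed

lemma free_prod2_generated:
  assumes K: "carrier G = generate G K" "K \<subseteq> carrier G" and L: "carrier H = generate H L" "L \<subseteq> carrier H"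
  shows "carrier (free_prod2 G H) = generate (free_prod2 G H) (free_prod2_inl G H ` K \<union> free_prod2_inr G H ` L)"
    (is "_ = generate _ ?gens")
proof
  interpret FP: group "free_prod2 G H" by (rule group_free_prod2)
  interpret inl: group_hom G "free_prod2 G H" "free_prod2_inl G H"
    using G group_free_prod2 free_prod2_inl_hom by (simp add: group_hom_def group_hom_axioms_def)
  interpret inr: group_hom H "free_prod2 G H" "free_prod2_inr G H"
    using H group_free_prod2 free_prod2_inr_hom by (simp add: group_hom_def group_hom_axioms_def)
  have sub: "?gens \<subseteq> carrier (free_prod2 G H)" using K(2) L(2) inl.hom_closed inr.hom_closed by blast
  then show "generate (free_prod2 G H) ?gens \<subseteq> carrier (free_prod2 G H)" by (rule FP.generate_incl)
  have "free_prod2_inl G H ` carrier G \<subseteq> generate (free_prod2 G H) ?gens"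
    using inl.generate_img[OF K(2)] K(1) FP.mono_generate[of "free_prod2_inl G H ` K" ?gens] by simp
  moreover have "free_prod2_inr G H ` carrier H \<subseteq> generate (free_prod2 G H) ?gens"
    using inr.generate_img[OF L(2)] L(1) FP.mono_generate[of "free_prod2_inr G H ` L" ?gens] by simp
  moreover have "(\<lambda>s. pres.cls [s]) ` (carrier G <+> carrier H) = free_prod2_inl G H ` carrier G \<union> free_prod2_inr G H ` carrier H"
    unfolding Plus_def image_Un image_image free_prod2_inl_def free_prod2_inr_def ..
  ultimately have "(\<lambda>s. pres.cls [s]) ` (carrier G <+> carrier H) \<subseteq> generate (free_prod2 G H) ?gens" by simp
  then show "carrier (free_prod2 G H) \<subseteq> generate (free_prod2 G H) ?gens"
    using FP.generate_subgroup_incl[OF _ FP.generate_is_subgroup[OF sub]] pres.presented_generated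
    by (simp add: free_prod2_def)
qed

lemma free_prod2_universal:
  assumes P: "group P" and f: "f \<in> hom G P" "f' \<in> hom H P"
  obtains F where "F \<in> hom (free_prod2 G H) P"
    "!!g. g \<in> carrier G ==> F (free_prod2_inl G H g) = f g"
    "!!h. h \<in> carrier H ==> F (free_prod2_inr G H h) = f' h"
proof -
  have closed: "case_sum f f' \<in> (carrier G <+> carrier H) \<rightarrow> carrier P" using f by (auto simp: hom_def Pi_iff)
  have resp: "lprod P (map (case_sum f f') u) = lprod P (map (case_sum f f') v)"
    if "(u, v) \<in> mult_rels Inl G \<union> mult_rels Inr H" for u v
    using that mult_rels_respected[OF P _ G, of u v Inl "case_sum f f'"]
      mult_rels_respected[OF P _ H, of u v Inr "case_sum f f'"] f by auto
  obtain F where F: "F \<in> hom (free_prod2 G H) P" "!!s. s \<in> (carrier G <+> carrier H) ==> F (pres.cls [s]) = case_sum f f' s"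
    using pres.presented_universal[OF P closed resp] unfolding free_prod2_def by blast
  show ?thesis
    by (rule that[OF F(1)]) (use F(2)[OF InlI] F(2)[OF InrI] in \<open>simp_all add: free_prod2_inl_def free_prod2_inr_def\<close>)
qed

end

section \<open>Fundamental groups of graphs of groups\<close>

text \<open>Vertex groups, incidence, and the two families of maps on the edge groups, as far as
  they enter the defining relations.\<close>

locale group_graph =
  fixes \<Gamma> :: "('v, 'e, 'g, 'h) graph_of_groups" and T :: "('v, 'e) pre_digraph"
  assumes vertex_groups: "!!v. v \<in> verts (gg_graph \<Gamma>) ==> group (gg_vgrp \<Gamma> v)"
    and ends: "!!e. e \<in> arcs (gg_graph \<Gamma>) ==> tail (gg_graph \<Gamma>) e \<in> verts (gg_graph \<Gamma>)"
      "!!e. e \<in> arcs (gg_graph \<Gamma>) ==> head (gg_graph \<Gamma>) e \<in> verts (gg_graph \<Gamma>)"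
    and alpha_closed: "!!e g. e \<in> arcs (gg_graph \<Gamma>) ==> g \<in> carrier (gg_egrp \<Gamma> e) ==>
      gg_alpha \<Gamma> e g \<in> carrier (gg_vgrp \<Gamma> (tail (gg_graph \<Gamma>) e))"
    and beta_closed: "!!e g. e \<in> arcs (gg_graph \<Gamma>) ==> g \<in> carrier (gg_egrp \<Gamma> e) ==>
      gg_beta \<Gamma> e g \<in> carrier (gg_vgrp \<Gamma> (head (gg_graph \<Gamma>) e))"
    and tree_arcs: "arcs T \<subseteq> arcs (gg_graph \<Gamma>)"
begin

abbreviation V where "V \<equiv> verts (gg_graph \<Gamma>)"
abbreviation E where "E \<equiv> arcs (gg_graph \<Gamma>)"
abbreviation vg where "vg \<equiv> gg_vgrp \<Gamma>"

sublocale fp: free_product_of V vg by (rule free_product_of.intro) (rule vertex_groups)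
sublocale fp2: free_product2_of "free_prod V vg" "free_group E"
  by (rule free_product2_of.intro) (rule fp.group_free_prod, rule group_free_group)

abbreviation C where "C \<equiv> pi1_cover \<Gamma>"

lemma group_cover: "group C" unfolding pi1_cover_def by (rule fp2.group_free_prod2)

sublocale C: group C by (rule group_cover)

lemma pi1_vert_hom: "v \<in> V ==> pi1_vert \<Gamma> v \<in> hom (vg v) C"
proof -
  assume "v \<in> V"
  then have "free_prod2_inl (free_prod V vg) (free_group E) \<circ> free_prod_in V vg v \<in> hom (vg v) (free_prod2 (free_prod V vg) (free_group E))"
    by (intro hom_compose[OF fp.free_prod_in_hom fp2.free_prod2_inl_hom])
  moreover have "free_prod2_inl (free_prod V vg) (free_group E) \<circ> free_prod_in V vg v = pi1_vert \<Gamma> v"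
    by (simp add: fun_eq_iff pi1_vert_def)
  ultimately show ?thesis by (simp add: pi1_cover_def)
qed

lemma pi1_vert_closed: "v \<in> V ==> g \<in> carrier (vg v) ==> pi1_vert \<Gamma> v g \<in> carrier C"
  using pi1_vert_hom by (auto simp: hom_def Pi_iff)

lemma pi1_edge_closed: "e \<in> E ==> pi1_edge \<Gamma> e \<in> carrier C"
  unfolding pi1_edge_def pi1_cover_def by (rule hom_in_carrier[OF fp2.free_prod2_inr_hom free_group_gen_closed])

definition gens :: "('v, 'e, 'g) pi1_word set" where
  "gens = {pi1_vert \<Gamma> v g | v g. v \<in> V \<and> g \<in> carrier (vg v)} \<union> pi1_edge \<Gamma> ` E"

lemma gens_closed: "gens \<subseteq> carrier C"
  using pi1_vert_closed pi1_edge_closed by (auto simp: gens_def)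

lemma cover_generated: "carrier C = generate C gens"
proof -
  have "free_prod2_inl (free_prod V vg) (free_group E) ` {free_prod_in V vg v g | v g. v \<in> V \<and> g \<in> carrier (vg v)}
      \<union> free_prod2_inr (free_prod V vg) (free_group E) ` (free_group_gen E ` E) = gens"
    unfolding gens_def pi1_vert_def pi1_edge_def by auto
  moreover have "{free_prod_in V vg v g | v g. v \<in> V \<and> g \<in> carrier (vg v)} \<subseteq> carrier (free_prod V vg)"
    using fp.free_prod_in_hom by (auto simp: hom_def Pi_iff)
  moreover have "free_group_gen E ` E \<subseteq> carrier (free_group E)" using free_group_gen_closed by auto
  ultimately show ?thesis
    using fp2.free_prod2_generated[OF fp.free_prod_generated _ free_group_generated] by (simp add: pi1_cover_def)
qed

lemma cover_universal:
  assumes P: "group P" and f: "!!v. v \<in> V ==> f v \<in> hom (vg v) P" and t: "!!e. e \<in> E ==> t e \<in> carrier P"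
  obtains F where "F \<in> hom C P" "!!v g. v \<in> V ==> g \<in> carrier (vg v) ==> F (pi1_vert \<Gamma> v g) = f v g"
    "!!e. e \<in> E ==> F (pi1_edge \<Gamma> e) = t e"
proof -
  obtain F1 where F1: "F1 \<in> hom (free_prod V vg) P"
    "!!v g. v \<in> V ==> g \<in> carrier (vg v) ==> F1 (free_prod_in V vg v g) = f v g"
    by (rule fp.free_prod_universal[OF P f]) blast+
  obtain F2 where F2: "F2 \<in> hom (free_group E) P" "!!e. e \<in> E ==> F2 (free_group_gen E e) = t e"
    by (rule free_group_universal[OF P t]) blast+
  obtain F where F: "F \<in> hom (free_prod2 (free_prod V vg) (free_group E)) P"
    "!!g. g \<in> carrier (free_prod V vg) ==> F (free_prod2_inl (free_prod V vg) (free_group E) g) = F1 g"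
    "!!h. h \<in> carrier (free_group E) ==> F (free_prod2_inr (free_prod V vg) (free_group E) h) = F2 h"
    by (rule fp2.free_prod2_universal[OF P F1(1) F2(1)]) blast+
  have "free_prod_in V vg v g \<in> carrier (free_prod V vg)" if "v \<in> V" "g \<in> carrier (vg v)" for v g
    using fp.free_prod_in_hom that by (auto simp: hom_def Pi_iff)
  then show ?thesis
    by (intro that[of F])
       (use F(1,2) F(3)[OF free_group_gen_closed] F1(2) F2(2) in \<open>auto simp: pi1_cover_def pi1_vert_def pi1_edge_def\<close>)
qed

lemma rels_closed: "pi1_rels \<Gamma> T \<subseteq> carrier C"
  using pi1_vert_closed pi1_edge_closed ends alpha_closed beta_closed tree_arcs
  unfolding pi1_rels_def by (auto intro!: C.m_closed C.inv_closed)

sublocale Q: quotient_presentation C "pi1_rels \<Gamma> T"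
  by (intro quotient_presentation.intro quotient_presentation_axioms.intro group_cover rels_closed)

abbreviation proj where "proj x \<equiv> Q.N #>\<^bsub>C\<^esub> x"

text \<open>The images of the vertex groups and the edges in the fundamental group.\<close>

definition iv :: "'v => 'g => ('v, 'e, 'g) pi1_word set" where "iv v g = proj (pi1_vert \<Gamma> v g)"
definition ie :: "'e => ('v, 'e, 'g) pi1_word set" where "ie e = proj (pi1_edge \<Gamma> e)"

lemma group_pi1: "group (pi1 \<Gamma> T)" unfolding pi1_def by (rule Q.group_quotient)

sublocale pi: group "pi1 \<Gamma> T" by (rule group_pi1)

lemma proj_hom: "group_hom C (pi1 \<Gamma> T) (\<lambda>x. proj x)"
  using group_pi1 group_cover Q.projection_hom by (simp add: group_hom_def group_hom_axioms_def pi1_def)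

sublocale proj: group_hom C "pi1 \<Gamma> T" "\<lambda>x. proj x" by (rule proj_hom)

lemma iv_hom: "v \<in> V ==> iv v \<in> hom (vg v) (pi1 \<Gamma> T)"
proof -
  assume "v \<in> V"
  then have "(\<lambda>x. proj x) \<circ> pi1_vert \<Gamma> v \<in> hom (vg v) (pi1 \<Gamma> T)" by (intro hom_compose[OF pi1_vert_hom proj.homh])
  moreover have "(\<lambda>x. proj x) \<circ> pi1_vert \<Gamma> v = iv v" by (simp add: fun_eq_iff iv_def)
  ultimately show ?thesis by simp
qed

lemma iv_closed: "v \<in> V ==> g \<in> carrier (vg v) ==> iv v g \<in> carrier (pi1 \<Gamma> T)"
  using iv_hom by (auto simp: hom_def Pi_iff)

lemma ie_closed: "e \<in> E ==> ie e \<in> carrier (pi1 \<Gamma> T)"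
  unfolding ie_def by (rule proj.hom_closed) (rule pi1_edge_closed)

lemma ie_tree: "e \<in> arcs T ==> ie e = \<one>\<^bsub>pi1 \<Gamma> T\<^esub>"
  unfolding ie_def pi1_def by (rule Q.relator_trivial) (simp add: pi1_rels_def)

lemma edge_relation:
  assumes e: "e \<in> E" and g: "g \<in> carrier (gg_egrp \<Gamma> e)"
  shows "inv\<^bsub>pi1 \<Gamma> T\<^esub> ie e \<otimes>\<^bsub>pi1 \<Gamma> T\<^esub> iv (tail (gg_graph \<Gamma>) e) (gg_alpha \<Gamma> e g) \<otimes>\<^bsub>pi1 \<Gamma> T\<^esub> ie e
    = iv (head (gg_graph \<Gamma>) e) (gg_beta \<Gamma> e g)"
proof -
  note closed = pi1_edge_closed[OF e] pi1_vert_closed[OF ends(1)[OF e] alpha_closed[OF e g]] pi1_vert_closed[OF ends(2)[OF e] beta_closed[OF e g]]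
  have "inv\<^bsub>C\<^esub> (pi1_edge \<Gamma> e)
        \<otimes>\<^bsub>C\<^esub> pi1_vert \<Gamma> (tail (gg_graph \<Gamma>) e) (gg_alpha \<Gamma> e g)
        \<otimes>\<^bsub>C\<^esub> pi1_edge \<Gamma> e
        \<otimes>\<^bsub>C\<^esub> inv\<^bsub>C\<^esub> (pi1_vert \<Gamma> (head (gg_graph \<Gamma>) e) (gg_beta \<Gamma> e g)) \<in> pi1_rels \<Gamma> T"
    unfolding pi1_rels_def using e g by blast
  then show ?thesis unfolding iv_def ie_def pi1_def by (rule Q.relator_equation[OF closed])
qed

definition pi1_gens :: "('v, 'e, 'g) pi1_word set set" where
  "pi1_gens = {iv v g | v g. v \<in> V \<and> g \<in> carrier (vg v)} \<union> ie ` E"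

lemma pi1_gens_closed: "pi1_gens \<subseteq> carrier (pi1 \<Gamma> T)"
  using iv_closed ie_closed by (auto simp: pi1_gens_def)

lemma pi1_generated: "carrier (pi1 \<Gamma> T) = generate (pi1 \<Gamma> T) pi1_gens"
proof -
  have "(\<lambda>x. proj x) ` gens = pi1_gens" unfolding gens_def pi1_gens_def iv_def ie_def by auto
  then show ?thesis using Q.quotient_generated[OF cover_generated gens_closed] by (simp add: pi1_def)
qed

text \<open>A homomorphism on the fundamental group amounts to homomorphisms on the vertex
  groups and elements for the edges that satisfy the defining relations.\<close>

theorem pi1_universal:
  assumes P: "group P" and f: "!!v. v \<in> V ==> f v \<in> hom (vg v) P" and t: "!!e. e \<in> E ==> t e \<in> carrier P"
    and rel: "!!e g. e \<in> E ==> g \<in> carrier (gg_egrp \<Gamma> e) ==>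
      inv\<^bsub>P\<^esub> t e \<otimes>\<^bsub>P\<^esub> f (tail (gg_graph \<Gamma>) e) (gg_alpha \<Gamma> e g) \<otimes>\<^bsub>P\<^esub> t e = f (head (gg_graph \<Gamma>) e) (gg_beta \<Gamma> e g)"
    and tree: "!!e. e \<in> arcs T ==> t e = \<one>\<^bsub>P\<^esub>"
  obtains F where "F \<in> hom (pi1 \<Gamma> T) P" "!!v g. v \<in> V ==> g \<in> carrier (vg v) ==> F (iv v g) = f v g"
    "!!e. e \<in> E ==> F (ie e) = t e"
proof -
  interpret P: group P by (rule P)
  obtain F0 where F0: "F0 \<in> hom C P" "!!v g. v \<in> V ==> g \<in> carrier (vg v) ==> F0 (pi1_vert \<Gamma> v g) = f v g"
    "!!e. e \<in> E ==> F0 (pi1_edge \<Gamma> e) = t e"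
    by (rule cover_universal[OF P f t]) blast+
  interpret F0: group_hom C P F0 using group_cover P F0(1) by (simp add: group_hom_def group_hom_axioms_def)
  have "F0 r = \<one>\<^bsub>P\<^esub>" if "r \<in> pi1_rels \<Gamma> T" for r
  proof -
    from that consider e g where "e \<in> E" "g \<in> carrier (gg_egrp \<Gamma> e)"
        "r = inv\<^bsub>C\<^esub> (pi1_edge \<Gamma> e)
        \<otimes>\<^bsub>C\<^esub> pi1_vert \<Gamma> (tail (gg_graph \<Gamma>) e) (gg_alpha \<Gamma> e g)
        \<otimes>\<^bsub>C\<^esub> pi1_edge \<Gamma> e
        \<otimes>\<^bsub>C\<^esub> inv\<^bsub>C\<^esub> (pi1_vert \<Gamma> (head (gg_graph \<Gamma>) e) (gg_beta \<Gamma> e g))"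
      | e where "e \<in> arcs T" "r = pi1_edge \<Gamma> e" unfolding pi1_rels_def by blast
    then show ?thesis
    proof cases
      case 1
      note closed = pi1_edge_closed[OF 1(1)] pi1_vert_closed[OF ends(1)[OF 1(1)] alpha_closed[OF 1(1,2)]] pi1_vert_closed[OF ends(2)[OF 1(1)] beta_closed[OF 1(1,2)]]
      have "F0 r = inv\<^bsub>P\<^esub> t e \<otimes>\<^bsub>P\<^esub> f (tail (gg_graph \<Gamma>) e) (gg_alpha \<Gamma> e g) \<otimes>\<^bsub>P\<^esub> t e \<otimes>\<^bsub>P\<^esub> inv\<^bsub>P\<^esub> f (head (gg_graph \<Gamma>) e) (gg_beta \<Gamma> e g)"
        unfolding 1(3) using closed F0(2)[OF ends(1)[OF 1(1)] alpha_closed[OF 1(1,2)]]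
          F0(2)[OF ends(2)[OF 1(1)] beta_closed[OF 1(1,2)]] F0(3)[OF 1(1)] by simp
      moreover have "f (head (gg_graph \<Gamma>) e) (gg_beta \<Gamma> e g) \<in> carrier P"
        using f[OF ends(2)[OF 1(1)]] beta_closed[OF 1(1,2)] by (auto simp: hom_def Pi_iff)
      ultimately show ?thesis using rel[OF 1(1,2)] by simp
    next
      case 2
      then show ?thesis using tree_arcs F0(3)[of e] tree by auto
    qed
  qed
  then obtain F where F: "F \<in> hom (pi1 \<Gamma> T) P" "!!x. x \<in> carrier C ==> F (proj x) = F0 x"
    unfolding pi1_def by (rule Q.quotient_universal[OF P F0(1)]) blast+
  then show ?thesis
    by (intro that[of F]) (use F0 pi1_vert_closed pi1_edge_closed in \<open>auto simp: iv_def ie_def\<close>)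
qed

end

text \<open>If the tree contains all vertices, the tree product contains all vertex groups, and
  the remaining edges contribute the stable letters.\<close>

locale spanned_group_graph = group_graph \<Gamma> T
  for \<Gamma> :: "('v, 'e, 'g, 'h) graph_of_groups" and T +
  assumes spanning: "verts T = verts (gg_graph \<Gamma>)"
    and tree_ends: "tail T = tail (gg_graph \<Gamma>)" "head T = head (gg_graph \<Gamma>)"
begin

sublocale tr: group_graph "\<Gamma>\<lparr>gg_graph := T\<rparr>" T
  by (rule group_graph.intro) (use vertex_groups ends alpha_closed beta_closed tree_arcs spanning tree_ends in auto)

sublocale tp: free_product2_of "tree_product \<Gamma> T" "free_group (E - arcs T)"
  by (rule free_product2_of.intro) (simp_all add: tree_product_def tr.group_pi1 group_free_group)

abbreviation D where "D \<equiv> tree_pres_cover \<Gamma> T"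

sublocale D: group D unfolding tree_pres_cover_def by (rule tp.group_free_prod2)

lemma tree_product_in_eq: "tree_product_in \<Gamma> T v g = tr.iv v g"
  by (simp add: tree_product_in_def tr.iv_def)

lemma tree_product_in_hom: "v \<in> V ==> tree_product_in \<Gamma> T v \<in> hom (vg v) (tree_product \<Gamma> T)"
  using tr.iv_hom[of v] spanning by (simp add: tree_product_def tree_product_in_eq[abs_def] eta_contract_eq)

lemma tree_pres_vert_hom: "v \<in> V ==> tree_pres_vert \<Gamma> T v \<in> hom (vg v) D"
  using hom_compose[OF tree_product_in_hom tp.free_prod2_inl_hom, of v]
  by (simp add: tree_pres_vert_def[abs_def] tree_pres_cover_def comp_def)

lemma tree_pres_vert_closed: "v \<in> V ==> g \<in> carrier (vg v) ==> tree_pres_vert \<Gamma> T v g \<in> carrier D"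
  using tree_pres_vert_hom by (auto simp: hom_def Pi_iff)

lemma tree_pres_edge_closed: "e \<in> E - arcs T ==> tree_pres_edge \<Gamma> T e \<in> carrier D"
  unfolding tree_pres_edge_def tree_pres_cover_def by (rule hom_in_carrier[OF tp.free_prod2_inr_hom free_group_gen_closed])

lemma tree_pres_rels_closed: "tree_pres_rels \<Gamma> T \<subseteq> carrier D"
  using tree_pres_vert_closed tree_pres_edge_closed ends alpha_closed beta_closed
  unfolding tree_pres_rels_def by (auto intro!: D.m_closed D.inv_closed)

sublocale DQ: quotient_presentation D "tree_pres_rels \<Gamma> T"
  by (intro quotient_presentation.intro quotient_presentation_axioms.intro D.is_group tree_pres_rels_closed)

abbreviation tproj where "tproj x \<equiv> DQ.N #>\<^bsub>D\<^esub> x"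

definition jv :: "'v => 'g => ('v, 'e, 'g) tree_pres_word set" where "jv v g = tproj (tree_pres_vert \<Gamma> T v g)"
definition je :: "'e => ('v, 'e, 'g) tree_pres_word set" where "je e = tproj (tree_pres_edge \<Gamma> T e)"

sublocale tp1: group "tree_pres \<Gamma> T" unfolding tree_pres_def by (rule DQ.group_quotient)

lemma tproj_hom: "group_hom D (tree_pres \<Gamma> T) (\<lambda>x. tproj x)"
  using tp1.is_group D.is_group DQ.projection_hom by (simp add: group_hom_def group_hom_axioms_def tree_pres_def)

sublocale tproj: group_hom D "tree_pres \<Gamma> T" "\<lambda>x. tproj x" by (rule tproj_hom)

lemma jv_hom: "v \<in> V ==> jv v \<in> hom (vg v) (tree_pres \<Gamma> T)"
  using hom_compose[OF tree_pres_vert_hom tproj.homh, of v] by (simp add: comp_def jv_def[abs_def])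

lemma jv_closed: "v \<in> V ==> g \<in> carrier (vg v) ==> jv v g \<in> carrier (tree_pres \<Gamma> T)"
  using jv_hom by (auto simp: hom_def Pi_iff)

lemma je_closed: "e \<in> E - arcs T ==> je e \<in> carrier (tree_pres \<Gamma> T)"
  unfolding je_def by (rule tproj.hom_closed) (rule tree_pres_edge_closed)

lemma tree_pres_edge_relation:
  assumes e: "e \<in> E - arcs T" and g: "g \<in> carrier (gg_egrp \<Gamma> e)"
  shows "inv\<^bsub>tree_pres \<Gamma> T\<^esub> je e \<otimes>\<^bsub>tree_pres \<Gamma> T\<^esub> jv (tail (gg_graph \<Gamma>) e) (gg_alpha \<Gamma> e g) \<otimes>\<^bsub>tree_pres \<Gamma> T\<^esub> je e
    = jv (head (gg_graph \<Gamma>) e) (gg_beta \<Gamma> e g)"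
proof -
  have eE: "e \<in> E" using e by simp
  note closed = tree_pres_edge_closed[OF e] tree_pres_vert_closed[OF ends(1)[OF eE] alpha_closed[OF eE g]] tree_pres_vert_closed[OF ends(2)[OF eE] beta_closed[OF eE g]]
  have "inv\<^bsub>D\<^esub> (tree_pres_edge \<Gamma> T e)
        \<otimes>\<^bsub>D\<^esub> tree_pres_vert \<Gamma> T (tail (gg_graph \<Gamma>) e) (gg_alpha \<Gamma> e g)
        \<otimes>\<^bsub>D\<^esub> tree_pres_edge \<Gamma> T e
        \<otimes>\<^bsub>D\<^esub> inv\<^bsub>D\<^esub> (tree_pres_vert \<Gamma> T (head (gg_graph \<Gamma>) e) (gg_beta \<Gamma> e g)) \<in> tree_pres_rels \<Gamma> T"
    unfolding tree_pres_rels_def using e g by blast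
  then show ?thesis unfolding jv_def je_def tree_pres_def by (rule DQ.relator_equation[OF closed])
qed

lemma tree_relation:
  assumes e: "e \<in> arcs T" and g: "g \<in> carrier (gg_egrp \<Gamma> e)"
  shows "jv (tail (gg_graph \<Gamma>) e) (gg_alpha \<Gamma> e g) = jv (head (gg_graph \<Gamma>) e) (gg_beta \<Gamma> e g)"
proof -
  have eE: "e \<in> E" using e tree_arcs by blast
  have "tr.iv (tail (gg_graph \<Gamma>) e) (gg_alpha \<Gamma> e g) \<in> carrier (pi1 (\<Gamma>\<lparr>gg_graph := T\<rparr>) T)"
    using tr.iv_closed[of "tail (gg_graph \<Gamma>) e"] ends(1)[OF eE] alpha_closed[OF eE g] spanning by simp
  then have "tr.iv (tail (gg_graph \<Gamma>) e) (gg_alpha \<Gamma> e g) = tr.iv (head (gg_graph \<Gamma>) e) (gg_beta \<Gamma> e g)"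
    using tr.edge_relation[of e g] tr.ie_tree[OF e] e g tree_ends by simp
  then show ?thesis by (simp add: jv_def tree_pres_vert_def tree_product_in_eq)
qed

definition tree_pres_gens :: "('v, 'e, 'g) tree_pres_word set set" where
  "tree_pres_gens = {jv v g | v g. v \<in> V \<and> g \<in> carrier (vg v)} \<union> je ` (E - arcs T)"

lemma tree_pres_gens_closed: "tree_pres_gens \<subseteq> carrier (tree_pres \<Gamma> T)"
  using jv_closed je_closed by (auto simp: tree_pres_gens_def)

lemma tree_pres_generated: "carrier (tree_pres \<Gamma> T) = generate (tree_pres \<Gamma> T) tree_pres_gens"
proof -
  \<comment> \<open>the letters of the tree edges are trivial and can be omitted from the
    generators\<close>
  let ?K = "{tree_product_in \<Gamma> T v g | v g. v \<in> V \<and> g \<in> carrier (vg v)}"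
  have one: "generate (tree_product \<Gamma> T) (?K \<union> tr.ie ` arcs T) = generate (tree_product \<Gamma> T) ?K"
  proof
    interpret tree_product: group "tree_product \<Gamma> T" unfolding tree_product_def by (rule tr.group_pi1)
    have K: "?K \<subseteq> carrier (tree_product \<Gamma> T)" using hom_in_carrier[OF tree_product_in_hom] by blast
    have "tr.ie ` arcs T \<subseteq> {\<one>\<^bsub>tree_product \<Gamma> T\<^esub>}" using tr.ie_tree by (auto simp: tree_product_def)
    also have "{\<one>\<^bsub>tree_product \<Gamma> T\<^esub>} \<subseteq> generate (tree_product \<Gamma> T) ?K" by (simp add: generate.one)
    finally have ie: "tr.ie ` arcs T \<subseteq> generate (tree_product \<Gamma> T) ?K" .
    have "?K \<subseteq> generate (tree_product \<Gamma> T) ?K" by (rule subsetI, rule generate.incl)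
    then have "?K \<union> tr.ie ` arcs T \<subseteq> generate (tree_product \<Gamma> T) ?K" using ie by (rule Un_least)
    then show "generate (tree_product \<Gamma> T) (?K \<union> tr.ie ` arcs T) \<subseteq> generate (tree_product \<Gamma> T) ?K"
      by (rule tree_product.generate_subgroup_incl[OF _ tree_product.generate_is_subgroup[OF K]])
    show "generate (tree_product \<Gamma> T) ?K \<subseteq> generate (tree_product \<Gamma> T) (?K \<union> tr.ie ` arcs T)"
      by (rule tree_product.mono_generate) simp
  qed
  have K: "carrier (tree_product \<Gamma> T) = generate (tree_product \<Gamma> T) ?K"
  proof -
    have "tr.pi1_gens = ?K \<union> tr.ie ` arcs T"
      unfolding tr.pi1_gens_def tree_product_in_eq using spanning by simp
    then show ?thesis using tr.pi1_generated one unfolding tree_product_def by simp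
  qed
  have K': "?K \<subseteq> carrier (tree_product \<Gamma> T)" using hom_in_carrier[OF tree_product_in_hom] by blast
  have L': "free_group_gen (E - arcs T) ` (E - arcs T) \<subseteq> carrier (free_group (E - arcs T))"
    by (rule image_subsetI) (rule free_group_gen_closed)
  let ?cover_gens = "free_prod2_inl (tree_product \<Gamma> T) (free_group (E - arcs T)) ` ?K
    \<union> free_prod2_inr (tree_product \<Gamma> T) (free_group (E - arcs T)) ` (free_group_gen (E - arcs T) ` (E - arcs T))"
  have cover: "carrier D = generate D ?cover_gens"
    unfolding tree_pres_cover_def by (rule tp.free_prod2_generated[OF K K' free_group_generated L'])
  have eq: "?cover_gens = {tree_pres_vert \<Gamma> T v g | v g. v \<in> V \<and> g \<in> carrier (vg v)} \<union> tree_pres_edge \<Gamma> T ` (E - arcs T)"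
    unfolding tree_pres_vert_def tree_pres_edge_def by auto
  have "?cover_gens \<subseteq> carrier D" unfolding eq using tree_pres_vert_closed tree_pres_edge_closed by auto
  note DQ.quotient_generated[OF cover this]
  moreover have "(\<lambda>x. tproj x) ` ?cover_gens = tree_pres_gens"
    unfolding eq tree_pres_gens_def jv_def je_def by auto
  ultimately show ?thesis by (simp add: tree_pres_def)
qed

theorem tree_pres_universal:
  assumes P: "group P" and f: "!!v. v \<in> V ==> f v \<in> hom (vg v) P" and t: "!!e. e \<in> E - arcs T ==> t e \<in> carrier P"
    and rel: "!!e g. e \<in> E - arcs T ==> g \<in> carrier (gg_egrp \<Gamma> e) ==>
      inv\<^bsub>P\<^esub> t e \<otimes>\<^bsub>P\<^esub> f (tail (gg_graph \<Gamma>) e) (gg_alpha \<Gamma> e g) \<otimes>\<^bsub>P\<^esub> t e = f (head (gg_graph \<Gamma>) e) (gg_beta \<Gamma> e g)"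
    and tree: "!!e g. e \<in> arcs T ==> g \<in> carrier (gg_egrp \<Gamma> e) ==>
      f (tail (gg_graph \<Gamma>) e) (gg_alpha \<Gamma> e g) = f (head (gg_graph \<Gamma>) e) (gg_beta \<Gamma> e g)"
  obtains F where "F \<in> hom (tree_pres \<Gamma> T) P" "!!v g. v \<in> V ==> g \<in> carrier (vg v) ==> F (jv v g) = f v g"
    "!!e. e \<in> E - arcs T ==> F (je e) = t e"
proof -
  interpret P: group P by (rule P)
  have fc: "f v g \<in> carrier P" if "v \<in> V" "g \<in> carrier (vg v)" for v g using f that by (auto simp: hom_def Pi_iff)
  have 1: "f v \<in> hom (gg_vgrp (\<Gamma>\<lparr>gg_graph := T\<rparr>) v) P" if "v \<in> verts (gg_graph (\<Gamma>\<lparr>gg_graph := T\<rparr>))" for v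
    using that f spanning by simp
  have 2: "inv\<^bsub>P\<^esub> \<one>\<^bsub>P\<^esub> \<otimes>\<^bsub>P\<^esub> f (tail (gg_graph (\<Gamma>\<lparr>gg_graph := T\<rparr>)) e) (gg_alpha (\<Gamma>\<lparr>gg_graph := T\<rparr>) e g) \<otimes>\<^bsub>P\<^esub> \<one>\<^bsub>P\<^esub>
      = f (head (gg_graph (\<Gamma>\<lparr>gg_graph := T\<rparr>)) e) (gg_beta (\<Gamma>\<lparr>gg_graph := T\<rparr>) e g)"
    if "e \<in> arcs (gg_graph (\<Gamma>\<lparr>gg_graph := T\<rparr>))" "g \<in> carrier (gg_egrp (\<Gamma>\<lparr>gg_graph := T\<rparr>) e)" for e g
  proof -
    from that have eg: "e \<in> arcs T" "g \<in> carrier (gg_egrp \<Gamma> e)" and eE: "e \<in> E" using tree_arcs by auto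
    show ?thesis using tree[OF eg] tree_ends fc[OF ends(1)[OF eE] alpha_closed[OF eE eg(2)]] fc[OF ends(2)[OF eE] beta_closed[OF eE eg(2)]]
      by simp
  qed
  obtain F1 where F1: "F1 \<in> hom (tree_product \<Gamma> T) P" "!!v g. v \<in> V ==> g \<in> carrier (vg v) ==> F1 (tr.iv v g) = f v g"
    unfolding tree_product_def
    by (rule tr.pi1_universal[where f = f and t = "\<lambda>_. \<one>\<^bsub>P\<^esub>", OF P 1 P.one_closed 2 HOL.refl]) (auto simp: spanning)
  obtain F2 where F2: "F2 \<in> hom (free_group (E - arcs T)) P" "!!e. e \<in> E - arcs T ==> F2 (free_group_gen (E - arcs T) e) = t e"
    by (rule free_group_universal[OF P t]) blast+
  obtain F0 where F0: "F0 \<in> hom D P"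
    "!!g. g \<in> carrier (tree_product \<Gamma> T) ==> F0 (free_prod2_inl (tree_product \<Gamma> T) (free_group (E - arcs T)) g) = F1 g"
    "!!h. h \<in> carrier (free_group (E - arcs T)) ==> F0 (free_prod2_inr (tree_product \<Gamma> T) (free_group (E - arcs T)) h) = F2 h"
    unfolding tree_pres_cover_def by (rule tp.free_prod2_universal[OF P F1(1) F2(1)]) blast+
  have F0v: "F0 (tree_pres_vert \<Gamma> T v g) = f v g" if "v \<in> V" "g \<in> carrier (vg v)" for v g
    using F0(2)[of "tree_product_in \<Gamma> T v g"] F1(2)[OF that] tree_product_in_hom[OF that(1)] that
    by (auto simp: tree_pres_vert_def tree_product_in_eq hom_def Pi_iff)
  have F0e: "F0 (tree_pres_edge \<Gamma> T e) = t e" if "e \<in> E - arcs T" for e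
    unfolding tree_pres_edge_def using F0(3)[OF free_group_gen_closed[OF that]] F2(2)[OF that] by simp
  interpret F0: group_hom D P F0 using D.is_group P F0(1) by (simp add: group_hom_def group_hom_axioms_def)
  have "F0 r = \<one>\<^bsub>P\<^esub>" if "r \<in> tree_pres_rels \<Gamma> T" for r
  proof -
    from that obtain e g where e: "e \<in> E - arcs T" and g: "g \<in> carrier (gg_egrp \<Gamma> e)" and
       r: "r = inv\<^bsub>D\<^esub> (tree_pres_edge \<Gamma> T e)
        \<otimes>\<^bsub>D\<^esub> tree_pres_vert \<Gamma> T (tail (gg_graph \<Gamma>) e) (gg_alpha \<Gamma> e g)
        \<otimes>\<^bsub>D\<^esub> tree_pres_edge \<Gamma> T e
        \<otimes>\<^bsub>D\<^esub> inv\<^bsub>D\<^esub> (tree_pres_vert \<Gamma> T (head (gg_graph \<Gamma>) e) (gg_beta \<Gamma> e g))"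
      unfolding tree_pres_rels_def by blast
    have eE: "e \<in> E" using e by simp
    note closed = tree_pres_edge_closed[OF e] tree_pres_vert_closed[OF ends(1)[OF eE] alpha_closed[OF eE g]] tree_pres_vert_closed[OF ends(2)[OF eE] beta_closed[OF eE g]]
    have "F0 r = inv\<^bsub>P\<^esub> t e \<otimes>\<^bsub>P\<^esub> f (tail (gg_graph \<Gamma>) e) (gg_alpha \<Gamma> e g) \<otimes>\<^bsub>P\<^esub> t e \<otimes>\<^bsub>P\<^esub> inv\<^bsub>P\<^esub> f (head (gg_graph \<Gamma>) e) (gg_beta \<Gamma> e g)"
      unfolding r using closed F0v[OF ends(1)[OF eE] alpha_closed[OF eE g]]
        F0v[OF ends(2)[OF eE] beta_closed[OF eE g]] F0e[OF e] by simp
    then show ?thesis using rel[OF e g] fc[OF ends(2)[OF eE] beta_closed[OF eE g]] by simp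
  qed
  then obtain F where F: "F \<in> hom (tree_pres \<Gamma> T) P" "!!x. x \<in> carrier D ==> F (tproj x) = F0 x"
    unfolding tree_pres_def by (rule DQ.quotient_universal[OF P F0(1)]) blast+
  show ?thesis
    by (rule that[OF F(1)]) (use F(2) F0v F0e tree_pres_vert_closed tree_pres_edge_closed in \<open>auto simp: jv_def je_def\<close>)
qed

text \<open>Both groups have the same universal property: in the first one the edges of the tree
  are present as generators but trivial.\<close>

theorem pi1_iso_tree_pres: "pi1 \<Gamma> T \<cong> tree_pres \<Gamma> T"
proof -
  let ?t = "\<lambda>e. if e \<in> arcs T then \<one>\<^bsub>tree_pres \<Gamma> T\<^esub> else je e"
  have t: "?t e \<in> carrier (tree_pres \<Gamma> T)" if "e \<in> E" for e using that je_closed by simp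
  have rel: "inv\<^bsub>tree_pres \<Gamma> T\<^esub> ?t e \<otimes>\<^bsub>tree_pres \<Gamma> T\<^esub> jv (tail (gg_graph \<Gamma>) e) (gg_alpha \<Gamma> e g) \<otimes>\<^bsub>tree_pres \<Gamma> T\<^esub> ?t e
      = jv (head (gg_graph \<Gamma>) e) (gg_beta \<Gamma> e g)" if "e \<in> E" "g \<in> carrier (gg_egrp \<Gamma> e)" for e g
    using that tree_pres_edge_relation[of e g] tree_relation[of e g] jv_closed[OF ends(2) beta_closed, OF that(1) that] by simp
  obtain F where F: "F \<in> hom (pi1 \<Gamma> T) (tree_pres \<Gamma> T)" "!!v g. v \<in> V ==> g \<in> carrier (vg v) ==> F (iv v g) = jv v g"
    "!!e. e \<in> E ==> F (ie e) = ?t e"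
    by (rule pi1_universal[OF tp1.is_group jv_hom t rel]) auto
  have rel': "iv (tail (gg_graph \<Gamma>) e) (gg_alpha \<Gamma> e g) = iv (head (gg_graph \<Gamma>) e) (gg_beta \<Gamma> e g)"
    if "e \<in> arcs T" "g \<in> carrier (gg_egrp \<Gamma> e)" for e g
  proof -
    have eE: "e \<in> E" using that tree_arcs by blast
    show ?thesis using edge_relation[OF eE that(2)] ie_tree[OF that(1)] iv_closed[OF ends(1)[OF eE] alpha_closed[OF eE that(2)]] by simp
  qed
  have rel0: "inv\<^bsub>pi1 \<Gamma> T\<^esub> ie e \<otimes>\<^bsub>pi1 \<Gamma> T\<^esub> iv (tail (gg_graph \<Gamma>) e) (gg_alpha \<Gamma> e g) \<otimes>\<^bsub>pi1 \<Gamma> T\<^esub> ie e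
    = iv (head (gg_graph \<Gamma>) e) (gg_beta \<Gamma> e g)" if "e \<in> E - arcs T" "g \<in> carrier (gg_egrp \<Gamma> e)" for e g
    using that edge_relation by simp
  have ie': "ie e \<in> carrier (pi1 \<Gamma> T)" if "e \<in> E - arcs T" for e using that ie_closed by simp
  obtain F' where F': "F' \<in> hom (tree_pres \<Gamma> T) (pi1 \<Gamma> T)" "!!v g. v \<in> V ==> g \<in> carrier (vg v) ==> F' (jv v g) = iv v g"
    "!!e. e \<in> E - arcs T ==> F' (je e) = ie e"
    by (rule tree_pres_universal[OF group_pi1 iv_hom ie' rel0 rel']) auto
  have one: "F' \<one>\<^bsub>tree_pres \<Gamma> T\<^esub> = \<one>\<^bsub>pi1 \<Gamma> T\<^esub>"
    using F'(1) by (intro hom_one tp1.is_group group_pi1)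
  show ?thesis
  proof (rule iso_by_inverse_homs[OF group_pi1 tp1.is_group F(1) F'(1) pi1_generated pi1_gens_closed
        tree_pres_generated tree_pres_gens_closed])
    fix x assume "x \<in> pi1_gens"
    then consider v g where "x = iv v g" "v \<in> V" "g \<in> carrier (vg v)" | e where "x = ie e" "e \<in> E"
      unfolding pi1_gens_def by blast
    then show "F' (F x) = x" using F F' one ie_tree by cases auto
  next
    fix y assume "y \<in> tree_pres_gens"
    then consider v g where "y = jv v g" "v \<in> V" "g \<in> carrier (vg v)" | e where "y = je e" "e \<in> E - arcs T"
      unfolding tree_pres_gens_def by blast
    then show "F (F' y) = y" using F F' by cases auto
  qed
qed

end

section \<open>Point stabilizers of an amalgam\<close>

lemma (in group) cancel_inv:
  assumes "v \<in> carrier G" "y \<in> carrier G"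
  shows "inv v \<otimes> (v \<otimes> y) = y" "v \<otimes> (inv v \<otimes> y) = y"
  using assms by (simp_all flip: m_assoc)

lemma (in group) transport_mult:
  assumes "u \<in> carrier G" "v \<in> carrier G" "w \<in> carrier G" "g \<in> carrier G" "h \<in> carrier G"
  shows "(u \<otimes> g \<otimes> inv v) \<otimes> (v \<otimes> h \<otimes> inv w) = u \<otimes> (g \<otimes> h) \<otimes> inv w"
  using assms by (simp add: m_assoc cancel_inv)

text \<open>An amalgam acting on X, with the graph of orbits of A, B and A \<inter> B, and for
  each point x an element t x that moves it to the base point. These elements are compatible
  with the orbits: t is constant on A-orbits modulo A, and, after correction by \<gamma>, on
  B-orbits modulo B. The vertex and edge groups are the stabilizers of the points of the orbits,
  transported to the base point.\<close>

locale orbit_group_graph = amalgam G A B + spanned_group_graph \<Gamma> T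
  for G (structure) and A B :: "'a set" and \<Gamma> :: "('v, 'e, 'a, 'a) graph_of_groups" and T +
  fixes X :: "'x set" and act :: "'a => 'x => 'x" and base :: 'x and S :: "'a set"
    and vA vB :: "'x => 'v" and ed :: "'x => 'e" and t :: "'x => 'a" and \<gamma> :: "'e => 'a"
  assumes act_closed: "!!g x. g \<in> carrier G ==> x \<in> X ==> act g x \<in> X"
    and act_one: "!!x. x \<in> X ==> act \<one> x = x"
    and act_mult: "!!g h x. g \<in> carrier G ==> h \<in> carrier G ==> x \<in> X ==> act (g \<otimes> h) x = act g (act h x)"
    and base: "base \<in> X" and S_def: "S = {g \<in> carrier G. act g base = base}"
    and V_eq: "verts (gg_graph \<Gamma>) = vA ` X \<union> vB ` X" and E_eq: "arcs (gg_graph \<Gamma>) = ed ` X"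
    and ends_ed: "!!x. x \<in> X ==> tail (gg_graph \<Gamma>) (ed x) = vA x" "!!x. x \<in> X ==> head (gg_graph \<Gamma>) (ed x) = vB x"
    and bipartite: "!!x y. x \<in> X ==> y \<in> X ==> vA x \<noteq> vB y"
    and vA_iff: "!!x y. x \<in> X ==> y \<in> X ==> vA x = vA y \<longleftrightarrow> (\<exists>a\<in>A. y = act a x)"
    and vB_iff: "!!x y. x \<in> X ==> y \<in> X ==> vB x = vB y \<longleftrightarrow> (\<exists>b\<in>B. y = act b x)"
    and ed_act: "!!u x. u \<in> A ==> u \<in> B ==> x \<in> X ==> ed (act u x) = ed x"
    and t: "!!x. x \<in> X ==> t x \<in> carrier G" "!!x. x \<in> X ==> act (t x) x = base"
    and \<gamma>: "!!e. e \<in> arcs (gg_graph \<Gamma>) ==> \<gamma> e \<in> S" "!!e. e \<in> arcs T ==> \<gamma> e = \<one>"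
    and tA: "!!a x. a \<in> A ==> x \<in> X ==> inv (t x) \<otimes> t (act a x) \<in> A"
    and tB: "!!b x. b \<in> B ==> x \<in> X ==> inv (inv (\<gamma> (ed x)) \<otimes> t x) \<otimes> (inv (\<gamma> (ed (act b x))) \<otimes> t (act b x)) \<in> B"
    and vgA: "!!x. x \<in> X ==> gg_vgrp \<Gamma> (vA x) = G\<lparr>carrier := {g \<in> S. inv (t x) \<otimes> g \<otimes> t x \<in> A}\<rparr>"
    and vgB: "!!x. x \<in> X ==> gg_vgrp \<Gamma> (vB x) =
      G\<lparr>carrier := {g \<in> S. inv (inv (\<gamma> (ed x)) \<otimes> t x) \<otimes> g \<otimes> (inv (\<gamma> (ed x)) \<otimes> t x) \<in> B}\<rparr>"
    and eg: "!!x. x \<in> X ==> gg_egrp \<Gamma> (ed x) = G\<lparr>carrier := {g \<in> S. inv (t x) \<otimes> g \<otimes> t x \<in> A \<inter> B}\<rparr>"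
    and alpha: "!!e g. gg_alpha \<Gamma> e g = g" and beta: "!!e g. gg_beta \<Gamma> e g = inv (\<gamma> e) \<otimes> g \<otimes> \<gamma> e"
begin

abbreviation P where "P \<equiv> pi1 \<Gamma> T"

text \<open>The transport element to be used along B-orbits.\<close>

definition s :: "'x => 'a" where "s x = inv (\<gamma> (ed x)) \<otimes> t x"

lemma S_carrier: "g \<in> S ==> g \<in> carrier G" by (simp add: S_def)

lemma subgroup_S: "subgroup S G"
proof (rule subgroupI)
  show "S \<noteq> {}" using base act_one by (auto simp: S_def)
next
  fix g assume g: "g \<in> S"
  then have "act (inv g) (act g base) = act (inv g \<otimes> g) base" using base by (intro act_mult[symmetric]) (auto simp: S_def)
  then show "inv g \<in> S" using g base by (simp add: S_def act_one)
qed (auto simp: S_def act_mult base)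

sublocale S: group "G\<lparr>carrier := S\<rparr>" by (rule subgroup_imp_group[OF subgroup_S])

lemma A_carrier: "a \<in> A ==> a \<in> carrier G" and B_carrier: "b \<in> B ==> b \<in> carrier G"
  using AB_carrier by auto

lemma ed_E: "x \<in> X ==> ed x \<in> E" and vA_V: "x \<in> X ==> vA x \<in> V" and vB_V: "x \<in> X ==> vB x \<in> V"
  by (auto simp: V_eq E_eq)

lemma \<gamma>_carrier: "x \<in> X ==> \<gamma> (ed x) \<in> carrier G"
  using \<gamma>(1) S_carrier by (simp add: E_eq)

lemma s_carrier: "x \<in> X ==> s x \<in> carrier G" by (simp add: s_def t \<gamma>_carrier)

lemma act_inv: "g \<in> carrier G ==> x \<in> X ==> act g x = y ==> act (inv g) y = x"
  by (auto simp: act_one simp flip: act_mult)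

lemma s_base: "x \<in> X ==> act (s x) x = base"
  using act_inv[of "\<gamma> (ed x)" base base] \<gamma>(1)[of "ed x"] base
  by (simp add: s_def act_mult \<gamma>_carrier t S_def E_eq)

lemma vA_act: "a \<in> A ==> x \<in> X ==> vA (act a x) = vA x"
  using vA_iff[of x "act a x"] by (auto simp: act_closed A_carrier)
lemma vB_act: "b \<in> B ==> x \<in> X ==> vB (act b x) = vB x"
  using vB_iff[of x "act b x"] by (auto simp: act_closed B_carrier)

lemma transport_S:
  assumes "g \<in> carrier G" "x \<in> X" "u \<in> carrier G" "act u (act g x) = base" "v \<in> carrier G" "act v x = base"
  shows "u \<otimes> g \<otimes> inv v \<in> S"
proof -
  have "act (u \<otimes> g \<otimes> inv v) base = base"
    using assms act_inv[OF assms(5,2,6)] base by (simp add: act_mult act_closed)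
  then show ?thesis using assms by (simp add: S_def)
qed

lemma cancel_mid: "u \<in> carrier G ==> v \<in> carrier G ==> g \<in> carrier G ==> inv v \<otimes> (u \<otimes> g \<otimes> inv v) \<otimes> v = inv v \<otimes> u \<otimes> g"
  by (simp add: m_assoc)

text \<open>An element a that moves x within its A-orbit is transported to the base point and
  interpreted in the vertex group.\<close>

definition cA :: "'a => 'x => ('v, 'e, 'a) pi1_word set" where
  "cA a x = iv (vA x) (t (act a x) \<otimes> a \<otimes> inv (t x))"

text \<open>Along B-orbits one travels over the edge of x to the vertex and back over the edge
  of b x; this makes the two cocycles agree on A \<inter> B by the edge relation.\<close>

definition cB :: "'a => 'x => ('v, 'e, 'a) pi1_word set" where
  "cB b x = ie (ed (act b x)) \<otimes>\<^bsub>P\<^esub> iv (vB x) (s (act b x) \<otimes> b \<otimes> inv (s x)) \<otimes>\<^bsub>P\<^esub> inv\<^bsub>P\<^esub> ie (ed x)"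

lemma vgA_mem: "x \<in> X ==> a \<in> A ==> t (act a x) \<otimes> a \<otimes> inv (t x) \<in> carrier (vg (vA x))"
  using transport_S[of a x "t (act a x)" "t x"] tA subgroup.m_closed[OF A tA]
  by (simp add: vgA t act_closed A_carrier cancel_mid)

lemma vgB_mem: "x \<in> X ==> b \<in> B ==> s (act b x) \<otimes> b \<otimes> inv (s x) \<in> carrier (vg (vB x))"
  using transport_S[of b x "s (act b x)" "s x"] subgroup.m_closed[OF B tB]
  by (simp add: vgB s_carrier s_base act_closed B_carrier cancel_mid flip: s_def)

lemma iv_mult: "v \<in> V ==> g \<in> carrier (vg v) ==> h \<in> carrier (vg v) ==> iv v (g \<otimes>\<^bsub>vg v\<^esub> h) = iv v g \<otimes>\<^bsub>P\<^esub> iv v h"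
  using iv_hom by (simp add: hom_def)

lemma iv_A_mult: "x \<in> X ==> g \<in> carrier (vg (vA x)) ==> h \<in> carrier (vg (vA x)) ==> iv (vA x) (g \<otimes> h) = iv (vA x) g \<otimes>\<^bsub>P\<^esub> iv (vA x) h"
  using iv_mult[of "vA x" g h] by (simp add: vA_V vgA)

lemma iv_B_mult: "x \<in> X ==> g \<in> carrier (vg (vB x)) ==> h \<in> carrier (vg (vB x)) ==> iv (vB x) (g \<otimes> h) = iv (vB x) g \<otimes>\<^bsub>P\<^esub> iv (vB x) h"
  using iv_mult[of "vB x" g h] by (simp add: vB_V vgB)

sublocale amalgam_action G A B P X act cA cB
proof (rule amalgam_action.intro[OF amalgam_axioms group_pi1], rule amalgam_action_axioms.intro)
  fix a x assume "a \<in> A" "x \<in> X"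
  then show "cA a x \<in> carrier P" unfolding cA_def by (intro iv_closed vA_V vgA_mem)
next
  fix b x assume bx: "b \<in> B" "x \<in> X"
  then have "act b x \<in> X" by (simp add: act_closed B_carrier)
  then show "cB b x \<in> carrier P" unfolding cB_def using bx
    by (intro pi.m_closed pi.inv_closed ie_closed iv_closed vB_V vgB_mem ed_E)
next
  fix g h x assume gh: "g \<in> A" "h \<in> A" "x \<in> X"
  then have hx: "act h x \<in> X" and ghx: "act (g \<otimes> h) x = act g (act h x)" by (simp_all add: act_closed act_mult A_carrier)
  have v: "vA (act h x) = vA x" using gh by (intro vA_act)
  have "t (act g (act h x)) \<otimes> g \<otimes> inv (t (act h x)) \<in> carrier (vg (vA x))"
    using vgA_mem[OF hx gh(1)] v by simp
  then show "cA (g \<otimes> h) x = cA g (act h x) \<otimes>\<^bsub>P\<^esub> cA h x"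
    using gh hx vgA_mem[OF gh(3,2)] unfolding cA_def v ghx
    by (simp add: transport_mult t act_closed A_carrier flip: iv_A_mult)
next
  fix g h x assume gh: "g \<in> B" "h \<in> B" "x \<in> X"
  then have hx: "act h x \<in> X" and ghx: "act (g \<otimes> h) x = act g (act h x)" by (simp_all add: act_closed act_mult B_carrier)
  have ghX: "act g (act h x) \<in> X" using hx gh by (simp add: act_closed B_carrier)
  have v: "vB (act h x) = vB x" using gh by (intro vB_act)
  have m1: "s (act g (act h x)) \<otimes> g \<otimes> inv (s (act h x)) \<in> carrier (vg (vB x))"
    using vgB_mem[OF hx gh(1)] v by simp
  have m2: "s (act h x) \<otimes> h \<otimes> inv (s x) \<in> carrier (vg (vB x))" by (rule vgB_mem[OF gh(3,2)])
  have tm: "s (act g (act h x)) \<otimes> (g \<otimes> h) \<otimes> inv (s x) =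
     (s (act g (act h x)) \<otimes> g \<otimes> inv (s (act h x))) \<otimes> (s (act h x) \<otimes> h \<otimes> inv (s x))"
    by (rule transport_mult[symmetric]) (use gh hx ghX in \<open>simp_all add: s_carrier B_carrier\<close>)
  note c = ie_closed[OF ed_E[OF ghX]] ie_closed[OF ed_E[OF hx]] ie_closed[OF ed_E[OF gh(3)]]
    iv_closed[OF vB_V[OF gh(3)] m1] iv_closed[OF vB_V[OF gh(3)] m2]
  show "cB (g \<otimes> h) x = cB g (act h x) \<otimes>\<^bsub>P\<^esub> cB h x"
    unfolding cB_def v ghx tm iv_B_mult[OF gh(3) m1 m2]
    by (rule pi.transport_mult[symmetric]) (fact c)+
next
  fix u x assume u: "u \<in> A" "u \<in> B" "x \<in> X"
  have ux: "act u x \<in> X" using u by (simp add: act_closed A_carrier)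
  let ?x = "t (act u x) \<otimes> u \<otimes> inv (t x)"
  have g: "\<gamma> (ed x) \<in> carrier G" by (rule \<gamma>_carrier[OF u(3)])
  have b: "inv (\<gamma> (ed x)) \<otimes> ?x \<otimes> \<gamma> (ed x) = s (act u x) \<otimes> u \<otimes> inv (s x)"
    using u ux g unfolding s_def by (simp add: ed_act t A_carrier inv_mult_group m_assoc)
  have eqB: "inv (s x) \<otimes> (s (act u x) \<otimes> u \<otimes> inv (s x)) \<otimes> s x = inv (t x) \<otimes> ?x \<otimes> t x"
    unfolding cancel_mid[OF s_carrier[OF ux] s_carrier[OF u(3)] A_carrier[OF u(1)]] cancel_mid[OF t(1)[OF ux] t(1)[OF u(3)] A_carrier[OF u(1)]]
    using u ux g unfolding s_def
    by (simp add: ed_act t A_carrier inv_mult_group m_assoc cancel_inv)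
  have xA: "?x \<in> carrier (vg (vA x))" by (rule vgA_mem[OF u(3,1)])
  have "s (act u x) \<otimes> u \<otimes> inv (s x) \<in> carrier (vg (vB x))" by (rule vgB_mem[OF u(3,2)])
  then have "?x \<in> carrier (gg_egrp \<Gamma> (ed x))"
    using xA eqB by (simp add: eg[OF u(3)] vgA[OF u(3)] vgB[OF u(3)] flip: s_def)
  from edge_relation[OF ed_E[OF u(3)] this]
  have rel: "inv\<^bsub>P\<^esub> ie (ed x) \<otimes>\<^bsub>P\<^esub> iv (vA x) ?x \<otimes>\<^bsub>P\<^esub> ie (ed x) = iv (vB x) (s (act u x) \<otimes> u \<otimes> inv (s x))"
    by (simp add: alpha beta b ends_ed u)
  note c = ie_closed[OF ed_E[OF u(3)]] iv_closed[OF vA_V[OF u(3)] xA]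
  show "cA u x = cB u x"
    unfolding cA_def cB_def ed_act[OF u] rel[symmetric] using c by (simp add: pi.m_assoc pi.cancel_inv)
qed (simp_all add: act_closed act_one act_mult)

lemma s_eq: "x \<in> X ==> \<gamma> (ed x) \<otimes> s x = t x"
  by (simp add: s_def cancel_inv t \<gamma>_carrier)

text \<open>The evident homomorphism to the stabilizer maps the cocycle at (g, x) to g
  transported to the base point.\<close>

lemma retraction:
  obtains \<phi> where "\<phi> \<in> hom P (G\<lparr>carrier := S\<rparr>)"
    "!!g x. g \<in> carrier G ==> x \<in> X ==> \<phi> (cocycle g x) = t (act g x) \<otimes> g \<otimes> inv (t x)"
proof -
  have f: "(\<lambda>g. g) \<in> hom (vg v) (G\<lparr>carrier := S\<rparr>)" if "v \<in> V" for v
  proof -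
    from that consider x where "x \<in> X" "v = vA x" | x where "x \<in> X" "v = vB x" by (auto simp: V_eq)
    then show ?thesis by cases (auto simp: hom_def vgA vgB)
  qed
  have rel: "inv\<^bsub>G\<lparr>carrier := S\<rparr>\<^esub> \<gamma> e \<otimes>\<^bsub>G\<lparr>carrier := S\<rparr>\<^esub> gg_alpha \<Gamma> e g \<otimes>\<^bsub>G\<lparr>carrier := S\<rparr>\<^esub> \<gamma> e = gg_beta \<Gamma> e g"
    if "e \<in> E" for e g
    using m_inv_consistent[OF subgroup_S \<gamma>(1)[OF that]] by (simp add: alpha beta)
  obtain \<phi> where \<phi>: "\<phi> \<in> hom P (G\<lparr>carrier := S\<rparr>)"
    "!!v g. v \<in> V ==> g \<in> carrier (vg v) ==> \<phi> (iv v g) = g" "!!e. e \<in> E ==> \<phi> (ie e) = \<gamma> e"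
    by (rule pi1_universal[where f = "\<lambda>_ g. g" and t = \<gamma>, OF S.is_group f]) (use \<gamma> rel in auto)
  interpret \<phi>: group_hom P "G\<lparr>carrier := S\<rparr>" \<phi>
    using group_pi1 S.is_group \<phi>(1) by (simp add: group_hom_def group_hom_axioms_def)
  have "\<phi> (cocycle g x) = t (act g x) \<otimes> g \<otimes> inv (t x)" if "g \<in> carrier G" "x \<in> X" for g x
    using that
  proof (rule cocycle_induct)
    fix x assume x: "x \<in> X"
    then show "\<phi> \<one>\<^bsub>P\<^esub> = t (act \<one> x) \<otimes> \<one> \<otimes> inv (t x)" using \<phi>.hom_one by (simp add: act_one t)
  next
    fix a x assume "a \<in> A" "x \<in> X"
    then show "\<phi> (cA a x) = t (act a x) \<otimes> a \<otimes> inv (t x)"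
      unfolding cA_def by (intro \<phi>(2) vA_V vgA_mem)
  next
    fix b x assume b: "b \<in> B" "x \<in> X"
    then have bx: "act b x \<in> X" by (simp add: act_closed B_carrier)
    note m = vgB_mem[OF b(2,1)]
    note c = ie_closed[OF ed_E[OF bx]] ie_closed[OF ed_E[OF b(2)]] iv_closed[OF vB_V[OF b(2)] m]
    have "\<phi> (cB b x) = \<gamma> (ed (act b x)) \<otimes> (s (act b x) \<otimes> b \<otimes> inv (s x)) \<otimes> inv (\<gamma> (ed x))"
      unfolding cB_def using c \<phi>(2)[OF vB_V[OF b(2)] m] \<phi>(3)[OF ed_E[OF bx]] \<phi>(3)[OF ed_E[OF b(2)]]
        m_inv_consistent[OF subgroup_S \<gamma>(1)[OF ed_E[OF b(2)]]] by simp
    also have "\<dots> = (\<gamma> (ed (act b x)) \<otimes> s (act b x)) \<otimes> b \<otimes> inv (\<gamma> (ed x) \<otimes> s x)"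
      using b bx by (simp add: inv_mult_group m_assoc s_carrier \<gamma>_carrier B_carrier)
    finally show "\<phi> (cB b x) = t (act b x) \<otimes> b \<otimes> inv (t x)" by (simp only: s_eq[OF bx] s_eq[OF b(2)])
  next
    fix g h x z z' assume *: "g \<in> carrier G" "h \<in> carrier G" "x \<in> X" "z \<in> carrier P" "z' \<in> carrier P"
      "\<phi> z = t (act g (act h x)) \<otimes> g \<otimes> inv (t (act h x))" "\<phi> z' = t (act h x) \<otimes> h \<otimes> inv (t x)"
    then have "\<phi> (z \<otimes>\<^bsub>P\<^esub> z') = (t (act g (act h x)) \<otimes> g \<otimes> inv (t (act h x))) \<otimes> (t (act h x) \<otimes> h \<otimes> inv (t x))"
      by simp
    also have "\<dots> = t (act g (act h x)) \<otimes> (g \<otimes> h) \<otimes> inv (t x)"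
      by (rule transport_mult) (use * in \<open>simp_all add: t act_closed\<close>)
    finally show "\<phi> (z \<otimes>\<^bsub>P\<^esub> z') = t (act (g \<otimes> h) x) \<otimes> (g \<otimes> h) \<otimes> inv (t x)" using * by (simp add: act_mult)
  qed
  then show ?thesis using \<phi>(1) that by blast
qed

text \<open>The values of the cocycle on the elements that move x to y. For x = y the base point
  they form the image of the stabilizer.\<close>

definition conn :: "('v, 'e, 'a) pi1_word set => 'x => 'x => bool" where
  "conn z x y \<longleftrightarrow> x \<in> X \<and> y \<in> X \<and> (\<exists>g\<in>carrier G. act g x = y \<and> cocycle g x = z)"

lemma connI: "g \<in> carrier G ==> x \<in> X ==> act g x = y ==> cocycle g x = z ==> conn z x y"
  unfolding conn_def using act_closed by blast

lemma conn_closed: "conn z x y ==> z \<in> carrier P"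
  unfolding conn_def using cocycle_closed by blast

lemma conn_refl: "x \<in> X ==> conn \<one>\<^bsub>P\<^esub> x x"
  by (rule connI[of \<one>]) (simp_all add: act_one cocycle_one)

lemma conn_mult: "conn w y z ==> conn v x y ==> conn (w \<otimes>\<^bsub>P\<^esub> v) x z"
  unfolding conn_def by (elim conjE bexE) (intro conjI, assumption+, rule_tac x="ga \<otimes> g" in bexI, auto simp: cocycle_mult act_mult)

lemma conn_inv:
  assumes "conn v x y"
  shows "conn (inv\<^bsub>P\<^esub> v) y x"
proof -
  obtain g where g: "g \<in> carrier G" "x \<in> X" "y \<in> X" "act g x = y" "cocycle g x = v" using assms unfolding conn_def by blast
  have gy: "act (inv g) y = x" by (rule act_inv[OF g(1,2,4)])
  have "cocycle (inv g \<otimes> g) x = cocycle (inv g) y \<otimes>\<^bsub>P\<^esub> v" using g by (subst cocycle_mult) auto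
  then have "cocycle (inv g) y \<otimes>\<^bsub>P\<^esub> v = \<one>\<^bsub>P\<^esub>" using g by (simp add: cocycle_one)
  then have "cocycle (inv g) y = inv\<^bsub>P\<^esub> v"
    by (rule pi.inv_equality[symmetric]) (use g cocycle_closed in auto)
  then show ?thesis using g gy by (intro connI[of "inv g"]) auto
qed

text \<open>Two points of an A-orbit are connected by t(y)^-1 t(x), which lies in A and has
  trivial cocycle.\<close>

lemma conn_A:
  assumes x: "x \<in> X" and y: "y \<in> X" and eq: "vA x = vA y"
  shows "conn \<one>\<^bsub>P\<^esub> x y"
proof -
  obtain a where a: "a \<in> A" "y = act a x" using vA_iff[OF x y] eq by blast
  let ?g = "inv (t y) \<otimes> t x"
  have "inv (inv (t x) \<otimes> t y) \<in> A" using subgroup.m_inv_closed[OF A tA[OF a(1) x]] a by simp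
  then have gA: "?g \<in> A" using x y by (simp add: inv_mult_group t)
  have gx: "act ?g x = y" using act_inv[OF t(1)[OF y] y t(2)[OF y]] x y by (simp add: act_mult t)
  have "t y \<otimes> ?g \<otimes> inv (t x) = \<one>" using x y by (simp add: t cancel_inv flip: m_assoc)
  then have "cA ?g x = iv (vA x) \<one>" by (simp add: cA_def gx)
  also have "\<dots> = \<one>\<^bsub>P\<^esub>"
    using hom_one[OF iv_hom[OF vA_V[OF x]] vertex_groups[OF vA_V[OF x]] group_pi1] by (simp add: vgA[OF x])
  finally show ?thesis using gA gx x by (intro connI[of ?g]) (auto simp: cocycle_A A_carrier)
qed

lemma conn_B:
  assumes x: "x \<in> X" and y: "y \<in> X" and eq: "vB x = vB y"
  shows "conn (ie (ed y) \<otimes>\<^bsub>P\<^esub> inv\<^bsub>P\<^esub> ie (ed x)) x y"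
proof -
  obtain b where b: "b \<in> B" "y = act b x" using vB_iff[OF x y] eq by blast
  let ?g = "inv (s y) \<otimes> s x"
  have "inv (inv (s x) \<otimes> s y) \<in> B" using subgroup.m_inv_closed[OF B tB[OF b(1) x]] b by (simp add: s_def)
  then have gB: "?g \<in> B" using x y by (simp add: inv_mult_group s_carrier)
  have gx: "act ?g x = y" using act_inv[OF s_carrier[OF y] y s_base[OF y]] x y by (simp add: act_mult s_carrier s_base)
  have "s y \<otimes> ?g \<otimes> inv (s x) = \<one>" using x y by (simp add: s_carrier cancel_inv flip: m_assoc)
  then have "cB ?g x = ie (ed y) \<otimes>\<^bsub>P\<^esub> iv (vB x) \<one> \<otimes>\<^bsub>P\<^esub> inv\<^bsub>P\<^esub> ie (ed x)" by (simp add: cB_def gx)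
  also have "iv (vB x) \<one> = \<one>\<^bsub>P\<^esub>"
    using hom_one[OF iv_hom[OF vB_V[OF x]] vertex_groups[OF vB_V[OF x]] group_pi1] by (simp add: vgB[OF x])
  finally have "cB ?g x = ie (ed y) \<otimes>\<^bsub>P\<^esub> inv\<^bsub>P\<^esub> ie (ed x)" using ie_closed[OF ed_E[OF y]] by simp
  then show ?thesis using gB gx x by (intro connI[of ?g]) (auto simp: cocycle_B B_carrier)
qed

lemma conn_tree_edge:
  assumes "x \<in> X" "y \<in> X" "vB x = vB y" "ed x \<in> arcs T" "ed y \<in> arcs T"
  shows "conn \<one>\<^bsub>P\<^esub> x y"
  using conn_B[OF assms(1-3)] ie_tree[OF assms(4)] ie_tree[OF assms(5)] by simp

lemma conn_one_trans: "conn \<one>\<^bsub>P\<^esub> x y ==> conn \<one>\<^bsub>P\<^esub> y z ==> conn \<one>\<^bsub>P\<^esub> x z"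
  using conn_mult[of "\<one>\<^bsub>P\<^esub>" y z "\<one>\<^bsub>P\<^esub>" x] by simp

text \<open>For the vertices of the second kind the edge of the point is required to lie in the
  tree, as only then its letter is trivial.\<close>

definition at_vertex :: "'x => 'v => bool" where
  "at_vertex x v \<longleftrightarrow> x \<in> X \<and> (vA x = v \<or> vB x = v \<and> ed x \<in> arcs T)"

lemma conn_at_vertex: "at_vertex x v ==> at_vertex y v ==> conn \<one>\<^bsub>P\<^esub> x y"
  unfolding at_vertex_def using conn_A conn_tree_edge bipartite[of x y] bipartite[of y x] by auto

lemma tree_step:
  assumes "fst e \<in> arcs T"
  obtains r where "ed r = fst e" "at_vertex r (step_from T e)" "at_vertex r (step_to T e)"
proof -
  obtain r where "r \<in> X" "fst e = ed r" using assms tree_arcs E_eq by auto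
  then show ?thesis using assms ends_ed[of r] tree_ends
    by (intro that[of r]) (auto simp: at_vertex_def step_from_def step_to_def)
qed

text \<open>Trivial values propagate along the tree.\<close>

lemma conn_path: "upath T u p v ==> at_vertex x u ==> at_vertex y v ==> conn \<one>\<^bsub>P\<^esub> x y"
proof (induction p arbitrary: u x)
  case Nil
  then show ?case using conn_at_vertex by auto
next
  case (Cons e p)
  then have e: "fst e \<in> arcs T" "step_from T e = u" "upath T (step_to T e) p v" by auto
  obtain r where r: "at_vertex r (step_from T e)" "at_vertex r (step_to T e)" by (rule tree_step[OF e(1)])
  have "conn \<one>\<^bsub>P\<^esub> x r" using conn_at_vertex Cons.prems(2) r(1) e(2) by blast
  moreover have "conn \<one>\<^bsub>P\<^esub> r y" by (rule Cons.IH[OF e(3) r(2) Cons.prems(3)])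
  ultimately show ?case by (rule conn_one_trans)
qed

context
  assumes tree_connected: "!!u v. u \<in> verts T ==> v \<in> verts T ==> \<exists>p. upath T u p v"
begin

lemma conn_one: "x \<in> X ==> y \<in> X ==> conn \<one>\<^bsub>P\<^esub> x y"
  using tree_connected[of "vA x" "vA y"] conn_path[of "vA x" _ "vA y" x y] spanning vA_V
  by (auto simp: at_vertex_def)

lemma conn_base: "conn z x y ==> conn z base base"
proof -
  assume z: "conn z x y"
  then have xy: "x \<in> X" "y \<in> X" by (auto simp: conn_def)
  have "conn (\<one>\<^bsub>P\<^esub> \<otimes>\<^bsub>P\<^esub> (z \<otimes>\<^bsub>P\<^esub> \<one>\<^bsub>P\<^esub>)) base base"
    by (rule conn_mult[OF conn_one[OF xy(2) base] conn_mult[OF z conn_one[OF base xy(1)]]])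
  then show ?thesis using conn_closed[OF z] by simp
qed

lemma tree_edge_at_B:
  assumes "x \<in> X"
  obtains y where "y \<in> X" "vB y = vB x" "ed y \<in> arcs T"
proof -
  obtain p where p: "upath T (vB x) p (vA x)" using tree_connected spanning vA_V vB_V assms by blast
  then obtain e p' where e: "p = e # p'" using bipartite[OF assms assms] by (cases p) auto
  then have eT: "step_from T e = vB x" "fst e \<in> arcs T" using p by auto
  obtain r where "ed r = fst e" "at_vertex r (step_from T e)" by (rule tree_step[OF eT(2)])
  then have "ed r = fst e" "at_vertex r (vB x)" using eT(1) by simp_all
  then show ?thesis using eT(2) bipartite[OF _ assms] that by (auto simp: at_vertex_def)
qed

lemma conn_edge: "x \<in> X ==> conn (ie (ed x)) base base"
proof -
  assume x: "x \<in> X"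
  obtain y where y: "y \<in> X" "vB y = vB x" "ed y \<in> arcs T" by (rule tree_edge_at_B[OF x])
  have "conn (ie (ed x) \<otimes>\<^bsub>P\<^esub> inv\<^bsub>P\<^esub> ie (ed y)) y x" by (rule conn_B[OF y(1) x y(2)])
  then show ?thesis using ie_tree[OF y(3)] ie_closed[OF ed_E[OF x]] by (intro conn_base[of _ y x]) simp
qed

lemma conn_vA:
  assumes x: "x \<in> X" and z: "z \<in> carrier (vg (vA x))"
  shows "conn (iv (vA x) z) base base"
proof -
  let ?g = "inv (t x) \<otimes> z \<otimes> t x"
  have z': "z \<in> S" "?g \<in> A" using z vgA[OF x] by auto
  have gx: "act ?g x = x" using z' x act_inv[OF t(1)[OF x] x t(2)[OF x]] base by (simp add: act_mult t S_def)
  have "t x \<otimes> ?g \<otimes> inv (t x) = z" using x z' S_carrier by (simp add: t m_assoc cancel_inv)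
  then have "cA ?g x = iv (vA x) z" by (simp add: cA_def gx)
  then have "conn (iv (vA x) z) x x" using z' x gx by (intro connI[of ?g]) (auto simp: cocycle_A A_carrier)
  then show ?thesis by (rule conn_base)
qed

lemma conn_vB:
  assumes x: "x \<in> X" and z: "z \<in> carrier (vg (vB x))"
  shows "conn (iv (vB x) z) base base"
proof -
  let ?g = "inv (s x) \<otimes> z \<otimes> s x" and ?e = "ie (ed x)"
  have z': "z \<in> S" "?g \<in> B" using z vgB[OF x] by (auto simp: s_def)
  have gx: "act ?g x = x" using z' x act_inv[OF s_carrier[OF x] x s_base[OF x]] base by (simp add: act_mult s_carrier s_base S_def)
  have "s x \<otimes> ?g \<otimes> inv (s x) = z" using x z' S_carrier by (simp add: s_carrier m_assoc cancel_inv)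
  then have "cB ?g x = ?e \<otimes>\<^bsub>P\<^esub> iv (vB x) z \<otimes>\<^bsub>P\<^esub> inv\<^bsub>P\<^esub> ?e" by (simp add: cB_def gx)
  then have "conn (?e \<otimes>\<^bsub>P\<^esub> iv (vB x) z \<otimes>\<^bsub>P\<^esub> inv\<^bsub>P\<^esub> ?e) x x"
    using z' x gx by (intro connI[of ?g]) (auto simp: cocycle_B B_carrier)
  then have "conn (?e \<otimes>\<^bsub>P\<^esub> iv (vB x) z \<otimes>\<^bsub>P\<^esub> inv\<^bsub>P\<^esub> ?e) base base" by (rule conn_base)
  from conn_mult[OF conn_inv[OF conn_edge[OF x]] conn_mult[OF this conn_edge[OF x]]]
  have "conn (inv\<^bsub>P\<^esub> ?e \<otimes>\<^bsub>P\<^esub> ((?e \<otimes>\<^bsub>P\<^esub> iv (vB x) z \<otimes>\<^bsub>P\<^esub> inv\<^bsub>P\<^esub> ?e) \<otimes>\<^bsub>P\<^esub> ?e)) base base" .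
  then show ?thesis using ie_closed[OF ed_E[OF x]] iv_closed[OF vB_V[OF x] z] by (simp add: pi.m_assoc pi.cancel_inv)
qed

text \<open>The image of the stabilizer contains all generators of the fundamental
  group.\<close>

lemma conn_all:
  assumes "z \<in> carrier P"
  shows "conn z base base"
proof -
  have "z \<in> generate P pi1_gens" using assms pi1_generated by simp
  then show ?thesis
  proof induction
    case one
    show ?case by (rule conn_refl[OF base])
  next
    case (incl h)
    then show ?case unfolding pi1_gens_def V_eq E_eq using conn_vA conn_vB conn_edge by auto
  next
    case (inv h)
    then have "conn h base base" unfolding pi1_gens_def V_eq E_eq using conn_vA conn_vB conn_edge by auto
    then show ?case by (rule conn_inv)
  next
    case (eng h h')
    then show ?case using conn_mult by blast
  qed
qed

text \<open>The restriction of the cocycle to the stabilizer is injective because retraction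
  inverts it, and surjective by conn_all.\<close>

theorem stabilizer_iso_pi1: "G\<lparr>carrier := S\<rparr> \<cong> P"
proof -
  obtain \<phi> where \<phi>: "\<phi> \<in> hom P (G\<lparr>carrier := S\<rparr>)"
    "!!g x. g \<in> carrier G ==> x \<in> X ==> \<phi> (cocycle g x) = t (act g x) \<otimes> g \<otimes> inv (t x)"
    by (rule retraction) blast
  let ?t = "t base"
  have t0: "?t \<in> carrier G" "act ?t base = base" using t base by auto
  have t0': "act (inv ?t) base = base" by (rule act_inv[OF t0(1) base t0(2)])
  define \<psi> where "\<psi> h = cocycle (inv ?t \<otimes> h \<otimes> ?t) base" for h
  have \<phi>\<psi>: "\<phi> (\<psi> h) = h" if "h \<in> S" for h
  proof -
    have h: "h \<in> carrier G" "act h base = base" using that by (auto simp: S_def)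
    have "act (inv ?t \<otimes> h \<otimes> ?t) base = base" using h t0 t0' base by (simp add: act_mult)
    then show ?thesis unfolding \<psi>_def using h t0 base by (simp add: \<phi>(2) m_assoc cancel_inv)
  qed
  have hom: "\<psi> \<in> hom (G\<lparr>carrier := S\<rparr>) P"
  proof (rule homI)
    fix h assume "h \<in> carrier (G\<lparr>carrier := S\<rparr>)"
    then show "\<psi> h \<in> carrier P" unfolding \<psi>_def using t0 base by (intro cocycle_closed) (auto simp: S_def)
  next
    fix h k assume "h \<in> carrier (G\<lparr>carrier := S\<rparr>)" "k \<in> carrier (G\<lparr>carrier := S\<rparr>)"
    then have hk: "h \<in> carrier G" "k \<in> carrier G" "act k base = base" by (auto simp: S_def)
    have "inv ?t \<otimes> (h \<otimes> k) \<otimes> ?t = (inv ?t \<otimes> h \<otimes> ?t) \<otimes> (inv ?t \<otimes> k \<otimes> ?t)"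
      using hk t0 by (simp add: m_assoc cancel_inv)
    moreover have "act (inv ?t \<otimes> k \<otimes> ?t) base = base" using hk t0 t0' base by (simp add: act_mult)
    ultimately show "\<psi> (h \<otimes>\<^bsub>G\<lparr>carrier := S\<rparr>\<^esub> k) = \<psi> h \<otimes>\<^bsub>P\<^esub> \<psi> k"
      unfolding \<psi>_def using hk t0 base by (simp add: cocycle_mult)
  qed
  have inj: "inj_on \<psi> S" by (rule inj_on_inverseI) (rule \<phi>\<psi>)
  have "carrier P \<subseteq> \<psi> ` S"
  proof
    fix z assume "z \<in> carrier P"
    then obtain g where g: "g \<in> carrier G" "act g base = base" "cocycle g base = z" using conn_all unfolding conn_def by blast
    have "?t \<otimes> g \<otimes> inv ?t \<in> S" using g t0 t0' base by (simp add: S_def act_mult)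
    moreover have "\<psi> (?t \<otimes> g \<otimes> inv ?t) = z" unfolding \<psi>_def using g t0 by (simp add: m_assoc cancel_inv)
    ultimately show "z \<in> \<psi> ` S" by blast
  qed
  moreover have "\<psi> ` S \<subseteq> carrier P" using hom by (auto simp: hom_def)
  ultimately have "bij_betw \<psi> S (carrier P)" using inj by (auto simp: bij_betw_def)
  then show ?thesis using hom by (auto simp: is_iso_def iso_def)
qed

end

end

section \<open>Maximal trees span\<close>

lemma upath_mono:
  assumes "upath T u p v" "verts T \<subseteq> verts T'" "arcs T \<subseteq> arcs T'" "tail T' = tail T" "head T' = head T"
  shows "upath T' u p v"
  using assms(1) by (induction p arbitrary: u) (use assms(2-) in \<open>auto simp: step_from_def step_to_def\<close>)

lemma upath_append: "upath T u p v ==> upath T v q w ==> upath T u (p @ q) w"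
  by (induction p arbitrary: u) auto

lemma upath_next:
  assumes "upath T u p v" "e \<in> set p"
  shows "step_to T e = v \<or> (\<exists>e'\<in>set p. step_from T e' = step_to T e)"
  using assms
proof (induction p arbitrary: u)
  case (Cons f p)
  show ?case
  proof (cases "e = f")
    case True
    then show ?thesis using Cons.prems by (cases p) auto
  next
    case False
    then show ?thesis using Cons by auto
  qed
qed simp

lemma upath_prev:
  assumes "upath T u p v" "e \<in> set p"
  shows "step_from T e = u \<or> (\<exists>e'\<in>set p. step_to T e' = step_from T e)"
  using assms
proof (induction p arbitrary: u)
  case (Cons f p)
  show ?case
  proof (cases "e = f")
    case False
    then have "step_from T e = step_to T f \<or> (\<exists>e'\<in>set p. step_to T e' = step_from T e)"
      using Cons by auto
    then show ?thesis by auto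
  qed (use Cons.prems in auto)
qed simp

text \<open>In a closed path each step is followed and preceded by another one, in the cyclic
  order.\<close>

lemma circuit_neighbours:
  assumes p: "upath T u p u" and e: "e \<in> set p"
  shows "\<exists>e'\<in>set p. step_from T e' = step_to T e" "\<exists>e'\<in>set p. step_to T e' = step_from T e"
proof -
  obtain f q where f: "p = f # q" using e by (cases p) auto
  then have "step_from T f = u" using p by simp
  then show "\<exists>e'\<in>set p. step_from T e' = step_to T e" using upath_next[OF p e] f by auto
  have "upath T u (q @ [l]) u ==> step_to T l = u" for q l
  proof -
    have "upath T w (q @ [l]) u ==> step_to T l = u" for w by (induction q arbitrary: w) auto
    then show "upath T u (q @ [l]) u ==> step_to T l = u" .
  qed
  moreover obtain q' l where l: "p = q' @ [l]" using f by (metis rev_exhaust list.distinct(1))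
  ultimately have "step_to T l = u" using p by blast
  then show "\<exists>e'\<in>set p. step_to T e' = step_from T e" using upath_prev[OF p e] l by auto
qed

text \<open>A circuit through the new edge would have to leave the new vertex w by the same
  edge, as no other edge is incident to w.\<close>

lemma utree_add_pendant:
  assumes T: "utree T" and w: "w \<notin> verts T" and u: "u \<in> verts T"
    and e: "tail T e = u \<and> head T e = w \<or> tail T e = w \<and> head T e = u"
  shows "utree (T\<lparr>verts := insert w (verts T), arcs := insert e (arcs T)\<rparr>)" (is "utree ?T'")
proof -
  have wf: "wf_digraph T" using T by (simp add: utree_def)
  have ends: "tail T f \<in> verts T" "head T f \<in> verts T" if "f \<in> arcs T" for f
    using wf that by (simp_all add: wf_digraph_def)
  have steps: "step_from ?T' = step_from T" "step_to ?T' = step_to T"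
    by (simp_all add: fun_eq_iff step_from_def step_to_def)
  have wf': "wf_digraph ?T'" using ends u e by (auto simp: wf_digraph_def)
  have path: "\<exists>p. upath ?T' x p y" if "x \<in> verts T" "y \<in> verts T" for x y
  proof -
    obtain p where "upath T x p y" using T \<open>x \<in> verts T\<close> \<open>y \<in> verts T\<close> unfolding utree_def by blast
    then have "upath ?T' x p y" by (rule upath_mono) auto
    then show ?thesis by blast
  qed
  have out: "\<exists>p. upath ?T' u p w"
    using e u by (intro exI[of _ "[(e, tail T e = u)]"]) (use w in \<open>auto simp: step_from_def step_to_def\<close>)
  have back': "\<exists>p. upath ?T' w p u"
    using e u by (intro exI[of _ "[(e, tail T e = w)]"]) (use w in \<open>auto simp: step_from_def step_to_def\<close>)
  have conn: "\<exists>p. upath ?T' x p y" if "x \<in> verts ?T'" "y \<in> verts ?T'" for x y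
  proof -
    have to_u: "\<exists>p. upath ?T' x p u" using that(1) path[OF _ u] back' by auto
    have from_u: "\<exists>p. upath ?T' u p y" using \<open>y \<in> verts ?T'\<close> path[OF u] out by auto
    from to_u obtain q where q: "upath ?T' x q u" by (rule exE)
    from from_u obtain r where "upath ?T' u r y" by (rule exE)
    with q have "upath ?T' x (q @ r) y" by (rule upath_append)
    then show ?thesis by (rule exI)
  qed
  have "\<not> ucircuit ?T' p" for p
  proof
    assume c: "ucircuit ?T' p"
    then obtain x where x: "upath ?T' x p x" and d: "distinct (map fst p)" and ne: "p \<noteq> []" unfolding ucircuit_def by blast
    have arcs: "upath ?T' y q z ==> f \<in> set q ==> fst f \<in> insert e (arcs T)" for y q z f
      by (induction q arbitrary: y) auto
    show False
    proof (cases "e \<in> fst ` set p")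
      case True
      then obtain f where f: "f \<in> set p" "fst f = e" by auto
      have only: "g = f" if "g \<in> set p" "step_from T g = w \<or> step_to T g = w" for g
      proof -
        have "fst g \<notin> arcs T" using that(2) ends[of "fst g"] w by (auto simp: step_from_def step_to_def split: if_splits)
        then have "fst g = fst f" using arcs[OF x \<open>g \<in> set p\<close>] f by auto
        then show ?thesis using d \<open>g \<in> set p\<close> f(1) by (metis distinct_map inj_onD)
      qed
      have "step_from T f = w \<or> step_to T f = w" using e f(2) by (auto simp: step_from_def step_to_def)
      then have "step_from T f = step_to T f"
        using circuit_neighbours[OF x f(1)] only unfolding steps by metis
      then show False using e f(2) w u by (auto simp: step_from_def step_to_def split: if_splits)
    next
      case False
      have old: "upath ?T' y q z ==> e \<notin> fst ` set q ==> q \<noteq> [] ==> upath T y q z" for y q z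
      proof (induction q arbitrary: y)
        case (Cons f q)
        then have "fst f \<in> arcs T" by auto
        moreover from this have "step_to T f \<in> verts T" using ends by (auto simp: step_to_def)
        ultimately show ?case using Cons by (cases q) (auto simp: steps)
      qed simp
      then have "upath T x p x" using x ne False by blast
      then have "ucircuit T p" using c unfolding ucircuit_def steps by blast
      then show False using T unfolding utree_def by blast
    qed
  qed
  then show ?thesis using wf' conn unfolding utree_def by auto
qed

text \<open>An edge with exactly one end in a maximal tree could be added to it.\<close>

lemma maximal_tree_edge_closed:
  assumes max: "maximal_tree T \<Delta>" and e: "e \<in> arcs \<Delta>"
  shows "tail \<Delta> e \<in> verts T \<longleftrightarrow> head \<Delta> e \<in> verts T"
proof -
  have T: "utree T" and sub: "subgraph T \<Delta>"
    and m: "!!T'. utree T' ==> subgraph T' \<Delta> ==> subgraph T T' ==> T' = T"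
    using max unfolding maximal_tree_def by auto
  have eq: "tail \<Delta> = tail T" "head \<Delta> = head T" using sub by (simp_all add: subgraph_def compatible_def)
  have wf: "wf_digraph \<Delta>" using sub by (simp add: subgraph_def)
  have no: False if uw: "u \<in> verts T" "w \<notin> verts T" "tail T e = u \<and> head T e = w \<or> tail T e = w \<and> head T e = u" for u w
  proof -
    let ?T' = "T\<lparr>verts := insert w (verts T), arcs := insert e (arcs T)\<rparr>"
    have T': "utree ?T'" by (rule utree_add_pendant[OF T uw(2,1,3)])
    then have wf': "wf_digraph ?T'" by (simp add: utree_def)
    have "w \<in> verts \<Delta>" using wf e uw(3) unfolding wf_digraph_def eq by auto
    then have "subgraph ?T' \<Delta>" using sub wf' e by (auto simp: subgraph_def compatible_def)
    moreover have "subgraph T ?T'" using sub wf' by (auto simp: subgraph_def compatible_def)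
    ultimately have "?T' = T" using m T' by blast
    then have "verts ?T' = verts T" by simp
    then show False using uw(2) by auto
  qed
  then show ?thesis unfolding eq by blast
qed

section \<open>Orbits and stabilizers in the Calogero-Moser spaces\<close>

context group
begin

lemma l_cosetE: assumes "\<tau> \<in> \<sigma> <# H" obtains h where "h \<in> H" "\<tau> = \<sigma> \<otimes> h"
  using assms by (auto simp: l_coset_def)

lemma same_l_coset:
  assumes H: "subgroup H G" and \<sigma>: "\<sigma> \<in> carrier G" and "\<tau> \<in> \<sigma> <# H" "\<tau>' \<in> \<sigma> <# H"
  shows "inv \<tau> \<otimes> \<tau>' \<in> H"
proof -
  obtain h h' where h: "h \<in> H" "\<tau> = \<sigma> \<otimes> h" "h' \<in> H" "\<tau>' = \<sigma> \<otimes> h'"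
    using assms(3,4) by (auto simp: l_coset_def)
  have "h \<in> carrier G" "h' \<in> carrier G" using h subgroup.mem_carrier[OF H] by auto
  then have "inv \<tau> \<otimes> \<tau>' = inv h \<otimes> h'" using h \<sigma> by (simp add: inv_mult_group m_assoc cancel_inv)
  then show ?thesis using H h by (simp add: subgroup.m_closed subgroup.m_inv_closed)
qed

lemma l_coset_mult:
  assumes "subgroup H G" "\<sigma> \<in> carrier G" "\<tau> \<in> \<sigma> <# H" "h \<in> H"
  shows "\<tau> \<otimes> h \<in> \<sigma> <# H"
proof -
  obtain k where "k \<in> H" "\<tau> = \<sigma> \<otimes> k" by (rule l_cosetE[OF assms(3)])
  then have "\<tau> \<otimes> h = \<sigma> \<otimes> (k \<otimes> h)" "k \<otimes> h \<in> H"
    using assms subgroup.mem_carrier[OF assms(1)] by (simp_all add: m_assoc subgroup.m_closed)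
  then show ?thesis by (auto simp: l_coset_def)
qed

lemma l_coset_left_cancel:
  assumes "subgroup H G" "\<gamma> \<in> carrier G" "\<sigma> \<in> carrier G" "\<tau> \<in> (\<gamma> \<otimes> \<sigma>) <# H"
  shows "inv \<gamma> \<otimes> \<tau> \<in> \<sigma> <# H"
proof -
  obtain k where "k \<in> H" "\<tau> = (\<gamma> \<otimes> \<sigma>) \<otimes> k" by (rule l_cosetE[OF assms(4)])
  then have "inv \<gamma> \<otimes> \<tau> = \<sigma> \<otimes> k" "k \<in> H"
    using assms subgroup.mem_carrier[OF assms(1)] by (simp_all add: m_assoc cancel_inv)
  then show ?thesis by (auto simp: l_coset_def)
qed

lemma l_coset_member_carrier: "subgroup H G ==> \<sigma> \<in> carrier G ==> \<tau> \<in> \<sigma> <# H ==> \<tau> \<in> carrier G"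
  using subgroup.mem_carrier by (fastforce simp: l_coset_def)

text \<open>The conjugate of H by \<sigma> depends only on the coset \<sigma> H.\<close>

lemma conjugate_subgroup_mem:
  assumes H: "subgroup H G" and \<sigma>: "\<sigma> \<in> carrier G" and \<tau>: "\<tau> \<in> \<sigma> <# H" and g: "g \<in> carrier G"
  shows "g \<in> (\<sigma> <# H) #> inv \<sigma> \<longleftrightarrow> inv \<tau> \<otimes> g \<otimes> \<tau> \<in> H"
proof -
  obtain k where k: "k \<in> H" "\<tau> = \<sigma> \<otimes> k" by (rule l_cosetE[OF \<tau>])
  note Hc = subgroup.mem_carrier[OF H] and Hm = subgroup.m_closed[OF H] and Hi = subgroup.m_inv_closed[OF H]
  have kc: "k \<in> carrier G" using k Hc by simp
  have eq: "inv \<tau> \<otimes> g \<otimes> \<tau> = inv k \<otimes> (inv \<sigma> \<otimes> g \<otimes> \<sigma>) \<otimes> k"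
    using \<sigma> g kc by (simp add: k inv_mult_group m_assoc)
  show ?thesis
  proof
    assume "g \<in> (\<sigma> <# H) #> inv \<sigma>"
    then obtain h where h: "h \<in> H" "g = \<sigma> \<otimes> h \<otimes> inv \<sigma>" by (auto simp: l_coset_def r_coset_def)
    then have "inv \<sigma> \<otimes> g \<otimes> \<sigma> = h" using \<sigma> Hc by (simp add: m_assoc cancel_inv)
    then show "inv \<tau> \<otimes> g \<otimes> \<tau> \<in> H" unfolding eq using h k by (simp add: Hm Hi)
  next
    assume m: "inv \<tau> \<otimes> g \<otimes> \<tau> \<in> H"
    let ?h = "k \<otimes> (inv \<tau> \<otimes> g \<otimes> \<tau>) \<otimes> inv k"
    have "?h \<in> H" using m k by (simp add: Hm Hi)
    moreover have "g = \<sigma> \<otimes> ?h \<otimes> inv \<sigma>" unfolding eq using \<sigma> g kc by (simp add: m_assoc cancel_inv)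
    ultimately show "g \<in> (\<sigma> <# H) #> inv \<sigma>" by (auto simp: l_coset_def r_coset_def)
  qed
qed

lemma subgroup_conjugate:
  assumes S: "subgroup S G" and H: "subgroup H G" and \<tau>: "\<tau> \<in> carrier G"
  shows "subgroup {g \<in> S. inv \<tau> \<otimes> g \<otimes> \<tau> \<in> H} G"
proof (rule subgroupI)
  note Sc = subgroup.mem_carrier[OF S]
  show "{g \<in> S. inv \<tau> \<otimes> g \<otimes> \<tau> \<in> H} \<subseteq> carrier G" using Sc by blast
  show "{g \<in> S. inv \<tau> \<otimes> g \<otimes> \<tau> \<in> H} \<noteq> {}"
    using subgroup.one_closed[OF S] subgroup.one_closed[OF H] \<tau> by (auto intro!: exI[of _ \<one>])
next
  fix g assume g: "g \<in> {g \<in> S. inv \<tau> \<otimes> g \<otimes> \<tau> \<in> H}"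
  then have gc: "g \<in> carrier G" using subgroup.mem_carrier[OF S] by simp
  have "inv \<tau> \<otimes> inv g \<otimes> \<tau> = inv (inv \<tau> \<otimes> g \<otimes> \<tau>)" using gc \<tau> by (simp add: inv_mult_group m_assoc)
  then show "inv g \<in> {g \<in> S. inv \<tau> \<otimes> g \<otimes> \<tau> \<in> H}"
    using g subgroup.m_inv_closed[OF S] subgroup.m_inv_closed[OF H] by simp
next
  fix g h assume g: "g \<in> {g \<in> S. inv \<tau> \<otimes> g \<otimes> \<tau> \<in> H}" and h: "h \<in> {g \<in> S. inv \<tau> \<otimes> g \<otimes> \<tau> \<in> H}"
  then have gc: "g \<in> carrier G" "h \<in> carrier G" using subgroup.mem_carrier[OF S] by simp_all
  have "inv \<tau> \<otimes> (g \<otimes> h) \<otimes> \<tau> = (inv \<tau> \<otimes> g \<otimes> \<tau>) \<otimes> (inv \<tau> \<otimes> h \<otimes> \<tau>)" using gc \<tau> by (simp add: m_assoc cancel_inv)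
  then show "g \<otimes> h \<in> {g \<in> S. inv \<tau> \<otimes> g \<otimes> \<tau> \<in> H}"
    using g h subgroup.m_closed[OF S] subgroup.m_closed[OF H] by simp
qed

end

interpretation amalgam_G: amalgam grpG setA setB
proof (intro amalgam.intro group_G amalgam_axioms.intro subgroup_A subgroup_B)
  have "generate grpG (setA \<union> setB) \<subseteq> carrier grpG" by (rule G.generate_incl) (use setA_G setB_G in blast)
  then show "carrier grpG = generate grpG (setA \<union> setB)" using generated_by_A_B by blast
qed (rule alternating_product_nontrivial)

lemma subgroup_U: "subgroup setU grpG"
  unfolding setU_def by (rule G.subgroups_Inter_pair[OF subgroup_A subgroup_B])

lemma cm_orbit_eq: "cm_orbit n H p = (\<lambda>h. cm_act n h p) ` H"
  by (auto simp: cm_orbit_def orbit_def)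

lemma cm_orbits_eq: "cm_orbits n H = cm_orbit n H ` cm_space n"
  by (auto simp: cm_orbits_def orbits_def cm_orbit_def)

lemma cm_orbit_eq_iff:
  assumes H: "subgroup H grpG" and p: "p \<in> cm_space n" and q: "q \<in> cm_space n"
  shows "cm_orbit n H p = cm_orbit n H q \<longleftrightarrow> (\<exists>h\<in>H. q = cm_act n h p)"
proof
  have "id \<in> H" using subgroup.one_closed[OF H] by simp
  then have "q \<in> cm_orbit n H q" using cm_act_one[OF q] by (force simp: cm_orbit_eq)
  moreover assume "cm_orbit n H p = cm_orbit n H q"
  ultimately have "q \<in> cm_orbit n H p" by simp
  then show "\<exists>h\<in>H. q = cm_act n h p" by (auto simp: cm_orbit_eq)
next
  assume "\<exists>h\<in>H. q = cm_act n h p"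
  then obtain h where h: "h \<in> H" "q = cm_act n h p" by blast
  note Hc = subgroup.mem_carrier[OF H]
  have 1: "cm_act n k q = cm_act n (k \<circ> h) p" "k \<circ> h \<in> H" if "k \<in> H" for k
    using that h Hc p subgroup.m_closed[OF H, of k h] by (simp_all add: cm_act_mult)
  have 2: "cm_act n k p = cm_act n (k \<circ> ginv h) q" "k \<circ> ginv h \<in> H" if "k \<in> H" for k
  proof -
    have i: "ginv h \<in> H" using subgroup.m_inv_closed[OF H h(1)] .
    show kh: "k \<circ> ginv h \<in> H" using subgroup.m_closed[OF H that i] by simp
    have "k \<circ> ginv h \<circ> h = k" using inv_G[OF Hc[OF h(1)]] by (auto simp: fun_eq_iff)
    then show "cm_act n k p = cm_act n (k \<circ> ginv h) q"
      using cm_act_mult[OF Hc[OF kh] Hc[OF h(1)] p] h(2) by simp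
  qed
  show "cm_orbit n H p = cm_orbit n H q"
    unfolding cm_orbit_eq
  proof (intro equalityI image_subsetI)
    fix k assume k: "k \<in> H"
    show "cm_act n k p \<in> (\<lambda>h. cm_act n h q) ` H" using 2[OF k] by auto
    show "cm_act n k q \<in> (\<lambda>h. cm_act n h p) ` H" using 1[OF k] by auto
  qed
qed

lemma orbAB_orbit:
  assumes p: "p \<in> cm_space n"
  shows "orbA n (cm_orbit n setU p) = cm_orbit n setA p" "orbB n (cm_orbit n setU p) = cm_orbit n setB p"
proof -
  have "(\<Union>q\<in>cm_orbit n setU p. cm_orbit n H q) = cm_orbit n H p" if H: "subgroup H grpG" "setU \<subseteq> H" for H
  proof -
    have "cm_orbit n H q = cm_orbit n H p" if q: "q \<in> cm_orbit n setU p" for q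
    proof -
      obtain u where u: "u \<in> setU" "q = cm_act n u p" using q by (auto simp: cm_orbit_eq)
      then have "u \<in> H" "q \<in> cm_space n" using H subgroup.mem_carrier[OF subgroup_U] p by (auto simp: cm_act_closed)
      then show ?thesis using cm_orbit_eq_iff[OF H(1) p] u by auto
    qed
    moreover have "cm_orbit n setU p \<noteq> {}" using subgroup.one_closed[OF subgroup_U] by (auto simp: cm_orbit_eq)
    ultimately show ?thesis by auto
  qed
  then show "orbA n (cm_orbit n setU p) = cm_orbit n setA p" "orbB n (cm_orbit n setU p) = cm_orbit n setB p"
    unfolding orbA_def orbB_def using subgroup_A subgroup_B by (auto simp: setU_def)
qed

context
  fixes n :: nat and T :: "(cm_vertex, cm_edge) pre_digraph"
    and pA pB :: "cm_point set => cm_point" and \<sigma>A \<sigma>B :: "cm_point set => falg => falg"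
    and pU :: "cm_edge => cm_point" and \<sigma>U \<gamma> :: "cm_edge => falg => falg"
  assumes T: "maximal_tree T (cm_graph n)" and choice: "cm_choice n T pA \<sigma>A pB \<sigma>B pU \<sigma>U \<gamma>"
begin

abbreviation (input) "X \<equiv> cm_space n"
abbreviation (input) "orA p \<equiv> cm_orbit n setA p"
abbreviation (input) "orB p \<equiv> cm_orbit n setB p"
abbreviation (input) "orU p \<equiv> cm_orbit n setU p"

lemma T_sub: "subgraph T (cm_graph n)" and T_tree: "utree T"
  using T by (simp_all add: maximal_tree_def)

lemma T_ends: "tail T = tail (cm_graph n)" "head T = head (cm_graph n)"
  using T_sub by (simp_all add: subgraph_def compatible_def)

lemma graph_verts: "verts (cm_graph n) = (\<lambda>p. Inl (orA p)) ` X \<union> (\<lambda>p. Inr (orB p)) ` X"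
  and graph_arcs: "arcs (cm_graph n) = orU ` X"
  by (auto simp: cm_graph_def cm_orbits_eq Plus_def)

lemma graph_ends: "p \<in> X ==> tail (cm_graph n) (orU p) = Inl (orA p)" "p \<in> X ==> head (cm_graph n) (orU p) = Inr (orB p)"
  by (simp_all add: cm_graph_def orbAB_orbit)

text \<open>The chosen elements \<sigma>A exist for every A-orbit; in particular they witness
  transitivity of the action.\<close>

lemma base_eq_act:
  assumes p: "p \<in> X"
  obtains \<sigma> where "\<sigma> \<in> carrier grpG" "cm_act n \<sigma> p = cm_base n"
proof -
  have "based n (orA p) (pA (orA p)) (\<sigma>A (orA p))"
    using choice p unfolding cm_choice_def by (simp add: cm_orbits_eq)
  then obtain a where a: "a \<in> setA" "pA (orA p) = cm_act n a p" and \<sigma>: "\<sigma>A (orA p) \<in> carrier grpG"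
      "cm_act n (\<sigma>A (orA p)) (pA (orA p)) = cm_base n"
    by (auto simp: based_def cm_orbit_eq)
  have aG: "a \<in> carrier grpG" using a setA_G by blast
  have "cm_act n (\<sigma>A (orA p) \<circ> a) p = cm_base n" using a \<sigma> p aG by (simp add: cm_act_mult)
  then show ?thesis using G.m_closed[OF \<sigma>(1) aG] by (intro that[of "\<sigma>A (orA p) \<circ> a"]) simp_all
qed

lemma space_nonempty: "\<exists>p. p \<in> X"
proof -
  have "verts T \<noteq> {}" "verts T \<subseteq> verts (cm_graph n)" using T_tree T_sub by (simp_all add: utree_def subgraph_def)
  then show ?thesis unfolding graph_verts by blast
qed

lemma base_in: "cm_base n \<in> X"
proof -
  obtain p where p: "p \<in> X" using space_nonempty by blast
  obtain \<sigma> where "\<sigma> \<in> carrier grpG" "cm_act n \<sigma> p = cm_base n" by (rule base_eq_act[OF p])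
  then show ?thesis using cm_act_closed p by metis
qed

lemma transitive:
  assumes p: "p \<in> X" and q: "q \<in> X"
  obtains g where "g \<in> carrier grpG" "cm_act n g p = q"
proof -
  obtain \<sigma> where \<sigma>: "\<sigma> \<in> carrier grpG" "cm_act n \<sigma> p = cm_base n" by (rule base_eq_act[OF p])
  obtain \<tau> where \<tau>: "\<tau> \<in> carrier grpG" "cm_act n \<tau> q = cm_base n" by (rule base_eq_act[OF q])
  have \<tau>': "ginv \<tau> \<in> carrier grpG" using \<tau> by simp
  have "ginv \<tau> \<circ> \<tau> = id" using inv_G[OF \<tau>(1)] by (auto simp: fun_eq_iff)
  then have "cm_act n (ginv \<tau>) (cm_act n \<tau> q) = q"
    using cm_act_mult[OF \<tau>' \<tau>(1) q] cm_act_one[OF q] by simp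
  then have "cm_act n (ginv \<tau> \<circ> \<sigma>) p = q" using cm_act_mult[OF \<tau>' \<sigma>(1) p] \<sigma> \<tau> by simp
  then show ?thesis using G.m_closed[OF \<tau>' \<sigma>(1)] by (intro that[of "ginv \<tau> \<circ> \<sigma>"]) simp_all
qed

text \<open>Consider the points whose A-orbit is a vertex of T. Since T is closed under passing
  to the other end of an edge, this set is stable under A and B, hence under G, and the action
  is transitive.\<close>

lemma tree_spans: "verts T = verts (cm_graph n)"
proof
  show "verts T \<subseteq> verts (cm_graph n)" using T_sub by (simp add: subgraph_def)
  have AB: "Inl (orA p) \<in> verts T \<longleftrightarrow> Inr (orB p) \<in> verts T" if p: "p \<in> X" for p
  proof -
    have "orU p \<in> arcs (cm_graph n)" using p graph_arcs by auto
    from maximal_tree_edge_closed[OF T this] show ?thesis using graph_ends[OF p] by simp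
  qed
  have inv: "Inl (orA (cm_act n g p)) \<in> verts T" if "g \<in> carrier grpG" "p \<in> X" "Inl (orA p) \<in> verts T" for g p
  proof -
    have gen: "g \<in> generate grpG (setA \<union> setB)" using that(1) by (rule generated_by_A_B)
    have step: "Inl (orA (cm_act n h p)) \<in> verts T" if h: "h \<in> setA \<union> setB" and p: "p \<in> X" and i: "Inl (orA p) \<in> verts T" for h p
    proof -
      have hp: "cm_act n h p \<in> X" using h p setA_G setB_G by (auto intro!: cm_act_closed)
      from h show ?thesis
      proof
        assume "h \<in> setA"
        then have "orA (cm_act n h p) = orA p" using cm_orbit_eq_iff[OF subgroup_A p hp] by blast
        then show ?thesis using i by simp
      next
        assume "h \<in> setB"
        then have "orB (cm_act n h p) = orB p" using cm_orbit_eq_iff[OF subgroup_B p hp] by blast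
        then show ?thesis using i AB[OF p] AB[OF hp] by simp
      qed
    qed
    from gen have "\<forall>p\<in>X. Inl (orA p) \<in> verts T \<longrightarrow> Inl (orA (cm_act n g p)) \<in> verts T"
    proof (induction)
      case one
      show ?case unfolding one_G by (intro ballI impI, subst cm_act_one)
    next
      case (incl h)
      then show ?case using step by blast
    next
      case (inv h)
      then have "ginv h \<in> setA \<union> setB"
        using subgroup.m_inv_closed[OF subgroup_A] subgroup.m_inv_closed[OF subgroup_B] by blast
      then show ?case using step by blast
    next
      case (eng h h')
      have G: "h \<in> carrier grpG" "h' \<in> carrier grpG"
        using eng(1,2) G.generate_in_carrier[of "setA \<union> setB"] setA_G setB_G by blast+
      show ?case unfolding mult_G
      proof (intro ballI impI)
        fix p assume p: "p \<in> X" "Inl (orA p) \<in> verts T"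
        show "Inl (orA (cm_act n (h \<circ> h') p)) \<in> verts T"
          unfolding cm_act_mult[OF G p(1)] using eng(3,4) cm_act_closed[OF G(2) p(1)] p by blast
      qed
    qed
    then show ?thesis using that by blast
  qed
  obtain v where v: "v \<in> verts T" using T_tree unfolding utree_def by blast
  then have "v \<in> verts (cm_graph n)" using T_sub by (auto simp: subgraph_def)
  then obtain p where p: "p \<in> X" "Inl (orA p) \<in> verts T" using v AB unfolding graph_verts by blast
  have all: "Inl (orA q) \<in> verts T" if q: "q \<in> X" for q
  proof -
    obtain g where "g \<in> carrier grpG" "cm_act n g p = q" by (rule transitive[OF p(1) q])
    then show ?thesis using inv[of g p] p by simp
  qed
  show "verts (cm_graph n) \<subseteq> verts T" unfolding graph_verts using all AB by auto
qed

lemma tree_path: "u \<in> verts T ==> v \<in> verts T ==> \<exists>p. upath T u p v"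
  using T_tree unfolding utree_def by blast

abbreviation (input) "S \<equiv> carrier (grpGn n)"

lemma S_eq: "S = {g \<in> carrier grpG. cm_act n g (cm_base n) = cm_base n}"
  by (simp add: grpGn_def stabilizer_def)

lemma grpGn_eq: "grpGn n = grpG\<lparr>carrier := S\<rparr>"
  by (simp add: grpGn_def)

lemma chosen_A: "p \<in> X ==> \<sigma>A (orA p) \<in> carrier grpG"
  and chosen_B: "p \<in> X ==> \<sigma>B (orB p) \<in> carrier grpG"
  using choice unfolding cm_choice_def based_def by (simp_all add: cm_orbits_eq)

lemma chosen_U:
  assumes "p \<in> X"
  shows "pU (orU p) \<in> orU p" "\<sigma>U (orU p) \<in> carrier grpG" "cm_act n (\<sigma>U (orU p)) (pU (orU p)) = cm_base n"
    "\<gamma> (orU p) \<in> S" "\<sigma>U (orU p) \<in> \<sigma>A (orA p) <#\<^bsub>grpG\<^esub> setA"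
    "\<sigma>U (orU p) \<in> (\<gamma> (orU p) \<odot> \<sigma>B (orB p)) <#\<^bsub>grpG\<^esub> setB"
proof -
  have "orU p \<in> cm_orbits n setU" using assms by (simp add: cm_orbits_eq)
  with choice have "based n (orU p) (pU (orU p)) (\<sigma>U (orU p)) \<and> \<gamma> (orU p) \<in> S \<and>
    \<sigma>U (orU p) \<in> (\<sigma>A (orA p) <#\<^bsub>grpG\<^esub> setA) \<inter> ((\<gamma> (orU p) \<odot> \<sigma>B (orB p)) <#\<^bsub>grpG\<^esub> setB)"
    unfolding cm_choice_def orbAB_orbit[OF assms, symmetric] by blast
  then show "pU (orU p) \<in> orU p" "\<sigma>U (orU p) \<in> carrier grpG" "cm_act n (\<sigma>U (orU p)) (pU (orU p)) = cm_base n"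
    "\<gamma> (orU p) \<in> S" "\<sigma>U (orU p) \<in> \<sigma>A (orA p) <#\<^bsub>grpG\<^esub> setA"
    "\<sigma>U (orU p) \<in> (\<gamma> (orU p) \<odot> \<sigma>B (orB p)) <#\<^bsub>grpG\<^esub> setB"
    unfolding based_def by blast+
qed

text \<open>The chosen \<sigma>U of the U-orbit of p, corrected by an element of U that moves p
  to the chosen base point of that orbit.\<close>

definition transport :: "cm_point => falg => falg" where
  "transport p = \<sigma>U (orU p) \<odot> (SOME u. u \<in> setU \<and> cm_act n u p = pU (orU p))"

lemma transport_props:
  assumes p: "p \<in> X"
  shows "transport p \<in> carrier grpG" "cm_act n (transport p) p = cm_base n" "transport p \<in> \<sigma>U (orU p) <#\<^bsub>grpG\<^esub> setU"
    "transport p \<in> \<sigma>A (orA p) <#\<^bsub>grpG\<^esub> setA" "ginv (\<gamma> (orU p)) \<odot> transport p \<in> \<sigma>B (orB p) <#\<^bsub>grpG\<^esub> setB"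
proof -
  let ?u = "SOME u. u \<in> setU \<and> cm_act n u p = pU (orU p)"
  have "\<exists>u. u \<in> setU \<and> cm_act n u p = pU (orU p)" using chosen_U(1)[OF p] by (auto simp: cm_orbit_eq)
  then have "?u \<in> setU \<and> cm_act n ?u p = pU (orU p)" by (rule someI_ex)
  then have u: "?u \<in> setU" "cm_act n ?u p = pU (orU p)" by (rule conjunct1, rule conjunct2)
  then have uAB: "?u \<in> setA" "?u \<in> setB" by (simp_all add: setU_def)
  have uG: "?u \<in> carrier grpG" using uAB setA_G by blast
  note c = chosen_U[OF p]
  have \<gamma>G: "\<gamma> (orU p) \<in> carrier grpG" using c(4) by (simp add: S_eq)
  have \<gamma>\<sigma>: "\<gamma> (orU p) \<odot> \<sigma>B (orB p) \<in> carrier grpG" by (rule G.m_closed[OF \<gamma>G chosen_B[OF p]])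
  show "transport p \<in> carrier grpG" unfolding transport_def by (rule G.m_closed[OF c(2) uG])
  show "cm_act n (transport p) p = cm_base n" unfolding transport_def mult_G using cm_act_mult[OF c(2) uG p] u c(3) by simp
  show "transport p \<in> \<sigma>U (orU p) <#\<^bsub>grpG\<^esub> setU" unfolding transport_def l_coset_def using u by blast
  show "transport p \<in> \<sigma>A (orA p) <#\<^bsub>grpG\<^esub> setA" unfolding transport_def by (rule G.l_coset_mult[OF subgroup_A chosen_A[OF p] c(5) uAB(1)])
  have "transport p \<in> (\<gamma> (orU p) \<odot> \<sigma>B (orB p)) <#\<^bsub>grpG\<^esub> setB"
    unfolding transport_def by (rule G.l_coset_mult[OF subgroup_B \<gamma>\<sigma> c(6) uAB(2)])
  then show "ginv (\<gamma> (orU p)) \<odot> transport p \<in> \<sigma>B (orB p) <#\<^bsub>grpG\<^esub> setB"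
    by (rule G.l_coset_left_cancel[OF subgroup_B \<gamma>G chosen_B[OF p]])
qed

lemma S_carrier: "g \<in> S ==> g \<in> carrier grpG" by (simp add: S_eq)

lemma conj_grp_eq:
  assumes H: "subgroup H grpG" and \<sigma>: "\<sigma> \<in> carrier grpG" and \<tau>: "\<tau> \<in> \<sigma> <#\<^bsub>grpG\<^esub> H"
  shows "conj_grp n H \<sigma> = grpG\<lparr>carrier := {g \<in> S. ginv \<tau> \<odot> g \<odot> \<tau> \<in> H}\<rparr>"
proof -
  have "S \<inter> ((\<sigma> <#\<^bsub>grpG\<^esub> H) #>\<^bsub>grpG\<^esub> ginv \<sigma>) = {g \<in> S. ginv \<tau> \<odot> g \<odot> \<tau> \<in> H}"
    using G.conjugate_subgroup_mem[OF H \<sigma> \<tau>] S_carrier by blast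
  then show ?thesis by (simp add: conj_grp_def)
qed

abbreviation (input) "\<Gamma> \<equiv> cm_gog n \<sigma>A \<sigma>B \<sigma>U \<gamma>"

lemma gog_sel: "gg_graph \<Gamma> = cm_graph n" "gg_alpha \<Gamma> e g = g"
  "gg_beta \<Gamma> e g = ginv (\<gamma> e) \<odot> g \<odot> \<gamma> e"
  by (simp_all add: cm_gog_def)

lemma vgrp_A: "p \<in> X ==> gg_vgrp \<Gamma> (Inl (orA p)) = grpG\<lparr>carrier := {g \<in> S. ginv (transport p) \<odot> g \<odot> transport p \<in> setA}\<rparr>"
  using conj_grp_eq[OF subgroup_A chosen_A transport_props(4)] by (simp add: cm_gog_def del: mult_G)

lemma vgrp_B: "p \<in> X ==> gg_vgrp \<Gamma> (Inr (orB p)) = grpG\<lparr>carrier := {g \<in> S.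
    ginv (ginv (\<gamma> (orU p)) \<odot> transport p) \<odot> g \<odot> (ginv (\<gamma> (orU p)) \<odot> transport p) \<in> setB}\<rparr>"
  using conj_grp_eq[OF subgroup_B chosen_B transport_props(5)] by (simp add: cm_gog_def del: mult_G)

lemma egrp_U: "p \<in> X ==> gg_egrp \<Gamma> (orU p) = grpG\<lparr>carrier := {g \<in> S. ginv (transport p) \<odot> g \<odot> transport p \<in> setA \<inter> setB}\<rparr>"
  using conj_grp_eq[OF subgroup_U chosen_U(2) transport_props(3)] by (simp add: cm_gog_def setU_def del: mult_G)

lemma subgroup_stabilizer: "subgroup S grpG"
proof (rule G.subgroupI)
  show "S \<noteq> {}" using cm_act_one[OF base_in] G.one_closed by (auto simp: S_eq)
next
  fix g assume g: "g \<in> S"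
  then have gG: "g \<in> carrier grpG" "ginv g \<in> carrier grpG" by (simp_all add: S_eq)
  have "ginv g \<circ> g = id" using inv_G[OF gG(1)] by (auto simp: fun_eq_iff)
  then have "cm_act n (ginv g) (cm_act n g (cm_base n)) = cm_base n"
    using cm_act_mult[OF gG(2,1) base_in] cm_act_one[OF base_in] by simp
  then show "ginv g \<in> S" using g gG by (simp add: S_eq)
next
  fix g h assume "g \<in> S" "h \<in> S"
  then show "g \<odot> h \<in> S" using G.m_closed[of g h] cm_act_mult[of g h "cm_base n" n] base_in by (simp add: S_eq)
qed (simp add: S_eq)

lemma spanned: "spanned_group_graph \<Gamma> T"
proof (intro spanned_group_graph.intro group_graph.intro spanned_group_graph_axioms.intro)
  fix v assume "v \<in> verts (gg_graph \<Gamma>)"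
  then consider p where "p \<in> X" "v = Inl (orA p)" | p where "p \<in> X" "v = Inr (orB p)"
    unfolding gog_sel graph_verts by blast
  then show "group (gg_vgrp \<Gamma> v)"
  proof cases
    case 1
    show ?thesis unfolding 1(2) vgrp_A[OF 1(1)]
      by (rule G.subgroup_imp_group[OF G.subgroup_conjugate[OF subgroup_stabilizer subgroup_A transport_props(1)[OF 1(1)]]])
  next
    case 2
    have "ginv (\<gamma> (orU p)) \<odot> transport p \<in> carrier grpG"
      by (rule G.l_coset_member_carrier[OF subgroup_B chosen_B transport_props(5)]) (rule 2)+
    then show ?thesis unfolding 2(2) vgrp_B[OF 2(1)]
      by (rule G.subgroup_imp_group[OF G.subgroup_conjugate[OF subgroup_stabilizer subgroup_B]])
  qed
next
  fix e assume "e \<in> arcs (gg_graph \<Gamma>)"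
  then obtain p where p: "p \<in> X" "e = orU p" unfolding gog_sel graph_arcs by blast
  show "tail (gg_graph \<Gamma>) e \<in> verts (gg_graph \<Gamma>)" "head (gg_graph \<Gamma>) e \<in> verts (gg_graph \<Gamma>)"
    unfolding gog_sel p(2) graph_ends[OF p(1)] graph_verts using p(1) by blast+
  fix g assume g: "g \<in> carrier (gg_egrp \<Gamma> e)"
  then have g': "g \<in> S" "ginv (transport p) \<odot> g \<odot> transport p \<in> setA"
    "ginv (transport p) \<odot> g \<odot> transport p \<in> setB" unfolding p(2) egrp_U[OF p(1)] by (simp_all del: mult_G)
  show "gg_alpha \<Gamma> e g \<in> carrier (gg_vgrp \<Gamma> (tail (gg_graph \<Gamma>) e))"
    unfolding gog_sel p(2) graph_ends[OF p(1)] vgrp_A[OF p(1)] using g' by (simp del: mult_G)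
  let ?\<gamma> = "\<gamma> (orU p)"
  have \<gamma>: "?\<gamma> \<in> S" by (rule chosen_U(4)[OF p(1)])
  have "ginv ?\<gamma> \<odot> g \<odot> ?\<gamma> \<in> S"
    by (intro subgroup.m_closed[OF subgroup_stabilizer] subgroup.m_inv_closed[OF subgroup_stabilizer] \<gamma> g')
  moreover have "ginv (ginv ?\<gamma> \<odot> transport p) \<odot> (ginv ?\<gamma> \<odot> g \<odot> ?\<gamma>) \<odot> (ginv ?\<gamma> \<odot> transport p)
      = ginv (transport p) \<odot> g \<odot> transport p"
    using S_carrier[OF \<gamma>] S_carrier[OF g'(1)] transport_props(1)[OF p(1)]
    by (simp add: G.inv_mult_group G.m_assoc G.cancel_inv del: mult_G)
  ultimately show "gg_beta \<Gamma> e g \<in> carrier (gg_vgrp \<Gamma> (head (gg_graph \<Gamma>) e))"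
    unfolding gog_sel p(2) graph_ends[OF p(1)] vgrp_B[OF p(1)] using g' by (simp del: mult_G)
next
  show "arcs T \<subseteq> arcs (gg_graph \<Gamma>)" using T_sub by (simp add: gog_sel subgraph_def)
  show "verts T = verts (gg_graph \<Gamma>)" "tail T = tail (gg_graph \<Gamma>)" "head T = head (gg_graph \<Gamma>)"
    by (simp_all add: gog_sel tree_spans T_ends)
qed

lemma orbit_graph:
  "orbit_group_graph grpG setA setB \<Gamma> T X (cm_act n) (cm_base n) S (\<lambda>p. Inl (orA p)) (\<lambda>p. Inr (orB p)) orU transport \<gamma>"
proof (intro orbit_group_graph.intro amalgam_G.amalgam_axioms spanned orbit_group_graph_axioms.intro)
  fix x assume x: "x \<in> X"
  show "tail (gg_graph \<Gamma>) (orU x) = Inl (orA x)" "head (gg_graph \<Gamma>) (orU x) = Inr (orB x)"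
    unfolding gog_sel by (rule graph_ends[OF x])+
  show "cm_act n \<one>\<^bsub>grpG\<^esub> x = x" using cm_act_one[OF x] by simp
  {
    fix u assume u: "u \<in> setA" "u \<in> setB"
    then have uU: "u \<in> setU" and "cm_act n u x \<in> X" using x setA_G by (auto simp: setU_def cm_act_closed)
    then show "orU (cm_act n u x) = orU x" using cm_orbit_eq_iff[OF subgroup_U x] by blast
  next
    fix a assume a: "a \<in> setA"
    then have ax: "cm_act n a x \<in> X" using x setA_G by (auto intro: cm_act_closed)
    then have "orA (cm_act n a x) = orA x" using cm_orbit_eq_iff[OF subgroup_A x] a by blast
    then show "ginv (transport x) \<odot> transport (cm_act n a x) \<in> setA"
      using G.same_l_coset[OF subgroup_A chosen_A[OF x] transport_props(4)[OF x]] transport_props(4)[OF ax] by simp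
  next
    fix b assume b: "b \<in> setB"
    then have bx: "cm_act n b x \<in> X" using x setB_G by (auto intro: cm_act_closed)
    then have "orB (cm_act n b x) = orB x" using cm_orbit_eq_iff[OF subgroup_B x] b by blast
    then show "ginv (ginv (\<gamma> (orU x)) \<odot> transport x) \<odot>
       (ginv (\<gamma> (orU (cm_act n b x))) \<odot> transport (cm_act n b x)) \<in> setB"
      using G.same_l_coset[OF subgroup_B chosen_B[OF x] transport_props(5)[OF x]] transport_props(5)[OF bx] by (simp del: mult_G)
  }
next
  fix g x assume "g \<in> carrier grpG" "x \<in> X"
  then show "cm_act n g x \<in> X" by (rule cm_act_closed)
next
  fix g h x assume "g \<in> carrier grpG" "h \<in> carrier grpG" "x \<in> X"
  then show "cm_act n (g \<odot> h) x = cm_act n g (cm_act n h x)" by (simp add: cm_act_mult)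
next
  fix x y assume "x \<in> X" "y \<in> X"
  then show "(Inl (orA x) = (Inl (orA y) :: cm_vertex)) = (\<exists>a\<in>setA. y = cm_act n a x)"
    "(Inr (orB x) = (Inr (orB y) :: cm_vertex)) = (\<exists>b\<in>setB. y = cm_act n b x)"
    by (simp_all add: cm_orbit_eq_iff[OF subgroup_A] cm_orbit_eq_iff[OF subgroup_B])
next
  fix e assume "e \<in> arcs (gg_graph \<Gamma>)"
  then show "\<gamma> e \<in> S" using chosen_U(4) by (auto simp: gog_sel graph_arcs)
next
  fix e assume "e \<in> arcs T"
  then show "\<gamma> e = \<one>\<^bsub>grpG\<^esub>" using choice by (simp add: cm_choice_def)
qed (rule base_in S_eq transport_props(1,2) vgrp_A vgrp_B egrp_U gog_sel(2,3); assumption |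
     simp add: gog_sel graph_verts graph_arcs; fail)+

theorem stabilizer_presentations: "grpGn n \<cong> pi1 \<Gamma> T" "pi1 \<Gamma> T \<cong> tree_pres \<Gamma> T"
proof -
  interpret bs: orbit_group_graph grpG setA setB \<Gamma> T X "cm_act n" "cm_base n" S
    "\<lambda>p. Inl (orA p)" "\<lambda>p. Inr (orB p)" orU transport \<gamma>
    by (rule orbit_graph)
  show "grpGn n \<cong> pi1 \<Gamma> T" using bs.stabilizer_iso_pi1[OF tree_path] by (simp flip: grpGn_eq)
  show "pi1 \<Gamma> T \<cong> tree_pres \<Gamma> T" by (rule bs.pi1_iso_tree_pres)
qed

end

theorem theorem12:
  fixes n :: nat
    and T :: "(cm_vertex, cm_edge) pre_digraph"
    and pA pB :: "cm_point set \<Rightarrow> cm_point"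
    and \<sigma>A \<sigma>B :: "cm_point set \<Rightarrow> falg \<Rightarrow> falg"
    and pU :: "cm_edge \<Rightarrow> cm_point"
    and \<sigma>U \<gamma> :: "cm_edge \<Rightarrow> falg \<Rightarrow> falg"
  assumes "maximal_tree T (cm_graph n)"
    and "cm_choice n T pA \<sigma>A pB \<sigma>B pU \<sigma>U \<gamma>"
  shows "grpGn n \<cong> pi1 (cm_gog n \<sigma>A \<sigma>B \<sigma>U \<gamma>) T \<and>
         pi1 (cm_gog n \<sigma>A \<sigma>B \<sigma>U \<gamma>) T \<cong> tree_pres (cm_gog n \<sigma>A \<sigma>B \<sigma>U \<gamma>) T"
  using stabilizer_presentations[OF assms] by blast

end
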